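(* Let $n$ be a positive integer and let $V_n$ be the vector space of all pairs $(f,\omega)$, where $f$ is a bivariate polynomial of degree at most $n+1$ and $\omega=P\,dx+Q\,dy$ is a polynomial one-form on $\mathbb{C}^2$ of degree at most $n$ ($\deg P,\deg Q\le n$). There is a dense open subset of $V_n$ with the following property: for every pair $(f,\omega)$ of this open subset and for every integer $k\ge1$ there exists a continuous family of closed loops $\delta(t)\subset f^{-1}(t)$, representing a non-zero class in $\mathrm{gr}^kF_t$, such that the corresponding Poincaré–Pontryagin function $M_k(t)$ is not identically zero.
   Context: Polynomials and one-forms have complex coefficients. For a regular value $t$ of $f$, $F_t=\pi_1(f^{-1}(t),* )$ is the fundamental group of the affine fiber. For a group $F$, the lower central series is $F^1=F$, $F^{k}=(F,F^{k-1})$ (the subgroup generated by commutators $aba^{-1}b^{-1}$, $a\in F$, $b\in F^{k-1}$), and $\mathrm{gr}^kF=F^k/F^{k+1}$. A family $\delta(t)\subset f^{-1}(t)$ is considered for regular values $t$; "representing a non-zero class in $\mathrm{gr}^kF_t$" means that $\delta(t)\in F_t^k$ and $\delta(t)\notin F_t^{k+1}$ (this does not depend on the base point). Given $(f,\omega)$ and $\delta(t)$, consider the foliation $df+\varepsilon\omega=0$ for $\varepsilon$ near $0$, and the holonomy map $h_\delta^\varepsilon$ along $\delta(t)$ of this foliation, on a transversal to the leaves of $df=0$ parametrized by the value $t$ of $f$: $$h^\varepsilon_\delta(t)=t+\sum_{i\ge1}\varepsilon^iM_i(t).$$ If $\delta(t)$ represents a non-zero class in $\mathrm{gr}^kF_t$,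 then $M_1=\dots=M_{k-1}=0$; the function $M_k$ is called the Poincaré–Pontryagin(–Melnikov) function associated to $(f,\omega)$ and $\delta(t)$.
   Formalization: For n = 1 only k = 1 is claimed: a generic f of degree 2 has regular fibers homeomorphic to ℂ*, so F_t is infinite cyclic, gr^k F_t = 0 for k ≥ 2, and the claim as stated fails there. *)

theory Defs
  imports "HOL-Algebra.Generated_Groups" "HOL-Analysis.Analysis"
    "HOL-Computational_Algebra.Polynomial"
begin

section \<open>Bivariate polynomials and polynomial one-forms\<close>

text \<open>A polynomial in \<open>x, y\<close> is a polynomial in \<open>y\<close> (the outer variable) whose coefficients are
  polynomials in \<open>x\<close>: the coefficient of the monomial \<open>x^i y^j\<close> of \<open>p\<close> is \<open>coeff (coeff p j) i\<close>.\<close>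

type_synonym bipoly = "complex poly poly"

definition bicoeff :: "bipoly \<Rightarrow> nat \<Rightarrow> nat \<Rightarrow> complex"
  where "bicoeff p i j = coeff (coeff p j) i"

definition total_degree_le :: "bipoly \<Rightarrow> nat \<Rightarrow> bool"
  where "total_degree_le p d \<longleftrightarrow> (\<forall>i j. bicoeff p i j \<noteq> 0 \<longrightarrow> i + j \<le> d)"

definition bieval :: "bipoly \<Rightarrow> complex \<times> complex \<Rightarrow> complex"
  where "bieval p z = poly (poly p [:snd z:]) (fst z)"

text \<open>The pair \<open>(P, Q)\<close> stands for the one-form \<open>P dx + Q dy\<close>.\<close>

type_synonym one_form = "bipoly \<times> bipoly"

definition differential :: "bipoly \<Rightarrow> one_form"
  where "differential f = (map_poly pderiv f, pderiv f)"

definition apply_form :: "one_form \<Rightarrow> complex \<times> complex \<Rightarrow> complex \<times> complex \<Rightarrow> complex"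
  where "apply_form \<omega> z v = bieval (fst \<omega>) z * fst v + bieval (snd \<omega>) z * snd v"

definition V :: "nat \<Rightarrow> (bipoly \<times> one_form) set"
  where "V n = {(f, P, Q). total_degree_le f (n + 1) \<and> total_degree_le P n \<and> total_degree_le Q n}"

text \<open>The coefficient map identifies \<open>V n\<close> with a finite-dimensional coordinate subspace of a
  product of copies of the complex numbers, so the topology induced by it is the usual topology
  of this finite-dimensional vector space.\<close>

definition V_topology :: "nat \<Rightarrow> (bipoly \<times> one_form) topology"
  where "V_topology n =
    pullback_topology (V n) (\<lambda>(f, P, Q). (bicoeff f, bicoeff P, bicoeff Q)) euclidean"

definition fiber :: "bipoly \<Rightarrow> complex \<Rightarrow> (complex \<times> complex) set"
  where "fiber f t = {z. bieval f z = t}"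

definition regular_value :: "bipoly \<Rightarrow> complex \<Rightarrow> bool"
  where "regular_value f t \<longleftrightarrow> (\<forall>z \<in> fiber f t. \<exists>v. apply_form (differential f) z v \<noteq> 0)"


section \<open>Fundamental group and lower central series\<close>

definition loops_at :: "'a::topological_space set \<Rightarrow> 'a \<Rightarrow> (real \<Rightarrow> 'a) set"
  where "loops_at S a = {p. path p \<and> path_image p \<subseteq> S \<and> pathstart p = a \<and> pathfinish p = a}"

definition homotopy_class :: "'a::topological_space set \<Rightarrow> (real \<Rightarrow> 'a) \<Rightarrow> (real \<Rightarrow> 'a) set"
  where "homotopy_class S p = {q. homotopic_paths S p q}"

definition fundamental_group ::
    "'a::real_normed_vector set \<Rightarrow> 'a \<Rightarrow> (real \<Rightarrow> 'a) set monoid"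
  where "fundamental_group S a =
    \<lparr>carrier = homotopy_class S ` loops_at S a,
     monoid.mult = (\<lambda>A B. \<Union>p\<in>A. \<Union>q\<in>B. homotopy_class S (p +++ q)),
     one = homotopy_class S (linepath a a)\<rparr>"

text \<open>The series is indexed from 1, as is customary; the value at 0 is a dummy.\<close>

fun lower_central_series :: "('a, 'b) monoid_scheme \<Rightarrow> nat \<Rightarrow> 'a set"
  where
    "lower_central_series G 0 = carrier G"
  | "lower_central_series G (Suc 0) = carrier G"
  | "lower_central_series G (Suc (Suc k)) =
      generate G {a \<otimes>\<^bsub>G\<^esub> b \<otimes>\<^bsub>G\<^esub> inv\<^bsub>G\<^esub> a \<otimes>\<^bsub>G\<^esub> inv\<^bsub>G\<^esub> b | a b.
        a \<in> carrier G \<and> b \<in> lower_central_series G (Suc k)}"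

definition represents_nonzero_gr :: "('a, 'b) monoid_scheme \<Rightarrow> nat \<Rightarrow> 'a \<Rightarrow> bool"
  where "represents_nonzero_gr G k x \<longleftrightarrow>
    x \<in> lower_central_series G k \<and> x \<notin> lower_central_series G (Suc k)"

lemma homotopy_class_eq:
  assumes "homotopic_paths S p q"
  shows "homotopy_class S p = homotopy_class S q"
  unfolding homotopy_class_def
  by (rule Collect_cong) (metis assms homotopic_paths_sym homotopic_paths_trans)

lemma homotopy_class_eq_iff:
  assumes "path p" "path_image p \<subseteq> S"
  shows "homotopy_class S p = homotopy_class S q \<longleftrightarrow> homotopic_paths S p q"
proof
  assume "homotopy_class S p = homotopy_class S q"
  moreover have "p \<in> homotopy_class S p"
    using assms by (simp add: homotopy_class_def)
  ultimately show "homotopic_paths S p q"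
    by (simp add: homotopy_class_def homotopic_paths_sym)
qed (rule homotopy_class_eq)

lemma fundamental_group_mult:
  assumes "p \<in> loops_at S a" "q \<in> loops_at S a"
  shows "homotopy_class S p \<otimes>\<^bsub>fundamental_group S a\<^esub> homotopy_class S q = homotopy_class S (p +++ q)"
proof -
  have eq: "homotopy_class S (p' +++ q') = homotopy_class S (p +++ q)"
    if "p' \<in> homotopy_class S p" "q' \<in> homotopy_class S q" for p' q'
  proof -
    have "homotopic_paths S (p +++ q) (p' +++ q')"
      using that assms by (intro homotopic_paths_join) (simp_all add: homotopy_class_def loops_at_def)
    thus ?thesis
      by (rule homotopy_class_eq[symmetric])
  qed
  have mem: "p \<in> homotopy_class S p" "q \<in> homotopy_class S q"
    using assms by (simp_all add: homotopy_class_def loops_at_def)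
  have "(\<Union>p'\<in>homotopy_class S p. \<Union>q'\<in>homotopy_class S q. homotopy_class S (p' +++ q')) =
      (\<Union>p'\<in>homotopy_class S p. \<Union>q'\<in>homotopy_class S q. homotopy_class S (p +++ q))"
    by (intro SUP_cong refl eq)
  also have "\<dots> = homotopy_class S (p +++ q)"
    using mem by (simp only: UN_constant) auto
  finally show ?thesis
    by (simp add: fundamental_group_def)
qed

lemma group_fundamental_group:
  assumes "a \<in> S"
  shows "group (fundamental_group S a)"
proof -
  let ?G = "fundamental_group S a" and ?c = "homotopy_class S" and ?L = "loops_at S a"
  have carr: "carrier ?G = ?c ` ?L" and one: "\<one>\<^bsub>?G\<^esub> = ?c (linepath a a)"
    by (simp_all add: fundamental_group_def)
  have lin: "linepath a a \<in> ?L"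
    using assms by (simp add: loops_at_def)
  have join: "p +++ q \<in> ?L" if "p \<in> ?L" "q \<in> ?L" for p q
    using that by (auto simp: loops_at_def path_image_join)
  have rev: "reversepath p \<in> ?L" if "p \<in> ?L" for p
    using that by (auto simp: loops_at_def)
  have eqI: "?c p = ?c q" if "homotopic_paths S p q" for p q
    using that by (rule homotopy_class_eq)
  show ?thesis
  proof (rule groupI)
    fix x y assume "x \<in> carrier ?G" "y \<in> carrier ?G"
    thus "x \<otimes>\<^bsub>?G\<^esub> y \<in> carrier ?G"
      using join by (auto simp: carr fundamental_group_mult)
  next
    show "\<one>\<^bsub>?G\<^esub> \<in> carrier ?G"
      using lin by (simp add: carr one)
  next
    fix x y z assume "x \<in> carrier ?G" "y \<in> carrier ?G" "z \<in> carrier ?G"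
    then obtain p q r where pqr: "p \<in> ?L" "q \<in> ?L" "r \<in> ?L" "x = ?c p" "y = ?c q" "z = ?c r"
      by (auto simp: carr)
    have "homotopic_paths S (p +++ (q +++ r)) ((p +++ q) +++ r)"
      using pqr by (intro homotopic_paths_assoc) (auto simp: loops_at_def)
    thus "x \<otimes>\<^bsub>?G\<^esub> y \<otimes>\<^bsub>?G\<^esub> z = x \<otimes>\<^bsub>?G\<^esub> (y \<otimes>\<^bsub>?G\<^esub> z)"
      using pqr join by (simp add: fundamental_group_mult eqI)
  next
    fix x assume "x \<in> carrier ?G"
    then obtain p where p: "p \<in> ?L" "x = ?c p"
      by (auto simp: carr)
    have "homotopic_paths S (linepath a a +++ p) p"
      using p by (intro homotopic_paths_lid') (auto simp: loops_at_def)
    thus "\<one>\<^bsub>?G\<^esub> \<otimes>\<^bsub>?G\<^esub> x = x"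
      using p lin by (simp add: one fundamental_group_mult eqI)
    have "homotopic_paths S (reversepath p +++ p) (linepath a a)"
      using p homotopic_paths_linv[of p S] by (auto simp: loops_at_def)
    hence "?c (reversepath p) \<otimes>\<^bsub>?G\<^esub> x = \<one>\<^bsub>?G\<^esub>"
      using p rev by (simp add: one fundamental_group_mult eqI)
    thus "\<exists>y\<in>carrier ?G. y \<otimes>\<^bsub>?G\<^esub> x = \<one>\<^bsub>?G\<^esub>"
      using p rev by (auto simp: carr)
  qed
qed


section \<open>Families of loops, holonomy, and Poincare--Pontryagin functions\<close>

text \<open>A holomorphic transversal to the leaves of \<open>df = 0\<close>, parametrized by the value of \<open>f\<close>
  (transversality follows from differentiating \<open>f (\<sigma> t) = t\<close>).\<close>

definition transversal :: "bipoly \<Rightarrow> complex set \<Rightarrow> (complex \<Rightarrow> complex \<times> complex) \<Rightarrow> bool"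
  where "transversal f T \<sigma> \<longleftrightarrow>
    (fst \<circ> \<sigma>) holomorphic_on T \<and> (snd \<circ> \<sigma>) holomorphic_on T \<and> (\<forall>t\<in>T. bieval f (\<sigma> t) = t)"

text \<open>A continuous family of (piecewise smooth) closed loops in the regular fibers over a domain
  \<open>T\<close>; the loop over \<open>t\<close> is based at the point \<open>\<sigma> t\<close> of the transversal.\<close>

definition loop_family ::
    "bipoly \<Rightarrow> complex set \<Rightarrow> (complex \<Rightarrow> complex \<times> complex) \<Rightarrow> (complex \<Rightarrow> real \<Rightarrow> complex \<times> complex) \<Rightarrow> bool"
  where "loop_family f T \<sigma> \<delta> \<longleftrightarrow>
    T \<noteq> {} \<and> open T \<and> connected T \<and> (\<forall>t\<in>T. regular_value f t) \<and>
    transversal f T \<sigma> \<and>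
    continuous_on (T \<times> {0..1}) (\<lambda>(t, s). \<delta> t s) \<and>
    (\<forall>t\<in>T. \<delta> t \<in> loops_at (fiber f t) (\<sigma> t) \<and> valid_path (\<delta> t))"

text \<open>A path contained in a leaf of the foliation \<open>df + \<epsilon>\<omega> = 0\<close>. At the endpoints the derivative is
  one-sided; at the finitely many corners there is nothing to check.\<close>

definition leaf_path :: "bipoly \<Rightarrow> one_form \<Rightarrow> complex \<Rightarrow> (real \<Rightarrow> complex \<times> complex) \<Rightarrow> bool"
  where "leaf_path f \<omega> \<epsilon> g \<longleftrightarrow> valid_path g \<and>
    (\<forall>s\<in>{0..1}. \<forall>v. (g has_vector_derivative v) (at s within {0..1}) \<longrightarrow>
      apply_form (differential f) (g s) v + \<epsilon> * apply_form \<omega> (g s) v = 0)"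

text \<open>\<open>h \<epsilon> t\<close> is the holonomy of \<open>df + \<epsilon>\<omega> = 0\<close> along \<open>\<delta> t\<close>: the loop \<open>\<delta> t\<close> is deformed continuously,
  as \<open>\<epsilon>\<close> moves away from 0, to a path in the leaf through \<open>\<sigma> t\<close> which ends at the point
  \<open>\<sigma> (h \<epsilon> t)\<close> of the transversal. Only the germ of \<open>h\<close> along \<open>\<epsilon> = 0\<close> is determined by this (lifts to
  leaves are unique, up to sliding along the leaf, near each loop \<open>\<delta> t\<close>).\<close>

definition holonomy_map ::
    "bipoly \<Rightarrow> one_form \<Rightarrow> complex set \<Rightarrow> (complex \<Rightarrow> complex \<times> complex) \<Rightarrow>
      (complex \<Rightarrow> real \<Rightarrow> complex \<times> complex) \<Rightarrow> (complex \<Rightarrow> complex \<Rightarrow> complex) \<Rightarrow> bool"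
  where "holonomy_map f \<omega> T \<sigma> \<delta> h \<longleftrightarrow>
    (\<exists>W \<gamma>. open W \<and> {0} \<times> T \<subseteq> W \<and>
      continuous_on (W \<times> {0..1}) (\<lambda>((\<epsilon>, t), s). \<gamma> \<epsilon> t s) \<and>
      (\<forall>t\<in>T. \<forall>s\<in>{0..1}. \<gamma> 0 t s = \<delta> t s) \<and>
      (\<forall>(\<epsilon>, t)\<in>W. t \<in> T \<and> h \<epsilon> t \<in> T \<and> leaf_path f \<omega> \<epsilon> (\<gamma> \<epsilon> t) \<and>
        pathstart (\<gamma> \<epsilon> t) = \<sigma> t \<and> pathfinish (\<gamma> \<epsilon> t) = \<sigma> (h \<epsilon> t)))"

text \<open>The coefficients of the expansion \<open>h \<epsilon> t = t + (\<Sum>i\<ge>1. \<epsilon>^i * M i t)\<close> at \<open>\<epsilon> = 0\<close>; they depend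
  only on the germ of \<open>h\<close>, hence are determined by \<open>f, \<omega>, \<sigma>, \<delta>\<close>.\<close>

definition Poincare_Pontryagin ::
    "bipoly \<Rightarrow> one_form \<Rightarrow> complex set \<Rightarrow> (complex \<Rightarrow> complex \<times> complex) \<Rightarrow>
      (complex \<Rightarrow> real \<Rightarrow> complex \<times> complex) \<Rightarrow> nat \<Rightarrow> (complex \<Rightarrow> complex) \<Rightarrow> bool"
  where "Poincare_Pontryagin f \<omega> T \<sigma> \<delta> k m \<longleftrightarrow>
    (\<exists>h M. holonomy_map f \<omega> T \<sigma> \<delta> h \<and>
      (\<forall>t\<in>T. \<forall>\<^sub>F \<epsilon> in nhds 0. (\<lambda>i. \<epsilon> ^ Suc i * M (Suc i) t) sums (h \<epsilon> t - t)) \<and>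
      m = M k)"

end

theory Submission
  imports Defs "HOL-Complex_Analysis.Complex_Analysis" "HOL-Computational_Algebra.Fundamental_Theorem_Algebra"
begin

text \<open>Write \<open>f = \<Sum>\<^sub>j x\<^sup>j \<phi>\<^sub>j(u)\<close> with \<open>u = y / x\<close>, \<open>N = n + 1\<close>, and let \<open>\<phi> = \<phi>\<^sub>N\<close> have simple roots. Over a small circle
  around a root of \<open>\<phi>\<close>, run through \<open>N\<close> times, the fibers of large value contain a loop near infinity, along which
  the integral of \<open>\<omega>\<close> is \<open>A + B t\<close> by Newton's identities for the \<open>N\<close> sheets. Two circles with a common point
  give loops \<open>a\<close>, \<open>b\<close> with the same base point. The iterated commutator \<open>\<delta> = [a, [a, \<dots>, [a, b]]]\<close> of weight \<open>k\<close>
  has \<open>M\<^sub>k = B\<^sub>a\<^sup>k\<^sup>-\<^sup>2 (A\<^sub>a B\<^sub>b - A\<^sub>b B\<^sub>a)\<close>, because the leading term of a commutator of germs tangent to the identity is the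
  Wronskian of their leading terms. That \<open>\<delta>\<close> does not lie in the next term of the lower central series is seen from
  the homotopy invariant iterated integrals of \<open>\<omega>\<^sup>k\<^sup>-\<^sup>1 \<eta>\<close>, \<open>\<eta>\<close> a second polynomial form. All nondegeneracy conditions used
  are open, and successive perturbations of \<open>f\<close> and \<open>\<omega>\<close> by monomials achieve them.\<close>

section \<open>Contracting differential equations with holomorphic parameters\<close>

text \<open>Loops near infinity are used because everything about them is explicit: in the
  coordinates \<open>u\<close>, \<open>v\<close> the foliation is a small perturbation of a product,
  so one contraction argument gives the flow over the whole parameter interval and its holomorphy.
  Vanishing cycles and monodromy do not enter. A circle is run through N times because the N-th root
  \<open>E\<close> of 1/\<phi> closes up only then. Summing over the N sheets produces power sums of
  the roots x of f(x, u x) = t; here t enters only the last elementary symmetric function, hence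
  only the N-th power sum, and affinely. A second form \<eta> is taken because the class of the
  commutator is detected by the determinant of the integrals of \<omega> and \<eta> over a and b,
  which vanishes for \<eta> = \<omega>. The genericity conditions do not mention k, so one open set
  serves all k. For n = 1 the generic fiber is a smooth affine conic, homeomorphic to the punctured
  plane; its fundamental group is abelian and gr^k is zero for k \<ge> 2. This is the reason for the
  premise \<open>n = 1 \<longrightarrow> k = 1\<close>.\<close>

lemma holomorphic_on_integral_param:
  fixes g :: "complex \<Rightarrow> real \<Rightarrow> complex"
  assumes D: "open D" and cont: "continuous_on (D \<times> {0..1}) (\<lambda>(z, t). g z t)"
    and hol: "\<And>t. t \<in> {0..1} \<Longrightarrow> (\<lambda>z. g z t) holomorphic_on D"
  shows "(\<lambda>z. integral {0..1} (g z)) holomorphic_on D"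
proof (rule holomorphic_uniform_sequence[OF D])
  \<comment> \<open>Riemann sums with \<open>n\<close> equal steps: they are holomorphic as finite
    sums, and uniform continuity on a compact disc times the interval makes them converge uniformly
    there.\<close>
  let ?f = "\<lambda>n z. \<Sum>k<n. g z (real k / real n) / of_nat n"
  show "?f n holomorphic_on D" for n
    by (intro holomorphic_intros hol) (auto simp: field_simps)
  fix x assume "x \<in> D"
  then obtain d where d: "d > 0" "cball x d \<subseteq> D"
    using D open_contains_cball by blast
  have "uniformly_continuous_on (cball x d \<times> {0..1}) (\<lambda>(z, t). g z t)"
    using d by (intro compact_uniformly_continuous continuous_on_subset[OF cont] compact_Times) auto
  note unif = this[unfolded uniformly_continuous_on_def, rule_format]
  have "uniform_limit (cball x d) ?f (\<lambda>z. integral {0..1} (g z)) sequentially"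
  proof (rule uniform_limitI)
    fix e :: real assume e: "e > 0"
    then obtain h where h: "h > 0" and hh: "\<And>p q. p \<in> cball x d \<times> {0..1} \<Longrightarrow> q \<in> cball x d \<times> {0..1} \<Longrightarrow>
        dist q p < h \<Longrightarrow> dist (case q of (z, t) \<Rightarrow> g z t) (case p of (z, t) \<Rightarrow> g z t) < e / 2"
      using unif[of "e / 2"] by (metis half_gt_zero)
    obtain m :: nat where m: "m > 0" "1 / real m < h"
      using h by (meson nat_approx_posE of_nat_less_0_iff of_nat_Suc zero_less_Suc)
    have "dist (?f n z) (integral {0..1} (g z)) < e" if n: "n \<ge> m" and z: "z \<in> cball x d" for n z
    proof -
      have n0: "n > 0" and nh: "1 / real n < h"
        using n m frac_le[of 1 1 "real m" "real n"] by auto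
      have cz: "continuous_on {0..1} (g z)"
        using z d by (intro continuous_on_compose2[OF cont, of _ "\<lambda>t. (z, t)", simplified] continuous_intros) auto
      have piece: "(\<lambda>t. g z t) integrable_on {a..b}" if "0 \<le> a" "b \<le> 1" for a b
        by (rule integrable_continuous_real, rule continuous_on_subset[OF cz]) (use that in auto)
      have split: "integral {0..real k / real n} (g z) = (\<Sum>i<k. integral {real i / real n..real (Suc i) / real n} (g z))"
        if "k \<le> n" for k
        using that
      proof (induction k)
        case (Suc k)
        have "integral {0..real (Suc k) / real n} (g z) =
            integral {0..real k / real n} (g z) + integral {real k / real n..real (Suc k) / real n} (g z)"
          using Suc.prems n0
          by (intro Henstock_Kurzweil_Integration.integral_combine[symmetric] piece) (auto simp: field_simps)
        thus ?case using Suc by simp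
      qed auto
      have "integral {0..1} (g z) = (\<Sum>i<n. integral {real i / real n..real (Suc i) / real n} (g z))"
        using split[of n] n0 by simp
      hence "?f n z - integral {0..1} (g z) =
          (\<Sum>i<n. g z (real i / real n) / of_nat n - integral {real i / real n..real (Suc i) / real n} (g z))"
        by (simp add: sum_subtractf)
      also have "norm \<dots> \<le> (\<Sum>i<n. e / 2 / real n)"
      proof (rule sum_norm_le)
        fix i assume i: "i \<in> {..<n}"
        let ?a = "real i / real n" and ?b = "real (Suc i) / real n"
        have ab: "0 \<le> ?a" "?a \<le> ?b" "?b \<le> 1" "?b - ?a = 1 / real n"
          using i n0 by (auto simp: field_simps)
        have "g z ?a / of_nat n = integral {?a..?b} (\<lambda>t. g z ?a)"
          using ab by (simp add: scaleR_conv_of_real)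
        hence "g z ?a / of_nat n - integral {?a..?b} (g z) = integral {?a..?b} (\<lambda>t. g z ?a - g z t)"
          using ab by (subst Henstock_Kurzweil_Integration.integral_diff) (auto intro!: piece)
        also have "norm \<dots> \<le> e / 2 * (?b - ?a)"
        proof (rule integral_bound)
          show "continuous_on {?a..?b} (\<lambda>t. g z ?a - g z t)"
            using ab by (intro continuous_intros continuous_on_subset[OF cz]) auto
          fix t assume t: "t \<in> {?a..?b}"
          have "dist (z, ?a) (z, t) < h"
            using t ab nh by (auto simp: dist_Pair_Pair dist_real_def)
          have "0 \<le> t" "t \<le> 1" "?a \<le> 1" using t ab by (auto simp only: atLeastAtMost_iff)
          with hh[of "(z, t)" "(z, ?a)"] z ab(1) \<open>dist (z, ?a) (z, t) < h\<close> show "norm (g z ?a - g z t) \<le> e / 2"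
            by (simp add: dist_norm)
        qed (use ab in auto)
        finally show "norm (g z ?a / of_nat n - integral {?a..?b} (g z)) \<le> e / 2 / real n"
          using ab by simp
      qed
      also have "\<dots> < e" using n0 e by simp
      finally show ?thesis by (simp add: dist_norm)
    qed
    thus "\<forall>\<^sub>F n in sequentially. \<forall>z\<in>cball x d. dist (?f n z) (integral {0..1} (g z)) < e"
      unfolding eventually_sequentially by blast
  qed
  thus "\<exists>d>0. cball x d \<subseteq> D \<and> uniform_limit (cball x d) ?f (\<lambda>z. integral {0..1} (g z)) sequentially"
    using d by blast
qed

text \<open>Integrals with a moving endpoint are written over the fixed interval {0..1}, so that
  \<open>s\<close> becomes an ordinary parameter of the integrand and the theorems on parameter
  integrals apply. This lemma translates back.\<close>

lemma integral_rescale: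
  fixes g :: "real \<Rightarrow> complex"
  assumes g: "continuous_on {0..1} g" and s: "s \<in> {0..1}"
  shows "integral {0..1} (\<lambda>\<theta>. of_real s * g (s * \<theta>)) = integral {0..s} g"
proof -
  define F where "F = (\<lambda>x. integral {0..x} g)"
  have F: "(F has_vector_derivative g x) (at x within {0..1})" if "x \<in> {0..1}" for x
    unfolding F_def using g that by (rule integral_has_vector_derivative)
  have "((\<lambda>\<theta>. of_real s * g (s * \<theta>)) has_integral F (s * 1) - F (s * 0)) {0..1}"
  proof (rule fundamental_theorem_of_calculus)
    fix x :: real assume x: "x \<in> {0..1}"
    have sx: "s * x \<in> {0..1}" using s x by (auto intro: mult_le_one)
    have "((F \<circ> (\<lambda>x. s * x)) has_vector_derivative s *\<^sub>R g (s * x)) (at x within {0..1})"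
    proof (rule vector_diff_chain_within)
      show "((\<lambda>x. s * x) has_vector_derivative s) (at x within {0..1})"
        by (auto intro!: derivative_eq_intros simp: has_vector_derivative_def)
      show "(F has_vector_derivative g (s * x)) (at (s * x) within (\<lambda>x. s * x) ` {0..1})"
        by (rule has_vector_derivative_within_subset[OF F[OF sx]]) (use s in \<open>auto intro: mult_le_one\<close>)
    qed
    thus "((\<lambda>x. F (s * x)) has_vector_derivative of_real s * g (s * x)) (at x within {0..1})"
      by (simp add: o_def scaleR_conv_of_real)
  qed simp
  hence "((\<lambda>\<theta>. of_real s * g (s * \<theta>)) has_integral integral {0..s} g) {0..1}"
    by (simp add: F_def)
  thus ?thesis by (rule integral_unique)
qed

text \<open>The bound r/2 keeps a solution that starts within r/2 of \<open>c\<close> inside the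
  disc of radius \<open>r\<close> during unit time, and the Lipschitz constant 1/2 makes the Picard
  operator a contraction on all of {0..1}. Holomorphy in (\<epsilon>, v) is demanded along
  holomorphic curves only, so that the theory of one complex variable suffices.\<close>

locale contraction_ode =
  fixes G :: "real \<Rightarrow> complex \<Rightarrow> complex \<Rightarrow> complex" and c :: complex and r e0 :: real
  assumes r: "r > 0" and e0: "e0 > 0"
    and cont: "continuous_on ({0..1} \<times> cball 0 e0 \<times> cball c r) (\<lambda>(s, \<epsilon>, v). G s \<epsilon> v)"
    and bound: "\<And>s \<epsilon> v. s \<in> {0..1} \<Longrightarrow> \<epsilon> \<in> cball 0 e0 \<Longrightarrow> v \<in> cball c r \<Longrightarrow> norm (G s \<epsilon> v) \<le> r / 2"
    and lip: "\<And>s \<epsilon> v v'. s \<in> {0..1} \<Longrightarrow> \<epsilon> \<in> cball 0 e0 \<Longrightarrow> v \<in> cball c r \<Longrightarrow> v' \<in> cball c r \<Longrightarrow>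
      norm (G s \<epsilon> v - G s \<epsilon> v') \<le> norm (v - v') / 2"
    and hol: "\<And>s D e w. s \<in> {0..1} \<Longrightarrow> open D \<Longrightarrow> e holomorphic_on D \<Longrightarrow> w holomorphic_on D \<Longrightarrow>
      e ` D \<subseteq> cball 0 e0 \<Longrightarrow> w ` D \<subseteq> cball c r \<Longrightarrow> (\<lambda>\<zeta>. G s (e \<zeta>) (w \<zeta>)) holomorphic_on D"
begin

fun picard :: "nat \<Rightarrow> complex \<Rightarrow> complex \<Rightarrow> real \<Rightarrow> complex" where
  "picard 0 \<epsilon> v s = v"
| "picard (Suc k) \<epsilon> v s = v + integral {0..1} (\<lambda>\<theta>. of_real s * G (s * \<theta>) \<epsilon> (picard k \<epsilon> v (s * \<theta>)))"

abbreviation "odom \<equiv> {0..1::real} \<times> cball (0::complex) e0 \<times> cball c (r / 2)"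

lemma continuous_on_G:
  assumes "continuous_on A a" "continuous_on A b" "continuous_on A d"
    and "\<And>x. x \<in> A \<Longrightarrow> a x \<in> {0..1} \<and> b x \<in> cball 0 e0 \<and> d x \<in> cball c r"
  shows "continuous_on A (\<lambda>x. G (a x) (b x) (d x))"
proof -
  have "continuous_on A ((\<lambda>(s, \<epsilon>, v). G s \<epsilon> v) \<circ> (\<lambda>x. (a x, b x, d x)))"
    using assms by (intro continuous_on_compose continuous_intros continuous_on_subset[OF cont]) auto
  thus ?thesis by (simp add: o_def)
qed

text \<open>Stated for an arbitrary candidate \<open>u\<close>, since it is applied to the iterates
  as well as to their limit. The radius \<open>r\<close> is made up of r/2 from the start value and
  r/2 from the integral.\<close>

lemma picard_step:
  assumes u: "continuous_on odom (\<lambda>(s, \<epsilon>, v). u \<epsilon> v s)"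
    and u_in: "\<And>s \<epsilon> v. (s, \<epsilon>, v) \<in> odom \<Longrightarrow> u \<epsilon> v s \<in> cball c r"
  shows "continuous_on odom (\<lambda>(s, \<epsilon>, v). v + integral {0..1} (\<lambda>\<theta>. of_real s * G (s * \<theta>) \<epsilon> (u \<epsilon> v (s * \<theta>))))"
    and "(s, \<epsilon>, v) \<in> odom \<Longrightarrow> v + integral {0..1} (\<lambda>\<theta>. of_real s * G (s * \<theta>) \<epsilon> (u \<epsilon> v (s * \<theta>))) \<in> cball c r"
    and "(s, \<epsilon>, v) \<in> odom \<Longrightarrow> continuous_on {0..1} (\<lambda>\<theta>. of_real s * G (s * \<theta>) \<epsilon> (u \<epsilon> v (s * \<theta>)))"
proof -
  have u': "continuous_on (odom \<times> {0..1}) (\<lambda>((s, \<epsilon>, v), \<theta>). u \<epsilon> v (s * \<theta>))"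
  proof -
    have "continuous_on (odom \<times> {0..1}) ((\<lambda>(s, \<epsilon>, v). u \<epsilon> v s) \<circ> (\<lambda>((s, \<epsilon>, v), \<theta>). (s * \<theta>, \<epsilon>, v)))"
      by (intro continuous_on_compose continuous_on_subset[OF u])
         (auto simp: case_prod_unfold intro!: continuous_intros mult_le_one)
    thus ?thesis by (simp add: o_def case_prod_unfold)
  qed
  have big: "continuous_on (odom \<times> {0..1}) (\<lambda>((s, \<epsilon>, v), \<theta>). of_real s * G (s * \<theta>) \<epsilon> (u \<epsilon> v (s * \<theta>)))"
    unfolding case_prod_unfold
  proof (intro continuous_on_mult continuous_on_G u'[unfolded case_prod_unfold])
    fix x assume x: "x \<in> odom \<times> {0..1::real}"
    hence "fst (fst x) * snd x \<in> {0..1}"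
      by (auto intro: mult_le_one)
    with x u_in[of "fst (fst x) * snd x" "fst (snd (fst x))" "snd (snd (fst x))"]
    show "fst (fst x) * snd x \<in> {0..1} \<and> fst (snd (fst x)) \<in> cball 0 e0 \<and>
        u (fst (snd (fst x))) (snd (snd (fst x))) (fst (fst x) * snd x) \<in> cball c r"
      by (auto simp: mem_Times_iff simp del: mem_cball)
  qed (auto intro!: continuous_intros)
  have "continuous_on (odom \<times> cbox 0 (1::real)) (\<lambda>(p, \<theta>). (\<lambda>(s, \<epsilon>, v) \<theta>. of_real s * G (s * \<theta>) \<epsilon> (u \<epsilon> v (s * \<theta>))) p \<theta>)"
    using big by (simp add: case_prod_unfold)
  from integral_continuous_on_param[OF this]
  have "continuous_on odom (\<lambda>p. integral {0..1} (\<lambda>\<theta>. of_real (fst p) * G (fst p * \<theta>) (fst (snd p)) (u (fst (snd p)) (snd (snd p)) (fst p * \<theta>))))"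
    by (simp add: case_prod_unfold)
  thus "continuous_on odom (\<lambda>(s, \<epsilon>, v). v + integral {0..1} (\<lambda>\<theta>. of_real s * G (s * \<theta>) \<epsilon> (u \<epsilon> v (s * \<theta>))))"
    unfolding case_prod_unfold by (intro continuous_intros) auto
  assume dm: "(s, \<epsilon>, v) \<in> odom"
  have "continuous_on {0..1} ((\<lambda>((s, \<epsilon>, v), \<theta>). of_real s * G (s * \<theta>) \<epsilon> (u \<epsilon> v (s * \<theta>))) \<circ> (\<lambda>\<theta>. ((s, \<epsilon>, v), \<theta>)))"
    using dm by (intro continuous_on_compose continuous_on_subset[OF big] continuous_intros) auto
  thus c1: "continuous_on {0..1} (\<lambda>\<theta>. of_real s * G (s * \<theta>) \<epsilon> (u \<epsilon> v (s * \<theta>)))"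
    by (simp add: o_def)
  have "norm (integral {0..1} (\<lambda>\<theta>. of_real s * G (s * \<theta>) \<epsilon> (u \<epsilon> v (s * \<theta>)))) \<le> r / 2 * (1 - 0)"
  proof (rule integral_bound[OF _ c1])
    fix \<theta> :: real assume t: "\<theta> \<in> {0..1}"
    hence st: "s * \<theta> \<in> {0..1}" using dm by (auto intro: mult_le_one)
    have "norm (G (s * \<theta>) \<epsilon> (u \<epsilon> v (s * \<theta>))) \<le> r / 2"
      using st dm by (intro bound u_in) auto
    hence "\<bar>s\<bar> * norm (G (s * \<theta>) \<epsilon> (u \<epsilon> v (s * \<theta>))) \<le> 1 * (r / 2)"
      using dm by (intro mult_mono) auto
    thus "norm (of_real s * G (s * \<theta>) \<epsilon> (u \<epsilon> v (s * \<theta>))) \<le> r / 2"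
      by (simp add: norm_mult)
  qed simp
  moreover have "norm (v - c) \<le> r / 2"
    using dm by (auto simp: dist_norm norm_minus_commute)
  ultimately show "v + integral {0..1} (\<lambda>\<theta>. of_real s * G (s * \<theta>) \<epsilon> (u \<epsilon> v (s * \<theta>))) \<in> cball c r"
    using norm_triangle_ineq[of "v - c" "integral {0..1} (\<lambda>\<theta>. of_real s * G (s * \<theta>) \<epsilon> (u \<epsilon> v (s * \<theta>)))"]
    by (simp add: dist_norm norm_minus_commute algebra_simps)
qed

lemma picard_facts:
  "continuous_on odom (\<lambda>(s, \<epsilon>, v). picard k \<epsilon> v s) \<and> (\<forall>(s, \<epsilon>, v)\<in>odom. picard k \<epsilon> v s \<in> cball c r)"
proof (induction k)
  case 0
  have "cball c (r / 2) \<subseteq> cball c r" using r by auto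
  thus ?case by (auto simp: case_prod_unfold intro!: continuous_intros)
next
  case (Suc k)
  have c: "continuous_on odom (\<lambda>(s, \<epsilon>, v). picard k \<epsilon> v s)"
    and i: "\<And>s \<epsilon> v. (s, \<epsilon>, v) \<in> odom \<Longrightarrow> picard k \<epsilon> v s \<in> cball c r"
    using Suc by blast+
  show ?case
    using picard_step(1)[OF c i] picard_step(2)[OF c i] unfolding picard.simps by blast
qed

lemma picard_in: "(s, \<epsilon>, v) \<in> odom \<Longrightarrow> picard k \<epsilon> v s \<in> cball c r"
  using picard_facts by blast

lemma picard_diff:
  assumes u: "continuous_on odom (\<lambda>(s, \<epsilon>, v). u \<epsilon> v s)"
    and u_in: "\<And>s \<epsilon> v. (s, \<epsilon>, v) \<in> odom \<Longrightarrow> u \<epsilon> v s \<in> cball c r"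
    and u': "continuous_on odom (\<lambda>(s, \<epsilon>, v). u' \<epsilon> v s)"
    and u'_in: "\<And>s \<epsilon> v. (s, \<epsilon>, v) \<in> odom \<Longrightarrow> u' \<epsilon> v s \<in> cball c r"
    and B: "\<And>s \<epsilon> v. (s, \<epsilon>, v) \<in> odom \<Longrightarrow> norm (u \<epsilon> v s - u' \<epsilon> v s) \<le> B"
    and dm: "(s, \<epsilon>, v) \<in> odom"
  shows "norm (integral {0..1} (\<lambda>\<theta>. of_real s * G (s * \<theta>) \<epsilon> (u \<epsilon> v (s * \<theta>))) -
      integral {0..1} (\<lambda>\<theta>. of_real s * G (s * \<theta>) \<epsilon> (u' \<epsilon> v (s * \<theta>)))) \<le> B / 2"
proof -
  note c1 = picard_step(3)[OF u u_in dm] and c2 = picard_step(3)[OF u' u'_in dm]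
  have "integral {0..1} (\<lambda>\<theta>. of_real s * G (s * \<theta>) \<epsilon> (u \<epsilon> v (s * \<theta>))) -
      integral {0..1} (\<lambda>\<theta>. of_real s * G (s * \<theta>) \<epsilon> (u' \<epsilon> v (s * \<theta>))) =
      integral {0..1} (\<lambda>\<theta>. of_real s * G (s * \<theta>) \<epsilon> (u \<epsilon> v (s * \<theta>)) - of_real s * G (s * \<theta>) \<epsilon> (u' \<epsilon> v (s * \<theta>)))"
    by (intro Henstock_Kurzweil_Integration.integral_diff[symmetric] integrable_continuous_real c1 c2)
  also have "norm \<dots> \<le> B / 2 * (1 - 0)"
  proof (rule integral_bound)
    show "continuous_on {0..1} (\<lambda>\<theta>. of_real s * G (s * \<theta>) \<epsilon> (u \<epsilon> v (s * \<theta>)) - of_real s * G (s * \<theta>) \<epsilon> (u' \<epsilon> v (s * \<theta>)))"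
      by (intro continuous_on_diff c1 c2)
    fix \<theta> :: real assume t: "\<theta> \<in> {0..1}"
    hence st: "(s * \<theta>, \<epsilon>, v) \<in> odom" using dm by (auto intro: mult_le_one)
    have "norm (G (s * \<theta>) \<epsilon> (u \<epsilon> v (s * \<theta>)) - G (s * \<theta>) \<epsilon> (u' \<epsilon> v (s * \<theta>))) \<le> norm (u \<epsilon> v (s * \<theta>) - u' \<epsilon> v (s * \<theta>)) / 2"
      using st u_in[OF st] u'_in[OF st] by (intro lip) auto
    also have "\<dots> \<le> B / 2" using B[OF st] by simp
    finally have "\<bar>s\<bar> * norm (G (s * \<theta>) \<epsilon> (u \<epsilon> v (s * \<theta>)) - G (s * \<theta>) \<epsilon> (u' \<epsilon> v (s * \<theta>))) \<le> 1 * (B / 2)"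
      using dm by (intro mult_mono) auto
    thus "norm (of_real s * G (s * \<theta>) \<epsilon> (u \<epsilon> v (s * \<theta>)) - of_real s * G (s * \<theta>) \<epsilon> (u' \<epsilon> v (s * \<theta>))) \<le> B / 2"
      by (simp add: norm_mult flip: right_diff_distrib)
  qed simp
  finally show ?thesis by simp
qed

text \<open>The constant 2r bounds the distance of the first two iterates, both of which lie within
  \<open>r\<close> of \<open>c\<close>; every further step halves it.\<close>

lemma picard_Cauchy:
  "(s, \<epsilon>, v) \<in> odom \<Longrightarrow> norm (picard (Suc k) \<epsilon> v s - picard k \<epsilon> v s) \<le> (1 / 2) ^ k * (2 * r)"
proof (induction k arbitrary: s \<epsilon> v)
  case 0
  have "norm (picard (Suc 0) \<epsilon> v s - c) \<le> r" "norm (picard 0 \<epsilon> v s - c) \<le> r"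
    using picard_in[OF 0, of "Suc 0"] picard_in[OF 0, of 0] by (simp_all only: mem_cball dist_norm norm_minus_commute)
  thus ?case using norm_triangle_ineq4[of "picard (Suc 0) \<epsilon> v s - c" "picard 0 \<epsilon> v s - c"] by simp
next
  case (Suc k)
  have "norm (integral {0..1} (\<lambda>\<theta>. of_real s * G (s * \<theta>) \<epsilon> (picard (Suc k) \<epsilon> v (s * \<theta>))) -
      integral {0..1} (\<lambda>\<theta>. of_real s * G (s * \<theta>) \<epsilon> (picard k \<epsilon> v (s * \<theta>)))) \<le> (1 / 2) ^ k * (2 * r) / 2"
    by (rule picard_diff) (use picard_facts[of "Suc k"] picard_facts[of k] picard_in Suc in \<open>blast+\<close>)
  thus ?case by simp
qed

text \<open>A telescoping series whose partial sums are the iterates, so that the Weierstrass test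
  gives uniform convergence at once.\<close>

definition flow :: "real \<Rightarrow> complex \<Rightarrow> complex \<Rightarrow> complex" where
  "flow s \<epsilon> v = v + (\<Sum>i. picard (Suc i) \<epsilon> v s - picard i \<epsilon> v s)"

lemma picard_uniform_limit:
  "uniform_limit odom (\<lambda>k (s, \<epsilon>, v). picard k \<epsilon> v s) (\<lambda>(s, \<epsilon>, v). flow s \<epsilon> v) sequentially"
proof -
  have "uniform_limit odom (\<lambda>n x. \<Sum>i<n. (\<lambda>(s, \<epsilon>, v). picard (Suc i) \<epsilon> v s - picard i \<epsilon> v s) x)
      (\<lambda>x. \<Sum>i. (\<lambda>(s, \<epsilon>, v). picard (Suc i) \<epsilon> v s - picard i \<epsilon> v s) x) sequentially"
  proof (rule Weierstrass_m_test)
    show "summable (\<lambda>k. (1 / 2) ^ k * (2 * r))"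
      by (intro summable_mult2 summable_geometric) simp
    show "norm ((\<lambda>(s, \<epsilon>, v). picard (Suc k) \<epsilon> v s - picard k \<epsilon> v s) x) \<le> (1 / 2) ^ k * (2 * r)" if "x \<in> odom" for k x
      using picard_Cauchy[of "fst x" "fst (snd x)" "snd (snd x)" k] that by (simp only: case_prod_unfold prod.collapse)
  qed
  hence "uniform_limit odom (\<lambda>n x. (\<lambda>(s, \<epsilon>, v). v) x + (\<Sum>i<n. (\<lambda>(s, \<epsilon>, v). picard (Suc i) \<epsilon> v s - picard i \<epsilon> v s) x))
      (\<lambda>x. (\<lambda>(s, \<epsilon>, v). v) x + (\<Sum>i. (\<lambda>(s, \<epsilon>, v). picard (Suc i) \<epsilon> v s - picard i \<epsilon> v s) x)) sequentially"
    by (intro uniform_limit_add uniform_limit_const)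
  moreover have "v + (\<Sum>i<n. picard (Suc i) \<epsilon> v s - picard i \<epsilon> v s) = picard n \<epsilon> v s" for n s \<epsilon> v
    using sum_lessThan_telescope[of "\<lambda>i. picard i \<epsilon> v s" n] by simp
  ultimately show ?thesis by (simp add: flow_def case_prod_unfold)
qed

lemma continuous_on_flow: "continuous_on odom (\<lambda>(s, \<epsilon>, v). flow s \<epsilon> v)"
  by (rule uniform_limit_theorem[OF _ picard_uniform_limit])
     (use picard_facts in \<open>auto simp: case_prod_unfold intro!: always_eventually\<close>)

lemma picard_tendsto: "(s, \<epsilon>, v) \<in> odom \<Longrightarrow> (\<lambda>k. picard k \<epsilon> v s) \<longlonglongrightarrow> flow s \<epsilon> v"
  using tendsto_uniform_limitI[OF picard_uniform_limit, of "(s, \<epsilon>, v)"] by simp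

lemma flow_in: "(s, \<epsilon>, v) \<in> odom \<Longrightarrow> flow s \<epsilon> v \<in> cball c r"
  by (rule Lim_in_closed_set[OF closed_cball _ _ picard_tendsto])
     (use picard_in in \<open>auto intro!: always_eventually\<close>)

lemma flow_eq:
  assumes dm: "(s, \<epsilon>, v) \<in> odom"
  shows "flow s \<epsilon> v = v + integral {0..1} (\<lambda>\<theta>. of_real s * G (s * \<theta>) \<epsilon> (flow (s * \<theta>) \<epsilon> v))"
proof -
  let ?I = "\<lambda>u. integral {0..1} (\<lambda>\<theta>. of_real s * G (s * \<theta>) \<epsilon> (u (s * \<theta>)))"
  have "(\<lambda>k. picard (Suc k) \<epsilon> v s) \<longlonglongrightarrow> v + ?I (\<lambda>s. flow s \<epsilon> v)"
  proof (rule tendstoI)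
    fix e :: real assume e: "e > 0"
    have "\<forall>\<^sub>F k in sequentially. \<forall>x\<in>odom. dist ((\<lambda>(s, \<epsilon>, v). picard k \<epsilon> v s) x) ((\<lambda>(s, \<epsilon>, v). flow s \<epsilon> v) x) < e"
      using uniform_limitD[OF picard_uniform_limit e] .
    thus "\<forall>\<^sub>F k in sequentially. dist (picard (Suc k) \<epsilon> v s) (v + ?I (\<lambda>s. flow s \<epsilon> v)) < e"
    proof eventually_elim
      case (elim k)
      have "norm (?I (picard k \<epsilon> v) - ?I (\<lambda>s. flow s \<epsilon> v)) \<le> e / 2"
        by (rule picard_diff[of "picard k" "\<lambda>\<epsilon> v s. flow s \<epsilon> v", OF _ picard_in continuous_on_flow flow_in _ dm])
           (use picard_facts[of k] elim in \<open>auto simp: dist_norm intro!: less_imp_le\<close>)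
      thus ?case using e by (simp add: dist_norm)
    qed
  qed
  from LIMSEQ_unique[OF LIMSEQ_Suc[OF picard_tendsto[OF dm]] this] show ?thesis .
qed

lemma flow_0: "(0, \<epsilon>, v) \<in> odom \<Longrightarrow> flow 0 \<epsilon> v = v"
  by (subst flow_eq) auto

lemma continuous_on_flow_s: "\<epsilon> \<in> cball 0 e0 \<Longrightarrow> v \<in> cball c (r / 2) \<Longrightarrow> continuous_on {0..1} (\<lambda>s. flow s \<epsilon> v)"
  by (rule continuous_on_compose2[OF continuous_on_flow, of _ "\<lambda>s. (s, \<epsilon>, v)", simplified])
     (auto intro!: continuous_intros)

lemma flow_deriv:
  assumes dm: "(s, \<epsilon>, v) \<in> odom"
  shows "((\<lambda>s. flow s \<epsilon> v) has_vector_derivative G s \<epsilon> (flow s \<epsilon> v)) (at s within {0..1})"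
proof -
  have cg: "continuous_on {0..1} (\<lambda>s. G s \<epsilon> (flow s \<epsilon> v))"
    using dm flow_in by (intro continuous_on_G continuous_on_flow_s continuous_intros) auto
  have "((\<lambda>s. v + integral {0..s} (\<lambda>s. G s \<epsilon> (flow s \<epsilon> v))) has_vector_derivative 0 + G s \<epsilon> (flow s \<epsilon> v)) (at s within {0..1})"
    using dm by (intro has_vector_derivative_add has_vector_derivative_const integral_has_vector_derivative[OF cg]) auto
  moreover have "v + integral {0..s} (\<lambda>s. G s \<epsilon> (flow s \<epsilon> v)) = flow s \<epsilon> v" if "s \<in> {0..1}" for s
    using flow_eq[of s \<epsilon> v] integral_rescale[OF cg that] dm that by simp
  ultimately show ?thesis
    using dm by (intro has_vector_derivative_transform[of s "{0..1}" "\<lambda>s. flow s \<epsilon> v"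
        "\<lambda>s. v + integral {0..s} (\<lambda>s. G s \<epsilon> (flow s \<epsilon> v))"]) simp_all
qed

text \<open>Where the difference of the two solutions is largest in norm, the mean value inequality
  with constant 1/2 over an interval of length at most 1 bounds this maximum by half of
  itself.\<close>

lemma ode_unique:
  assumes w: "\<And>s. s \<in> {0..1} \<Longrightarrow> (w has_vector_derivative G s \<epsilon> (w s)) (at s within {0..1})"
    and w_in: "\<And>s. s \<in> {0..1} \<Longrightarrow> w s \<in> cball c r"
    and \<epsilon>: "\<epsilon> \<in> cball 0 e0" and w0: "w 0 \<in> cball c (r / 2)"
    and s: "s \<in> {0..1}"
  shows "w s = flow s \<epsilon> (w 0)"
proof -
  define d where "d = (\<lambda>s. w s - flow s \<epsilon> (w 0))"
  have dm: "(s, \<epsilon>, w 0) \<in> odom" if "s \<in> {0..1}" for s using that \<epsilon> w0 by auto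
  have dd: "(d has_vector_derivative G s \<epsilon> (w s) - G s \<epsilon> (flow s \<epsilon> (w 0))) (at s within {0..1})" if "s \<in> {0..1}" for s
    unfolding d_def using that by (intro has_vector_derivative_diff w flow_deriv dm)
  have cd: "continuous_on {0..1} d"
    unfolding continuous_on_eq_continuous_within
    using dd has_vector_derivative_continuous by blast
  obtain m where m: "m \<in> {0..1}" "\<And>s. s \<in> {0..1} \<Longrightarrow> norm (d s) \<le> norm (d m)"
    using continuous_attains_sup[of "{0..1::real}" "\<lambda>s. norm (d s)"] continuous_on_norm[OF cd]
    by (metis atLeastAtMost_iff compact_Icc empty_iff order_refl zero_le_one)
  have "norm (d m - d 0) \<le> norm (d m) / 2 * norm (m - 0)"
  proof (rule differentiable_bound[where S = "{0..1}" and f' = "\<lambda>s h. h *\<^sub>R (G s \<epsilon> (w s) - G s \<epsilon> (flow s \<epsilon> (w 0)))"])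
    fix s :: real assume s: "s \<in> {0..1}"
    show "(d has_derivative (\<lambda>h. h *\<^sub>R (G s \<epsilon> (w s) - G s \<epsilon> (flow s \<epsilon> (w 0))))) (at s within {0..1})"
      using dd[OF s] by (simp add: has_vector_derivative_def)
    have "norm (G s \<epsilon> (w s) - G s \<epsilon> (flow s \<epsilon> (w 0))) \<le> norm (w s - flow s \<epsilon> (w 0)) / 2"
      using s \<epsilon> w_in flow_in[OF dm[OF s]] by (intro lip) auto
    also have "\<dots> \<le> norm (d m) / 2" using m(2)[OF s] by (simp add: d_def)
    finally show "onorm (\<lambda>h. h *\<^sub>R (G s \<epsilon> (w s) - G s \<epsilon> (flow s \<epsilon> (w 0)))) \<le> norm (d m) / 2"
      by (simp add: onorm_scaleR_left onorm_id)
  qed (use m in auto)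
  moreover have "d 0 = 0" using flow_0[OF dm] by (simp add: d_def)
  moreover have "norm (d m) / 2 * norm (m - 0) \<le> norm (d m) / 2" using m(1) by (intro mult_left_le) auto
  ultimately have "norm (d m) \<le> norm (d m) / 2" by (metis diff_0_right order_trans)
  hence "norm (d m) \<le> 0" by simp
  with m(2)[OF s] show ?thesis by (simp add: d_def)
qed

text \<open>Each iterate is holomorphic along the curve by the lemma on parameter integrals, and the
  convergence is uniform.\<close>

lemma flow_holomorphic:
  assumes D: "open D" and e: "e holomorphic_on D" and w: "w holomorphic_on D"
    and e_in: "e ` D \<subseteq> cball 0 e0" and w_in: "w ` D \<subseteq> cball c (r / 2)" and s: "s \<in> {0..1}"
  shows "(\<lambda>\<zeta>. flow s (e \<zeta>) (w \<zeta>)) holomorphic_on D"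
proof -
  have dm: "(s, e \<zeta>, w \<zeta>) \<in> odom" if "\<zeta> \<in> D" "s \<in> {0..1}" for \<zeta> s
    using that e_in w_in by auto
  have pic: "(\<lambda>\<zeta>. picard k (e \<zeta>) (w \<zeta>) s) holomorphic_on D" if "s \<in> {0..1}" for k s
    using that
  proof (induction k arbitrary: s)
    case (Suc k)
    have "(\<lambda>\<zeta>. integral {0..1} (\<lambda>\<theta>. of_real s * G (s * \<theta>) (e \<zeta>) (picard k (e \<zeta>) (w \<zeta>) (s * \<theta>)))) holomorphic_on D"
    proof (rule holomorphic_on_integral_param[OF D])
      have "continuous_on (D \<times> {0..1}) ((\<lambda>(s, \<epsilon>, v). picard k \<epsilon> v s) \<circ> (\<lambda>(\<zeta>, \<theta>). (s * \<theta>, e \<zeta>, w \<zeta>)))"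
      proof (intro continuous_on_compose continuous_on_subset[OF picard_facts[THEN conjunct1]])
        show "continuous_on (D \<times> {0..1}) (\<lambda>(\<zeta>, \<theta>). (s * \<theta>, e \<zeta>, w \<zeta>))"
          unfolding case_prod_unfold
          by (intro continuous_on_Pair continuous_on_mult continuous_on_const continuous_on_snd continuous_on_id
              continuous_on_compose2[OF holomorphic_on_imp_continuous_on[OF e]]
              continuous_on_compose2[OF holomorphic_on_imp_continuous_on[OF w]] continuous_on_fst) auto
        show "(\<lambda>(\<zeta>, \<theta>). (s * \<theta>, e \<zeta>, w \<zeta>)) ` (D \<times> {0..1}) \<subseteq> odom"
        proof (rule image_subsetI)
          fix x assume "x \<in> D \<times> {0..1::real}"
          hence "(s * snd x, e (fst x), w (fst x)) \<in> odom"
            using Suc.prems by (intro dm) (auto intro: mult_le_one)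
          thus "(case x of (\<zeta>, \<theta>) \<Rightarrow> (s * \<theta>, e \<zeta>, w \<zeta>)) \<in> odom"
            by (simp add: case_prod_unfold)
        qed
      qed
      hence c2: "continuous_on (D \<times> {0..1}) (\<lambda>x. picard k (e (fst x)) (w (fst x)) (s * snd x))"
        by (simp add: o_def case_prod_unfold)
      show "continuous_on (D \<times> {0..1}) (\<lambda>(\<zeta>, \<theta>). of_real s * G (s * \<theta>) (e \<zeta>) (picard k (e \<zeta>) (w \<zeta>) (s * \<theta>)))"
        unfolding case_prod_unfold
      proof (intro continuous_on_mult continuous_on_const continuous_on_G c2)
        show "continuous_on (D \<times> {0..1}) (\<lambda>x. e (fst x))"
          by (rule continuous_on_compose2[OF holomorphic_on_imp_continuous_on[OF e]]) (auto intro: continuous_intros)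
        fix x assume x: "x \<in> D \<times> {0..1::real}"
        hence "s * snd x \<in> {0..1}" using Suc.prems by (auto intro: mult_le_one)
        with x show "s * snd x \<in> {0..1} \<and> e (fst x) \<in> cball 0 e0 \<and> picard k (e (fst x)) (w (fst x)) (s * snd x) \<in> cball c r"
          using e_in picard_in[OF dm] by auto
      qed (auto intro: continuous_intros)
      fix \<theta> :: real assume "\<theta> \<in> {0..1}"
      hence st: "s * \<theta> \<in> {0..1}" using Suc.prems by (auto intro: mult_le_one)
      show "(\<lambda>\<zeta>. of_real s * G (s * \<theta>) (e \<zeta>) (picard k (e \<zeta>) (w \<zeta>) (s * \<theta>))) holomorphic_on D"
        by (intro holomorphic_intros hol[OF st D e Suc.IH[OF st] e_in]) (use picard_in[OF dm[OF _ st]] in auto)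
    qed
    thus ?case using w by (auto intro!: holomorphic_intros)
  qed (use w in simp)
  show ?thesis
  proof (rule holomorphic_uniform_sequence[OF D])
    show "(\<lambda>\<zeta>. picard k (e \<zeta>) (w \<zeta>) s) holomorphic_on D" for k using pic s .
    fix x assume "x \<in> D"
    then obtain d where d: "d > 0" "cball x d \<subseteq> D"
      using D open_contains_cball by blast
    have "uniform_limit (cball x d) (\<lambda>k \<zeta>. picard k (e \<zeta>) (w \<zeta>) s) (\<lambda>\<zeta>. flow s (e \<zeta>) (w \<zeta>)) sequentially"
    proof (rule uniform_limitI)
      fix \<eta> :: real assume "\<eta> > 0"
      from uniform_limitD[OF picard_uniform_limit this]
      show "\<forall>\<^sub>F k in sequentially. \<forall>x\<in>cball x d. dist (picard k (e x) (w x) s) (flow s (e x) (w x)) < \<eta>"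
      proof eventually_elim
        case (elim k)
        show ?case
        proof
          fix x' assume "x' \<in> cball x d"
          hence "(s, e x', w x') \<in> odom" using d by (intro dm s) auto
          from bspec[OF elim this] show "dist (picard k (e x') (w x') s) (flow s (e x') (w x')) < \<eta>" by simp
        qed
      qed
    qed
    with d show "\<exists>d>0. cball x d \<subseteq> D \<and>
        uniform_limit (cball x d) (\<lambda>k \<zeta>. picard k (e \<zeta>) (w \<zeta>) s) (\<lambda>\<zeta>. flow s (e \<zeta>) (w \<zeta>)) sequentially"
      by blast
  qed
qed

end

lemma contraction_ode_reverse:
  assumes "contraction_ode G c r e0"
  shows "contraction_ode (\<lambda>s \<epsilon> v. - G (1 - s) \<epsilon> v) c r e0"
proof -
  interpret contraction_ode G c r e0 by fact
  show ?thesis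
  proof
    show "continuous_on ({0..1} \<times> cball 0 e0 \<times> cball c r) (\<lambda>(s, \<epsilon>, v). - G (1 - s) \<epsilon> v)"
      unfolding case_prod_unfold by (intro continuous_intros continuous_on_G) auto
  next
    fix s :: real and \<epsilon> v v' :: complex assume "s \<in> {0..1}" "\<epsilon> \<in> cball 0 e0" "v \<in> cball c r" "v' \<in> cball c r"
    thus "norm (- G (1 - s) \<epsilon> v - - G (1 - s) \<epsilon> v') \<le> norm (v - v') / 2"
      using lip[of "1 - s" \<epsilon> v v'] by (simp add: norm_minus_commute)
  qed (use r e0 bound hol in \<open>auto intro!: holomorphic_intros\<close>)
qed

text \<open>The solution run backwards solves the reversed equation, so uniqueness applies. This
  will make the holonomy of a reversed loop the exact inverse of the holonomy of the loop.\<close>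

lemma flow_reverse:
  assumes "contraction_ode G c r e0" and s: "s \<in> {0..1}" and \<epsilon>: "\<epsilon> \<in> cball 0 e0"
    and v: "v \<in> cball c (r / 2)" and w: "contraction_ode.flow G 1 \<epsilon> v \<in> cball c (r / 2)"
  shows "contraction_ode.flow (\<lambda>s \<epsilon> v. - G (1 - s) \<epsilon> v) s \<epsilon> (contraction_ode.flow G 1 \<epsilon> v) =
    contraction_ode.flow G (1 - s) \<epsilon> v"
proof -
  interpret contraction_ode G c r e0 by fact
  interpret rev: contraction_ode "\<lambda>s \<epsilon> v. - G (1 - s) \<epsilon> v" c r e0
    by (rule contraction_ode_reverse) fact
  define w where "w = (\<lambda>s. flow (1 - s) \<epsilon> v)"
  have "w s = rev.flow s \<epsilon> (w 0)"
  proof (rule rev.ode_unique[OF _ _ \<epsilon> _ s])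
    fix x :: real assume x: "x \<in> {0..1}"
    have "((\<lambda>s. flow s \<epsilon> v) \<circ> (\<lambda>x. 1 - x) has_vector_derivative (- 1) *\<^sub>R G (1 - x) \<epsilon> (flow (1 - x) \<epsilon> v)) (at x within {0..1})"
    proof (rule vector_diff_chain_within)
      show "((\<lambda>x. 1 - x) has_vector_derivative - 1) (at x within {0..1})"
        by (auto intro!: derivative_eq_intros)
      have "(\<lambda>x. 1 - x) ` {0..1} = {0..1::real}" by (auto simp: image_iff intro!: bexI[of _ "1 - _"])
      thus "((\<lambda>s. flow s \<epsilon> v) has_vector_derivative G (1 - x) \<epsilon> (flow (1 - x) \<epsilon> v)) (at (1 - x) within (\<lambda>x. 1 - x) ` {0..1})"
        using x \<epsilon> v by (auto intro!: flow_deriv)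
    qed
    thus "(w has_vector_derivative - G (1 - x) \<epsilon> (w x)) (at x within {0..1})"
      by (simp add: w_def o_def)
  qed (use w \<epsilon> v in \<open>auto simp: w_def simp del: mem_cball intro!: flow_in\<close>)
  thus ?thesis by (simp add: w_def)
qed

section \<open>Detecting the lower central series by iterated integrals\<close>

text \<open>The finite difference w(x + c) - w(x) acts like a derivative: it costs one degree and
  multiplies the leading coefficient by (m + 1) c. The induction writes w = a + x v, whose
  difference is c v + (c + x) d with \<open>d\<close> the difference of \<open>v\<close>.\<close>

lemma shift_poly_diff:
  fixes w :: "complex poly"
  assumes "degree w \<le> Suc m"
  shows "degree (pcompose w [:c, 1:] - w) \<le> m \<and>
    coeff (pcompose w [:c, 1:] - w) m = of_nat (Suc m) * c * coeff w (Suc m)"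
  using assms
proof (induction m arbitrary: w)
  case 0
  obtain a v where w: "w = pCons a v" by (cases w)
  with 0 have "degree v = 0" by (auto split: if_splits)
  then obtain b where "v = [:b:]" by (rule degree_eq_zeroE)
  thus ?case by (simp add: w pcompose_pCons)
next
  case (Suc m)
  obtain a v where w: "w = pCons a v" by (cases w)
  with Suc.prems have v: "degree v \<le> Suc m" by (auto split: if_splits)
  define d where "d = pcompose v [:c, 1:] - v"
  have d: "degree d \<le> m" "coeff d m = of_nat (Suc m) * c * coeff v (Suc m)"
    using Suc.IH[OF v] by (auto simp: d_def)
  have eq: "pcompose w [:c, 1:] - w = smult c v + smult c d + pCons 0 d"
    by (simp add: w d_def pcompose_pCons algebra_simps smult_diff_right)
  have "coeff d (Suc m) = 0" using d(1) by (simp add: coeff_eq_0)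
  hence "coeff (pcompose w [:c, 1:] - w) (Suc m) = of_nat (Suc (Suc m)) * c * coeff w (Suc (Suc m))"
    unfolding eq using d(2) by (simp add: w algebra_simps)
  moreover have "degree (pcompose w [:c, 1:] - w) \<le> Suc m"
    unfolding eq using d(1) v
    by (intro degree_add_le order_trans[OF degree_smult_le] order_trans[OF degree_pCons_le]) auto
  ultimately show ?case by blast
qed

lemma pcompose_shift_shift:
  fixes w :: "complex poly"
  shows "pcompose (pcompose w [:a, 1:]) [:b, 1:] = pcompose w [:a + b, 1:]"
  by (simp add: pcompose_assoc[symmetric] pcompose_pCons algebra_simps)

section \<open>Iterated commutators in an abstract group\<close>

context group
begin

text \<open>With \<open>m\<close> brackets the word has weight \<open>m + 1\<close> in the lower
  central series.\<close>

fun ad_word :: "'a \<Rightarrow> 'a \<Rightarrow> nat \<Rightarrow> 'a" where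
  "ad_word a b 0 = b"
| "ad_word a b (Suc m) = a \<otimes> ad_word a b m \<otimes> inv a \<otimes> inv (ad_word a b m)"

lemma lower_central_series_subset: "lower_central_series G k \<subseteq> carrier G"
proof (induction k rule: less_induct)
  case (less k)
  consider "k = 0" | "k = 1" | m where "k = Suc (Suc m)" by (metis One_nat_def not0_implies_Suc)
  thus ?case
  proof cases
    case 3
    have "{a \<otimes> b \<otimes> inv a \<otimes> inv b | a b. a \<in> carrier G \<and> b \<in> lower_central_series G (Suc m)} \<subseteq> carrier G"
      using less[of "Suc m"] 3 by auto
    thus ?thesis using generate_in_carrier 3 by auto
  qed auto
qed

lemma ad_word_in:
  assumes "a \<in> carrier G" "b \<in> carrier G"
  shows "ad_word a b m \<in> lower_central_series G (Suc m)"
proof (induction m)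
  case (Suc m)
  thus ?case using assms by (auto intro!: generate.incl)
qed (use assms in simp)

lemma ad_word_carrier: "a \<in> carrier G \<Longrightarrow> b \<in> carrier G \<Longrightarrow> ad_word a b m \<in> carrier G"
  by (induction m) auto

end

text \<open>\<open>X\<close> abstracts the integral of a form \<open>\<theta>\<close>, and \<open>E w\<close> the iterated integral of \<open>w(\<integral>\<theta>) \<eta>\<close>.
  The weight loses one degree with every commutator, which is what detects depth in the lower
  central series.\<close>

locale iterated_integral_pairing = group G for G (structure) +
  fixes X :: "'a \<Rightarrow> complex" and E :: "complex poly \<Rightarrow> 'a \<Rightarrow> complex"
  assumes X_mult: "x \<in> carrier G \<Longrightarrow> y \<in> carrier G \<Longrightarrow> X (x \<otimes> y) = X x + X y"
    and E_mult: "x \<in> carrier G \<Longrightarrow> y \<in> carrier G \<Longrightarrow> E w (x \<otimes> y) = E w x + E (pcompose w [:X x, 1:]) y"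
    and E_add: "x \<in> carrier G \<Longrightarrow> E (w + w') x = E w x + E w' x"
    and E_smult: "x \<in> carrier G \<Longrightarrow> E (smult c w) x = c * E w x"
begin

lemma X_one [simp]: "X \<one> = 0"
  using X_mult[of \<one> \<one>] by simp

lemma X_inv [simp]: "x \<in> carrier G \<Longrightarrow> X (inv x) = - X x"
  using X_mult[of x "inv x"] by (simp add: eq_neg_iff_add_eq_0 add.commute)

lemma E_one [simp]: "E w \<one> = 0"
  using E_mult[of \<one> \<one> w] by (simp add: pcompose_idR)

lemma E_inv: "x \<in> carrier G \<Longrightarrow> E w (inv x) = - E (pcompose w [:- X x, 1:]) x"
  using E_mult[of "inv x" x w] by (simp add: eq_neg_iff_add_eq_0)

lemma E_zero [simp]: "x \<in> carrier G \<Longrightarrow> E 0 x = 0"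
  using E_smult[of x 0 0] by simp

lemma E_diff: "x \<in> carrier G \<Longrightarrow> E (w - w') x = E w x - E w' x"
  using E_add[of x w "smult (-1) w'"] E_smult[of x "-1" w'] by simp

text \<open>In q p q^(-1) p^(-1) each of \<open>p\<close> and \<open>q\<close> occurs twice with
  opposite signs, once under the original weight and once under the weight shifted by the X-value of
  the other. Only finite differences of \<open>w\<close> survive.\<close>

lemma E_commutator:
  assumes "q \<in> carrier G" "p \<in> carrier G"
  shows "E w (q \<otimes> p \<otimes> inv q \<otimes> inv p) =
    E (pcompose w [:X q, 1:] - w) p - E (pcompose w [:X p, 1:] - w) q"
  using assms by (simp add: E_mult X_mult E_inv E_diff pcompose_shift_shift)

lemma X_lower_central_series: "x \<in> lower_central_series G (Suc (Suc m)) \<Longrightarrow> X x = 0"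
proof -
  assume "x \<in> lower_central_series G (Suc (Suc m))"
  hence "x \<in> generate G {a \<otimes> b \<otimes> inv a \<otimes> inv b | a b. a \<in> carrier G \<and> b \<in> lower_central_series G (Suc m)}"
    (is "x \<in> generate G ?C") by simp
  hence "x \<in> carrier G \<and> X x = 0"
  proof induction
    case one thus ?case by simp
  next
    case (incl h)
    thus ?case using lower_central_series_subset[of "Suc m"] by (auto simp: X_mult subset_iff)
  next
    case (inv h)
    thus ?case using lower_central_series_subset[of "Suc m"] by (auto simp: X_mult subset_iff)
  next
    case (eng h1 h2) thus ?case by (simp add: X_mult)
  qed
  thus ?thesis by simp
qed

text \<open>A generator is a commutator of some \<open>a\<close> with an element \<open>b\<close>
  one level higher up. As X b = 0, shifting by X b does nothing, and the commutator formula leaves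
  only a finite difference of \<open>w\<close> evaluated at \<open>b\<close>; its degree is one
  lower, so the induction hypothesis kills it.\<close>

lemma E_lower_central_series:
  "x \<in> lower_central_series G (Suc (Suc m)) \<Longrightarrow> degree w \<le> m \<Longrightarrow> E w x = 0"
proof (induction m arbitrary: x w)
  case (0 x)
  obtain c where w: "w = [:c:]" using 0 degree_eq_zeroE by auto
  have shift: "pcompose [:c:] [:d, 1:] = [:c:]" for d by (simp add: pcompose_pCons)
  have "x \<in> generate G {a \<otimes> b \<otimes> inv a \<otimes> inv b | a b. a \<in> carrier G \<and> b \<in> carrier G}"
    using 0 by simp
  hence "x \<in> carrier G \<and> E w x = 0"
  proof induction
    case (incl h)
    thus ?case by (auto simp: E_commutator w shift E_diff)
  next
    case (inv h)
    then obtain a b where h: "h = a \<otimes> b \<otimes> inv a \<otimes> inv b" "a \<in> carrier G" "b \<in> carrier G" by blast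
    hence "E [:c:] h = 0" by (simp add: E_commutator shift E_diff)
    thus ?case using h by (simp add: E_inv w shift)
  next
    case (eng h1 h2) thus ?case by (simp add: E_mult w shift)
  qed simp
  thus ?case by simp
next
  case (Suc m x)
  have comm: "E w (a \<otimes> b \<otimes> inv a \<otimes> inv b) = 0"
    if ab: "a \<in> carrier G" "b \<in> lower_central_series G (Suc (Suc m))" and w: "degree w \<le> Suc m" for a b w
  proof -
    have b: "b \<in> carrier G" "X b = 0"
      using ab lower_central_series_subset X_lower_central_series by blast+
    have "E (pcompose w [:X a, 1:] - w) b = 0"
      using shift_poly_diff[OF w] by (intro Suc.IH[OF ab(2)]) auto
    thus ?thesis using ab b by (simp add: E_commutator pcompose_idR E_diff)
  qed
  have "x \<in> generate G {a \<otimes> b \<otimes> inv a \<otimes> inv b | a b. a \<in> carrier G \<and> b \<in> lower_central_series G (Suc (Suc m))}"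
    (is "_ \<in> generate G ?C") using Suc.prems(1) by simp
  moreover have C: "h \<in> carrier G \<and> X h = 0 \<and> E w h = 0" if "h \<in> ?C" for h
    using that lower_central_series_subset[of "Suc (Suc m)"] comm[OF _ _ Suc.prems(2)]
    by (auto simp: X_mult subset_iff)
  ultimately have "x \<in> carrier G \<and> X x = 0 \<and> E w x = 0"
  proof induction
    case (incl h) thus ?case by blast
  next
    case (inv h)
    hence "h \<in> carrier G \<and> X h = 0 \<and> E w h = 0" by blast
    thus ?case by (simp add: E_inv pcompose_idR)
  next
    case (eng h1 h2)
    hence "h1 \<in> carrier G" "X h1 = 0" "E w h1 = 0" "h2 \<in> carrier G" "X h2 = 0" "E w h2 = 0" by blast+
    thus ?case by (simp add: E_mult X_mult pcompose_idR)
  next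
    case one thus ?case by simp
  qed
  thus ?case by simp
qed

text \<open>Each bracket with \<open>a\<close> replaces the weight by its finite difference with
  step X a. The innermost bracket [a, b] then meets a linear weight and contributes the determinant;
  the successive differences produce the factorial and the power of X a.\<close>

lemma E_ad_word:
  assumes a: "a \<in> carrier G" and b: "b \<in> carrier G" and w: "degree w \<le> Suc m"
  shows "E w (ad_word a b (Suc m)) =
    coeff w (Suc m) * fact (Suc m) * X a ^ m * (X a * E 1 b - X b * E 1 a)"
  using w
proof (induction m arbitrary: w)
  case 0
  have shift: "E (pcompose w [:c, 1:] - w) x = c * coeff w 1 * E 1 x" if "x \<in> carrier G" for c x
  proof -
    have "degree (pcompose w [:c, 1:] - w) = 0" "coeff (pcompose w [:c, 1:] - w) 0 = c * coeff w 1"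
      using shift_poly_diff[of w 0 c] 0 by auto
    hence "pcompose w [:c, 1:] - w = smult (c * coeff w 1) 1"
      by (metis degree_eq_zeroE coeff_pCons_0 smult_one)
    thus ?thesis by (simp only: E_smult[OF that])
  qed
  show ?case using a b by (simp add: E_commutator shift algebra_simps)
next
  case (Suc m)
  define p where "p = ad_word a b (Suc m)"
  have p: "p \<in> carrier G" "X p = 0"
    using ad_word_carrier[OF a b] X_lower_central_series[of p m] ad_word_in[OF a b, of "Suc m"]
    by (auto simp only: p_def)
  have "ad_word a b (Suc (Suc m)) = a \<otimes> p \<otimes> inv a \<otimes> inv p"
    unfolding p_def by (simp only: ad_word.simps)
  hence "E w (ad_word a b (Suc (Suc m))) = E (pcompose w [:X a, 1:] - w) p"
    using a p by (simp add: E_commutator pcompose_idR E_diff)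
  also have "\<dots> = coeff (pcompose w [:X a, 1:] - w) (Suc m) * fact (Suc m) * X a ^ m * (X a * E 1 b - X b * E 1 a)"
    unfolding p_def using shift_poly_diff[OF Suc.prems, of "X a"] by (intro Suc.IH) auto
  finally show ?case
    using shift_poly_diff[OF Suc.prems, of "X a"] by (simp add: algebra_simps)
qed

text \<open>The weight x^(m+1) annihilates the next term of the series for degree reasons, whereas
  its value at the word is (m+1)! (X a)^m times the determinant.\<close>

lemma represents_nonzero_gr_ad_word:
  assumes a: "a \<in> carrier G" and b: "b \<in> carrier G" and Xa: "X a \<noteq> 0"
    and det: "X a * E 1 b - X b * E 1 a \<noteq> 0"
  shows "represents_nonzero_gr G (Suc (Suc m)) (ad_word a b (Suc m))"
  unfolding represents_nonzero_gr_def
proof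
  show "ad_word a b (Suc m) \<in> lower_central_series G (Suc (Suc m))"
    by (rule ad_word_in[OF a b])
  have "E (monom 1 (Suc m)) (ad_word a b (Suc m)) \<noteq> 0"
    using Xa det by (subst E_ad_word[OF a b]) (auto simp: degree_monom_eq simp del: ad_word.simps fact_Suc)
  thus "ad_word a b (Suc m) \<notin> lower_central_series G (Suc (Suc (Suc m)))"
    using E_lower_central_series[of "ad_word a b (Suc m)" "Suc m" "monom 1 (Suc m)"]
    by (auto simp: degree_monom_eq simp del: ad_word.simps lower_central_series.simps)
qed

lemma represents_nonzero_gr_1:
  assumes "a \<in> carrier G" "X a \<noteq> 0"
  shows "represents_nonzero_gr G 1 a"
  using assms X_lower_central_series[of a 0] by (auto simp: represents_nonzero_gr_def numeral_2_eq_2)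

end

text \<open>Local functions whose differences are locally constant are patched by summing small
  increments along the straight segment from a base point. A Lebesgue number puts neighbouring
  points into one chart, where increments are additive; moving the endpoint sweeps out a strip of
  small quadrilaterals over which they cancel.\<close>

lemma local_to_global_convex:
  fixes K :: "'k::real_normed_vector set" and g :: "'k \<Rightarrow> 'k \<Rightarrow> complex"
  assumes K: "convex K" "compact K"
    and N: "\<And>k. k \<in> K \<Longrightarrow> open (N k) \<and> k \<in> N k"
    and compat: "\<And>k l m. k \<in> K \<Longrightarrow> l \<in> K \<Longrightarrow> m \<in> K \<Longrightarrow> m \<in> N k \<Longrightarrow> m \<in> N l \<Longrightarrow>
      \<exists>U. open U \<and> m \<in> U \<and> (\<forall>x\<in>K \<inter> U. g k x - g l x = g k m - g l m)"
  obtains \<Gamma> where "\<And>k. k \<in> K \<Longrightarrow> \<exists>U c. open U \<and> k \<in> U \<and> (\<forall>x\<in>K \<inter> U. \<Gamma> x = g k x + c)"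
proof (cases "K = {}")
  case True thus ?thesis using that by blast
next
  case False
  then obtain o' where o: "o' \<in> K" by blast
  have "\<forall>k\<in>K. \<exists>\<rho>>0. ball k \<rho> \<subseteq> N k"
    using N by (meson open_contains_ball)
  then obtain \<rho> where \<rho>: "\<And>k. k \<in> K \<Longrightarrow> \<rho> k > 0 \<and> ball k (\<rho> k) \<subseteq> N k" by metis
  define B where "B = (\<lambda>k. ball k (\<rho> k))"
  have const: "g k x - g l x = g k y - g l y"
    if kl: "k \<in> K" "l \<in> K" and "x \<in> K \<inter> (B k \<inter> B l)" "y \<in> K \<inter> (B k \<inter> B l)" for k l x y
  proof (rule connected_local_const[of "K \<inter> (B k \<inter> B l)" x y "\<lambda>x. g k x - g l x"])
    show "connected (K \<inter> (B k \<inter> B l))"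
      unfolding B_def by (intro convex_connected convex_Int K convex_ball)
    show "\<forall>a\<in>K \<inter> (B k \<inter> B l). \<forall>\<^sub>F b in at a within K \<inter> (B k \<inter> B l). g k a - g l a = g k b - g l b"
    proof
      fix a assume a: "a \<in> K \<inter> (B k \<inter> B l)"
      have "a \<in> K" "a \<in> N k" "a \<in> N l"
        using \<rho>[OF kl(1)] \<rho>[OF kl(2)] a by (auto simp: B_def simp del: mem_ball)
      then obtain U where U: "open U" "a \<in> U" "\<forall>x\<in>K \<inter> U. g k x - g l x = g k a - g l a"
        using compat[OF kl] a by metis
      have "\<forall>\<^sub>F b in at a within K \<inter> (B k \<inter> B l). b \<in> U \<and> b \<in> K"
        using U(1,2) by (auto simp: eventually_at_topological)
      thus "\<forall>\<^sub>F b in at a within K \<inter> (B k \<inter> B l). g k a - g l a = g k b - g l b"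
        by eventually_elim (use U in auto)
    qed
  qed (use that in auto)
  obtain e where e: "e > 0" "\<And>T. T \<subseteq> K \<Longrightarrow> diameter T < e \<Longrightarrow> \<exists>b\<in>B ` K. T \<subseteq> b"
  proof (rule Lebesgue_number_lemma[OF K(2), of "B ` K"])
    show "B ` K \<noteq> {}" using False by simp
    show "K \<subseteq> \<Union> (B ` K)" using \<rho> by (auto simp: B_def)
    show "\<And>b. b \<in> B ` K \<Longrightarrow> open b" by (auto simp: B_def)
  qed auto
  \<comment> \<open>A ball of radius e/3 has diameter at most 2e/3, which is below the Lebesgue
    number.\<close>
  define h where "h = e / 3"
  have h: "h > 0" using e by (simp add: h_def)
  have chart: "\<exists>k\<in>K. K \<inter> ball x h \<subseteq> B k" if "x \<in> K" for x
  proof -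
    have "diameter (K \<inter> ball x h) \<le> 2 * h"
    proof (rule diameter_le)
      fix a b assume "a \<in> K \<inter> ball x h" "b \<in> K \<inter> ball x h"
      hence "dist a x < h" "dist b x < h" by (auto simp: dist_commute)
      thus "norm (a - b) \<le> 2 * h" using dist_triangle2[of a b x] by (simp add: dist_norm)
    qed (use h in auto)
    also have "2 * h < e" using e by (simp add: h_def)
    finally show ?thesis using e(2)[of "K \<inter> ball x h"] by auto
  qed
  then obtain ch where ch: "\<And>x. x \<in> K \<Longrightarrow> ch x \<in> K \<and> K \<inter> ball x h \<subseteq> B (ch x)" by metis
  define c where "c = (\<lambda>x y. g (ch x) y - g (ch x) x)"
  have c_eq: "c x y = g k y - g k x" if "x \<in> K" "y \<in> K" "dist x y < h" "k \<in> K" "x \<in> B k" "y \<in> B k" for x y k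
  proof -
    have "x \<in> B (ch x)" "y \<in> B (ch x)" using ch[OF that(1)] that h by auto
    thus ?thesis using const[of "ch x" k y x] ch[OF that(1)] that unfolding c_def by (simp add: algebra_simps)
  qed
  have cocycle: "c x y + c y z = c x z"
    if "x \<in> K" "y \<in> K" "z \<in> K" "dist x y < h" "dist x z < h" "dist y z < h" for x y z
  proof -
    let ?k = "ch x"
    have k: "?k \<in> K" "x \<in> B ?k" "y \<in> B ?k" "z \<in> B ?k" using ch[OF that(1)] that h by auto
    show ?thesis using c_eq[of x y ?k] c_eq[of y z ?k] c_eq[of x z ?k] that k by simp
  qed
  obtain D where D: "D > 0" "\<And>x. x \<in> K \<Longrightarrow> norm (x - o') < D"
  proof -
    obtain D where "\<forall>x\<in>K. norm x \<le> D" using K(2) compact_imp_bounded bounded_iff by metis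
    hence "norm (x - o') < 2 * \<bar>D\<bar> + 1" if "x \<in> K" for x
      using norm_triangle_ineq4[of x o'] that o by (smt (verit, best))
    thus ?thesis by (intro that[of "2 * \<bar>D\<bar> + 1"]) auto
  qed
  \<comment> \<open>Steps shorter than h/2, and endpoints closer than h/2, keep the sides and the
    diagonal of each quadrilateral shorter than \<open>h\<close>.\<close>
  obtain n :: nat where n: "n > 0" "D / n < h / 2"
  proof -
    obtain n :: nat where "n > 2 * D / h" using reals_Archimedean2 by blast
    hence n: "2 * D < real n * h" using h by (simp add: pos_divide_less_eq)
    have "n > 0" using n D(1) by (cases n) auto
    thus ?thesis using n by (intro that[of n]) (simp_all add: field_simps)
  qed
  define pt where "pt = (\<lambda>x j. o' + (real j / real n) *\<^sub>R (x - o'))"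
  have pt_in: "pt x j \<in> K" if "x \<in> K" "j \<le> n" for x j
  proof -
    have "pt x j = (1 - real j / real n) *\<^sub>R o' + (real j / real n) *\<^sub>R x"
      by (simp add: pt_def algebra_simps)
    thus ?thesis using K(1) o that n unfolding convex_alt by auto
  qed
  have pt_step: "dist (pt x j) (pt x (Suc j)) < h / 2" if "x \<in> K" for x j
  proof -
    have "pt x (Suc j) - pt x j = (1 / real n) *\<^sub>R (x - o')"
      by (simp add: pt_def add_divide_distrib flip: scaleR_left.diff)
    hence "norm (pt x (Suc j) - pt x j) = norm (x - o') / real n" by simp
    hence "dist (pt x j) (pt x (Suc j)) = norm (x - o') / real n"
      by (metis dist_commute dist_norm)
    also have "\<dots> \<le> D / real n" using D(2)[OF that] n by (intro divide_right_mono) auto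
    finally show ?thesis using n(2) by linarith
  qed
  define \<Gamma> where "\<Gamma> = (\<lambda>x. \<Sum>j<n. c (pt x j) (pt x (Suc j)))"
  have \<Gamma>_near: "\<Gamma> y = \<Gamma> x + c x y" if x: "x \<in> K" and y: "y \<in> K" and xy: "dist x y < h / 2" for x y
  proof -
    have pts: "dist (pt x j) (pt y j) < h / 2" if "j \<le> n" for j
    proof -
      have "pt x j - pt y j = (real j / real n) *\<^sub>R (x - y)"
        by (simp add: pt_def algebra_simps)
      hence "dist (pt x j) (pt y j) = (real j / real n) * dist x y" by (simp add: dist_norm)
      also have "\<dots> \<le> 1 * dist x y" using that n by (intro mult_right_mono) auto
      finally show ?thesis using xy by simp
    qed
    have "j \<le> n \<Longrightarrow> (\<Sum>j<j. c (pt x j) (pt x (Suc j))) + c (pt x j) (pt y j) =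
        (\<Sum>j<j. c (pt y j) (pt y (Suc j)))" for j
    proof (induction j)
      case 0
      have "pt x 0 = o'" "pt y 0 = o'" by (auto simp: pt_def)
      thus ?case using cocycle[of o' o' o'] o h by simp
    next
      case (Suc j)
      let ?a = "pt x j" and ?a' = "pt x (Suc j)" and ?b = "pt y j" and ?b' = "pt y (Suc j)"
      have K4: "?a \<in> K" "?a' \<in> K" "?b \<in> K" "?b' \<in> K" using pt_in x y Suc.prems by auto
      have d: "dist ?a ?a' < h / 2" "dist ?b ?b' < h / 2" "dist ?a ?b < h / 2" "dist ?a' ?b' < h / 2"
        using pt_step x y pts Suc.prems by auto
      \<comment> \<open>The diagonal cuts the quadrilateral into two triangles, to each of which
        \<open>cocycle\<close> applies.\<close>
      have "dist ?a ?b' < h" using d dist_triangle[of ?a ?b' ?b] by linarith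
      hence "c ?a ?a' + c ?a' ?b' = c ?a ?b'" "c ?a ?b + c ?b ?b' = c ?a ?b'"
        using K4 d h by (auto intro!: cocycle)
      moreover have "(\<Sum>j<j. c (pt x j) (pt x (Suc j))) + c ?a ?b = (\<Sum>j<j. c (pt y j) (pt y (Suc j)))"
        using Suc by simp
      ultimately show ?case unfolding sum.lessThan_Suc by (metis add.assoc)
    qed
    from this[of n] show ?thesis using n by (simp add: \<Gamma>_def pt_def)
  qed
  show ?thesis
  proof (rule that)
    fix k assume k: "k \<in> K"
    define V where "V = ball k (h / 2) \<inter> B k"
    have "\<Gamma> x = g k x + (\<Gamma> k - g k k)" if "x \<in> K \<inter> V" for x
    proof -
      have "\<Gamma> x = \<Gamma> k + c k x" using that k by (intro \<Gamma>_near) (auto simp: V_def)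
      moreover have "c k x = g k x - g k k"
        using that k h \<rho>[OF k] by (intro c_eq) (auto simp: V_def B_def)
      ultimately show ?thesis by simp
    qed
    moreover have "open V" "k \<in> V" using h \<rho>[OF k] by (auto simp: V_def B_def)
    ultimately show "\<exists>U c. open U \<and> k \<in> U \<and> (\<forall>x\<in>K \<inter> U. \<Gamma> x = g k x + c)" by blast
  qed
qed

section \<open>Homotopy invariance of iterated integrals\<close>

text \<open>The derivative is taken within \<open>S\<close>: on a smooth curve this constrains \<xi>
  only in tangent directions, although \<open>A\<close> and \<xi> are written in the ambient
  space.\<close>

definition primitive_on ::
    "'a::real_normed_vector set \<Rightarrow> 'a set \<Rightarrow> ('a \<Rightarrow> complex) \<Rightarrow> ('a \<Rightarrow> 'a \<Rightarrow> complex) \<Rightarrow> bool" where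
  "primitive_on S U A \<xi> \<longleftrightarrow> open U \<and> (\<forall>z\<in>S \<inter> U. (A has_derivative \<xi> z) (at z within S))"

lemma primitive_on_mono: "primitive_on S U A \<xi> \<Longrightarrow> open W \<Longrightarrow> W \<subseteq> U \<Longrightarrow> primitive_on S W A \<xi>"
  unfolding primitive_on_def by blast

lemma primitive_on_add_const: "primitive_on S U A \<xi> \<Longrightarrow> primitive_on S U (\<lambda>z. A z + c) \<xi>"
  unfolding primitive_on_def by (auto intro!: derivative_eq_intros)

text \<open>A primitive of the pullback of \<xi> under \<open>H\<close>, expressed through local
  primitives on \<open>S\<close> instead of derivatives of \<open>H\<close>. Thus \<open>H\<close>
  may be a merely continuous path or homotopy.\<close>

definition potential ::
    "'a::real_normed_vector set \<Rightarrow> ('a \<Rightarrow> 'a \<Rightarrow> complex) \<Rightarrow> 'k::topological_space set \<Rightarrow> ('k \<Rightarrow> 'a) \<Rightarrow> ('k \<Rightarrow> complex) \<Rightarrow> bool" where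
  "potential S \<xi> K H \<Gamma> \<longleftrightarrow> (\<forall>k\<in>K. \<exists>N U A. open N \<and> k \<in> N \<and> primitive_on S U A \<xi> \<and>
    (\<forall>l\<in>K \<inter> N. H l \<in> U \<and> \<Gamma> l = A (H l)))"

text \<open>The same local primitive \<open>A\<close> that gives \<Gamma> also enters the weight, so
  \<Delta> is a primitive of w(\<Gamma>) times the pullback of \<eta>.\<close>

definition potential2 ::
    "'a::real_normed_vector set \<Rightarrow> ('a \<Rightarrow> 'a \<Rightarrow> complex) \<Rightarrow> ('a \<Rightarrow> 'a \<Rightarrow> complex) \<Rightarrow> (complex \<Rightarrow> complex) \<Rightarrow>
      'k::topological_space set \<Rightarrow> ('k \<Rightarrow> 'a) \<Rightarrow> ('k \<Rightarrow> complex) \<Rightarrow> ('k \<Rightarrow> complex) \<Rightarrow> bool" where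
  "potential2 S \<theta> \<eta> w K H \<Gamma> \<Delta> \<longleftrightarrow> (\<forall>k\<in>K. \<exists>N U A B. open N \<and> k \<in> N \<and> primitive_on S U A \<theta> \<and>
    primitive_on S U B (\<lambda>z v. w (A z) * \<eta> z v) \<and>
    (\<forall>l\<in>K \<inter> N. H l \<in> U \<and> \<Gamma> l = A (H l) \<and> \<Delta> l = B (H l)))"

lemma potentialE:
  assumes "potential S \<xi> K H \<Gamma>" "k \<in> K"
  obtains N U A where "open N" "k \<in> N" "primitive_on S U A \<xi>" "\<And>l. l \<in> K \<inter> N \<Longrightarrow> H l \<in> U \<and> \<Gamma> l = A (H l)"
  using bspec[OF assms(1)[unfolded potential_def] assms(2)] by (elim exE conjE) (rule that, auto)

lemma potential2E:
  assumes "potential2 S \<theta> \<eta> w K H \<Gamma> \<Delta>" "k \<in> K"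
  obtains N U A B where "open N" "k \<in> N" "primitive_on S U A \<theta>" "primitive_on S U B (\<lambda>z v. w (A z) * \<eta> z v)"
    "\<And>l. l \<in> K \<inter> N \<Longrightarrow> H l \<in> U \<and> \<Gamma> l = A (H l) \<and> \<Delta> l = B (H l)"
  using bspec[OF assms(1)[unfolded potential2_def] assms(2)] by (elim exE conjE) (rule that, auto)

lemma potential2_imp_potential: "potential2 S \<theta> \<eta> w K H \<Gamma> \<Delta> \<Longrightarrow> potential S \<theta> K H \<Gamma>"
  unfolding potential_def
proof
  fix k assume "potential2 S \<theta> \<eta> w K H \<Gamma> \<Delta>" "k \<in> K"
  thus "\<exists>N U A. open N \<and> k \<in> N \<and> primitive_on S U A \<theta> \<and> (\<forall>l\<in>K \<inter> N. H l \<in> U \<and> \<Gamma> l = A (H l))"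
    by (rule potential2E) (intro exI conjI ballI, auto)
qed

lemma continuous_on_nbhd:
  assumes "continuous_on K H" "open U" "k \<in> K" "H k \<in> U"
  obtains N where "open N" "k \<in> N" "\<And>l. l \<in> K \<Longrightarrow> l \<in> N \<Longrightarrow> H l \<in> U"
proof -
  obtain N where "open N" "N \<inter> K = H -` U \<inter> K"
    using assms(1,2) continuous_on_open_invariant by metis
  hence "l \<in> N \<longleftrightarrow> H l \<in> U" if "l \<in> K" for l
    using that by (metis Int_iff vimage_eq)
  thus ?thesis using assms(3,4) \<open>open N\<close> by (intro that[of N]) auto
qed

text \<open>Covers at once a change of parameter and a change of the additive constant of \<Gamma>;
  the latter has to be compensated by a translation of the weight. The two halves of a joined path
  are both obtained in this way.\<close>

lemma potential2_comp:
  assumes p: "potential2 S \<theta> \<eta> w K H \<Gamma> \<Delta>" and g: "continuous_on K' g" "g ` K' \<subseteq> K"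
    and H': "\<And>x. x \<in> K' \<Longrightarrow> H' x = H (g x)"
    and w: "\<And>x. w' (x + c) = w x"
  shows "potential2 S \<theta> \<eta> w' K' H' (\<lambda>x. \<Gamma> (g x) + c) (\<lambda>x. \<Delta> (g x))"
  unfolding potential2_def
proof
  fix k assume k: "k \<in> K'"
  hence gk: "g k \<in> K" using g by blast
  obtain N U A B where N: "open N" "g k \<in> N" "primitive_on S U A \<theta>"
      "primitive_on S U B (\<lambda>z v. w (A z) * \<eta> z v)"
      "\<And>l. l \<in> K \<inter> N \<Longrightarrow> H l \<in> U \<and> \<Gamma> l = A (H l) \<and> \<Delta> l = B (H l)"
    by (rule potential2E[OF p gk]) (rule that)
  obtain N' where "open N'" "k \<in> N'" "\<And>l. l \<in> K' \<Longrightarrow> l \<in> N' \<Longrightarrow> g l \<in> N"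
    using continuous_on_nbhd[OF g(1) N(1) k N(2)] by metis
  thus "\<exists>N U A B. open N \<and> k \<in> N \<and> primitive_on S U A \<theta> \<and> primitive_on S U B (\<lambda>z v. w' (A z) * \<eta> z v) \<and>
      (\<forall>l\<in>K' \<inter> N. H' l \<in> U \<and> \<Gamma> (g l) + c = A (H' l) \<and> \<Delta> (g l) = B (H' l))"
    using N g(2) H' primitive_on_add_const[OF N(3), of c] w
    by (intro exI[of _ N'] exI[of _ U] exI[of _ "\<lambda>z. A z + c"] exI[of _ B]) auto
qed

lemma locally_constant_on_connected:
  assumes "connected K" "\<And>k. k \<in> K \<Longrightarrow> \<exists>N. open N \<and> k \<in> N \<and> (\<forall>l\<in>K \<inter> N. F l = F k)" "x \<in> K" "y \<in> K"
  shows "F x = F y"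
proof (rule connected_local_const[OF assms(1,3,4)])
  show "\<forall>a\<in>K. \<forall>\<^sub>F b in at a within K. F a = F b"
  proof
    fix a assume "a \<in> K"
    then obtain N where N: "open N" "a \<in> N" "\<forall>l\<in>K \<inter> N. F l = F a" using assms(2) by blast
    have "\<forall>\<^sub>F b in at a within K. b \<in> N \<and> b \<in> K"
      using N(1,2) by (auto simp: eventually_at_topological)
    thus "\<forall>\<^sub>F b in at a within K. F a = F b" by eventually_elim (use N in auto)
  qed
qed

lemma potential_const:
  assumes p: "potential S \<xi> K H \<Gamma>" and K: "connected K" "x \<in> K" "y \<in> K" and H: "\<And>k. k \<in> K \<Longrightarrow> H k = z"
  shows "\<Gamma> x = \<Gamma> y"
proof (rule locally_constant_on_connected[OF K(1) _ K(2,3)])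
  fix k assume k: "k \<in> K"
  obtain N U A where N: "open N" "k \<in> N" "primitive_on S U A \<xi>" "\<And>l. l \<in> K \<inter> N \<Longrightarrow> H l \<in> U \<and> \<Gamma> l = A (H l)"
    by (rule potentialE[OF p k]) (rule that)
  thus "\<exists>N. open N \<and> k \<in> N \<and> (\<forall>l\<in>K \<inter> N. \<Gamma> l = \<Gamma> k)"
    using H k by (intro exI[of _ N]) auto
qed

lemma potential_deriv:
  assumes p: "potential S \<xi> {0..1} H \<Gamma>" and s: "s \<in> {0..1}"
    and H: "H ` {0..1} \<subseteq> S" "(H has_vector_derivative h) (at s within {0..1})"
  shows "(\<Gamma> has_vector_derivative \<xi> (H s) h) (at s within {0..1})"
proof -
  obtain N U A where N: "open N" "s \<in> N" "primitive_on S U A \<xi>" "\<And>l. l \<in> {0..1} \<inter> N \<Longrightarrow> H l \<in> U \<and> \<Gamma> l = A (H l)"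
    by (rule potentialE[OF p s]) (rule that)
  have "(A has_derivative \<xi> (H s)) (at (H s) within S)"
    using N s H unfolding primitive_on_def by blast
  hence "(A has_derivative \<xi> (H s)) (at (H s) within H ` {0..1})"
    by (rule has_derivative_subset) (use H in auto)
  hence "((A \<circ> H) has_vector_derivative \<xi> (H s) h) (at s within {0..1})"
    by (rule vector_derivative_diff_chain_within[OF H(2)])
  moreover obtain d where d: "d > 0" "ball s d \<subseteq> N" using N openE by blast
  have "(A \<circ> H) x = \<Gamma> x" if "x \<in> {0..1}" "dist x s < d" for x
    using N(4)[of x] that d(2) by (auto simp: dist_commute subset_iff)
  ultimately show ?thesis
    using has_vector_derivative_transform_within[OF _ d(1) s] by blast
qed

text \<open>Isolated from any parametrization: \<open>S\<close> is a curve on which functions with vanishing derivative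
  are locally constant and on which \<open>\<theta>\<close> and all \<open>w(\<integral>\<theta>) \<eta>\<close> have local primitives.\<close>

locale integrable_forms =
  fixes S :: "'a::real_normed_vector set" and \<theta> \<eta> :: "'a \<Rightarrow> 'a \<Rightarrow> complex"
  assumes loc_const: "primitive_on S U F (\<lambda>z v. 0) \<Longrightarrow> z \<in> S \<Longrightarrow> z \<in> U \<Longrightarrow>
      \<exists>V. open V \<and> z \<in> V \<and> V \<subseteq> U \<and> (\<forall>x\<in>S \<inter> V. F x = F z)"
    and primitive: "z \<in> S \<Longrightarrow> \<exists>U A. z \<in> U \<and> primitive_on S U A \<theta>"
    and primitive2: "z \<in> S \<Longrightarrow> z \<in> U \<Longrightarrow> primitive_on S U A \<theta> \<Longrightarrow>
      \<exists>V B. z \<in> V \<and> primitive_on S V B (\<lambda>z v. poly w (A z) * \<eta> z v)"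
begin

lemma primitive_unique:
  assumes "primitive_on S U A \<xi>" "primitive_on S U' A' \<xi>" "z \<in> S" "z \<in> U" "z \<in> U'"
  obtains V where "open V" "z \<in> V" "V \<subseteq> U \<inter> U'" "\<And>x. x \<in> S \<Longrightarrow> x \<in> V \<Longrightarrow> A x - A' x = A z - A' z"
proof -
  have "primitive_on S (U \<inter> U') (\<lambda>x. A x - A' x) (\<lambda>z v. 0)"
    unfolding primitive_on_def
  proof (intro conjI ballI)
    show "open (U \<inter> U')" using assms unfolding primitive_on_def by blast
    fix x assume "x \<in> S \<inter> (U \<inter> U')"
    hence "(A has_derivative \<xi> x) (at x within S)" "(A' has_derivative \<xi> x) (at x within S)"
      using assms unfolding primitive_on_def by blast+
    from has_derivative_diff[OF this] show "((\<lambda>x. A x - A' x) has_derivative (\<lambda>v. 0)) (at x within S)" by simp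
  qed
  from loc_const[OF this assms(3)] assms(4,5) that show ?thesis by blast
qed

lemma potential_unique:
  assumes p: "potential S \<xi> K H \<Gamma>" "potential S \<xi> K H \<Gamma>'" and H: "continuous_on K H" "H ` K \<subseteq> S"
    and K: "connected K" "x \<in> K" "y \<in> K"
  shows "\<Gamma> x - \<Gamma>' x = \<Gamma> y - \<Gamma>' y"
proof (rule locally_constant_on_connected[OF K(1) _ K(2,3)])
  fix k assume k: "k \<in> K"
  obtain N U A where N: "open N" "k \<in> N" "primitive_on S U A \<xi>" "\<And>l. l \<in> K \<inter> N \<Longrightarrow> H l \<in> U \<and> \<Gamma> l = A (H l)"
    by (rule potentialE[OF p(1) k]) (rule that)
  obtain N' U' A' where N': "open N'" "k \<in> N'" "primitive_on S U' A' \<xi>" "\<And>l. l \<in> K \<inter> N' \<Longrightarrow> H l \<in> U' \<and> \<Gamma>' l = A' (H l)"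
    by (rule potentialE[OF p(2) k]) (rule that)
  obtain V where V: "open V" "H k \<in> V" "\<And>x. x \<in> S \<Longrightarrow> x \<in> V \<Longrightarrow> A x - A' x = A (H k) - A' (H k)"
  proof (rule primitive_unique[OF N(3) N'(3)])
    show "H k \<in> S" "H k \<in> U" "H k \<in> U'" using N(4)[of k] N'(4)[of k] N(2) N'(2) k H by auto
  qed (rule that)
  obtain M where M: "open M" "k \<in> M" "\<And>l. l \<in> K \<Longrightarrow> l \<in> M \<Longrightarrow> H l \<in> V"
    using continuous_on_nbhd[OF H(1) V(1) k V(2)] by metis
  show "\<exists>N. open N \<and> k \<in> N \<and> (\<forall>l\<in>K \<inter> N. \<Gamma> l - \<Gamma>' l = \<Gamma> k - \<Gamma>' k)"
  proof (intro exI[of _ "N \<inter> N' \<inter> M"] conjI ballI)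
    fix l assume l: "l \<in> K \<inter> (N \<inter> N' \<inter> M)"
    have "H l \<in> S" "H l \<in> V" using l M H by auto
    thus "\<Gamma> l - \<Gamma>' l = \<Gamma> k - \<Gamma>' k"
      using N(4)[of l] N'(4)[of l] N(4)[of k] N'(4)[of k] V(3)[of "H l"] l k N(2) N'(2) by auto
  qed (use N N' M in auto)
qed

text \<open>Two local primitives differ by a locally constant function, so their compositions with
  \<open>H\<close> can be patched over the convex set.\<close>

lemma potential_exists:
  fixes K :: "'k::real_normed_vector set"
  assumes K: "convex K" "compact K" and H: "continuous_on K H" "H ` K \<subseteq> S"
  obtains \<Gamma> where "potential S \<theta> K H \<Gamma>"
proof -
  have "\<exists>N U A. open N \<and> k \<in> N \<and> primitive_on S U A \<theta> \<and> (\<forall>l\<in>K \<inter> N. H l \<in> U)" if k: "k \<in> K" for k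
  proof -
    obtain U A where U: "H k \<in> U" "primitive_on S U A \<theta>"
      using primitive H k by blast
    hence "open U" unfolding primitive_on_def by blast
    then obtain N where "open N" "k \<in> N" "\<And>l. l \<in> K \<Longrightarrow> l \<in> N \<Longrightarrow> H l \<in> U"
      using continuous_on_nbhd[OF H(1) _ k U(1)] by metis
    thus ?thesis using U by blast
  qed
  hence "\<forall>k\<in>K. \<exists>q. case q of (N, U, A) \<Rightarrow> open N \<and> k \<in> N \<and> primitive_on S U A \<theta> \<and> (\<forall>l\<in>K \<inter> N. H l \<in> U)"
    by (intro ballI) (simp only: split_paired_Ex prod.case)
  from bchoice[OF this] obtain q where q: "\<forall>k\<in>K. case q k of (N, U, A) \<Rightarrow> open N \<and> k \<in> N \<and>
      primitive_on S U A \<theta> \<and> (\<forall>l\<in>K \<inter> N. H l \<in> U)" ..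
  define N U A where "N = (\<lambda>k. fst (q k))" and "U = (\<lambda>k. fst (snd (q k)))" and "A = (\<lambda>k. snd (snd (q k)))"
  have N: "\<And>k. k \<in> K \<Longrightarrow> open (N k) \<and> k \<in> N k \<and> primitive_on S (U k) (A k) \<theta> \<and> (\<forall>l\<in>K \<inter> N k. H l \<in> U k)"
    using q unfolding case_prod_unfold N_def U_def A_def by (rule bspec)
  obtain \<Gamma> where \<Gamma>: "\<And>k. k \<in> K \<Longrightarrow> \<exists>U c. open U \<and> k \<in> U \<and> (\<forall>x\<in>K \<inter> U. \<Gamma> x = A k (H x) + c)"
  proof (rule local_to_global_convex[OF K, of N "\<lambda>k x. A k (H x)"])
    fix k l m assume km: "k \<in> K" "l \<in> K" "m \<in> K" "m \<in> N k" "m \<in> N l"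
    obtain V where V: "open V" "H m \<in> V" "\<And>x. x \<in> S \<Longrightarrow> x \<in> V \<Longrightarrow> A k x - A l x = A k (H m) - A l (H m)"
    proof (rule primitive_unique[of "U k" "A k" \<theta> "U l" "A l" "H m"])
      show "primitive_on S (U k) (A k) \<theta>" "primitive_on S (U l) (A l) \<theta>" using N km by blast+
      show "H m \<in> S" "H m \<in> U k" "H m \<in> U l" using N[OF km(1)] N[OF km(2)] km(3-5) H by blast+
    qed (rule that)
    obtain M where M: "open M" "m \<in> M" "\<And>l. l \<in> K \<Longrightarrow> l \<in> M \<Longrightarrow> H l \<in> V"
      using continuous_on_nbhd[OF H(1) V(1) km(3) V(2)] by metis
    thus "\<exists>U. open U \<and> m \<in> U \<and> (\<forall>x\<in>K \<inter> U. A k (H x) - A l (H x) = A k (H m) - A l (H m))"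
      using V H by (intro exI[of _ M]) auto
  qed (use N in auto)
  have "potential S \<theta> K H \<Gamma>"
    unfolding potential_def
  proof
    fix k assume k: "k \<in> K"
    then obtain M c where M: "open M" "k \<in> M" "\<forall>x\<in>K \<inter> M. \<Gamma> x = A k (H x) + c" using \<Gamma> by blast
    show "\<exists>N U A. open N \<and> k \<in> N \<and> primitive_on S U A \<theta> \<and> (\<forall>l\<in>K \<inter> N. H l \<in> U \<and> \<Gamma> l = A (H l))"
      using N[OF k] M primitive_on_add_const[of S "U k" "A k" \<theta> c]
      by (intro exI[of _ "N k \<inter> M"] exI[of _ "U k"] exI[of _ "\<lambda>z. A k z + c"]) auto
  qed
  thus ?thesis using that by blast
qed

lemma primitive_weight_cong:
  assumes B: "primitive_on S U B (\<lambda>z v. poly w (A z) * \<eta> z v)" and "z \<in> S" "z \<in> U"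
    and W: "open W" "z \<in> W" "\<And>x. x \<in> S \<Longrightarrow> x \<in> W \<Longrightarrow> A x = A' x"
  shows "primitive_on S (U \<inter> W) B (\<lambda>z v. poly w (A' z) * \<eta> z v)"
  unfolding primitive_on_def
proof (intro conjI ballI)
  show "open (U \<inter> W)" using B W unfolding primitive_on_def by blast
  fix x assume x: "x \<in> S \<inter> (U \<inter> W)"
  hence "A x = A' x" using W by blast
  moreover have "(B has_derivative (\<lambda>v. poly w (A x) * \<eta> x v)) (at x within S)"
    using B x unfolding primitive_on_def by blast
  ultimately show "(B has_derivative (\<lambda>v. poly w (A' x) * \<eta> x v)) (at x within S)" by simp
qed

text \<open>Two local primitives of \<theta> that agree with \<Gamma> at \<open>k\<close> agree near
  \<open>H k\<close>, so the weighted form may be written with whichever is at hand. Weighted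
  potentials become comparable in this way.\<close>

lemma potential2_with_given_primitive:
  assumes p: "potential2 S \<theta> \<eta> (poly w) K H \<Gamma> \<Delta>" and H: "continuous_on K H" "H ` K \<subseteq> S"
    and k: "k \<in> K" and N: "open N" "k \<in> N" "primitive_on S U A \<theta>" "\<And>l. l \<in> K \<inter> N \<Longrightarrow> H l \<in> U \<and> \<Gamma> l = A (H l)"
  obtains M V B where "open M" "k \<in> M" "primitive_on S V B (\<lambda>z v. poly w (A z) * \<eta> z v)"
    "\<And>l. l \<in> K \<inter> M \<Longrightarrow> H l \<in> V \<and> \<Delta> l = B (H l)"
proof -
  obtain N' U' A' B where N': "open N'" "k \<in> N'" "primitive_on S U' A' \<theta>"
      "primitive_on S U' B (\<lambda>z v. poly w (A' z) * \<eta> z v)"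
      "\<And>l. l \<in> K \<inter> N' \<Longrightarrow> H l \<in> U' \<and> \<Gamma> l = A' (H l) \<and> \<Delta> l = B (H l)"
    by (rule potential2E[OF p k]) (rule that)
  have Hk: "H k \<in> S" "H k \<in> U" "H k \<in> U'" "A (H k) = A' (H k)"
    using N(4)[of k] N'(5)[of k] N(2) N'(2) k H by auto
  obtain V where V: "open V" "H k \<in> V" "\<And>x. x \<in> S \<Longrightarrow> x \<in> V \<Longrightarrow> A' x - A x = A' (H k) - A (H k)"
    using primitive_unique[OF N'(3) N(3) Hk(1,3,2)] by metis
  hence "primitive_on S (U' \<inter> V) B (\<lambda>z v. poly w (A z) * \<eta> z v)"
    using Hk by (intro primitive_weight_cong[OF N'(4)]) auto
  moreover obtain M where M: "open M" "k \<in> M" "\<And>l. l \<in> K \<Longrightarrow> l \<in> M \<Longrightarrow> H l \<in> V"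
    using continuous_on_nbhd[OF H(1) V(1) k V(2)] by metis
  ultimately show ?thesis using N' by (intro that[of "N' \<inter> M" "U' \<inter> V" B]) auto
qed

text \<open>The given \<Gamma> removes the freedom of an additive constant in the local primitives
  \<open>A\<close>. Hence the weighted forms agree on overlaps and their primitives differ there by
  local constants.\<close>

lemma potential2_exists:
  fixes K :: "'k::real_normed_vector set"
  assumes K: "convex K" "compact K" and H: "continuous_on K H" "H ` K \<subseteq> S"
    and p: "potential S \<theta> K H \<Gamma>"
  obtains \<Delta> where "potential2 S \<theta> \<eta> (poly w) K H \<Gamma> \<Delta>"
proof -
  let ?form = "\<lambda>A z v. poly w (A z) * \<eta> z v"
  have "\<exists>N U A B. open N \<and> k \<in> N \<and> primitive_on S U A \<theta> \<and> primitive_on S U B (?form A) \<and>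
      (\<forall>l\<in>K \<inter> N. H l \<in> U \<and> \<Gamma> l = A (H l))" if k: "k \<in> K" for k
  proof -
    obtain N U A where N: "open N" "k \<in> N" "primitive_on S U A \<theta>" "\<And>l. l \<in> K \<inter> N \<Longrightarrow> H l \<in> U \<and> \<Gamma> l = A (H l)"
      by (rule potentialE[OF p k]) (rule that)
    obtain V B where V: "H k \<in> V" "primitive_on S V B (?form A)"
      using primitive2[OF _ _ N(3), of "H k"] N k H by blast
    hence "open V" unfolding primitive_on_def by blast
    then obtain M where "open M" "k \<in> M" "\<And>l. l \<in> K \<Longrightarrow> l \<in> M \<Longrightarrow> H l \<in> V"
      using continuous_on_nbhd[OF H(1) _ k V(1)] by metis
    moreover have "open (U \<inter> V)" using N V unfolding primitive_on_def by blast
    ultimately show ?thesis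
      using N V primitive_on_mono[OF N(3), of "U \<inter> V"] primitive_on_mono[OF V(2), of "U \<inter> V"]
      by (intro exI[of _ "N \<inter> M"] exI[of _ "U \<inter> V"] exI[of _ A] exI[of _ B]) auto
  qed
  hence "\<forall>k\<in>K. \<exists>q. case q of (N, U, A, B) \<Rightarrow> open N \<and> k \<in> N \<and> primitive_on S U A \<theta> \<and>
      primitive_on S U B (?form A) \<and> (\<forall>l\<in>K \<inter> N. H l \<in> U \<and> \<Gamma> l = A (H l))"
    by (intro ballI) (simp only: split_paired_Ex prod.case)
  from bchoice[OF this] obtain q where q: "\<forall>k\<in>K. case q k of (N, U, A, B) \<Rightarrow> open N \<and> k \<in> N \<and>
      primitive_on S U A \<theta> \<and> primitive_on S U B (?form A) \<and> (\<forall>l\<in>K \<inter> N. H l \<in> U \<and> \<Gamma> l = A (H l))" ..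
  define N U A B where "N = (\<lambda>k. fst (q k))" and "U = (\<lambda>k. fst (snd (q k)))" and "A = (\<lambda>k. fst (snd (snd (q k))))"
    and "B = (\<lambda>k. snd (snd (snd (q k))))"
  have N: "\<And>k. k \<in> K \<Longrightarrow> open (N k) \<and> k \<in> N k \<and> primitive_on S (U k) (A k) \<theta> \<and>
      primitive_on S (U k) (B k) (?form (A k)) \<and> (\<forall>l\<in>K \<inter> N k. H l \<in> U k \<and> \<Gamma> l = A k (H l))"
    using q unfolding case_prod_unfold N_def U_def A_def B_def by (rule bspec)
  obtain \<Delta> where \<Delta>: "\<And>k. k \<in> K \<Longrightarrow> \<exists>U c. open U \<and> k \<in> U \<and> (\<forall>x\<in>K \<inter> U. \<Delta> x = B k (H x) + c)"
  proof (rule local_to_global_convex[OF K, of N "\<lambda>k x. B k (H x)"])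
    fix k l m assume km: "k \<in> K" "l \<in> K" "m \<in> K" "m \<in> N k" "m \<in> N l"
    have "H m \<in> U k \<and> \<Gamma> m = A k (H m)" "H m \<in> U l \<and> \<Gamma> m = A l (H m)"
      using N[OF km(1)] N[OF km(2)] km(3-5) by blast+
    hence Hm: "H m \<in> S" "H m \<in> U k" "H m \<in> U l" "A k (H m) = A l (H m)" using km(3) H by auto
    obtain V where V: "open V" "H m \<in> V" "\<And>x. x \<in> S \<Longrightarrow> x \<in> V \<Longrightarrow> A k x - A l x = A k (H m) - A l (H m)"
    proof (rule primitive_unique[of "U k" "A k" \<theta> "U l" "A l" "H m"])
      show "primitive_on S (U k) (A k) \<theta>" "primitive_on S (U l) (A l) \<theta>" using N km by blast+
    qed (use Hm in \<open>blast intro: that\<close>)+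
    have Bk: "primitive_on S (U k \<inter> V) (B k) (?form (A l))"
      using N[OF km(1)] Hm V by (intro primitive_weight_cong[of "U k" "B k" w "A k"]) auto
    obtain V' where V': "open V'" "H m \<in> V'" "\<And>x. x \<in> S \<Longrightarrow> x \<in> V' \<Longrightarrow> B k x - B l x = B k (H m) - B l (H m)"
    proof (rule primitive_unique[of "U k \<inter> V" "B k" "?form (A l)" "U l" "B l" "H m"])
      show "primitive_on S (U l) (B l) (?form (A l))" using N km by blast
      show "primitive_on S (U k \<inter> V) (B k) (?form (A l))" by (rule Bk)
    qed (use Hm V in \<open>blast intro: that\<close>)+
    obtain M where M: "open M" "m \<in> M" "\<And>l. l \<in> K \<Longrightarrow> l \<in> M \<Longrightarrow> H l \<in> V'"
      using continuous_on_nbhd[OF H(1) V'(1) km(3) V'(2)] by metis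
    thus "\<exists>U. open U \<and> m \<in> U \<and> (\<forall>x\<in>K \<inter> U. B k (H x) - B l (H x) = B k (H m) - B l (H m))"
      using V' H by (intro exI[of _ M]) auto
  qed (use N in auto)
  have "potential2 S \<theta> \<eta> (poly w) K H \<Gamma> \<Delta>"
    unfolding potential2_def
  proof
    fix k assume k: "k \<in> K"
    then obtain M c where M: "open M" "k \<in> M" "\<forall>x\<in>K \<inter> M. \<Delta> x = B k (H x) + c" using \<Delta> by blast
    show "\<exists>N U A B. open N \<and> k \<in> N \<and> primitive_on S U A \<theta> \<and> primitive_on S U B (?form A) \<and>
        (\<forall>l\<in>K \<inter> N. H l \<in> U \<and> \<Gamma> l = A (H l) \<and> \<Delta> l = B (H l))"
      using N[OF k] M primitive_on_add_const[of S "U k" "B k" "?form (A k)" c]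
      by (intro exI[of _ "N k \<inter> M"] exI[of _ "U k"] exI[of _ "A k"] exI[of _ "\<lambda>z. B k z + c"]) auto
  qed
  thus ?thesis using that by blast
qed

lemma potential2_lincomb:
  assumes p: "potential2 S \<theta> \<eta> (poly w) K H \<Gamma> \<Delta>" "potential2 S \<theta> \<eta> (poly w') K H \<Gamma> \<Delta>'"
    and H: "continuous_on K H" "H ` K \<subseteq> S"
  shows "potential2 S \<theta> \<eta> (poly (smult c w + w')) K H \<Gamma> (\<lambda>k. c * \<Delta> k + \<Delta>' k)"
  unfolding potential2_def
proof
  fix k assume k: "k \<in> K"
  obtain N U A B where N: "open N" "k \<in> N" "primitive_on S U A \<theta>" "primitive_on S U B (\<lambda>z v. poly w (A z) * \<eta> z v)"
      "\<And>l. l \<in> K \<inter> N \<Longrightarrow> H l \<in> U \<and> \<Gamma> l = A (H l) \<and> \<Delta> l = B (H l)"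
    by (rule potential2E[OF p(1) k]) (rule that)
  obtain M V B' where M: "open M" "k \<in> M" "primitive_on S V B' (\<lambda>z v. poly w' (A z) * \<eta> z v)"
      "\<And>l. l \<in> K \<inter> M \<Longrightarrow> H l \<in> V \<and> \<Delta>' l = B' (H l)"
  proof (rule potential2_with_given_primitive[OF p(2) H k N(1-3)])
    show "\<And>l. l \<in> K \<inter> N \<Longrightarrow> H l \<in> U \<and> \<Gamma> l = A (H l)" using N(5) by fastforce
  qed (rule that)
  have "primitive_on S (U \<inter> V) (\<lambda>z. c * B z + B' z) (\<lambda>z v. poly (smult c w + w') (A z) * \<eta> z v)"
    unfolding primitive_on_def
  proof (intro conjI ballI)
    show "open (U \<inter> V)" using N M unfolding primitive_on_def by blast
    fix z assume z: "z \<in> S \<inter> (U \<inter> V)"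
    have "((\<lambda>z. c * B z + B' z) has_derivative (\<lambda>v. c * (poly w (A z) * \<eta> z v) + poly w' (A z) * \<eta> z v)) (at z within S)"
    proof (intro has_derivative_add has_derivative_mult_right)
      show "(B has_derivative (\<lambda>v. poly w (A z) * \<eta> z v)) (at z within S)"
        using N(4) z unfolding primitive_on_def by blast
      show "(B' has_derivative (\<lambda>v. poly w' (A z) * \<eta> z v)) (at z within S)"
        using M(3) z unfolding primitive_on_def by blast
    qed
    thus "((\<lambda>z. c * B z + B' z) has_derivative (\<lambda>v. poly (smult c w + w') (A z) * \<eta> z v)) (at z within S)"
      by (simp add: algebra_simps)
  qed
  moreover have "primitive_on S (U \<inter> V) A \<theta>"
    using N(3) M(3) by (intro primitive_on_mono[OF N(3)]) (auto simp: primitive_on_def)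
  moreover have "H l \<in> U \<inter> V \<and> \<Gamma> l = A (H l) \<and> c * \<Delta> l + \<Delta>' l = c * B (H l) + B' (H l)" if "l \<in> K \<inter> (N \<inter> M)" for l
    using N(5)[of l] M(4)[of l] that by simp
  moreover have "open (N \<inter> M)" "k \<in> N \<inter> M" using N M by auto
  ultimately show "\<exists>N U A B. open N \<and> k \<in> N \<and> primitive_on S U A \<theta> \<and>
      primitive_on S U B (\<lambda>z v. poly (smult c w + w') (A z) * \<eta> z v) \<and>
      (\<forall>l\<in>K \<inter> N. H l \<in> U \<and> \<Gamma> l = A (H l) \<and> c * \<Delta> l + \<Delta>' l = B (H l))"
    by blast
qed

lemma potential2_unique:
  assumes p: "potential2 S \<theta> \<eta> (poly w) K H \<Gamma> \<Delta>" "potential2 S \<theta> \<eta> (poly w) K H \<Gamma>' \<Delta>'"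
    and H: "continuous_on K H" "H ` K \<subseteq> S" and K: "connected K" "x \<in> K" "y \<in> K" and eq: "\<Gamma> x = \<Gamma>' x"
  shows "\<Delta> x - \<Delta>' x = \<Delta> y - \<Delta>' y"
proof (rule locally_constant_on_connected[OF K(1) _ K(2,3)])
  fix k assume k: "k \<in> K"
  have \<Gamma>: "\<Gamma> l = \<Gamma>' l" if "l \<in> K" for l
    using potential_unique[OF p[THEN potential2_imp_potential] H K(1) that K(2)] eq by simp
  obtain N U A B where N: "open N" "k \<in> N" "primitive_on S U A \<theta>" "primitive_on S U B (\<lambda>z v. poly w (A z) * \<eta> z v)"
      "\<And>l. l \<in> K \<inter> N \<Longrightarrow> H l \<in> U \<and> \<Gamma> l = A (H l) \<and> \<Delta> l = B (H l)"
    by (rule potential2E[OF p(1) k]) (rule that)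
  obtain M V B' where M: "open M" "k \<in> M" "primitive_on S V B' (\<lambda>z v. poly w (A z) * \<eta> z v)"
      "\<And>l. l \<in> K \<inter> M \<Longrightarrow> H l \<in> V \<and> \<Delta>' l = B' (H l)"
  proof (rule potential2_with_given_primitive[OF p(2) H k N(1-3)])
    show "\<And>l. l \<in> K \<inter> N \<Longrightarrow> H l \<in> U \<and> \<Gamma>' l = A (H l)" using N(5) \<Gamma> by fastforce
  qed (rule that)
  obtain W where W: "open W" "H k \<in> W" "\<And>x. x \<in> S \<Longrightarrow> x \<in> W \<Longrightarrow> B x - B' x = B (H k) - B' (H k)"
  proof (rule primitive_unique[OF N(4) M(3)])
    show "H k \<in> S" "H k \<in> U" "H k \<in> V" using N(5)[of k] M(4)[of k] N(2) M(2) k H by auto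
  qed (rule that)
  obtain O' where O: "open O'" "k \<in> O'" "\<And>l. l \<in> K \<Longrightarrow> l \<in> O' \<Longrightarrow> H l \<in> W"
    using continuous_on_nbhd[OF H(1) W(1) k W(2)] by metis
  show "\<exists>N. open N \<and> k \<in> N \<and> (\<forall>l\<in>K \<inter> N. \<Delta> l - \<Delta>' l = \<Delta> k - \<Delta>' k)"
  proof (intro exI[of _ "N \<inter> M \<inter> O'"] conjI ballI)
    fix l assume l: "l \<in> K \<inter> (N \<inter> M \<inter> O')"
    have "H l \<in> S" "H l \<in> W" using l O H by auto
    thus "\<Delta> l - \<Delta>' l = \<Delta> k - \<Delta>' k"
      using N(5)[of l] M(4)[of l] N(5)[of k] M(4)[of k] W(3)[of "H l"] l k N(2) M(2) by auto
  qed (use N M O in auto)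
qed

section \<open>Line integrals and iterated integrals along paths, and their homotopy
  invariance\<close>

lemma diff_swap: "(a::complex) - b = c - d \<Longrightarrow> d - b = c - a"
  by algebra

definition line_integral :: "(real \<Rightarrow> 'a) \<Rightarrow> complex" where
  "line_integral p = (SOME d. \<exists>\<Gamma>. potential S \<theta> {0..1} p \<Gamma> \<and> d = \<Gamma> 1 - \<Gamma> 0)"

text \<open>Under the normalization \<open>\<Gamma> 0 = 0\<close> the weight is evaluated at the
  integral of \<theta> counted from the start of the path.\<close>

definition iterated_integral :: "complex poly \<Rightarrow> (real \<Rightarrow> 'a) \<Rightarrow> complex" where
  "iterated_integral w p =
    (SOME d. \<exists>\<Gamma> \<Delta>. potential2 S \<theta> \<eta> (poly w) {0..1} p \<Gamma> \<Delta> \<and> \<Gamma> 0 = 0 \<and> d = \<Delta> 1 - \<Delta> 0)"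

lemma line_integral_eq:
  assumes p: "path p" "path_image p \<subseteq> S" and \<Gamma>: "potential S \<theta> {0..1} p \<Gamma>"
  shows "line_integral p = \<Gamma> 1 - \<Gamma> 0"
proof -
  have "\<exists>\<Gamma>'. potential S \<theta> {0..1} p \<Gamma>' \<and> line_integral p = \<Gamma>' 1 - \<Gamma>' 0"
    unfolding line_integral_def by (rule someI[of _ "\<Gamma> 1 - \<Gamma> 0"]) (use \<Gamma> in blast)
  then obtain \<Gamma>' where \<Gamma>': "potential S \<theta> {0..1} p \<Gamma>'" "line_integral p = \<Gamma>' 1 - \<Gamma>' 0" by blast
  have "\<Gamma> 0 - \<Gamma>' 0 = \<Gamma> 1 - \<Gamma>' 1"
    using p by (intro potential_unique[OF \<Gamma> \<Gamma>'(1)]) (auto simp: path_def path_image_def)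
  thus ?thesis unfolding \<Gamma>'(2) by (rule diff_swap)
qed

lemma iterated_integral_eq:
  assumes p: "path p" "path_image p \<subseteq> S" and \<Gamma>: "potential2 S \<theta> \<eta> (poly w) {0..1} p \<Gamma> \<Delta>" "\<Gamma> 0 = 0"
  shows "iterated_integral w p = \<Delta> 1 - \<Delta> 0"
proof -
  have "\<exists>\<Gamma>' \<Delta>'. potential2 S \<theta> \<eta> (poly w) {0..1} p \<Gamma>' \<Delta>' \<and> \<Gamma>' 0 = 0 \<and> iterated_integral w p = \<Delta>' 1 - \<Delta>' 0"
    unfolding iterated_integral_def by (rule someI[of _ "\<Delta> 1 - \<Delta> 0"]) (use \<Gamma> in blast)
  then obtain \<Gamma>' \<Delta>' where \<Gamma>': "potential2 S \<theta> \<eta> (poly w) {0..1} p \<Gamma>' \<Delta>'" "\<Gamma>' 0 = 0"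
      "iterated_integral w p = \<Delta>' 1 - \<Delta>' 0" by blast
  have "\<Delta> 0 - \<Delta>' 0 = \<Delta> 1 - \<Delta>' 1"
    using p \<Gamma>(2) \<Gamma>'(2) by (intro potential2_unique[OF \<Gamma>(1) \<Gamma>'(1)]) (auto simp: path_def path_image_def)
  thus ?thesis unfolding \<Gamma>'(3) by (rule diff_swap)
qed

lemma potentials_exist:
  fixes K :: "'k::real_normed_vector set"
  assumes K: "convex K" "compact K" "k \<in> K" and H: "continuous_on K H" "H ` K \<subseteq> S"
  obtains \<Gamma> \<Delta> where "potential2 S \<theta> \<eta> (poly w) K H \<Gamma> \<Delta>" "\<Gamma> k = 0"
proof -
  obtain \<Gamma> where "potential S \<theta> K H \<Gamma>" using potential_exists[OF K(1,2) H] .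
  then obtain \<Delta> where "potential2 S \<theta> \<eta> (poly w) K H \<Gamma> \<Delta>" by (rule potential2_exists[OF K(1,2) H])
  \<comment> \<open>This serves only to subtract a constant from \<Gamma>. It changes the weight, so
    a \<Delta> for \<open>w\<close> itself is constructed afresh afterwards.\<close>
  from potential2_comp[OF this, of K "\<lambda>x. x" H "\<lambda>x. poly w (x + \<Gamma> k)" "- \<Gamma> k"]
  have "potential2 S \<theta> \<eta> (\<lambda>x. poly w (x + \<Gamma> k)) K H (\<lambda>x. \<Gamma> x - \<Gamma> k) \<Delta>" by simp
  hence "potential S \<theta> K H (\<lambda>x. \<Gamma> x - \<Gamma> k)" by (rule potential2_imp_potential)
  then obtain \<Delta> where "potential2 S \<theta> \<eta> (poly w) K H (\<lambda>x. \<Gamma> x - \<Gamma> k) \<Delta>" by (rule potential2_exists[OF K(1,2) H])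
  thus ?thesis by (rule that) simp
qed

text \<open>Potentials exist on the whole homotopy square. On the two sides where the homotopy
  stands still they are constant, and on the other two their increments are the integrals along
  \<open>p\<close> and \<open>q\<close>.\<close>

lemma homotopic_integrals_eq:
  assumes "homotopic_paths S p q"
  shows "line_integral p = line_integral q" "iterated_integral w p = iterated_integral w q"
proof -
  have pq: "path p" "path q" "path_image p \<subseteq> S" "path_image q \<subseteq> S"
    using assms homotopic_paths_imp_path homotopic_paths_imp_subset by blast+
  let ?K = "{0..1::real} \<times> {0..1::real}"
  obtain h where h: "continuous_on ?K h" "h ` ?K \<subseteq> S" "\<And>x. x \<in> {0..1} \<Longrightarrow> h (0, x) = p x"
      "\<And>x. x \<in> {0..1} \<Longrightarrow> h (1, x) = q x"
      "\<And>t. t \<in> {0..1} \<Longrightarrow> h (t, 0) = p 0" "\<And>t. t \<in> {0..1} \<Longrightarrow> h (t, 1) = p 1"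
    using assms unfolding homotopic_paths
    by (auto simp: pathstart_def pathfinish_def image_subset_iff_funcset)
  have K: "convex ?K" "compact ?K" "(0, 0) \<in> ?K" by (auto intro: convex_Times compact_Times)
  obtain \<Gamma> \<Delta> where pot: "potential2 S \<theta> \<eta> (poly w) ?K h \<Gamma> \<Delta>" "\<Gamma> (0, 0) = 0"
    using potentials_exist[OF K h(1,2)] by metis
  note pot1 = potential2_imp_potential[OF pot(1)]
  have side: "\<Gamma> (0, y) = \<Gamma> (1, y) \<and> \<Delta> (0, y) = \<Delta> (1, y)" if y: "y = 0 \<or> y = 1" for y
  proof -
    have y': "y \<in> {0..1}" using y by auto
    have hy: "h (x, y) = p y" if "x \<in> {0..1}" for x using h(5,6) that y by auto
    have c: "continuous_on {0..1} (\<lambda>x. (x, y))" "(\<lambda>x. (x, y)) ` {0..1} \<subseteq> ?K"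
      using y' by (auto intro!: continuous_intros)
    have "potential2 S \<theta> \<eta> (poly w) {0..1} (\<lambda>x. h (x, y)) (\<lambda>x. \<Gamma> (x, y) + 0) (\<lambda>x. \<Delta> (x, y))"
      by (rule potential2_comp[OF pot(1) c]) auto
    hence p2: "potential2 S \<theta> \<eta> (poly w) {0..1} (\<lambda>x. h (x, y)) (\<lambda>x. \<Gamma> (x, y)) (\<lambda>x. \<Delta> (x, y))" by simp
    have "\<Gamma> (0, y) = \<Gamma> (1, y)"
      by (rule potential_const[OF potential2_imp_potential[OF p2], of 0 1 "p y"]) (use hy in auto)
    moreover have "\<Delta> (0, y) = \<Delta> (1, y)"
    proof (rule locally_constant_on_connected[of "{0..1}" "\<lambda>x. \<Delta> (x, y)" 0 1])
      fix k :: real assume k: "k \<in> {0..1}"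
      obtain N U A B where N: "open N" "k \<in> N" "primitive_on S U A \<theta>" "primitive_on S U B (\<lambda>z v. poly w (A z) * \<eta> z v)"
          "\<And>l. l \<in> {0..1} \<inter> N \<Longrightarrow> h (l, y) \<in> U \<and> \<Gamma> (l, y) = A (h (l, y)) \<and> \<Delta> (l, y) = B (h (l, y))"
        by (rule potential2E[OF p2 k]) (rule that)
      thus "\<exists>N. open N \<and> k \<in> N \<and> (\<forall>l\<in>{0..1} \<inter> N. \<Delta> (l, y) = \<Delta> (k, y))"
        using hy k by (intro exI[of _ N]) auto
    qed auto
    ultimately show ?thesis by blast
  qed
  have edge: "line_integral r = \<Gamma> (x, 1) - \<Gamma> (x, 0) \<and> iterated_integral w r = \<Delta> (x, 1) - \<Delta> (x, 0)"
    if r: "path r" "path_image r \<subseteq> S" "\<And>y. y \<in> {0..1} \<Longrightarrow> h (x, y) = r y" "x = 0 \<or> x = 1" for r x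
  proof -
    have c: "continuous_on {0..1} (Pair x)" "Pair x ` {0..1} \<subseteq> ?K"
      using r by (auto intro!: continuous_intros)
    have "potential2 S \<theta> \<eta> (poly w) {0..1} r (\<lambda>y. \<Gamma> (x, y) + 0) (\<lambda>y. \<Delta> (x, y))"
      by (rule potential2_comp[OF pot(1) c]) (use r in auto)
    hence p2: "potential2 S \<theta> \<eta> (poly w) {0..1} r (\<lambda>y. \<Gamma> (x, y)) (\<lambda>y. \<Delta> (x, y))" by simp
    have "\<Gamma> (x, 0) = 0" using side[of 0] pot(2) r(4) by auto
    thus ?thesis
      using line_integral_eq[OF r(1,2) potential2_imp_potential[OF p2]] iterated_integral_eq[OF r(1,2) p2] by simp
  qed
  show "line_integral p = line_integral q" "iterated_integral w p = iterated_integral w q"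
    using edge[of p 0] edge[of q 1] side[of 0] side[of 1] pq h(3,4) by auto
qed

text \<open>Potentials of the joined path are restricted to its two halves. On the second half
  \<Gamma> starts at the line integral of \<open>p\<close>, which is the origin of the translated
  weight.\<close>

lemma integrals_join:
  assumes p: "path p" "path_image p \<subseteq> S" and q: "path q" "path_image q \<subseteq> S" and pq: "pathfinish p = pathstart q"
  shows "line_integral (p +++ q) = line_integral p + line_integral q"
    and "iterated_integral w (p +++ q) =
      iterated_integral w p + iterated_integral (pcompose w [:line_integral p, 1:]) q"
proof -
  have j: "path (p +++ q)" "path_image (p +++ q) \<subseteq> S"
    using p q pq by (auto simp: path_image_join)
  obtain \<Gamma> \<Delta> where pot: "potential2 S \<theta> \<eta> (poly w) {0..1} (p +++ q) \<Gamma> \<Delta>" "\<Gamma> 0 = 0"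
    using potentials_exist[of "{0..1::real}" 0 "p +++ q"] j by (auto simp: path_def path_image_def)
  have "potential2 S \<theta> \<eta> (poly w) {0..1} p (\<lambda>x. \<Gamma> (x / 2) + 0) (\<lambda>x. \<Delta> (x / 2))"
    by (rule potential2_comp[OF pot(1)]) (auto simp: joinpaths_def intro!: continuous_intros)
  hence p1: "potential2 S \<theta> \<eta> (poly w) {0..1} p (\<lambda>x. \<Gamma> (x / 2)) (\<lambda>x. \<Delta> (x / 2))" by simp
  have Xp: "line_integral p = \<Gamma> (1 / 2)" "iterated_integral w p = \<Delta> (1 / 2) - \<Delta> 0"
    using line_integral_eq[OF p potential2_imp_potential[OF p1]] iterated_integral_eq[OF p p1] pot(2) by auto
  have p2: "potential2 S \<theta> \<eta> (poly (pcompose w [:line_integral p, 1:])) {0..1} q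
      (\<lambda>x. \<Gamma> ((1 + x) / 2) + - \<Gamma> (1 / 2)) (\<lambda>x. \<Delta> ((1 + x) / 2))"
  proof (rule potential2_comp[OF pot(1)])
    fix x :: real assume x: "x \<in> {0..1}"
    show "q x = (p +++ q) ((1 + x) / 2)"
      using x pq by (cases "x = 0") (auto simp: joinpaths_def pathfinish_def pathstart_def add_divide_distrib)
  qed (auto simp: poly_pcompose Xp intro!: continuous_intros)
  have Xq: "line_integral q = \<Gamma> 1 - \<Gamma> (1 / 2)"
    "iterated_integral (pcompose w [:line_integral p, 1:]) q = \<Delta> 1 - \<Delta> (1 / 2)"
    using line_integral_eq[OF q potential2_imp_potential[OF p2]] iterated_integral_eq[OF q p2] by auto
  show "line_integral (p +++ q) = line_integral p + line_integral q"
    using line_integral_eq[OF j potential2_imp_potential[OF pot(1)]] pot(2) Xp Xq by simp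
  show "iterated_integral w (p +++ q) =
      iterated_integral w p + iterated_integral (pcompose w [:line_integral p, 1:]) q"
    using iterated_integral_eq[OF j pot] Xp Xq by simp
qed

lemma iterated_integral_lincomb:
  assumes p: "path p" "path_image p \<subseteq> S"
  shows "iterated_integral (smult c w + w') p = c * iterated_integral w p + iterated_integral w' p"
proof -
  have p': "continuous_on {0..1} p" "p ` {0..1} \<subseteq> S" using p by (auto simp: path_def path_image_def)
  have K: "convex {0..1::real}" "compact {0..1::real}" "0 \<in> {0..1::real}" by auto
  obtain \<Gamma> \<Delta> where pot: "potential2 S \<theta> \<eta> (poly w) {0..1} p \<Gamma> \<Delta>" "\<Gamma> 0 = 0"
    using potentials_exist[OF K p'] by metis
  obtain \<Delta>' where pot': "potential2 S \<theta> \<eta> (poly w') {0..1} p \<Gamma> \<Delta>'"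
    using potential2_exists[OF K(1,2) p' potential2_imp_potential[OF pot(1)]] by metis
  show ?thesis
    unfolding iterated_integral_eq[OF p potential2_lincomb[OF pot(1) pot' p'] pot(2)]
      iterated_integral_eq[OF p pot] iterated_integral_eq[OF p pot' pot(2)] by (simp add: algebra_simps)
qed

text \<open>For the constant weight 1 the second potential is a potential of \<eta> itself, so both
  values follow from the fundamental theorem of calculus.\<close>

lemma integrals_of_C1_path:
  assumes p: "path_image p \<subseteq> S"
    and p': "\<And>s. s \<in> {0..1} \<Longrightarrow> (p has_vector_derivative p' s) (at s within {0..1})"
  shows "line_integral p = integral {0..1} (\<lambda>s. \<theta> (p s) (p' s))"
    and "iterated_integral 1 p = integral {0..1} (\<lambda>s. \<eta> (p s) (p' s))"
proof -
  have cp: "continuous_on {0..1} p"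
    unfolding continuous_on_eq_continuous_within using p' has_vector_derivative_continuous by blast
  have img: "p ` {0..1} \<subseteq> S" using p by (simp add: path_image_def)
  have K: "convex {0..1::real}" "compact {0..1::real}" "0 \<in> {0..1::real}" by auto
  obtain \<Gamma> \<Delta> where pot: "potential2 S \<theta> \<eta> (poly 1) {0..1} p \<Gamma> \<Delta>" "\<Gamma> 0 = 0"
    using potentials_exist[OF K cp img] by metis
  have "potential S \<eta> {0..1} p \<Delta>"
    unfolding potential_def
  proof
    fix k :: real assume k: "k \<in> {0..1}"
    show "\<exists>N U A. open N \<and> k \<in> N \<and> primitive_on S U A \<eta> \<and> (\<forall>l\<in>{0..1} \<inter> N. p l \<in> U \<and> \<Delta> l = A (p l))"
      by (rule potential2E[OF pot(1) k]) (intro exI conjI ballI, auto)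
  qed
  note d = potential_deriv[OF potential2_imp_potential[OF pot(1)] _ img p'] potential_deriv[OF this _ img p']
  have "((\<lambda>s. \<theta> (p s) (p' s)) has_integral \<Gamma> 1 - \<Gamma> 0) {0..1}" "((\<lambda>s. \<eta> (p s) (p' s)) has_integral \<Delta> 1 - \<Delta> 0) {0..1}"
    using d by (auto intro!: fundamental_theorem_of_calculus)
  moreover have "path p" using cp by (simp add: path_def)
  ultimately show "line_integral p = integral {0..1} (\<lambda>s. \<theta> (p s) (p' s))"
      "iterated_integral 1 p = integral {0..1} (\<lambda>s. \<eta> (p s) (p' s))"
    using line_integral_eq[OF _ p potential2_imp_potential[OF pot(1)]] iterated_integral_eq[OF _ p pot]
    by (auto simp: integral_unique)
qed

definition class_integral :: "(real \<Rightarrow> 'a) set \<Rightarrow> complex" where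
  "class_integral C = line_integral (SOME p. p \<in> C)"

definition class_iterated_integral :: "complex poly \<Rightarrow> (real \<Rightarrow> 'a) set \<Rightarrow> complex" where
  "class_iterated_integral w C = iterated_integral w (SOME p. p \<in> C)"

lemma class_integral_eq:
  assumes "path p" "path_image p \<subseteq> S"
  shows "class_integral (homotopy_class S p) = line_integral p"
    and "class_iterated_integral w (homotopy_class S p) = iterated_integral w p"
proof -
  have "(SOME q. q \<in> homotopy_class S p) \<in> homotopy_class S p"
    by (rule someI[of _ p]) (use assms in \<open>simp add: homotopy_class_def\<close>)
  hence "homotopic_paths S p (SOME q. q \<in> homotopy_class S p)" by (simp add: homotopy_class_def)
  from homotopic_integrals_eq[OF this]
  show "class_integral (homotopy_class S p) = line_integral p"
    "class_iterated_integral w (homotopy_class S p) = iterated_integral w p"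
    by (simp_all add: class_integral_def class_iterated_integral_def)
qed

lemma iterated_integral_pairing:
  assumes a: "a \<in> S"
  shows "iterated_integral_pairing (fundamental_group S a) class_integral class_iterated_integral"
proof -
  interpret G: group "fundamental_group S a" by (rule group_fundamental_group[OF a])
  have carr: "\<exists>p. p \<in> loops_at S a \<and> path p \<and> path_image p \<subseteq> S \<and> pathstart p = a \<and> pathfinish p = a \<and> x = homotopy_class S p"
    if "x \<in> carrier (fundamental_group S a)" for x
    using that by (auto simp: fundamental_group_def loops_at_def)
  show ?thesis
  proof
    fix x y w assume x: "x \<in> carrier (fundamental_group S a)" and y: "y \<in> carrier (fundamental_group S a)"
    obtain p where p: "p \<in> loops_at S a" "path p" "path_image p \<subseteq> S" "pathstart p = a" "pathfinish p = a" "x = homotopy_class S p"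
      using carr[OF x] by blast
    obtain q where q: "q \<in> loops_at S a" "path q" "path_image q \<subseteq> S" "pathstart q = a" "pathfinish q = a" "y = homotopy_class S q"
      using carr[OF y] by blast
    have xy: "x \<otimes>\<^bsub>fundamental_group S a\<^esub> y = homotopy_class S (p +++ q)"
      using p q by (simp add: fundamental_group_mult)
    have j: "path (p +++ q)" "path_image (p +++ q) \<subseteq> S" using p q by (auto simp: path_image_join)
    show "class_integral (x \<otimes>\<^bsub>fundamental_group S a\<^esub> y) = class_integral x + class_integral y"
      using class_integral_eq[OF j] class_integral_eq[OF p(2,3)] class_integral_eq[OF q(2,3)]
        integrals_join[OF p(2,3) q(2,3)] p q xy by simp
    show "class_iterated_integral w (x \<otimes>\<^bsub>fundamental_group S a\<^esub> y) =
        class_iterated_integral w x + class_iterated_integral (pcompose w [:class_integral x, 1:]) y"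
      using class_integral_eq[OF j] class_integral_eq[OF p(2,3)] class_integral_eq[OF q(2,3)]
        integrals_join[OF p(2,3) q(2,3)] p q xy by simp
  next
    fix x w w' and c :: complex assume "x \<in> carrier (fundamental_group S a)"
    then obtain p where p: "path p" "path_image p \<subseteq> S" "x = homotopy_class S p" using carr by blast
    show "class_iterated_integral (w + w') x = class_iterated_integral w x + class_iterated_integral w' x"
      using class_integral_eq[OF p(1,2)] iterated_integral_lincomb[OF p(1,2), of 1 w w'] p by simp
    have "iterated_integral 0 p = 0" using iterated_integral_lincomb[OF p(1,2), of 1 0 0] by simp
    thus "class_iterated_integral (smult c w) x = c * class_iterated_integral w x"
      using class_integral_eq[OF p(1,2)] iterated_integral_lincomb[OF p(1,2), of c w 0] p by simp
  qed
qed

end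

section \<open>Displacement orders of holonomy germs\<close>

text \<open>Holomorphy in two variables, tested along holomorphic curves: this property passes to
  compositions of holonomy maps and contains holomorphy in each variable separately.\<close>

definition curve_holomorphic :: "(complex \<times> complex) set \<Rightarrow> (complex \<Rightarrow> complex \<Rightarrow> complex) \<Rightarrow> bool" where
  "curve_holomorphic W h \<longleftrightarrow> (\<forall>D e \<tau>. open D \<longrightarrow> e holomorphic_on D \<longrightarrow> \<tau> holomorphic_on D \<longrightarrow>
    (\<forall>\<zeta>\<in>D. (e \<zeta>, \<tau> \<zeta>) \<in> W) \<longrightarrow> (\<lambda>\<zeta>. h (e \<zeta>) (\<tau> \<zeta>)) holomorphic_on D)"

lemma curve_holomorphicD:
  "curve_holomorphic W h \<Longrightarrow> open D \<Longrightarrow> e holomorphic_on D \<Longrightarrow> \<tau> holomorphic_on D \<Longrightarrow>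
    (\<And>\<zeta>. \<zeta> \<in> D \<Longrightarrow> (e \<zeta>, \<tau> \<zeta>) \<in> W) \<Longrightarrow> (\<lambda>\<zeta>. h (e \<zeta>) (\<tau> \<zeta>)) holomorphic_on D"
  unfolding curve_holomorphic_def by blast

text \<open>A joint limit, \<epsilon> tending to 0 without reaching it while t moves near
  \<open>t0\<close>. Jointness is what encodes local uniformity in t.\<close>

abbreviation punctured_nhds :: "complex \<Rightarrow> (complex \<times> complex) filter" where
  "punctured_nhds t0 \<equiv> at 0 \<times>\<^sub>F nhds t0"

lemma punctured_nhds_le: "punctured_nhds t0 \<le> nhds (0, t0)"
  unfolding nhds_prod by (intro prod_filter_mono) (auto simp: at_within_def)

lemma filterlim_fst_punctured_nhds: "filterlim fst (at 0) (punctured_nhds t0)"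
  by (rule filterlim_fst)

text \<open>Every point of the disc has a neighbourhood on which the estimate holds for all small
  \<epsilon>; finitely many of them cover the disc.\<close>

lemma eventually_uniform_on_cball:
  fixes R :: "complex \<Rightarrow> complex \<Rightarrow> complex"
  assumes lim: "\<And>t1. t1 \<in> cball t0 r \<Longrightarrow> ((\<lambda>x. R (fst x) (snd x)) \<longlongrightarrow> m t1) (punctured_nhds t1)"
    and m: "\<And>t1. t1 \<in> cball t0 r \<Longrightarrow> isCont m t1" and \<eta>: "\<eta> > 0"
  shows "\<forall>\<^sub>F \<epsilon> in at 0. \<forall>t\<in>cball t0 r. norm (R \<epsilon> t - m t) < \<eta>"
proof -
  have "\<exists>U. open U \<and> t1 \<in> U \<and> (\<forall>\<^sub>F \<epsilon> in at 0. \<forall>t\<in>U. norm (R \<epsilon> t - m t) < \<eta>)" if t1: "t1 \<in> cball t0 r" for t1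
  proof -
    have "((\<lambda>x. m (snd x)) \<longlongrightarrow> m t1) (punctured_nhds t1)"
      using filterlim_compose[OF m[OF t1, THEN isCont_def[THEN iffD1], THEN tendsto_at_iff_tendsto_nhds[THEN iffD1]] filterlim_snd] .
    hence "((\<lambda>x. R (fst x) (snd x) - m (snd x)) \<longlongrightarrow> m t1 - m t1) (punctured_nhds t1)"
      by (intro tendsto_diff lim t1)
    hence "\<forall>\<^sub>F x in punctured_nhds t1. norm (R (fst x) (snd x) - m (snd x)) < \<eta>"
      using \<eta> by (auto dest!: tendstoD[of _ _ _ \<eta>] simp: dist_norm)
    then obtain P Q where PQ: "eventually P (at 0)" "eventually Q (nhds t1)"
        "\<And>x y. P x \<Longrightarrow> Q y \<Longrightarrow> norm (R x y - m y) < \<eta>"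
      unfolding eventually_prod_filter by auto
    obtain U where U: "open U" "t1 \<in> U" "\<And>y. y \<in> U \<Longrightarrow> Q y"
      using PQ(2) unfolding eventually_nhds by blast
    have "\<forall>\<^sub>F \<epsilon> in at 0. \<forall>t\<in>U. norm (R \<epsilon> t - m t) < \<eta>"
      using PQ(1) by eventually_elim (use PQ(3) U(3) in blast)
    thus ?thesis using U by blast
  qed
  hence "\<forall>t1\<in>cball t0 r. \<exists>U. open U \<and> t1 \<in> U \<and> (\<forall>\<^sub>F \<epsilon> in at 0. \<forall>t\<in>U. norm (R \<epsilon> t - m t) < \<eta>)"
    by (intro ballI)
  from bchoice[OF this] obtain U where U: "\<forall>t1\<in>cball t0 r. open (U t1) \<and> t1 \<in> U t1 \<and>
      (\<forall>\<^sub>F \<epsilon> in at 0. \<forall>t\<in>U t1. norm (R \<epsilon> t - m t) < \<eta>)" ..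
  obtain C where C: "C \<subseteq> cball t0 r" "finite C" "cball t0 r \<subseteq> (\<Union>c\<in>C. U c)"
  proof (rule compactE_image[of "cball t0 r" "cball t0 r" U])
    show "\<And>t1. t1 \<in> cball t0 r \<Longrightarrow> open (U t1)" using U by blast
    show "cball t0 r \<subseteq> (\<Union>c\<in>cball t0 r. U c)" using U by blast
  qed (auto intro: that)
  have "\<forall>\<^sub>F \<epsilon> in at 0. \<forall>c\<in>C. \<forall>t\<in>U c. norm (R \<epsilon> t - m t) < \<eta>"
  proof (rule eventually_ball_finite[OF C(2)], rule ballI)
    fix c assume "c \<in> C"
    with C(1) have "c \<in> cball t0 r" by (rule subsetD)
    from bspec[OF U this] show "\<forall>\<^sub>F \<epsilon> in at 0. \<forall>t\<in>U c. norm (R \<epsilon> t - m t) < \<eta>" by (elim conjE)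
  qed
  thus ?thesis
  proof eventually_elim
    case (elim \<epsilon>)
    show ?case
    proof
      fix t assume "t \<in> cball t0 r"
      then obtain c where "c \<in> C" "t \<in> U c" using C(3) by blast
      thus "norm (R \<epsilon> t - m t) < \<eta>" using elim by blast
    qed
  qed
qed

lemma lipschitz_of_deriv_bound:
  fixes g :: "complex \<Rightarrow> complex"
  assumes g: "g holomorphic_on ball t0 r" and B: "\<And>z. z \<in> ball t0 r \<Longrightarrow> norm (deriv g z) \<le> B"
    and pq: "p \<in> ball t0 r" "q \<in> ball t0 r"
  shows "norm (g p - g q) \<le> B * norm (p - q)"
proof (rule field_differentiable_bound[of "ball t0 r" g "deriv g"])
  show "(g has_field_derivative deriv g z) (at z within ball t0 r)" if "z \<in> ball t0 r" for z
    by (rule has_field_derivative_at_within[OF holomorphic_derivI[OF g open_ball that]])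
qed (use B pq in auto)

text \<open>The value \<open>d\<close> on the diagonal is free. Choosing the expected limit there
  lets the limit statement include the case of equal arguments.\<close>

definition divided_difference :: "(complex \<Rightarrow> complex) \<Rightarrow> complex \<Rightarrow> complex \<Rightarrow> complex \<Rightarrow> complex" where
  "divided_difference g d p q = (if p = q then d else (g p - g q) / (p - q))"

lemma divided_difference_eq: "g p - g q = divided_difference g d p q * (p - q)"
  by (simp add: divided_difference_def)

text \<open>\<open>R \<epsilon>\<close> tends to \<open>m\<close> uniformly on a disc, so Cauchy's
  estimate makes the derivative of the difference uniformly small. The difference quotients of
  \<open>R \<epsilon>\<close> then follow those of \<open>m\<close>, which tend to the derivative at
  \<open>t0\<close>.\<close>

lemma divided_difference_tendsto:
  fixes R :: "complex \<Rightarrow> complex \<Rightarrow> complex"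
  assumes T: "open T" "t0 \<in> T" and m: "m holomorphic_on T"
    and lim: "\<And>t1. t1 \<in> T \<Longrightarrow> ((\<lambda>x. R (fst x) (snd x)) \<longlongrightarrow> m t1) (punctured_nhds t1)"
    and hol: "r0 > 0" "\<forall>\<^sub>F \<epsilon> in at 0. R \<epsilon> holomorphic_on ball t0 r0"
    and e: "filterlim e (at 0) F" and p: "(p \<longlongrightarrow> t0) F" and q: "(q \<longlongrightarrow> t0) F"
  shows "((\<lambda>x. divided_difference (R (e x)) (deriv m t0) (p x) (q x)) \<longlongrightarrow> deriv m t0) F"
proof -
  obtain r1 where r1: "r1 > 0" "cball t0 r1 \<subseteq> T" using T open_contains_cball by blast
  define r where "r = min (r0 / 2) r1"
  have r: "r > 0" "r < r0" "cball t0 r \<subseteq> T" using r1 hol by (auto simp: r_def)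
  have mc: "isCont m t1" if "t1 \<in> T" for t1
    using m T that by (metis continuous_on_eq_continuous_at holomorphic_on_imp_continuous_on)
  have dm: "deriv m holomorphic_on T" using m T(1) by (rule holomorphic_deriv)
  show ?thesis
  proof (rule tendstoI)
    fix \<eta> :: real assume \<eta>: "\<eta> > 0"
    \<comment> \<open>The tolerance is split into \<eta>/4 for the variation of the derivative of
      \<open>m\<close> and \<eta>/4 for the Cauchy estimate on discs of radius r/2, which divides by
      r/2.\<close>
    define \<eta>' where "\<eta>' = min (\<eta> / 4) (\<eta> * r / 8)"
    have \<eta>': "\<eta>' > 0" "\<eta>' \<le> \<eta> / 4" "\<eta>' * 2 / r \<le> \<eta> / 4"
      using \<eta> r by (auto simp: \<eta>'_def field_simps min_def)
    have "isCont (deriv m) t0"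
      using dm T by (metis continuous_on_eq_continuous_at holomorphic_on_imp_continuous_on)
    then obtain s where s: "s > 0" "\<And>z. dist z t0 < s \<Longrightarrow> dist (deriv m z) (deriv m t0) < \<eta>'"
      using \<eta>'(1) unfolding continuous_at_eps_delta by metis
    define \<rho> where "\<rho> = min s (r / 2)"
    have \<rho>: "\<rho> > 0" "\<rho> \<le> r / 2" "\<rho> \<le> s" using s r by (auto simp: \<rho>_def)
    have m_lip: "norm ((m p - deriv m t0 * p) - (m q - deriv m t0 * q)) \<le> \<eta>' * norm (p - q)"
      if "p \<in> ball t0 \<rho>" "q \<in> ball t0 \<rho>" for p q
    proof (rule lipschitz_of_deriv_bound[OF _ _ that])
      have sub: "ball t0 \<rho> \<subseteq> T" using \<rho> r by auto
      show "(\<lambda>p. m p - deriv m t0 * p) holomorphic_on ball t0 \<rho>"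
        by (intro holomorphic_intros holomorphic_on_subset[OF m sub])
      fix z assume z: "z \<in> ball t0 \<rho>"
      have "(m has_field_derivative deriv m z) (at z)"
        using m T(1) sub z by (intro holomorphic_derivI) auto
      hence "((\<lambda>p. m p - deriv m t0 * p) has_field_derivative deriv m z - deriv m t0) (at z)"
        by (auto intro!: derivative_eq_intros)
      hence "deriv (\<lambda>p. m p - deriv m t0 * p) z = deriv m z - deriv m t0" by (rule DERIV_imp_deriv)
      thus "norm (deriv (\<lambda>p. m p - deriv m t0 * p) z) \<le> \<eta>'"
        using s(2)[of z] z \<rho> by (auto simp: dist_norm norm_minus_commute less_imp_le)
    qed
    have "\<forall>\<^sub>F \<epsilon> in at 0. \<forall>t\<in>cball t0 r. norm (R \<epsilon> t - m t) < \<eta>'"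
      by (rule eventually_uniform_on_cball[OF lim mc \<eta>'(1)]) (use r in auto)
    hence "\<forall>\<^sub>F \<epsilon> in at 0. \<forall>p\<in>ball t0 \<rho>. \<forall>q\<in>ball t0 \<rho>. norm (R \<epsilon> p - R \<epsilon> q - deriv m t0 * (p - q)) \<le> \<eta> / 2 * norm (p - q)"
      using hol(2)
    proof eventually_elim
      case (elim \<epsilon>)
      define g where "g = (\<lambda>t. R \<epsilon> t - m t)"
      have g: "g holomorphic_on ball t0 r" "continuous_on (cball t0 r) g"
      proof -
        have R: "R \<epsilon> holomorphic_on cball t0 r" using r by (intro holomorphic_on_subset[OF elim(2)]) auto
        have m': "m holomorphic_on cball t0 r" using r by (intro holomorphic_on_subset[OF m]) auto
        have "g holomorphic_on cball t0 r" unfolding g_def by (intro holomorphic_intros R m')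
        thus "g holomorphic_on ball t0 r" "continuous_on (cball t0 r) g"
          using holomorphic_on_subset ball_subset_cball holomorphic_on_imp_continuous_on by blast+
      qed
      have g_lip: "norm (g p - g q) \<le> \<eta>' * 2 / r * norm (p - q)" if "p \<in> ball t0 (r / 2)" "q \<in> ball t0 (r / 2)" for p q
      proof (rule lipschitz_of_deriv_bound[OF _ _ that])
        show "g holomorphic_on ball t0 (r / 2)" using r by (intro holomorphic_on_subset[OF g(1)]) auto
        fix z assume z: "z \<in> ball t0 (r / 2)"
        have sub: "cball z (r / 2) \<subseteq> cball t0 r"
        proof
          fix y assume "y \<in> cball z (r / 2)"
          thus "y \<in> cball t0 r" using z dist_triangle[of t0 y z] by simp
        qed
        have sub': "ball z (r / 2) \<subseteq> ball t0 r"
        proof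
          fix y assume "y \<in> ball z (r / 2)"
          thus "y \<in> ball t0 r" using z dist_triangle[of t0 y z] by simp
        qed
        have "norm ((deriv ^^ 1) g z) \<le> fact 1 * \<eta>' / (r / 2) ^ 1"
        proof (rule Cauchy_inequality)
          show "g holomorphic_on ball z (r / 2)" using g(1) sub' by (rule holomorphic_on_subset)
          show "continuous_on (cball z (r / 2)) g" using g(2) sub by (rule continuous_on_subset)
          fix x assume "norm (z - x) = r / 2"
          hence "x \<in> cball t0 r" using sub by (auto simp: dist_norm)
          thus "norm (g x) \<le> \<eta>'" using elim(1) by (auto simp: g_def intro: less_imp_le)
        qed (use r in auto)
        thus "norm (deriv g z) \<le> \<eta>' * 2 / r" by simp
      qed
      show ?case
      proof (intro ballI)
        fix p q assume pq: "p \<in> ball t0 \<rho>" "q \<in> ball t0 \<rho>"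
        have "norm (g p - g q) \<le> \<eta>' * 2 / r * norm (p - q)"
          using pq \<rho> by (intro g_lip) auto
        also have "\<dots> \<le> \<eta> / 4 * norm (p - q)" using \<eta>' by (intro mult_right_mono) auto
        finally have 1: "norm (g p - g q) \<le> \<eta> / 4 * norm (p - q)" .
        have "norm ((m p - deriv m t0 * p) - (m q - deriv m t0 * q)) \<le> \<eta>' * norm (p - q)"
          by (rule m_lip[OF pq])
        also have "\<dots> \<le> \<eta> / 4 * norm (p - q)" using \<eta>' by (intro mult_right_mono) auto
        finally have 2: "norm ((m p - deriv m t0 * p) - (m q - deriv m t0 * q)) \<le> \<eta> / 4 * norm (p - q)" .
        have "R \<epsilon> p - R \<epsilon> q - deriv m t0 * (p - q) = (g p - g q) + ((m p - deriv m t0 * p) - (m q - deriv m t0 * q))"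
          by (simp add: g_def algebra_simps)
        thus "norm (R \<epsilon> p - R \<epsilon> q - deriv m t0 * (p - q)) \<le> \<eta> / 2 * norm (p - q)"
          using norm_triangle_ineq[of "g p - g q" "(m p - deriv m t0 * p) - (m q - deriv m t0 * q)"] 1 2 by simp
      qed
    qed
    hence "\<forall>\<^sub>F x in F. \<forall>p\<in>ball t0 \<rho>. \<forall>q\<in>ball t0 \<rho>. norm (R (e x) p - R (e x) q - deriv m t0 * (p - q)) \<le> \<eta> / 2 * norm (p - q)"
      using e by (rule eventually_compose_filterlim)
    moreover have "\<forall>\<^sub>F x in F. p x \<in> ball t0 \<rho>" "\<forall>\<^sub>F x in F. q x \<in> ball t0 \<rho>"
      using p q \<rho>(1) by (auto simp: dist_commute dest: tendstoD)
    ultimately show "\<forall>\<^sub>F x in F. dist (divided_difference (R (e x)) (deriv m t0) (p x) (q x)) (deriv m t0) < \<eta>"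
    proof eventually_elim
      case (elim x)
      show ?case
      proof (cases "p x = q x")
        case False
        hence n: "norm (p x - q x) > 0" by simp
        have "divided_difference (R (e x)) (deriv m t0) (p x) (q x) - deriv m t0 =
            (R (e x) (p x) - R (e x) (q x) - deriv m t0 * (p x - q x)) / (p x - q x)"
          using False by (simp add: divided_difference_def field_simps)
        hence "norm (divided_difference (R (e x)) (deriv m t0) (p x) (q x) - deriv m t0) =
            norm (R (e x) (p x) - R (e x) (q x) - deriv m t0 * (p x - q x)) / norm (p x - q x)"
          by (simp add: norm_divide)
        also have "\<dots> \<le> \<eta> / 2" using elim n by (simp add: pos_divide_le_eq)
        finally show ?thesis using \<eta> by (simp add: dist_norm)
      qed (use \<eta> in \<open>simp add: divided_difference_def\<close>)
    qed
  qed
qed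

text \<open>\<open>h \<epsilon> t = t + \<epsilon>^k m(t) + o(\<epsilon>^k)\<close>, locally uniformly in \<open>t\<close>.\<close>

definition displacement_order :: "complex set \<Rightarrow> (complex \<Rightarrow> complex \<Rightarrow> complex) \<Rightarrow> nat \<Rightarrow> (complex \<Rightarrow> complex) \<Rightarrow> bool" where
  "displacement_order T h k m \<longleftrightarrow>
    (\<forall>t0\<in>T. ((\<lambda>x. (h (fst x) (snd x) - snd x) / fst x ^ k) \<longlongrightarrow> m t0) (punctured_nhds t0))"

text \<open>The radius \<open>r\<close> is the same for all small \<epsilon>; this uniformity lets
  Cauchy's estimate control the difference quotients.\<close>

definition germ_at_identity :: "complex set \<Rightarrow> (complex \<Rightarrow> complex \<Rightarrow> complex) \<Rightarrow> bool" where
  "germ_at_identity T h \<longleftrightarrow> (\<forall>t0\<in>T. ((\<lambda>x. h (fst x) (snd x)) \<longlongrightarrow> t0) (nhds (0, t0)) \<and>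
    (\<exists>r>0. \<forall>\<^sub>F \<epsilon> in at 0. h \<epsilon> holomorphic_on ball t0 r))"

definition inverse_germ :: "complex set \<Rightarrow> (complex \<Rightarrow> complex \<Rightarrow> complex) \<Rightarrow> (complex \<Rightarrow> complex \<Rightarrow> complex) \<Rightarrow> bool" where
  "inverse_germ T h h' \<longleftrightarrow> (\<forall>t0\<in>T. \<forall>\<^sub>F x in nhds (0, t0). h (fst x) (h' (fst x) (snd x)) = snd x)"

lemma tendsto_fst_nhds: "(fst \<longlongrightarrow> a) (nhds (a, b))"
  unfolding nhds_prod by (rule filterlim_fst)

lemma tendsto_snd_nhds: "(snd \<longlongrightarrow> b) (nhds (a, b))"
  unfolding nhds_prod by (rule filterlim_snd)

lemma germ_at_identity_comp_tendsto:
  assumes h: "germ_at_identity T h" and t0: "t0 \<in> T" and p: "(p \<longlongrightarrow> t0) (nhds (0, t0))"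
  shows "((\<lambda>x. h (fst x) (p x)) \<longlongrightarrow> t0) (nhds (0, t0))"
proof -
  have "((\<lambda>x. (fst x, p x)) \<longlongrightarrow> (0, t0)) (nhds (0, t0))"
    by (intro tendsto_Pair p tendsto_fst_nhds)
  moreover have "((\<lambda>x. h (fst x) (snd x)) \<longlongrightarrow> t0) (nhds (0, t0))"
    using h t0 unfolding germ_at_identity_def by blast
  ultimately show ?thesis using filterlim_compose by fastforce
qed

lemma inverse_germ_comp:
  assumes h: "inverse_germ T h h'" and t0: "t0 \<in> T" and p: "(p \<longlongrightarrow> t0) (nhds (0, t0))"
  shows "\<forall>\<^sub>F x in nhds (0, t0). h (fst x) (h' (fst x) (p x)) = p x"
proof -
  have "((\<lambda>x. (fst x, p x)) \<longlongrightarrow> (0, t0)) (nhds (0, t0))"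
    by (intro tendsto_Pair p tendsto_fst_nhds)
  moreover have "\<forall>\<^sub>F x in nhds (0, t0). h (fst x) (h' (fst x) (snd x)) = snd x"
    using h t0 unfolding inverse_germ_def by blast
  ultimately show ?thesis using eventually_compose_filterlim by fastforce
qed

text \<open>With \<kappa> the commutator applied to t, the relation ha(hc \<kappa>) = hc(ha t)
  contains no inverse maps. Writing its increments as difference quotients D1, D2 of the rescaled
  displacements RA, RC gives (\<kappa> - t)(1 + \<epsilon> D1 + \<epsilon>^k D2) = \<epsilon>^(k+1)
  (D2 RA - D1 RC). As k \<ge> 1, the bracket on the left tends to 1.\<close>

lemma displacement_order_commutator:
  fixes ha ha' hc hc' :: "complex \<Rightarrow> complex \<Rightarrow> complex"
  assumes T: "open T"
    and germs: "germ_at_identity T ha" "germ_at_identity T ha'" "germ_at_identity T hc" "germ_at_identity T hc'"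
    and inv: "inverse_germ T ha ha'" "inverse_germ T hc hc'"
    and ord: "displacement_order T ha 1 ma" "displacement_order T hc k mc"
    and hol: "ma holomorphic_on T" "mc holomorphic_on T" and k: "k \<ge> 1"
  shows "displacement_order T (\<lambda>\<epsilon> t. hc' \<epsilon> (ha' \<epsilon> (hc \<epsilon> (ha \<epsilon> t)))) (Suc k)
    (\<lambda>t. ma t * deriv mc t - deriv ma t * mc t)"
  unfolding displacement_order_def
proof
  fix t0 assume t0: "t0 \<in> T"
  let ?F = "punctured_nhds t0"
  define \<kappa> where "\<kappa> = (\<lambda>x. hc' (fst x) (ha' (fst x) (hc (fst x) (ha (fst x) (snd x)))))"
  have id: "(snd \<longlongrightarrow> t0) (nhds (0, t0))" by (rule tendsto_snd_nhds)
  note c = germ_at_identity_comp_tendsto[OF _ t0]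
  have ha: "((\<lambda>x. ha (fst x) (snd x)) \<longlongrightarrow> t0) (nhds (0, t0))" by (rule c[OF germs(1) id])
  note hcha = c[OF germs(3) ha]
  note aca = c[OF germs(2) hcha]
  have \<kappa>: "(\<kappa> \<longlongrightarrow> t0) (nhds (0, t0))" unfolding \<kappa>_def by (rule c[OF germs(4) aca])
  have hc\<kappa>: "((\<lambda>x. hc (fst x) (\<kappa> x)) \<longlongrightarrow> t0) (nhds (0, t0))" by (rule c[OF germs(3) \<kappa>])
  have e1: "\<forall>\<^sub>F x in nhds (0, t0). ha (fst x) (hc (fst x) (\<kappa> x)) = hc (fst x) (ha (fst x) (snd x))"
    using inverse_germ_comp[OF inv(1) t0 hcha] inverse_germ_comp[OF inv(2) t0 aca]
    by eventually_elim (simp add: \<kappa>_def)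
  note mono = filterlim_mono[OF _ order_refl punctured_nhds_le]
  have F: "(snd \<longlongrightarrow> t0) ?F" "((\<lambda>x. ha (fst x) (snd x)) \<longlongrightarrow> t0) ?F" "(\<kappa> \<longlongrightarrow> t0) ?F"
      "((\<lambda>x. hc (fst x) (\<kappa> x)) \<longlongrightarrow> t0) ?F"
    by (rule mono[OF id] mono[OF ha] mono[OF \<kappa>] mono[OF hc\<kappa>])+
  define RA where "RA = (\<lambda>\<epsilon> t. (ha \<epsilon> t - t) / \<epsilon>)"
  define RC where "RC = (\<lambda>\<epsilon> t. (hc \<epsilon> t - t) / \<epsilon> ^ k)"
  have limA: "((\<lambda>x. RA (fst x) (snd x)) \<longlongrightarrow> ma t1) (punctured_nhds t1)" if "t1 \<in> T" for t1
    using ord(1) that by (simp add: displacement_order_def RA_def)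
  have limC: "((\<lambda>x. RC (fst x) (snd x)) \<longlongrightarrow> mc t1) (punctured_nhds t1)" if "t1 \<in> T" for t1
    using ord(2) that by (simp add: displacement_order_def RC_def)
  have slice: "\<exists>r>0. \<forall>\<^sub>F \<epsilon> in at 0. (\<lambda>t. (h \<epsilon> t - t) / \<epsilon> ^ j) holomorphic_on ball t0 r" if h: "germ_at_identity T h" for h j
  proof -
    obtain r where r: "r > 0" "\<forall>\<^sub>F \<epsilon> in at 0. h \<epsilon> holomorphic_on ball t0 r"
      using h t0 unfolding germ_at_identity_def by blast
    have "\<forall>\<^sub>F \<epsilon>::complex in at 0. \<epsilon> \<noteq> 0" by (auto simp: eventually_at_filter)
    with r(2) have "\<forall>\<^sub>F \<epsilon> in at 0. (\<lambda>t. (h \<epsilon> t - t) / \<epsilon> ^ j) holomorphic_on ball t0 r"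
      by eventually_elim (auto intro!: holomorphic_intros)
    with r show ?thesis by blast
  qed
  obtain rA where rA: "rA > 0" "\<forall>\<^sub>F \<epsilon> in at 0. RA \<epsilon> holomorphic_on ball t0 rA"
    using slice[OF germs(1), of 1] by (auto simp: RA_def)
  obtain rC where rC: "rC > 0" "\<forall>\<^sub>F \<epsilon> in at 0. RC \<epsilon> holomorphic_on ball t0 rC"
    using slice[OF germs(3), of k] by (auto simp: RC_def)
  define D1 where "D1 = (\<lambda>x. divided_difference (RA (fst x)) (deriv ma t0) (snd x) (hc (fst x) (\<kappa> x)))"
  define D2 where "D2 = (\<lambda>x. divided_difference (RC (fst x)) (deriv mc t0) (ha (fst x) (snd x)) (\<kappa> x))"
  have D1: "(D1 \<longlongrightarrow> deriv ma t0) ?F"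
    unfolding D1_def by (rule divided_difference_tendsto[OF T t0 hol(1) limA rA filterlim_fst_punctured_nhds F(1,4)])
  have D2: "(D2 \<longlongrightarrow> deriv mc t0) ?F"
    unfolding D2_def by (rule divided_difference_tendsto[OF T t0 hol(2) limC rC filterlim_fst_punctured_nhds F(2,3)])
  have RA: "((\<lambda>x. RA (fst x) (snd x)) \<longlongrightarrow> ma t0) ?F" by (rule limA[OF t0])
  have "filterlim (\<lambda>x. (fst x, \<kappa> x)) ?F ?F"
    by (intro filterlim_Pair filterlim_fst_punctured_nhds F)
  from filterlim_compose[OF limC[OF t0] this] have RC: "((\<lambda>x. RC (fst x) (\<kappa> x)) \<longlongrightarrow> mc t0) ?F" by simp
  have fst0: "(fst \<longlongrightarrow> (0::complex)) ?F"
    using filterlim_fst_punctured_nhds by (rule filterlim_mono) (auto simp: at_within_def)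
  have den: "((\<lambda>x. 1 + fst x * D1 x + fst x ^ k * D2 x) \<longlongrightarrow> 1 + 0 * deriv ma t0 + 0 ^ k * deriv mc t0) ?F"
    by (intro tendsto_intros D1 D2 fst0)
  have den1: "((\<lambda>x. 1 + fst x * D1 x + fst x ^ k * D2 x) \<longlongrightarrow> 1) ?F"
    using den k by (cases k) auto
  have quot: "((\<lambda>x. (D2 x * RA (fst x) (snd x) - D1 x * RC (fst x) (\<kappa> x)) / (1 + fst x * D1 x + fst x ^ k * D2 x)) \<longlongrightarrow>
      (deriv mc t0 * ma t0 - deriv ma t0 * mc t0) / 1) ?F"
    by (intro tendsto_intros D1 D2 RA RC den1) auto
  have ne: "\<forall>\<^sub>F x in ?F. 1 + fst x * D1 x + fst x ^ k * D2 x \<noteq> 0"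
    using den1 by (rule tendsto_imp_eventually_ne) simp
  have ne0: "\<forall>\<^sub>F x in ?F. fst x \<noteq> 0"
    using eventually_compose_filterlim[OF _ filterlim_fst_punctured_nhds, of "\<lambda>\<epsilon>. \<epsilon> \<noteq> 0"]
    by (simp add: eventually_at_filter)
  have e1': "\<forall>\<^sub>F x in ?F. ha (fst x) (hc (fst x) (\<kappa> x)) = hc (fst x) (ha (fst x) (snd x))"
    by (rule filter_leD[OF punctured_nhds_le e1])
  have "\<forall>\<^sub>F x in ?F. (D2 x * RA (fst x) (snd x) - D1 x * RC (fst x) (\<kappa> x)) / (1 + fst x * D1 x + fst x ^ k * D2 x) =
      (\<kappa> x - snd x) / fst x ^ Suc k"
    using ne ne0 e1'
  proof eventually_elim
    case (elim x)
    define e t \<kappa>x where "e = fst x" and "t = snd x" and "\<kappa>x = \<kappa> x"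
    have e0: "e \<noteq> 0" using elim by (simp add: e_def)
    have hA: "ha e y = y + e * RA e y" for y using e0 by (simp add: RA_def)
    have hC: "hc e y = y + e ^ k * RC e y" for y using e0 by (simp add: RC_def)
    have d1: "RA e t - RA e (hc e \<kappa>x) = D1 x * (t - hc e \<kappa>x)"
      unfolding D1_def e_def t_def \<kappa>x_def by (rule divided_difference_eq)
    have d2: "RC e (ha e t) - RC e \<kappa>x = D2 x * (ha e t - \<kappa>x)"
      unfolding D2_def e_def t_def \<kappa>x_def by (rule divided_difference_eq)
    have "hc e \<kappa>x + e * RA e (hc e \<kappa>x) = ha e t + e ^ k * RC e (ha e t)"
      using elim(3) hA[of "hc e \<kappa>x"] hC[of "ha e t"] by (simp add: e_def t_def \<kappa>x_def)
    hence "\<kappa>x - t = e * (RA e t - RA e (hc e \<kappa>x)) + e ^ k * (RC e (ha e t) - RC e \<kappa>x)"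
      using hC[of \<kappa>x] hA[of t] by (simp add: algebra_simps)
    also have "\<dots> = e * (D1 x * (t - \<kappa>x - e ^ k * RC e \<kappa>x)) + e ^ k * (D2 x * (t + e * RA e t - \<kappa>x))"
      unfolding d1 d2 using hC[of \<kappa>x] hA[of t] by simp
    finally have "(\<kappa>x - t) * (1 + e * D1 x + e ^ k * D2 x) = e ^ Suc k * (D2 x * RA e t - D1 x * RC e \<kappa>x)"
      by (simp add: algebra_simps)
    thus ?case
      using elim(1) e0 unfolding e_def[symmetric] t_def[symmetric] \<kappa>x_def[symmetric]
      by (simp add: divide_eq_eq eq_divide_eq mult.commute)
  qed
  from Lim_transform_eventually[OF quot this]
  show "((\<lambda>x. (hc' (fst x) (ha' (fst x) (hc (fst x) (ha (fst x) (snd x)))) - snd x) / fst x ^ Suc k) \<longlongrightarrow>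
      ma t0 * deriv mc t0 - deriv ma t0 * mc t0) ?F"
    by (simp add: \<kappa>_def mult.commute)
qed

section \<open>Holonomy of families of loops\<close>

text \<open>The holonomy relation with its witnesses exposed, together with holomorphy of
  \<open>h\<close>. Joins of loops can then be formed without choosing the lifts again.\<close>

definition holonomy_data ::
    "bipoly \<Rightarrow> one_form \<Rightarrow> complex set \<Rightarrow> (complex \<Rightarrow> complex \<times> complex) \<Rightarrow> (complex \<times> complex) set \<Rightarrow>
      (complex \<Rightarrow> complex \<Rightarrow> real \<Rightarrow> complex \<times> complex) \<Rightarrow> (complex \<Rightarrow> real \<Rightarrow> complex \<times> complex) \<Rightarrow>
      (complex \<Rightarrow> complex \<Rightarrow> complex) \<Rightarrow> bool" where
  "holonomy_data f \<omega> T \<sigma> W \<gamma> \<delta> h \<longleftrightarrow> open W \<and> {0} \<times> T \<subseteq> W \<and>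
    continuous_on (W \<times> {0..1}) (\<lambda>((\<epsilon>, t), s). \<gamma> \<epsilon> t s) \<and>
    (\<forall>t\<in>T. \<forall>s\<in>{0..1}. \<gamma> 0 t s = \<delta> t s) \<and>
    (\<forall>t\<in>T. pathfinish (\<delta> t) = \<sigma> t) \<and>
    (\<forall>(\<epsilon>, t)\<in>W. t \<in> T \<and> h \<epsilon> t \<in> T \<and> leaf_path f \<omega> \<epsilon> (\<gamma> \<epsilon> t) \<and>
        pathstart (\<gamma> \<epsilon> t) = \<sigma> t \<and> pathfinish (\<gamma> \<epsilon> t) = \<sigma> (h \<epsilon> t)) \<and>
    curve_holomorphic W h"

lemma holonomy_data_imp_holonomy_map:
  "holonomy_data f \<omega> T \<sigma> W \<gamma> \<delta> h \<Longrightarrow> holonomy_map f \<omega> T \<sigma> \<delta> h"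
  unfolding holonomy_data_def holonomy_map_def by blast

lemma continuous_on_bieval: "continuous_on A (bieval p)"
proof -
  have "bieval p z = (\<Sum>j\<le>degree p. poly (coeff p j) (fst z) * snd z ^ j)" for z
    by (simp add: bieval_def poly_altdef[of p] poly_sum poly_power poly_mult)
  thus ?thesis by (simp add: continuous_intros)
qed

locale transversal_setup =
  fixes f :: bipoly and \<omega> :: one_form and T :: "complex set" and \<sigma> :: "complex \<Rightarrow> complex \<times> complex"
  assumes T_open: "open T" and section_eq: "t \<in> T \<Longrightarrow> bieval f (\<sigma> t) = t"
begin

lemma holonomy_at_0:
  assumes hd: "holonomy_data f \<omega> T \<sigma> W \<gamma> \<delta> h" and t: "t \<in> T"
  shows "h 0 t = t"
proof -
  have W: "(0, t) \<in> W" using hd t unfolding holonomy_data_def by blast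
  hence "h 0 t \<in> T" "pathfinish (\<gamma> 0 t) = \<sigma> (h 0 t)"
    using hd unfolding holonomy_data_def by blast+
  moreover have "pathfinish (\<gamma> 0 t) = \<sigma> t"
    using hd t unfolding holonomy_data_def pathfinish_def by simp
  ultimately show ?thesis using section_eq t by metis
qed

text \<open>\<open>h\<close> is recovered as the value of \<open>f\<close> at the endpoint of the
  lifted path, so it inherits continuity from \<gamma>.\<close>

lemma continuous_on_holonomy:
  assumes hd: "holonomy_data f \<omega> T \<sigma> W \<gamma> \<delta> h"
  shows "continuous_on W (\<lambda>x. h (fst x) (snd x))"
proof -
  have c: "continuous_on (W \<times> {0..1}) (\<lambda>((\<epsilon>, t), s). \<gamma> \<epsilon> t s)"
    using hd unfolding holonomy_data_def by blast
  have "continuous_on W ((\<lambda>((\<epsilon>, t), s). \<gamma> \<epsilon> t s) \<circ> (\<lambda>x. (x, 1::real)))"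
    by (intro continuous_on_compose continuous_on_subset[OF c] continuous_intros) auto
  hence "continuous_on W (bieval f \<circ> ((\<lambda>((\<epsilon>, t), s). \<gamma> \<epsilon> t s) \<circ> (\<lambda>x. (x, 1::real))))"
    by (rule continuous_on_compose) (rule continuous_on_bieval)
  moreover have "(bieval f \<circ> ((\<lambda>((\<epsilon>, t), s). \<gamma> \<epsilon> t s) \<circ> (\<lambda>x. (x, 1::real)))) x = h (fst x) (snd x)" if "x \<in> W" for x
  proof -
    obtain \<epsilon> t where x: "x = (\<epsilon>, t)" by (cases x)
    hence "h \<epsilon> t \<in> T" "pathfinish (\<gamma> \<epsilon> t) = \<sigma> (h \<epsilon> t)" using hd that unfolding holonomy_data_def by blast+
    thus ?thesis using section_eq by (simp add: x pathfinish_def)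
  qed
  ultimately show ?thesis by (rule continuous_on_eq)
qed

lemma holonomy_germ_at_identity:
  assumes hd: "holonomy_data f \<omega> T \<sigma> W \<gamma> \<delta> h"
  shows "germ_at_identity T h"
  unfolding germ_at_identity_def
proof (intro ballI conjI)
  fix t0 assume t0: "t0 \<in> T"
  have W: "open W" "(0, t0) \<in> W" using hd t0 unfolding holonomy_data_def by blast+
  have "isCont (\<lambda>x. h (fst x) (snd x)) (0, t0)"
    using continuous_on_holonomy[OF hd] W by (simp add: continuous_on_eq_continuous_at)
  hence "((\<lambda>x. h (fst x) (snd x)) \<longlongrightarrow> (\<lambda>x. h (fst x) (snd x)) (0, t0)) (nhds (0, t0))"
    by (rule tendsto_at_iff_tendsto_nhds[THEN iffD1, OF iffD1[OF isCont_def]])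
  hence "((\<lambda>x. h (fst x) (snd x)) \<longlongrightarrow> h 0 t0) (nhds (0, t0))" by simp
  thus "((\<lambda>x. h (fst x) (snd x)) \<longlongrightarrow> t0) (nhds (0, t0))"
    by (simp add: holonomy_at_0[OF hd t0])
  obtain A B where AB: "open A" "open B" "(0, t0) \<in> A \<times> B" "A \<times> B \<subseteq> W"
    using open_prod_elim[OF W] by metis
  obtain r where r: "r > 0" "ball t0 r \<subseteq> B" using AB openE by blast
  have "h \<epsilon> holomorphic_on ball t0 r" if "\<epsilon> \<in> A" for \<epsilon>
  proof -
    have "\<forall>\<zeta>\<in>ball t0 r. (\<epsilon>, \<zeta>) \<in> W" using that AB r by blast
    moreover have "curve_holomorphic W h" using hd unfolding holonomy_data_def by blast
    ultimately have "(\<lambda>\<zeta>. h ((\<lambda>_. \<epsilon>) \<zeta>) ((\<lambda>\<zeta>. \<zeta>) \<zeta>)) holomorphic_on ball t0 r"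
      by (intro curve_holomorphicD[OF _ open_ball holomorphic_on_const holomorphic_on_ident]) auto
    thus ?thesis by simp
  qed
  moreover have "\<forall>\<^sub>F \<epsilon> in at 0. \<epsilon> \<in> A" using AB by (intro eventually_at_in_open') auto
  ultimately have "\<forall>\<^sub>F \<epsilon> in at 0. h \<epsilon> holomorphic_on ball t0 r" by (auto elim: eventually_mono)
  thus "\<exists>r>0. \<forall>\<^sub>F \<epsilon> in at 0. h \<epsilon> holomorphic_on ball t0 r" using r by blast
qed

text \<open>On each half the velocity is doubled, which is harmless because the leaf equation is
  linear in the velocity.\<close>

lemma leaf_path_join:
  assumes p: "leaf_path f \<omega> \<epsilon> p" and q: "leaf_path f \<omega> \<epsilon> q" and pq: "pathfinish p = pathstart q"
  shows "leaf_path f \<omega> \<epsilon> (p +++ q)"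
  unfolding leaf_path_def
proof (intro conjI ballI allI impI)
  show "valid_path (p +++ q)" using p q pq unfolding leaf_path_def by (simp add: valid_path_join)
  let ?L = "\<lambda>z v. apply_form (differential f) z v + \<epsilon> * apply_form \<omega> z v"
  have lin: "?L z v = 0" if "?L z (v /\<^sub>R 2) = 0" for z v
  proof -
    have "?L z v = 2 * ?L z (v /\<^sub>R 2)" by (simp add: apply_form_def scaleR_conv_of_real algebra_simps)
    thus ?thesis unfolding that by simp
  qed
  fix s :: real and v assume s: "s \<in> {0..1}" and v: "(p +++ q has_vector_derivative v) (at s within {0..1})"
  show "?L ((p +++ q) s) v = 0"
  proof (cases "s \<le> 1 / 2")
    case True
    have "((\<lambda>x. (p +++ q) (x / 2)) has_vector_derivative v /\<^sub>R 2) (at (2 * s) within {0..1})"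
    proof -
      have "((p +++ q) \<circ> (\<lambda>x. x / 2) has_vector_derivative (1 / 2) *\<^sub>R v) (at (2 * s) within {0..1})"
      proof (rule vector_diff_chain_within)
        show "((\<lambda>x. x / 2) has_vector_derivative 1 / 2) (at (2 * s) within {0..1})"
          by (auto intro!: derivative_eq_intros)
        show "(p +++ q has_vector_derivative v) (at (2 * s / 2) within (\<lambda>x. x / 2) ` {0..1})"
          using v by (auto intro: has_vector_derivative_within_subset)
      qed
      thus ?thesis by (simp add: o_def)
    qed
    hence "(p has_vector_derivative v /\<^sub>R 2) (at (2 * s) within {0..1})"
      by (rule has_vector_derivative_transform[rotated 2]) (use True s in \<open>auto simp: joinpaths_def\<close>)
    moreover have "2 * s \<in> {0..1}" using True s by simp
    ultimately have "?L (p (2 * s)) (v /\<^sub>R 2) = 0" using p unfolding leaf_path_def by blast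
    thus ?thesis using True lin by (simp add: joinpaths_def)
  next
    case False
    have "((\<lambda>x. (p +++ q) ((1 + x) / 2)) has_vector_derivative v /\<^sub>R 2) (at (2 * s - 1) within {0..1})"
    proof -
      have "((p +++ q) \<circ> (\<lambda>x. (1 + x) / 2) has_vector_derivative (1 / 2) *\<^sub>R v) (at (2 * s - 1) within {0..1})"
      proof (rule vector_diff_chain_within)
        show "((\<lambda>x. (1 + x) / 2) has_vector_derivative 1 / 2) (at (2 * s - 1) within {0..1})"
          by (auto intro!: derivative_eq_intros)
        show "(p +++ q has_vector_derivative v) (at ((1 + (2 * s - 1)) / 2) within (\<lambda>x. (1 + x) / 2) ` {0..1})"
          using v by (auto intro: has_vector_derivative_within_subset)
      qed
      thus ?thesis by (simp add: o_def)
    qed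
    hence "(q has_vector_derivative v /\<^sub>R 2) (at (2 * s - 1) within {0..1})"
    proof (rule has_vector_derivative_transform[rotated 2, where S = "{0..1}"])
      fix x :: real assume x: "x \<in> {0..1}"
      show "q x = (p +++ q) ((1 + x) / 2)"
        using pq x by (cases "x = 0") (auto simp: joinpaths_def pathfinish_def pathstart_def add_divide_distrib)
    qed (use False s in auto)
    moreover have "2 * s - 1 \<in> {0..1}" using False s by simp
    ultimately have "?L (q (2 * s - 1)) (v /\<^sub>R 2) = 0" using q unfolding leaf_path_def by blast
    thus ?thesis using False lin by (simp add: joinpaths_def)
  qed
qed

text \<open>The second lift starts where the first one ends, so the holonomies compose in path
  order; the domain is cut down to the points at which the second transport is defined.\<close>

lemma holonomy_data_join:
  assumes hd1: "holonomy_data f \<omega> T \<sigma> W1 \<gamma>1 \<delta>1 h1" and hd2: "holonomy_data f \<omega> T \<sigma> W2 \<gamma>2 \<delta>2 h2"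
  shows "holonomy_data f \<omega> T \<sigma> {x\<in>W1. (fst x, h1 (fst x) (snd x)) \<in> W2}
    (\<lambda>\<epsilon> t. \<gamma>1 \<epsilon> t +++ \<gamma>2 \<epsilon> (h1 \<epsilon> t)) (\<lambda>t. \<delta>1 t +++ \<delta>2 t) (\<lambda>\<epsilon> t. h2 \<epsilon> (h1 \<epsilon> t))"
proof -
  let ?W = "{x\<in>W1. (fst x, h1 (fst x) (snd x)) \<in> W2}"
  note c = continuous_on_holonomy[OF hd1]
  have open12: "open W1" "open W2" using hd1 hd2 unfolding holonomy_data_def by blast+
  have "continuous_on W1 (\<lambda>x. (fst x, h1 (fst x) (snd x)))" by (intro continuous_intros c)
  hence "open (W1 \<inter> (\<lambda>x. (fst x, h1 (fst x) (snd x))) -` W2)"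
    using open12 continuous_open_preimage by blast
  moreover have "W1 \<inter> (\<lambda>x. (fst x, h1 (fst x) (snd x))) -` W2 = ?W" by auto
  ultimately have openW: "open ?W" by simp
  have sub0: "{0} \<times> T \<subseteq> ?W"
    using hd1 hd2 holonomy_at_0[OF hd1] unfolding holonomy_data_def by auto
  have d1: "t \<in> T" "h1 \<epsilon> t \<in> T" "leaf_path f \<omega> \<epsilon> (\<gamma>1 \<epsilon> t)" "pathstart (\<gamma>1 \<epsilon> t) = \<sigma> t" "pathfinish (\<gamma>1 \<epsilon> t) = \<sigma> (h1 \<epsilon> t)"
    if "(\<epsilon>, t) \<in> W1" for \<epsilon> t using hd1 that unfolding holonomy_data_def by blast+
  have d2: "h2 \<epsilon> t \<in> T" "leaf_path f \<omega> \<epsilon> (\<gamma>2 \<epsilon> t)" "pathstart (\<gamma>2 \<epsilon> t) = \<sigma> t" "pathfinish (\<gamma>2 \<epsilon> t) = \<sigma> (h2 \<epsilon> t)"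
    if "(\<epsilon>, t) \<in> W2" for \<epsilon> t using hd2 that unfolding holonomy_data_def by blast+
  have g1: "continuous_on (W1 \<times> {0..1}) (\<lambda>((\<epsilon>, t), s). \<gamma>1 \<epsilon> t s)"
    and g2: "continuous_on (W2 \<times> {0..1}) (\<lambda>((\<epsilon>, t), s). \<gamma>2 \<epsilon> t s)"
    using hd1 hd2 unfolding holonomy_data_def by blast+
  have cont: "continuous_on (?W \<times> {0..1::real}) (\<lambda>y. if snd y \<le> 1 / 2 then \<gamma>1 (fst (fst y)) (snd (fst y)) (2 * snd y)
      else \<gamma>2 (fst (fst y)) (h1 (fst (fst y)) (snd (fst y))) (2 * snd y - 1))"
  proof (rule continuous_on_cases_le)
    have "continuous_on {t \<in> ?W \<times> {0..1}. snd t \<le> (1::real) / 2} ((\<lambda>((\<epsilon>, t), s). \<gamma>1 \<epsilon> t s) \<circ> (\<lambda>y. (fst y, 2 * snd y)))"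
      by (intro continuous_on_compose continuous_on_subset[OF g1] continuous_intros) auto
    thus "continuous_on {t \<in> ?W \<times> {0..1}. snd t \<le> (1::real) / 2} (\<lambda>y. \<gamma>1 (fst (fst y)) (snd (fst y)) (2 * snd y))"
      by (simp add: o_def case_prod_unfold)
    have "continuous_on {t \<in> ?W \<times> {0..1}. (1::real) / 2 \<le> snd t}
        ((\<lambda>((\<epsilon>, t), s). \<gamma>2 \<epsilon> t s) \<circ> (\<lambda>y. ((fst (fst y), h1 (fst (fst y)) (snd (fst y))), 2 * snd y - 1)))"
      by (intro continuous_on_compose continuous_on_subset[OF g2] continuous_intros continuous_on_compose2[OF c]) auto
    thus "continuous_on {t \<in> ?W \<times> {0..1}. (1::real) / 2 \<le> snd t}
        (\<lambda>y. \<gamma>2 (fst (fst y)) (h1 (fst (fst y)) (snd (fst y))) (2 * snd y - 1))"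
      by (simp add: o_def case_prod_unfold)
    show "continuous_on (?W \<times> {0..1::real}) snd" by (intro continuous_intros)
    fix y assume y: "y \<in> ?W \<times> {0..1::real}" "snd y = 1 / 2"
    obtain \<epsilon> t s where yy: "y = ((\<epsilon>, t), s)" by (metis surj_pair)
    have s: "s = 1 / 2" and W: "(\<epsilon>, t) \<in> W1" "(\<epsilon>, h1 \<epsilon> t) \<in> W2" using y by (auto simp: yy)
    show "\<gamma>1 (fst (fst y)) (snd (fst y)) (2 * snd y) = \<gamma>2 (fst (fst y)) (h1 (fst (fst y)) (snd (fst y))) (2 * snd y - 1)"
      using d1(5)[OF W(1)] d2(3)[OF W(2)] by (simp add: yy s pathfinish_def pathstart_def)
  qed
  show ?thesis
    unfolding holonomy_data_def
  proof (intro conjI)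
    show "continuous_on (?W \<times> {0..1}) (\<lambda>((\<epsilon>, t), s). (\<gamma>1 \<epsilon> t +++ \<gamma>2 \<epsilon> (h1 \<epsilon> t)) s)"
      using cont by (simp add: joinpaths_def case_prod_unfold)
    show "\<forall>t\<in>T. \<forall>s\<in>{0..1}. (\<gamma>1 0 t +++ \<gamma>2 0 (h1 0 t)) s = (\<delta>1 t +++ \<delta>2 t) s"
      using hd1 hd2 holonomy_at_0[OF hd1] unfolding holonomy_data_def by (auto simp: joinpaths_def)
    show "\<forall>t\<in>T. pathfinish (\<delta>1 t +++ \<delta>2 t) = \<sigma> t"
      using hd2 unfolding holonomy_data_def by simp
    show "\<forall>(\<epsilon>, t)\<in>?W. t \<in> T \<and> h2 \<epsilon> (h1 \<epsilon> t) \<in> T \<and> leaf_path f \<omega> \<epsilon> (\<gamma>1 \<epsilon> t +++ \<gamma>2 \<epsilon> (h1 \<epsilon> t)) \<and>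
        pathstart (\<gamma>1 \<epsilon> t +++ \<gamma>2 \<epsilon> (h1 \<epsilon> t)) = \<sigma> t \<and>
        pathfinish (\<gamma>1 \<epsilon> t +++ \<gamma>2 \<epsilon> (h1 \<epsilon> t)) = \<sigma> (h2 \<epsilon> (h1 \<epsilon> t))"
      using d1 d2 by (auto intro!: leaf_path_join)
    show "curve_holomorphic ?W (\<lambda>\<epsilon> t. h2 \<epsilon> (h1 \<epsilon> t))"
      unfolding curve_holomorphic_def
    proof (intro allI impI)
      fix D e \<tau> assume D: "open D" "e holomorphic_on D" "\<tau> holomorphic_on D" "\<forall>\<zeta>\<in>D. (e \<zeta>, \<tau> \<zeta>) \<in> ?W"
      have h1: "(\<lambda>\<zeta>. h1 (e \<zeta>) (\<tau> \<zeta>)) holomorphic_on D"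
      proof (rule curve_holomorphicD[OF _ D(1-3)])
        show "curve_holomorphic W1 h1" using hd1 unfolding holonomy_data_def by blast
      qed (use D(4) in auto)
      have W2: "(e \<zeta>, h1 (e \<zeta>) (\<tau> \<zeta>)) \<in> W2" if "\<zeta> \<in> D" for \<zeta> using D(4) that by auto
      have ch: "curve_holomorphic W2 h2" using hd2 unfolding holonomy_data_def by blast
      show "(\<lambda>\<zeta>. h2 (e \<zeta>) (h1 (e \<zeta>) (\<tau> \<zeta>))) holomorphic_on D"
        by (rule curve_holomorphicD[OF ch D(1,2) h1 W2])
    qed
  qed (use openW sub0 in auto)
qed

text \<open>For fixed t the quotient (h \<epsilon> t - t) / \<epsilon>^k has a removable singularity
  at 0 with value m t. Its Taylor series times \<epsilon>^k is the required expansion.\<close>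

lemma Poincare_Pontryagin_of_displacement_order:
  assumes hd: "holonomy_data f \<omega> T \<sigma> W \<gamma> \<delta> h" and ord: "displacement_order T h k m" and k: "k \<ge> 1"
  obtains mk where "Poincare_Pontryagin f \<omega> T \<sigma> \<delta> k mk" "\<And>t. t \<in> T \<Longrightarrow> mk t = m t"
proof -
  have "\<exists>b. b 0 = m t \<and> (\<forall>\<^sub>F \<epsilon> in nhds 0. (\<lambda>i. b i * \<epsilon> ^ i * \<epsilon> ^ k) sums (h \<epsilon> t - t))" if t: "t \<in> T" for t
  proof -
    have W: "open W" "(0, t) \<in> W" using hd t unfolding holonomy_data_def by blast+
    obtain A B where AB: "open A" "open B" "(0, t) \<in> A \<times> B" "A \<times> B \<subseteq> W"
      using open_prod_elim[OF W] by metis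
    obtain r where r: "r > 0" "ball 0 r \<subseteq> A" using AB openE by blast
    have hol: "(\<lambda>\<epsilon>. h \<epsilon> t) holomorphic_on ball 0 r"
    proof -
      have "\<forall>\<zeta>\<in>ball 0 r. (\<zeta>, t) \<in> W" using AB r by blast
      moreover have "curve_holomorphic W h" using hd unfolding holonomy_data_def by blast
      ultimately have "(\<lambda>\<zeta>. h ((\<lambda>\<zeta>. \<zeta>) \<zeta>) ((\<lambda>_. t) \<zeta>)) holomorphic_on ball 0 r"
        by (intro curve_holomorphicD[OF _ open_ball holomorphic_on_ident holomorphic_on_const]) auto
      thus ?thesis by simp
    qed
    have "filterlim (\<lambda>\<epsilon>. (\<epsilon>, t)) (punctured_nhds t) (at 0)"
      by (intro filterlim_Pair filterlim_ident tendsto_const)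
    hence lim: "((\<lambda>\<epsilon>. (h \<epsilon> t - t) / \<epsilon> ^ k) \<longlongrightarrow> m t) (at 0)"
      using ord t filterlim_compose[of "\<lambda>x. (h (fst x) (snd x) - snd x) / fst x ^ k" "nhds (m t)" "punctured_nhds t"]
      unfolding displacement_order_def by fastforce
    define g where "g = (\<lambda>\<epsilon>. if \<epsilon> = 0 then m t else (h \<epsilon> t - t) / \<epsilon> ^ k)"
    have "g holomorphic_on ball 0 r"
    proof (rule no_isolated_singularity'[where K = "{0}"])
      fix z :: complex assume "z \<in> {0}"
      hence z: "z = 0" by simp
      have "(g \<longlongrightarrow> m t) (at 0)"
        by (rule Lim_transform_eventually[OF lim]) (auto simp: g_def eventually_at_filter)
      hence "(g \<longlongrightarrow> m t) (at 0 within ball 0 r)" by (rule tendsto_within_subset) simp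
      moreover have "g 0 = m t" by (simp add: g_def)
      ultimately show "(g \<longlongrightarrow> g z) (at z within ball 0 r)" unfolding z by simp
    next
      have "(\<lambda>\<epsilon>. (h \<epsilon> t - t) / \<epsilon> ^ k) holomorphic_on ball 0 r - {0}"
        by (intro holomorphic_intros holomorphic_on_subset[OF hol]) auto
      thus "g holomorphic_on ball 0 r - {0}" by (rule holomorphic_transform) (simp add: g_def)
    qed auto
    hence ps: "(\<lambda>i. (deriv ^^ i) g 0 / fact i * (\<epsilon> - 0) ^ i) sums g \<epsilon>" if "\<epsilon> \<in> ball 0 r" for \<epsilon>
      using that by (rule holomorphic_power_series)
    have "(\<lambda>i. (deriv ^^ i) g 0 / fact i * \<epsilon> ^ i * \<epsilon> ^ k) sums (h \<epsilon> t - t)" if "\<epsilon> \<in> ball 0 r" for \<epsilon>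
    proof -
      have "g \<epsilon> * \<epsilon> ^ k = h \<epsilon> t - t"
        using k holonomy_at_0[OF hd t] by (auto simp: g_def)
      thus ?thesis using sums_mult2[OF ps[OF that], of "\<epsilon> ^ k"] by simp
    qed
    moreover have "\<forall>\<^sub>F \<epsilon> in nhds 0. \<epsilon> \<in> ball (0::complex) r" using r by (intro eventually_nhds_in_open) auto
    ultimately have "\<forall>\<^sub>F \<epsilon> in nhds 0. (\<lambda>i. (deriv ^^ i) g 0 / fact i * \<epsilon> ^ i * \<epsilon> ^ k) sums (h \<epsilon> t - t)"
      by (auto elim: eventually_mono)
    thus ?thesis by (intro exI[of _ "\<lambda>i. (deriv ^^ i) g 0 / fact i"]) (simp add: g_def)
  qed
  hence "\<forall>t\<in>T. \<exists>b. b 0 = m t \<and> (\<forall>\<^sub>F \<epsilon> in nhds 0. (\<lambda>i. b i * \<epsilon> ^ i * \<epsilon> ^ k) sums (h \<epsilon> t - t))" by (intro ballI)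
  from bchoice[OF this] obtain b where b: "\<forall>t\<in>T. b t 0 = m t \<and>
      (\<forall>\<^sub>F \<epsilon> in nhds 0. (\<lambda>i. b t i * \<epsilon> ^ i * \<epsilon> ^ k) sums (h \<epsilon> t - t))" ..
  \<comment> \<open>The Taylor series of the quotient starts at index k. As the expansion is
    numbered from 1, it is shifted by k - 1 places only.\<close>
  define M where "M = (\<lambda>i t. if i < k then 0 else b t (i - k))"
  have "\<forall>t\<in>T. \<forall>\<^sub>F \<epsilon> in nhds 0. (\<lambda>i. \<epsilon> ^ Suc i * M (Suc i) t) sums (h \<epsilon> t - t)"
  proof
    fix t assume "t \<in> T"
    with b have "\<forall>\<^sub>F \<epsilon> in nhds 0. (\<lambda>i. b t i * \<epsilon> ^ i * \<epsilon> ^ k) sums (h \<epsilon> t - t)" by blast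
    thus "\<forall>\<^sub>F \<epsilon> in nhds 0. (\<lambda>i. \<epsilon> ^ Suc i * M (Suc i) t) sums (h \<epsilon> t - t)"
    proof eventually_elim
      case (elim \<epsilon>)
      have "(\<lambda>i. \<epsilon> ^ Suc (i + (k - 1)) * M (Suc (i + (k - 1))) t) = (\<lambda>i. b t i * \<epsilon> ^ i * \<epsilon> ^ k)"
        using k by (auto simp: M_def fun_eq_iff power_add Suc_diff_le simp flip: power_Suc)
      with elim have "(\<lambda>i. \<epsilon> ^ Suc (i + (k - 1)) * M (Suc (i + (k - 1))) t) sums (h \<epsilon> t - t)" by simp
      thus ?case
        by (subst (asm) sums_zero_iff_shift[where f = "\<lambda>i. \<epsilon> ^ Suc i * M (Suc i) t" and n = "k - 1"]) (use k in \<open>auto simp: M_def\<close>)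
    qed
  qed
  hence "Poincare_Pontryagin f \<omega> T \<sigma> \<delta> k (M k)"
    unfolding Poincare_Pontryagin_def using holonomy_data_imp_holonomy_map[OF hd] by blast
  moreover have "M k t = m t" if "t \<in> T" for t using b that by (simp add: M_def)
  ultimately show ?thesis using that by blast
qed

end

section \<open>Local primitives on regular fibers\<close>

lemma bieval_pCons: "bieval (pCons a p) z = poly a (fst z) + snd z * bieval p z"
  by (simp add: bieval_def)

lemma bieval_0 [simp]: "bieval 0 z = 0"
  by (simp add: bieval_def)

lemma bieval_add: "bieval (p + q) z = bieval p z + bieval q z"
  by (simp add: bieval_def)

lemma map_poly_pderiv_pCons: "map_poly pderiv (pCons a p) = pCons (pderiv a) (map_poly pderiv p)"
  for p :: bipoly
  by (rule poly_eqI) (simp add: coeff_map_poly coeff_pCons split: nat.split)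

lemma bieval_has_derivative: "(bieval p has_derivative apply_form (differential p) z) (at z within A)"
proof (induction p)
  case 0
  have "bieval (0 :: bipoly) = (\<lambda>z. 0)" by auto
  thus ?case by (simp add: apply_form_def differential_def)
next
  case (pCons a p)
  have poly_fst: "((\<lambda>z. poly a (fst z)) has_derivative (\<lambda>v. poly (pderiv a) (fst z) * fst v)) (at z within A)"
  proof -
    have "(poly a has_derivative (\<lambda>v. poly (pderiv a) (fst z) * v)) (at (fst z) within fst ` A)"
      using poly_DERIV[of a "fst z"] by (auto simp: has_field_derivative_def intro: has_derivative_at_withinI)
    from has_derivative_in_compose[OF has_derivative_fst[OF has_derivative_ident] this]
    show ?thesis by simp
  qed
  have "((\<lambda>z. poly a (fst z) + snd z * bieval p z) has_derivative
      (\<lambda>v. poly (pderiv a) (fst z) * fst v + (snd z * apply_form (differential p) z v + snd v * bieval p z))) (at z within A)"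
    by (intro has_derivative_add poly_fst has_derivative_mult pCons.IH has_derivative_snd has_derivative_ident)
  moreover have "poly (pderiv a) (fst z) * fst v + (snd z * apply_form (differential p) z v + snd v * bieval p z) =
      apply_form (differential (pCons a p)) z v" for v
    by (simp add: apply_form_def differential_def map_poly_pderiv_pCons pderiv_pCons bieval_pCons bieval_add algebra_simps)
  ultimately show ?case by (simp add: bieval_pCons[abs_def])
qed

lemma continuous_on_bieval' [continuous_intros]: "continuous_on A g \<Longrightarrow> continuous_on A (\<lambda>x. bieval p (g x))"
  by (rule continuous_on_compose2[of UNIV "bieval p"])
     (auto simp: continuous_on_eq_continuous_within intro: has_derivative_continuous[OF bieval_has_derivative])

lemma holomorphic_on_bieval [holomorphic_intros]:
  assumes "a holomorphic_on D" "b holomorphic_on D"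
  shows "(\<lambda>\<zeta>. bieval p (a \<zeta>, b \<zeta>)) holomorphic_on D"
proof (induction p)
  case (pCons c p)
  have "(\<lambda>\<zeta>. poly c (a \<zeta>)) holomorphic_on D"
    by (induction c) (auto intro!: holomorphic_intros assms)
  with pCons assms show ?case by (simp add: bieval_pCons holomorphic_intros)
qed simp

text \<open>The curve is locally a graph over one of the two coordinates: \<pi> is that coordinate
  and (a, b) is the inverse parametrization.\<close>

definition holomorphic_chart ::
    "(complex \<times> complex) set \<Rightarrow> (complex \<times> complex) set \<Rightarrow> complex set \<Rightarrow> (complex \<Rightarrow> complex) \<Rightarrow> (complex \<Rightarrow> complex) \<Rightarrow>
      (complex \<times> complex \<Rightarrow> complex) \<Rightarrow> bool" where
  "holomorphic_chart S U D a b \<pi> \<longleftrightarrow> open U \<and> open D \<and> a holomorphic_on D \<and> b holomorphic_on D \<and>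
    (\<pi> = fst \<or> \<pi> = snd) \<and> (\<forall>\<zeta>\<in>D. (a \<zeta>, b \<zeta>) \<in> S \<inter> U \<and> \<pi> (a \<zeta>, b \<zeta>) = \<zeta>) \<and>
    (\<forall>z\<in>S \<inter> U. \<pi> z \<in> D \<and> (a (\<pi> z), b (\<pi> z)) = z)"

text \<open>The inverse function theorem is applied to (x, y) \<mapsto> (x, F(x, y)). It yields only
  a real derivative of \<open>Y\<close>; complex linearity comes from differentiating F(x, Y x) =
  t.\<close>

lemma implicit_function:
  fixes F Fx Fy :: "complex \<times> complex \<Rightarrow> complex"
  assumes F: "\<And>z. (F has_derivative (\<lambda>v. Fx z * fst v + Fy z * snd v)) (at z)"
    and cont: "continuous_on UNIV Fx" "continuous_on UNIV Fy" and ne: "Fy z0 \<noteq> 0" and z0: "F z0 = t"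
  obtains U D Y where "open U" "open D" "z0 \<in> U" "Y holomorphic_on D"
    "\<And>x. x \<in> D \<Longrightarrow> (x, Y x) \<in> U \<and> F (x, Y x) = t"
    "\<And>z. z \<in> U \<Longrightarrow> F z = t \<Longrightarrow> fst z \<in> D \<and> Y (fst z) = snd z"
proof -
  define \<Phi> where "\<Phi> = (\<lambda>z. (fst z, F z))"
  define \<Phi>' where "\<Phi>' = (\<lambda>z. Blinfun (\<lambda>v. (fst v, Fx z * fst v + Fy z * snd v)))"
  have bl: "bounded_linear (\<lambda>v. (fst v, Fx z * fst v + Fy z * snd v))" for z
    by (intro bounded_linear_Pair bounded_linear_add bounded_linear_const_mult bounded_linear_fst bounded_linear_snd)
  have ap: "blinfun_apply (\<Phi>' z) v = (fst v, Fx z * fst v + Fy z * snd v)" for z v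
    unfolding \<Phi>'_def by (subst bounded_linear_Blinfun_apply[OF bl]) simp
  define J where "J = Blinfun (\<lambda>v. (fst v, (snd v - Fx z0 * fst v) * inverse (Fy z0)))"
  have bJ: "bounded_linear (\<lambda>v. (fst v, (snd v - Fx z0 * fst v) * inverse (Fy z0)))"
    by (intro bounded_linear_Pair bounded_linear_sub bounded_linear_const_mult bounded_linear_mult_const
        bounded_linear_fst bounded_linear_snd)
  have apJ: "blinfun_apply J v = (fst v, (snd v - Fx z0 * fst v) * inverse (Fy z0))" for v
    unfolding J_def by (subst bounded_linear_Blinfun_apply[OF bJ]) simp
  have der: "(\<Phi> has_derivative blinfun_apply (\<Phi>' z)) (at z)" for z
    unfolding \<Phi>_def ap[abs_def] by (intro has_derivative_Pair F has_derivative_fst has_derivative_ident)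
  have c\<Phi>': "continuous_on UNIV \<Phi>'"
    by (rule continuous_on_blinfun_componentwise) (auto simp: ap intro!: continuous_intros cont)
  have J: "J o\<^sub>L \<Phi>' z0 = id_blinfun"
    by (rule blinfun_eqI) (use ne in \<open>auto simp: ap apJ field_simps\<close>)
  obtain U W g g' where g: "open U" "z0 \<in> U" "open W" "\<Phi> z0 \<in> W" "homeomorphism U W \<Phi> g"
      "\<And>y. y \<in> W \<Longrightarrow> (g has_derivative g' y) (at y)" "\<And>y. y \<in> W \<Longrightarrow> bij (blinfun_apply (\<Phi>' (g y)))"
    by (rule inverse_function_theorem[OF open_UNIV der c\<Phi>' UNIV_I J], rule that, assumption+)
  define D where "D = {x. (x, t) \<in> W}"
  define Y where "Y = (\<lambda>x. snd (g (x, t)))"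
  have "D = (\<lambda>x. (x, t)) -` W" by (auto simp: D_def)
  hence D: "open D" using open_vimage[OF g(3), of "\<lambda>x. (x, t)"] by (simp add: continuous_intros)
  have gx: "g (x, t) = (x, Y x)" "g (x, t) \<in> U" "F (x, Y x) = t" if "x \<in> D" for x
  proof -
    have W: "(x, t) \<in> W" using that by (simp add: D_def)
    hence \<Phi>g: "\<Phi> (g (x, t)) = (x, t)" and "g (x, t) \<in> U" using g(5) by (auto simp: homeomorphism_def)
    thus "g (x, t) \<in> U" "g (x, t) = (x, Y x)" by (auto simp: \<Phi>_def Y_def prod_eq_iff)
    thus "F (x, Y x) = t" using \<Phi>g by (simp add: \<Phi>_def)
  qed
  have Y: "\<exists>d. (Y has_field_derivative d) (at x)" if x: "x \<in> D" for x
  proof -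
    have "((\<lambda>x. (x, t)) has_derivative (\<lambda>v. (v, 0))) (at x)"
      by (intro has_derivative_Pair has_derivative_ident has_derivative_const)
    moreover have "(g has_derivative g' (x, t)) (at (x, t))" using g(6) x by (simp add: D_def)
    ultimately have "((\<lambda>x. g (x, t)) has_derivative (\<lambda>v. g' (x, t) (v, 0))) (at x)"
      by (rule has_derivative_compose[where f = "\<lambda>x. (x, t)"])
    hence L: "(Y has_derivative (\<lambda>v. snd (g' (x, t) (v, 0)))) (at x)"
      unfolding Y_def by (rule has_derivative_snd)
    have "((\<lambda>x. (x, Y x)) has_derivative (\<lambda>v. (v, snd (g' (x, t) (v, 0))))) (at x)"
      by (intro has_derivative_Pair has_derivative_ident L)
    from has_derivative_compose[OF this F]
    have "((\<lambda>x. F (x, Y x)) has_derivative (\<lambda>v. Fx (x, Y x) * v + Fy (x, Y x) * snd (g' (x, t) (v, 0)))) (at x)"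
      by simp
    moreover have "((\<lambda>x. F (x, Y x)) has_derivative (\<lambda>v. 0)) (at x)"
      by (rule has_derivative_transform_within_open[OF has_derivative_const[of t] D x]) (simp add: gx)
    ultimately have "(\<lambda>v. Fx (x, Y x) * v + Fy (x, Y x) * snd (g' (x, t) (v, 0))) = (\<lambda>v. 0)"
      by (rule has_derivative_unique)
    hence eq: "Fx (x, Y x) * v + Fy (x, Y x) * snd (g' (x, t) (v, 0)) = 0" for v by metis
    \<comment> \<open>Invertibility of the differential at every point of the neighbourhood gives Fy
      \<noteq> 0 on all of \<open>D\<close>, so the derivative of \<open>Y\<close> is multiplication
      by -Fx/Fy.\<close>
    have "bij (blinfun_apply (\<Phi>' (x, Y x)))" using g(7)[of "(x, t)"] gx x by (simp add: D_def)
    hence "inj (blinfun_apply (\<Phi>' (x, Y x)))" by (rule bij_is_inj)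
    hence "blinfun_apply (\<Phi>' (x, Y x)) (0, 1) \<noteq> blinfun_apply (\<Phi>' (x, Y x)) (0, 0)"
      by (metis inj_eq prod.inject zero_neq_one)
    hence "Fy (x, Y x) \<noteq> 0" by (auto simp: ap)
    hence "snd (g' (x, t) (v, 0)) = - Fx (x, Y x) / Fy (x, Y x) * v" for v
      using eq[of v] by (simp add: field_simps add_eq_0_iff)
    hence "(\<lambda>v. snd (g' (x, t) (v, 0))) = (*) (- Fx (x, Y x) / Fy (x, Y x))" by (rule ext)
    from L[unfolded this] show ?thesis unfolding has_field_derivative_def by blast
  qed
  show ?thesis
  proof (rule that[of U D Y])
    show "Y holomorphic_on D" unfolding holomorphic_on_open[OF D] using Y by blast
    fix z assume z: "z \<in> U" "F z = t"
    have "\<Phi> z \<in> W" "g (\<Phi> z) = z" using g(5) z by (auto simp: homeomorphism_def)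
    moreover have "\<Phi> z = (fst z, t)" using z by (simp add: \<Phi>_def)
    ultimately show "fst z \<in> D \<and> Y (fst z) = snd z" by (simp add: D_def Y_def)
  qed (use g D gx in auto)
qed

lemma fiber_chart:
  assumes reg: "regular_value f t" and z0: "z0 \<in> fiber f t"
  obtains U D a b \<pi> where "holomorphic_chart (fiber f t) U D a b \<pi>" "z0 \<in> U"
proof -
  define Fx where "Fx = bieval (fst (differential f))"
  define Fy where "Fy = bieval (snd (differential f))"
  have der: "(bieval f has_derivative (\<lambda>v. Fx z * fst v + Fy z * snd v)) (at z)" for z
    using bieval_has_derivative[of f z UNIV] by (simp add: apply_form_def[abs_def] Fx_def Fy_def)
  have cont: "continuous_on UNIV Fx" "continuous_on UNIV Fy"
    unfolding Fx_def Fy_def by (auto intro!: continuous_intros)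
  have t: "bieval f z0 = t" using z0 by (simp add: fiber_def)
  have "Fx z0 \<noteq> 0 \<or> Fy z0 \<noteq> 0"
    using reg z0 unfolding regular_value_def by (auto simp: apply_form_def Fx_def Fy_def)
  thus ?thesis
  proof
    assume "Fy z0 \<noteq> 0"
    then obtain U D Y where U: "open U" "open D" "z0 \<in> U" "Y holomorphic_on D"
        "\<And>x. x \<in> D \<Longrightarrow> (x, Y x) \<in> U \<and> bieval f (x, Y x) = t"
        "\<And>z. z \<in> U \<Longrightarrow> bieval f z = t \<Longrightarrow> fst z \<in> D \<and> Y (fst z) = snd z"
      using implicit_function[OF der cont _ t] by metis
    hence "holomorphic_chart (fiber f t) U D (\<lambda>x. x) Y fst"
      unfolding holomorphic_chart_def by (auto simp: fiber_def)
    thus ?thesis using that U by blast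
  next
    assume Fx0: "Fx z0 \<noteq> 0"
    define F' where "F' = (\<lambda>z. bieval f (snd z, fst z))"
    have der': "(F' has_derivative (\<lambda>v. Fy (snd z, fst z) * fst v + Fx (snd z, fst z) * snd v)) (at z)" for z
    proof -
      have "((\<lambda>z. (snd z, fst z)) has_derivative (\<lambda>v. (snd v, fst v))) (at z)"
        by (intro has_derivative_Pair has_derivative_fst has_derivative_snd has_derivative_ident)
      from has_derivative_compose[OF this der] show ?thesis by (simp add: F'_def add.commute)
    qed
    have cont': "continuous_on UNIV (\<lambda>z. Fy (snd z, fst z))" "continuous_on UNIV (\<lambda>z. Fx (snd z, fst z))"
      by (auto intro!: continuous_on_compose2[OF cont(1)] continuous_on_compose2[OF cont(2)] continuous_intros)
    obtain U D Y where U: "open U" "open D" "(snd z0, fst z0) \<in> U" "Y holomorphic_on D"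
        "\<And>x. x \<in> D \<Longrightarrow> (x, Y x) \<in> U \<and> F' (x, Y x) = t"
        "\<And>z. z \<in> U \<Longrightarrow> F' z = t \<Longrightarrow> fst z \<in> D \<and> Y (fst z) = snd z"
      using implicit_function[OF der' cont', of "(snd z0, fst z0)" t] Fx0 t by (auto simp: F'_def)
    define U' where "U' = (\<lambda>z. (snd z, fst z)) -` U"
    have "open U'" unfolding U'_def
      by (rule continuous_open_vimage[OF U(1)]) (auto intro!: continuous_intros)
    moreover have "z0 \<in> U'" using U by (simp add: U'_def)
    ultimately have "holomorphic_chart (fiber f t) U' D Y (\<lambda>x. x) snd"
      using U unfolding holomorphic_chart_def by (auto simp: fiber_def U'_def F'_def)
    thus ?thesis using that \<open>z0 \<in> U'\<close> by blast
  qed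
qed

lemma chart_comp_deriv:
  assumes ch: "holomorphic_chart S U D a b \<pi>" and z: "\<zeta> \<in> D"
    and A: "(A has_derivative L) (at (a \<zeta>, b \<zeta>) within S)"
  shows "((\<lambda>\<zeta>. A (a \<zeta>, b \<zeta>)) has_derivative (\<lambda>h. L (deriv a \<zeta> * h, deriv b \<zeta> * h))) (at \<zeta>)"
proof -
  have D: "open D" "a holomorphic_on D" "b holomorphic_on D" "(\<lambda>\<zeta>. (a \<zeta>, b \<zeta>)) ` D \<subseteq> S"
    using ch unfolding holomorphic_chart_def by auto
  have "((\<lambda>\<zeta>. (a \<zeta>, b \<zeta>)) has_derivative (\<lambda>h. (deriv a \<zeta> * h, deriv b \<zeta> * h))) (at \<zeta> within D)"
    using holomorphic_derivI[OF D(2,1) z] holomorphic_derivI[OF D(3,1) z]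
    by (intro has_derivative_Pair) (auto simp: has_field_derivative_def intro: has_derivative_at_withinI)
  from has_derivative_in_compose[OF this has_derivative_subset[OF A D(4)]]
  have "((\<lambda>\<zeta>. A (a \<zeta>, b \<zeta>)) has_derivative (\<lambda>h. L (deriv a \<zeta> * h, deriv b \<zeta> * h))) (at \<zeta> within D)" .
  thus ?thesis unfolding at_within_open[OF z D(1)] .
qed

lemma chart_locally_constant:
  assumes ch: "holomorphic_chart S U D a b \<pi>" and z: "z \<in> S \<inter> U" and W: "open W" "z \<in> W"
    and F: "\<And>z. z \<in> S \<inter> W \<Longrightarrow> (F has_derivative (\<lambda>v. 0)) (at z within S)"
  shows "\<exists>O'. open O' \<and> z \<in> O' \<and> O' \<subseteq> W \<and> (\<forall>x\<in>S \<inter> O'. F x = (F z :: complex))"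
proof -
  note c = ch[unfolded holomorphic_chart_def]
  have cab: "continuous_on D (\<lambda>\<zeta>. (a \<zeta>, b \<zeta>))"
    using c by (auto intro!: continuous_intros holomorphic_on_imp_continuous_on)
  have p: "\<pi> z \<in> D" "(a (\<pi> z), b (\<pi> z)) = z" using c z by auto
  have "open (D \<inter> (\<lambda>\<zeta>. (a \<zeta>, b \<zeta>)) -` W)" using cab c W continuous_open_preimage by blast
  moreover have "\<pi> z \<in> D \<inter> (\<lambda>\<zeta>. (a \<zeta>, b \<zeta>)) -` W" using p W by simp
  ultimately obtain r where r: "r > 0" "ball (\<pi> z) r \<subseteq> D \<inter> (\<lambda>\<zeta>. (a \<zeta>, b \<zeta>)) -` W" using openE by blast
  have const: "F (a \<zeta>, b \<zeta>) = F (a (\<pi> z), b (\<pi> z))" if "\<zeta> \<in> ball (\<pi> z) r" for \<zeta>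
  proof -
    have "\<exists>k. \<forall>\<zeta>\<in>ball (\<pi> z) r. F (a \<zeta>, b \<zeta>) = k"
    proof (rule has_derivative_zero_constant)
      fix x assume x: "x \<in> ball (\<pi> z) r"
      hence xD: "x \<in> D" "(a x, b x) \<in> S \<inter> W" using r c by auto
      from chart_comp_deriv[OF ch xD(1) F[OF xD(2)]]
      show "((\<lambda>\<zeta>. F (a \<zeta>, b \<zeta>)) has_derivative (\<lambda>h. 0)) (at x within ball (\<pi> z) r)"
        by (rule has_derivative_at_withinI)
    qed simp
    then obtain k where "\<forall>\<zeta>\<in>ball (\<pi> z) r. F (a \<zeta>, b \<zeta>) = k" ..
    moreover have "\<pi> z \<in> ball (\<pi> z) r" using r by simp
    ultimately show ?thesis using that by metis
  qed
  define O' where "O' = U \<inter> W \<inter> \<pi> -` ball (\<pi> z) r"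
  have "continuous_on UNIV \<pi>" using c by (auto intro: continuous_intros)
  hence "open (\<pi> -` ball (\<pi> z) r)" by (simp add: open_vimage)
  hence "open O'" using c W unfolding O'_def by blast
  moreover have "z \<in> O'" using z W r by (simp add: O'_def)
  moreover have "F x = F z" if x: "x \<in> S \<inter> O'" for x
  proof -
    have "\<pi> x \<in> ball (\<pi> z) r" "(a (\<pi> x), b (\<pi> x)) = x" using x c by (auto simp: O'_def)
    thus ?thesis using const[of "\<pi> x"] p by simp
  qed
  ultimately show ?thesis by (intro exI[of _ O']) (auto simp: O'_def)
qed

text \<open>On the curve, \<open>z = \<psi>(\<pi> z)\<close> for the parametrization \<open>\<psi>\<close>, so the derivative of \<open>K \<circ> \<pi>\<close> within the
  curve may be corrected by a multiple of that of \<open>id - \<psi> \<circ> \<pi>\<close>.\<close>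

lemma chart_primitive:
  assumes ch: "holomorphic_chart S U D a b \<pi>" and z0: "z0 \<in> S \<inter> U"
    and W: "open W" "z0 \<in> W"
    and c: "(\<lambda>\<zeta>. c (a \<zeta>, b \<zeta>)) holomorphic_on (D \<inter> (\<lambda>\<zeta>. (a \<zeta>, b \<zeta>)) -` W)"
  shows "\<exists>W' B. z0 \<in> W' \<and> primitive_on S W' B (\<lambda>z v. c z * apply_form \<eta> z v)"
proof -
  note C = ch[unfolded holomorphic_chart_def]
  let ?\<psi> = "\<lambda>\<zeta>. (a \<zeta>, b \<zeta>)"
  have cab: "continuous_on D ?\<psi>"
    using C by (auto intro!: continuous_intros holomorphic_on_imp_continuous_on)
  have p: "\<pi> z0 \<in> D" "?\<psi> (\<pi> z0) = z0" using C z0 by auto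
  have "open (D \<inter> ?\<psi> -` W)" using cab C W continuous_open_preimage by blast
  moreover have "\<pi> z0 \<in> D \<inter> ?\<psi> -` W" using p W by simp
  ultimately obtain r where r: "r > 0" "ball (\<pi> z0) r \<subseteq> D \<inter> ?\<psi> -` W" using openE by blast
  let ?B = "ball (\<pi> z0) r"
  have hol: "a holomorphic_on ?B" "b holomorphic_on ?B" "(\<lambda>\<zeta>. c (?\<psi> \<zeta>)) holomorphic_on ?B"
    using C c r by (auto intro: holomorphic_on_subset)
  define k where "k = (\<lambda>\<zeta>. c (?\<psi> \<zeta>) * apply_form \<eta> (?\<psi> \<zeta>) (deriv a \<zeta>, deriv b \<zeta>))"
  have "k holomorphic_on ?B"
    unfolding k_def apply_form_def fst_conv snd_conv by (intro holomorphic_intros hol open_ball)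
  then obtain K where K: "\<And>x. x \<in> ?B \<Longrightarrow> (K has_field_derivative k x) (at x within ?B)"
    using holomorphic_convex_primitive'[OF convex_ball open_ball] by metis
  define W' where "W' = U \<inter> \<pi> -` ?B"
  have c\<pi>: "continuous_on UNIV \<pi>" using C by (auto intro: continuous_intros)
  hence "open (\<pi> -` ?B)" by (simp add: open_vimage)
  hence W': "open W'" "z0 \<in> W'" using C z0 r unfolding W'_def by auto
  have bl: "bounded_linear \<pi>" using C bounded_linear_fst bounded_linear_snd by blast
  have "primitive_on S W' (\<lambda>z. K (\<pi> z)) (\<lambda>z v. c z * apply_form \<eta> z v)"
    unfolding primitive_on_def
  proof (intro conjI ballI W')
    fix z assume z: "z \<in> S \<inter> W'"
    hence zb: "\<pi> z \<in> ?B" "?\<psi> (\<pi> z) = z" using C by (auto simp: W'_def)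
    hence zD: "\<pi> z \<in> D" using r by auto
    let ?\<xi> = "\<lambda>v. c z * apply_form \<eta> z v"
    have \<xi>: "bounded_linear ?\<xi>"
      unfolding apply_form_def
      by (intro bounded_linear_const_mult bounded_linear_add bounded_linear_fst bounded_linear_snd)
    have d\<pi>: "(\<pi> has_derivative \<pi>) (at z within S)" by (rule bounded_linear_imp_has_derivative[OF bl])
    have dK: "((\<lambda>z. K (\<pi> z)) has_derivative (\<lambda>v. k (\<pi> z) * \<pi> v)) (at z within S)"
    proof -
      have "(K has_field_derivative k (\<pi> z)) (at (\<pi> z))"
        using K[OF zb(1)] unfolding at_within_open[OF zb(1) open_ball] .
      hence "(K has_derivative (\<lambda>h. k (\<pi> z) * h)) (at (\<pi> z))" by (simp add: has_field_derivative_def)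
      from has_derivative_compose[OF d\<pi> this] show ?thesis .
    qed
    have d\<psi>: "((\<lambda>\<zeta>. ?\<xi> (?\<psi> \<zeta>)) has_derivative (\<lambda>h. ?\<xi> (deriv a (\<pi> z) * h, deriv b (\<pi> z) * h))) (at (\<pi> z))"
      by (rule chart_comp_deriv[OF ch zD]) (rule bounded_linear_imp_has_derivative[OF \<xi>])
    have d2: "((\<lambda>z. ?\<xi> (?\<psi> (\<pi> z))) has_derivative (\<lambda>v. ?\<xi> (deriv a (\<pi> z) * \<pi> v, deriv b (\<pi> z) * \<pi> v))) (at z within S)"
      using has_derivative_compose[OF d\<pi> d\<psi>] .
    have lin: "?\<xi> (deriv a (\<pi> z) * h, deriv b (\<pi> z) * h) = k (\<pi> z) * h" for h
      using zb(2) by (simp add: k_def apply_form_def algebra_simps)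
    have "((\<lambda>x. K (\<pi> x) - ?\<xi> (?\<psi> (\<pi> x)) + ?\<xi> x) has_derivative (\<lambda>v. k (\<pi> z) * \<pi> v - k (\<pi> z) * \<pi> v + ?\<xi> v)) (at z within S)"
      using d2 unfolding lin
      by (intro has_derivative_add has_derivative_diff dK bounded_linear_imp_has_derivative[OF \<xi>])
    hence d3: "((\<lambda>x. K (\<pi> x) - ?\<xi> (?\<psi> (\<pi> x)) + ?\<xi> x) has_derivative ?\<xi>) (at z within S)" by simp
    obtain e where e: "e > 0" "ball z e \<subseteq> W'" using W'(1) z openE by blast
    show "((\<lambda>z. K (\<pi> z)) has_derivative ?\<xi>) (at z within S)"
    proof (rule has_derivative_transform_within[OF d3 e(1)])
      fix x assume x: "x \<in> S" "dist x z < e"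
      hence "x \<in> S \<inter> U" using e by (auto simp: W'_def dist_commute)
      hence "?\<psi> (\<pi> x) = x" using C by auto
      thus "K (\<pi> x) - ?\<xi> (?\<psi> (\<pi> x)) + ?\<xi> x = K (\<pi> x)" by simp
    qed (use z in auto)
  qed
  thus ?thesis using W'(2) by blast
qed

lemma fiber_integrable_forms:
  assumes reg: "regular_value f t"
  shows "integrable_forms (fiber f t) (apply_form \<theta>) (apply_form \<eta>)"
proof
  let ?S = "fiber f t"
  fix U F z assume F: "primitive_on ?S U F (\<lambda>z v. 0)" and z: "z \<in> ?S" "z \<in> U"
  obtain U' D a b \<pi> where ch: "holomorphic_chart ?S U' D a b \<pi>" "z \<in> U'" using fiber_chart[OF reg z(1)] .
  show "\<exists>V. open V \<and> z \<in> V \<and> V \<subseteq> U \<and> (\<forall>x\<in>?S \<inter> V. F x = F z)"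
    using F z ch unfolding primitive_on_def by (intro chart_locally_constant[OF ch(1)]) auto
next
  let ?S = "fiber f t"
  fix z assume z: "z \<in> ?S"
  obtain U' D a b \<pi> where ch: "holomorphic_chart ?S U' D a b \<pi>" "z \<in> U'" using fiber_chart[OF reg z] .
  have "\<exists>W' B. z \<in> W' \<and> primitive_on ?S W' B (\<lambda>z v. (\<lambda>_. 1) z * apply_form \<theta> z v)"
    by (rule chart_primitive[OF ch(1), of z UNIV]) (use ch z in auto)
  thus "\<exists>U A. z \<in> U \<and> primitive_on ?S U A (apply_form \<theta>)" by simp
next
  let ?S = "fiber f t"
  fix z U A w assume z: "z \<in> ?S" "z \<in> U" and A: "primitive_on ?S U A (apply_form \<theta>)"
  obtain U' D a b \<pi> where ch: "holomorphic_chart ?S U' D a b \<pi>" "z \<in> U'" using fiber_chart[OF reg z(1)] .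
  note C = ch(1)[unfolded holomorphic_chart_def]
  let ?\<psi> = "\<lambda>\<zeta>. (a \<zeta>, b \<zeta>)"
  have U: "open U" using A unfolding primitive_on_def by blast
  have "continuous_on D ?\<psi>" using C by (auto intro!: continuous_intros holomorphic_on_imp_continuous_on)
  hence op: "open (D \<inter> ?\<psi> -` U)" using C U continuous_open_preimage by blast
  have "(\<lambda>\<zeta>. A (?\<psi> \<zeta>)) holomorphic_on (D \<inter> ?\<psi> -` U)"
    unfolding holomorphic_on_open[OF op]
  proof (intro ballI)
    fix \<zeta> assume z: "\<zeta> \<in> D \<inter> ?\<psi> -` U"
    hence "?\<psi> \<zeta> \<in> ?S \<inter> U" using C by auto
    hence "(A has_derivative apply_form \<theta> (?\<psi> \<zeta>)) (at (?\<psi> \<zeta>) within ?S)"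
      using A unfolding primitive_on_def by blast
    from chart_comp_deriv[OF ch(1) _ this]
    have "((\<lambda>\<zeta>. A (?\<psi> \<zeta>)) has_derivative (\<lambda>h. apply_form \<theta> (?\<psi> \<zeta>) (deriv a \<zeta> * h, deriv b \<zeta> * h))) (at \<zeta>)"
      using z by blast
    moreover have "apply_form \<theta> (?\<psi> \<zeta>) (deriv a \<zeta> * h, deriv b \<zeta> * h) = apply_form \<theta> (?\<psi> \<zeta>) (deriv a \<zeta>, deriv b \<zeta>) * h" for h
      by (simp add: apply_form_def algebra_simps)
    ultimately show "\<exists>d. ((\<lambda>\<zeta>. A (?\<psi> \<zeta>)) has_field_derivative d) (at \<zeta>)"
      unfolding has_field_derivative_def by (intro exI[of _ "apply_form \<theta> (?\<psi> \<zeta>) (deriv a \<zeta>, deriv b \<zeta>)"]) simp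
  qed
  hence "(poly w \<circ> (\<lambda>\<zeta>. A (?\<psi> \<zeta>))) holomorphic_on (D \<inter> ?\<psi> -` U)"
    by (rule holomorphic_on_compose) (intro holomorphic_intros)
  hence "(\<lambda>\<zeta>. (\<lambda>z. poly w (A z)) (?\<psi> \<zeta>)) holomorphic_on (D \<inter> ?\<psi> -` U)" by (simp add: o_def)
  from chart_primitive[OF ch(1) _ U z(2) this]
  show "\<exists>V B. z \<in> V \<and> primitive_on ?S V B (\<lambda>z v. poly w (A z) * apply_form \<eta> z v)"
    using ch z by blast
qed

section \<open>The foliation near infinity\<close>

definition homogeneous_part :: "(nat \<Rightarrow> nat \<Rightarrow> complex) \<Rightarrow> nat \<Rightarrow> complex \<times> complex \<Rightarrow> complex" where
  "homogeneous_part C j z = (\<Sum>i\<le>j. C (j - i) i * fst z ^ (j - i) * snd z ^ i)"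

text \<open>\<tau> is the homogenizing variable. It will be 1/R, so that \<tau> = 0 is the line at
  infinity, where only the part of degree \<open>d\<close> remains.\<close>

definition homogenization :: "(nat \<Rightarrow> nat \<Rightarrow> complex) \<Rightarrow> nat \<Rightarrow> complex \<Rightarrow> complex \<times> complex \<Rightarrow> complex" where
  "homogenization C d \<tau> z = (\<Sum>j\<le>d. \<tau> ^ (d - j) * homogeneous_part C j z)"

definition slope_poly :: "(nat \<Rightarrow> nat \<Rightarrow> complex) \<Rightarrow> nat \<Rightarrow> complex \<Rightarrow> complex" where
  "slope_poly C j u = (\<Sum>i\<le>j. C (j - i) i * u ^ i)"

text \<open>The formal derivative of \<open>slope_poly\<close>; for i = 0 the truncated exponent
  does no harm since the coefficient is 0.\<close>

definition slope_poly' :: "(nat \<Rightarrow> nat \<Rightarrow> complex) \<Rightarrow> nat \<Rightarrow> complex \<Rightarrow> complex" where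
  "slope_poly' C j u = (\<Sum>i\<le>j. of_nat i * C (j - i) i * u ^ (i - 1))"

definition coeffs_dx :: "(nat \<Rightarrow> nat \<Rightarrow> complex) \<Rightarrow> nat \<Rightarrow> nat \<Rightarrow> complex" where
  "coeffs_dx C i j = of_nat (Suc i) * C (Suc i) j"

definition coeffs_dy :: "(nat \<Rightarrow> nat \<Rightarrow> complex) \<Rightarrow> nat \<Rightarrow> nat \<Rightarrow> complex" where
  "coeffs_dy C i j = of_nat (Suc j) * C i (Suc j)"

lemma slope_poly_deriv: "(slope_poly C j has_field_derivative slope_poly' C j u) (at u)"
proof -
  have "((\<lambda>u. \<Sum>i\<le>j. C (j - i) i * u ^ i) has_field_derivative (\<Sum>i\<le>j. C (j - i) i * (of_nat i * u ^ (i - Suc 0)))) (at u)"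
    by (intro DERIV_sum DERIV_cmult) (auto intro!: derivative_eq_intros)
  thus ?thesis by (simp add: slope_poly_def[abs_def] slope_poly'_def algebra_simps)
qed

lemma homogeneous_part_slope: "homogeneous_part C j (x, x * u) = x ^ j * slope_poly C j u"
proof -
  have "x ^ (j - i) * (x * u) ^ i = x ^ j * u ^ i" if "i \<le> j" for i
    using that by (simp add: power_mult_distrib mult.assoc[symmetric] flip: power_add)
  hence eq: "C (j - i) i * x ^ (j - i) * (x * u) ^ i = x ^ j * (C (j - i) i * u ^ i)" if "i \<le> j" for i
    using that by (simp only: mult.assoc mult.left_commute)
  show ?thesis
    unfolding homogeneous_part_def slope_poly_def sum_distrib_left fst_conv snd_conv
    by (intro sum.cong[OF refl] eq) simp
qed

lemma bieval_eq_homogeneous_parts: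
  assumes "total_degree_le p d"
  shows "bieval p z = (\<Sum>j\<le>d. homogeneous_part (bicoeff p) j z)"
proof -
  let ?C = "bicoeff p" and ?x = "fst z" and ?y = "snd z"
  have zero: "?C i j = 0" if "i + j > d" for i j
    using assms that unfolding total_degree_le_def by (meson not_le)
  have inner: "poly (coeff p j) ?x = (\<Sum>i\<le>d. ?C i j * ?x ^ i)" for j
  proof -
    have "degree (coeff p j) \<le> d" by (rule degree_le) (use zero in \<open>auto simp: bicoeff_def\<close>)
    hence "(\<Sum>i\<le>d. ?C i j * ?x ^ i) = (\<Sum>i\<le>degree (coeff p j). ?C i j * ?x ^ i)"
      by (intro sum.mono_neutral_right) (auto simp: bicoeff_def coeff_eq_0)
    thus ?thesis by (simp add: poly_altdef bicoeff_def)
  qed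
  have dp: "degree p \<le> d"
    by (rule degree_le) (use zero in \<open>auto simp: bicoeff_def poly_eq_iff\<close>)
  have "bieval p z = (\<Sum>j\<le>degree p. poly (coeff p j) ?x * ?y ^ j)"
    by (simp add: bieval_def poly_altdef[of p] poly_sum poly_power poly_mult)
  also have "\<dots> = (\<Sum>j\<le>d. poly (coeff p j) ?x * ?y ^ j)"
    using dp by (intro sum.mono_neutral_left) (auto simp: coeff_eq_0)
  also have "\<dots> = (\<Sum>j\<le>d. \<Sum>i\<le>d. ?C i j * ?x ^ i * ?y ^ j)"
    by (simp add: inner sum_distrib_right)
  also have "\<dots> = (\<Sum>(j, i)\<in>{..d} \<times> {..d}. ?C i j * ?x ^ i * ?y ^ j)"
    by (simp add: sum.cartesian_product)
  also have "\<dots> = (\<Sum>(j, i)\<in>{(j, i). i + j \<le> d}. ?C i j * ?x ^ i * ?y ^ j)"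
  proof (rule sum.mono_neutral_right)
    show "\<forall>x\<in>{..d} \<times> {..d} - {(j, i). i + j \<le> d}. (case x of (j, i) \<Rightarrow> ?C i j * ?x ^ i * ?y ^ j) = 0"
    proof
      fix x assume x: "x \<in> {..d} \<times> {..d} - {(j, i). i + j \<le> d}"
      obtain j i where ji: "x = (j, i)" by (cases x)
      with x have "?C i j = 0" by (intro zero) auto
      thus "(case x of (j, i) \<Rightarrow> ?C i j * ?x ^ i * ?y ^ j) = 0" by (simp add: ji)
    qed
  qed auto
  also have "\<dots> = (\<Sum>(k, i)\<in>(SIGMA k:{..d}. {..k}). ?C (k - i) i * ?x ^ (k - i) * ?y ^ i)"
    by (rule sum.reindex_bij_witness[of _ "\<lambda>(k, i). (i, k - i)" "\<lambda>(j, i). (i + j, j)"]) auto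
  also have "\<dots> = (\<Sum>k\<le>d. homogeneous_part ?C k z)"
    unfolding homogeneous_part_def by (subst sum.Sigma) auto
  finally show ?thesis .
qed

lemma bieval_scale:
  assumes p: "total_degree_le p d" and R: "R \<noteq> 0"
  shows "bieval p (R * x, R * y) = R ^ d * homogenization (bicoeff p) d (1 / R) (x, y)"
proof -
  have hp: "homogeneous_part (bicoeff p) j (R * x, R * y) = R ^ j * homogeneous_part (bicoeff p) j (x, y)" for j
  proof -
    have "(R * x) ^ (j - i) * (R * y) ^ i = R ^ j * (x ^ (j - i) * y ^ i)" if "i \<le> j" for i
      using that by (simp add: power_mult_distrib algebra_simps flip: power_add)
    hence eq: "bicoeff p (j - i) i * (R * x) ^ (j - i) * (R * y) ^ i = R ^ j * (bicoeff p (j - i) i * x ^ (j - i) * y ^ i)" if "i \<le> j" for i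
      using that by (simp only: mult.assoc mult.left_commute)
    show ?thesis
      unfolding homogeneous_part_def sum_distrib_left fst_conv snd_conv by (intro sum.cong[OF refl] eq) simp
  qed
  have scl: "R ^ d * ((1 / R) ^ (d - j) * homogeneous_part (bicoeff p) j (x, y)) = R ^ j * homogeneous_part (bicoeff p) j (x, y)"
    if "j \<le> d" for j
  proof -
    have "R ^ d = R ^ (d - j) * R ^ j" using that by (simp flip: power_add)
    thus ?thesis using R by (simp add: power_divide)
  qed
  show ?thesis
    unfolding bieval_eq_homogeneous_parts[OF p] homogenization_def sum_distrib_left
    by (intro sum.cong[OF refl]) (simp only: atMost_iff hp scl)
qed

lemma homogenization_0: "homogenization C d 0 z = homogeneous_part C d z"
proof -
  have "homogenization C d 0 z = (\<Sum>j\<in>{d}. 0 ^ (d - j) * homogeneous_part C j z)"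
    unfolding homogenization_def by (rule sum.mono_neutral_right) (auto simp: zero_power)
  thus ?thesis by simp
qed

lemma continuous_on_homogenization [continuous_intros]:
  assumes "continuous_on A \<tau>" "continuous_on A g"
  shows "continuous_on A (\<lambda>x. homogenization C d (\<tau> x) (g x))"
  unfolding homogenization_def homogeneous_part_def by (intro continuous_intros assms)

lemma holomorphic_on_homogenization [holomorphic_intros]:
  assumes "a holomorphic_on A" "b holomorphic_on A"
  shows "(\<lambda>x. homogenization C d \<tau> (a x, b x)) holomorphic_on A"
  unfolding homogenization_def homogeneous_part_def fst_conv snd_conv by (intro holomorphic_intros assms)

lemma bicoeff_map_poly_pderiv: "bicoeff (map_poly pderiv f) = coeffs_dx (bicoeff f)"
  by (intro ext) (simp add: bicoeff_def coeffs_dx_def coeff_map_poly coeff_pderiv)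

lemma bicoeff_pderiv: "bicoeff (pderiv f) = coeffs_dy (bicoeff f)"
proof (intro ext)
  fix i j
  have "coeff (of_nat (Suc j) * q) i = of_nat (Suc j) * coeff q i" for q :: "complex poly"
    using coeff_smult[of "of_nat (Suc j)" q i] by (simp add: of_nat_poly)
  thus "bicoeff (pderiv f) i j = coeffs_dy (bicoeff f) i j"
    by (simp add: bicoeff_def coeffs_dy_def coeff_pderiv)
qed

lemma total_degree_le_pderiv:
  assumes "total_degree_le f (Suc n)"
  shows "total_degree_le (map_poly pderiv f) n" "total_degree_le (pderiv f) n"
  using assms unfolding total_degree_le_def bicoeff_map_poly_pderiv bicoeff_pderiv coeffs_dx_def coeffs_dy_def
  by fastforce+

lemma slope_poly_dy: "slope_poly (coeffs_dy C) n u = slope_poly' C (Suc n) u"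
  unfolding slope_poly_def slope_poly'_def coeffs_dy_def by (subst sum.atMost_Suc_shift) simp

text \<open>Euler's identity for the homogeneous part of degree n + 1, read at the point (1,
  u).\<close>

lemma slope_poly_Euler:
  "slope_poly (coeffs_dx C) n u + u * slope_poly (coeffs_dy C) n u = of_nat (Suc n) * slope_poly C (Suc n) u"
proof -
  have "slope_poly (coeffs_dx C) n u = (\<Sum>i\<le>n. of_nat (Suc n - i) * C (Suc n - i) i * u ^ i)"
    unfolding slope_poly_def coeffs_dx_def by (intro sum.cong) (auto simp: Suc_diff_le)
  also have "\<dots> = (\<Sum>i\<le>Suc n. of_nat (Suc n - i) * C (Suc n - i) i * u ^ i)" by simp
  finally have 1: "slope_poly (coeffs_dx C) n u = (\<Sum>i\<le>Suc n. of_nat (Suc n - i) * C (Suc n - i) i * u ^ i)" .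
  have 2: "u * slope_poly' C (Suc n) u = (\<Sum>i\<le>Suc n. of_nat i * C (Suc n - i) i * u ^ i)"
    unfolding slope_poly'_def sum_distrib_left
  proof (rule sum.cong)
    fix i show "u * (of_nat i * C (Suc n - i) i * u ^ (i - 1)) = of_nat i * C (Suc n - i) i * u ^ i"
      by (cases i) auto
  qed simp
  have "of_nat (Suc n - i) * C (Suc n - i) i * u ^ i + of_nat i * C (Suc n - i) i * u ^ i = of_nat (Suc n) * (C (Suc n - i) i * u ^ i)"
    if "i \<le> Suc n" for i
  proof -
    have "(of_nat (Suc n - i) + of_nat i :: complex) = of_nat (Suc n)" using that by (simp flip: of_nat_add del: of_nat_Suc)
    thus ?thesis by (simp add: distrib_right[symmetric] mult.assoc[symmetric] del: of_nat_Suc)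
  qed
  hence "(\<Sum>i\<le>Suc n. of_nat (Suc n - i) * C (Suc n - i) i * u ^ i) + (\<Sum>i\<le>Suc n. of_nat i * C (Suc n - i) i * u ^ i) =
      of_nat (Suc n) * slope_poly C (Suc n) u"
    unfolding slope_poly_def sum_distrib_left sum.distrib[symmetric] by (intro sum.cong) (auto simp del: of_nat_Suc)
  thus ?thesis unfolding 1 slope_poly_dy 2 .
qed

text \<open>Compactness of \<open>K\<close> times the parameter ball makes the estimate uniform in
  \<open>k\<close>.\<close>

lemma small_parameter:
  fixes g :: "'a::metric_space \<Rightarrow> 'p::{real_normed_vector,heine_borel} \<Rightarrow> complex"
  assumes K: "compact K" and \<rho>: "\<rho> > 0" and g: "continuous_on (K \<times> cball 0 \<rho>) (\<lambda>(k, p). g k p)"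
    and \<eta>: "\<eta> > 0"
  obtains \<delta> where "\<delta> > 0" "\<delta> \<le> \<rho>" "\<And>k p. k \<in> K \<Longrightarrow> norm p \<le> \<delta> \<Longrightarrow> norm (g k p - g k 0) < \<eta>"
proof -
  have "compact (K \<times> cball (0::'p) \<rho>)" using K by (intro compact_Times) auto
  from compact_uniformly_continuous[OF g this] obtain d where d: "d > 0"
      "\<And>x y. x \<in> K \<times> cball 0 \<rho> \<Longrightarrow> y \<in> K \<times> cball 0 \<rho> \<Longrightarrow> dist y x < d \<Longrightarrow> dist ((\<lambda>(k, p). g k p) y) ((\<lambda>(k, p). g k p) x) < \<eta>"
    unfolding uniformly_continuous_on_def using \<eta> by metis
  define \<delta> where "\<delta> = min \<rho> (d / 2)"
  have \<delta>: "\<delta> > 0" "\<delta> \<le> \<rho>" "\<delta> < d" using \<rho> d by (auto simp: \<delta>_def)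
  have "norm (g k p - g k 0) < \<eta>" if "k \<in> K" "norm p \<le> \<delta>" for k p
  proof -
    have "(k, 0) \<in> K \<times> cball 0 \<rho>" "(k, p) \<in> K \<times> cball 0 \<rho>" "dist (k, p) (k, 0) < d"
      using that \<delta> \<rho> by (auto simp: dist_Pair_Pair)
    from d(2)[OF this] show ?thesis by (simp add: dist_norm)
  qed
  thus ?thesis using that[OF \<delta>(1,2)] by blast
qed

text \<open>Near infinity the plane is described by \<open>x = R E v\<close>, \<open>y = u x\<close>, with \<open>u\<close> running over a closed curve
  and \<open>R = 1 / \<tau>\<close> large. Since \<open>E\<^sup>n\<^sup>+\<^sup>1\<close> cancels the top part of \<open>f\<close>, the leaves of \<open>df + \<epsilon>\<omega> = 0\<close> are given by an
  equation \<open>v' = field \<tau> s \<epsilon> v\<close> whose right-hand side vanishes at \<open>\<tau> = \<epsilon> = 0\<close>.\<close>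

locale loop_data =
  fixes n :: nat and f P Q :: bipoly and u E u' E' :: "real \<Rightarrow> complex"
  assumes degrees: "total_degree_le f (Suc n)" "total_degree_le P n" "total_degree_le Q n"
    and u: "\<And>s. s \<in> {0..1} \<Longrightarrow> (u has_vector_derivative u' s) (at s within {0..1})" "continuous_on {0..1} u'"
    and E: "\<And>s. s \<in> {0..1} \<Longrightarrow> (E has_vector_derivative E' s) (at s within {0..1})" "continuous_on {0..1} E'"
    and E_root: "\<And>s. s \<in> {0..1} \<Longrightarrow> E s ^ Suc n * slope_poly (bicoeff f) (Suc n) (u s) = 1"
    and closed: "u 1 = u 0" "E 1 = E 0"
begin

abbreviation "fx \<equiv> coeffs_dx (bicoeff f)"
abbreviation "fy \<equiv> coeffs_dy (bicoeff f)"
abbreviation "\<omega> \<equiv> (P, Q)"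

text \<open>On y = u x one has dy = u dx + x du, so up to a power of R the form df +
  \<epsilon>\<omega> becomes \<open>den\<close> dx + \<open>num\<close> x du. Setting x = R E v and
  dividing by x turns its vanishing into v'/v = -E'/E - u' num/den, which is
  \<open>field\<close>.\<close>

definition num :: "complex \<Rightarrow> real \<Rightarrow> complex \<Rightarrow> complex \<Rightarrow> complex" where
  "num \<tau> s \<epsilon> v = homogenization fy n \<tau> (E s * v, E s * v * u s) + \<epsilon> * homogenization (bicoeff Q) n \<tau> (E s * v, E s * v * u s)"

definition den :: "complex \<Rightarrow> real \<Rightarrow> complex \<Rightarrow> complex \<Rightarrow> complex" where
  "den \<tau> s \<epsilon> v = homogenization fx n \<tau> (E s * v, E s * v * u s) + u s * homogenization fy n \<tau> (E s * v, E s * v * u s) +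
    \<epsilon> * (homogenization (bicoeff P) n \<tau> (E s * v, E s * v * u s) + u s * homogenization (bicoeff Q) n \<tau> (E s * v, E s * v * u s))"

definition field :: "complex \<Rightarrow> real \<Rightarrow> complex \<Rightarrow> complex \<Rightarrow> complex" where
  "field \<tau> s \<epsilon> v = - v * (E' s / E s + u' s * num \<tau> s \<epsilon> v / den \<tau> s \<epsilon> v)"

lemma cont_u: "continuous_on {0..1} u" and cont_E: "continuous_on {0..1} E"
  unfolding continuous_on_eq_continuous_within
  using u(1) E(1) has_vector_derivative_continuous by blast+

lemma E_nz: "s \<in> {0..1} \<Longrightarrow> E s \<noteq> 0" and slope_nz: "s \<in> {0..1} \<Longrightarrow> slope_poly (bicoeff f) (Suc n) (u s) \<noteq> 0"
  using E_root by fastforce+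

lemma E_log_deriv:
  assumes s: "s \<in> {0..1}"
  shows "E' s / E s = - (u' s * slope_poly' (bicoeff f) (Suc n) (u s)) / (of_nat (Suc n) * slope_poly (bicoeff f) (Suc n) (u s))"
proof -
  let ?\<phi> = "slope_poly (bicoeff f) (Suc n)" and ?\<phi>' = "slope_poly' (bicoeff f) (Suc n)"
  have 1: "((\<lambda>s. E s ^ Suc n) has_vector_derivative E' s * (of_nat (Suc n) * E s ^ n)) (at s within {0..1})"
  proof -
    have "((\<lambda>w. w ^ Suc n) has_field_derivative of_nat (Suc n) * E s ^ n) (at (E s) within E ` {0..1})"
      by (rule derivative_eq_intros refl | simp)+
    from field_vector_diff_chain_within[OF E(1)[OF s] this] show ?thesis by (simp add: o_def)
  qed
  have 2: "((\<lambda>s. ?\<phi> (u s)) has_vector_derivative u' s * ?\<phi>' (u s)) (at s within {0..1})"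
    using field_vector_diff_chain_within[OF u(1)[OF s] has_field_derivative_at_within[OF slope_poly_deriv]] by (simp add: o_def)
  from has_vector_derivative_mult[OF 1 2]
  have d1: "((\<lambda>s. E s ^ Suc n * ?\<phi> (u s)) has_vector_derivative
      E s ^ Suc n * (u' s * ?\<phi>' (u s)) + E' s * (of_nat (Suc n) * E s ^ n) * ?\<phi> (u s)) (at s within {0..1})" .
  have d2: "((\<lambda>s. E s ^ Suc n * ?\<phi> (u s)) has_vector_derivative 0) (at s within {0..1})"
    by (rule has_vector_derivative_transform[OF s _ has_vector_derivative_const[of 1]]) (use E_root in auto)
  have "E s ^ Suc n * (u' s * ?\<phi>' (u s)) + E' s * (of_nat (Suc n) * E s ^ n) * ?\<phi> (u s) = 0"
    by (rule vector_derivative_unique_within_closed_interval[of 0 1 s, unfolded cbox_interval, OF zero_less_one s d1 d2])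
  hence "E s ^ n * (E s * (u' s * ?\<phi>' (u s)) + E' s * of_nat (Suc n) * ?\<phi> (u s)) = 0"
    by (simp add: algebra_simps)
  hence "E s * (u' s * ?\<phi>' (u s)) + E' s * of_nat (Suc n) * ?\<phi> (u s) = 0" using E_nz[OF s] by simp
  moreover have "(of_nat (Suc n) :: complex) \<noteq> 0" by (simp del: of_nat_Suc)
  ultimately show ?thesis
    using E_nz[OF s] slope_nz[OF s] by (simp add: divide_simps add_eq_0_iff del: of_nat_Suc) (simp add: algebra_simps)
qed

lemma den_0: "s \<in> {0..1} \<Longrightarrow> den 0 s 0 v = (E s * v) ^ n * (of_nat (Suc n) * slope_poly (bicoeff f) (Suc n) (u s))"
  unfolding den_def homogenization_0 homogeneous_part_slope slope_poly_Euler[symmetric] by (simp add: algebra_simps)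

lemma num_0: "num 0 s 0 v = (E s * v) ^ n * slope_poly' (bicoeff f) (Suc n) (u s)"
  by (simp add: num_def homogenization_0 homogeneous_part_slope slope_poly_dy)

text \<open>At infinity the leaves are the curves x^(n+1) \<phi>(u) = const, and the factor
  \<open>E\<close> was chosen so that constant \<open>v\<close> parametrizes them.\<close>

lemma field_0:
  assumes s: "s \<in> {0..1}" and v: "v \<noteq> 0"
  shows "field 0 s 0 v = 0"
proof -
  have "(E s * v) ^ n \<noteq> 0" using E_nz[OF s] v by simp
  hence "num 0 s 0 v / den 0 s 0 v = slope_poly' (bicoeff f) (Suc n) (u s) / (of_nat (Suc n) * slope_poly (bicoeff f) (Suc n) (u s))"
    unfolding den_0[OF s] num_0 by (rule mult_divide_mult_cancel_left)
  thus ?thesis unfolding field_def E_log_deriv[OF s] by (simp add: times_divide_eq_right[symmetric] del: times_divide_eq_right of_nat_Suc)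
qed

lemma continuous_on_den:
  assumes "continuous_on A t" "continuous_on A a" "continuous_on A b" "continuous_on A c" "a ` A \<subseteq> {0..1}"
  shows "continuous_on A (\<lambda>x. den (t x) (a x) (b x) (c x))" "continuous_on A (\<lambda>x. num (t x) (a x) (b x) (c x))"
proof -
  have uE: "continuous_on A (\<lambda>x. u (a x))" "continuous_on A (\<lambda>x. E (a x))"
    using assms by (auto intro!: continuous_on_compose2[OF cont_u] continuous_on_compose2[OF cont_E])
  show "continuous_on A (\<lambda>x. den (t x) (a x) (b x) (c x))"
    unfolding den_def by (intro continuous_intros assms uE)
  show "continuous_on A (\<lambda>x. num (t x) (a x) (b x) (c x))"
    unfolding num_def by (intro continuous_intros assms uE)
qed

lemma continuous_on_field:
  assumes "continuous_on A t" "continuous_on A a" "continuous_on A b" "continuous_on A c" "a ` A \<subseteq> {0..1}"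
    and ne: "\<And>x. x \<in> A \<Longrightarrow> den (t x) (a x) (b x) (c x) \<noteq> 0"
  shows "continuous_on A (\<lambda>x. field (t x) (a x) (b x) (c x))"
proof -
  have "continuous_on A (\<lambda>x. u' (a x))" "continuous_on A (\<lambda>x. E (a x))" "continuous_on A (\<lambda>x. E' (a x))"
    using assms by (auto intro!: continuous_on_compose2[OF u(2)] continuous_on_compose2[OF cont_E] continuous_on_compose2[OF E(2)])
  moreover have "\<forall>x\<in>A. E (a x) \<noteq> 0" using E_nz assms(5) by blast
  ultimately show ?thesis
    unfolding field_def using ne continuous_on_den[OF assms(1-5)] by (intro continuous_intros assms) auto
qed

text \<open>The field vanishes at \<tau> = \<epsilon> = 0, so for small parameters it is below r/2
  on the doubled disc of radius 2r, and Cauchy's estimate on discs of radius r turns this into the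
  Lipschitz constant 1/2. The bound r \<le> 1/4 keeps the doubled disc away from v = 0.\<close>

lemma contraction_ode_exists:
  assumes r: "0 < r" "r \<le> 1 / 4"
  obtains \<delta> where "\<delta> > 0" "\<And>\<tau>. norm \<tau> \<le> \<delta> \<Longrightarrow> contraction_ode (field \<tau>) 1 r \<delta>"
    "\<And>\<tau> s \<epsilon> v. norm \<tau> \<le> \<delta> \<Longrightarrow> norm \<epsilon> \<le> \<delta> \<Longrightarrow> s \<in> {0..1} \<Longrightarrow> v \<in> cball 1 r \<Longrightarrow> den \<tau> s \<epsilon> v \<noteq> 0"
proof -
  let ?K = "{0..1::real} \<times> cball (1::complex) (2 * r)"
  have K: "compact ?K" by (intro compact_Times) auto
  have v_nz: "v \<noteq> 0" if "v \<in> cball 1 (2 * r)" for v :: complex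
    using that r by (auto simp: dist_norm)
  let ?d = "\<lambda>k p. den (snd p) (fst k) (fst p) (snd k)" and ?g = "\<lambda>k p. field (snd p) (fst k) (fst p) (snd k)"
  have cd: "continuous_on (?K \<times> X) (\<lambda>(k, p). ?d k p)" for X
    unfolding case_prod_unfold by (intro continuous_on_den continuous_intros) auto
  have d0: "?d k 0 \<noteq> 0" if "k \<in> ?K" for k
  proof -
    have "fst k \<in> {0..1}" "snd k \<noteq> 0" using that v_nz[of "snd k"] by auto
    thus ?thesis using E_nz slope_nz by (simp add: den_0 del: of_nat_Suc)
  qed
  obtain m where m: "m > 0" "\<And>k. k \<in> ?K \<Longrightarrow> m \<le> norm (?d k 0)"
  proof -
    have "continuous_on ?K (\<lambda>k. norm (?d k 0))"
      by (intro continuous_intros continuous_on_den) auto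
    moreover have "?K \<noteq> {}" using r by auto
    ultimately obtain k0 where "k0 \<in> ?K" "\<forall>k\<in>?K. norm (?d k0 0) \<le> norm (?d k 0)"
      using continuous_attains_inf[OF K, of "\<lambda>k. norm (?d k 0)"] by blast
    thus ?thesis using d0 by (intro that[of "norm (?d k0 0)"]) auto
  qed
  obtain \<delta>1 where \<delta>1: "\<delta>1 > 0" "\<And>k p. k \<in> ?K \<Longrightarrow> norm p \<le> \<delta>1 \<Longrightarrow> norm (?d k p - ?d k 0) < m"
    using small_parameter[OF K zero_less_one cd m(1)] by metis
  have dne: "?d k p \<noteq> 0" if "k \<in> ?K" "norm p \<le> \<delta>1" for k p
    using \<delta>1(2)[OF that] m(2)[OF that(1)] by auto
  have cg: "continuous_on (?K \<times> cball 0 \<delta>1) (\<lambda>(k, p). ?g k p)"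
    unfolding case_prod_unfold
  proof (intro continuous_on_field continuous_intros)
    fix x assume x: "x \<in> ?K \<times> cball (0 :: complex \<times> complex) \<delta>1"
    show "den (snd (snd x)) (fst (fst x)) (fst (snd x)) (snd (fst x)) \<noteq> 0"
      using dne[of "fst x" "snd x"] x by auto
  qed auto
  obtain \<delta>2 where \<delta>2: "\<delta>2 > 0" "\<delta>2 \<le> \<delta>1" "\<And>k p. k \<in> ?K \<Longrightarrow> norm p \<le> \<delta>2 \<Longrightarrow> norm (?g k p - ?g k 0) < r / 2"
    using small_parameter[OF K \<delta>1(1) cg, of "r / 2"] r by auto
  have p_norm: "norm (\<epsilon>, \<tau>) \<le> \<delta>2" if "norm \<epsilon> \<le> \<delta>2 / 2" "norm \<tau> \<le> \<delta>2 / 2" for \<epsilon> \<tau> :: complex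
    using norm_Pair_le[of \<epsilon> \<tau>] that by linarith
  have den_nz: "den \<tau> s \<epsilon> v \<noteq> 0" if "norm \<tau> \<le> \<delta>2 / 2" "norm \<epsilon> \<le> \<delta>2 / 2" "s \<in> {0..1}" "v \<in> cball 1 (2 * r)" for \<tau> s \<epsilon> v
    using dne[of "(s, v)" "(\<epsilon>, \<tau>)"] p_norm[of \<epsilon> \<tau>] that \<delta>2(2) by auto
  have small: "norm (field \<tau> s \<epsilon> v) < r / 2" if "norm \<tau> \<le> \<delta>2 / 2" "norm \<epsilon> \<le> \<delta>2 / 2" "s \<in> {0..1}" "v \<in> cball 1 (2 * r)" for \<tau> s \<epsilon> v
    using \<delta>2(3)[of "(s, v)" "(\<epsilon>, \<tau>)"] p_norm[of \<epsilon> \<tau>] that field_0[OF that(3) v_nz[OF that(4)]] by auto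
  have sub: "cball 1 r \<subseteq> cball (1::complex) (2 * r)" using r by auto
  have hol: "(\<lambda>\<zeta>. field \<tau> s (e \<zeta>) (w \<zeta>)) holomorphic_on D"
    if "norm \<tau> \<le> \<delta>2 / 2" "s \<in> {0..1}" "e holomorphic_on D" "w holomorphic_on D" "e ` D \<subseteq> cball 0 (\<delta>2 / 2)" "w ` D \<subseteq> cball 1 (2 * r)"
    for \<tau> s e w D
  proof -
    have "den \<tau> s (e \<zeta>) (w \<zeta>) \<noteq> 0" if "\<zeta> \<in> D" for \<zeta> using den_nz \<open>norm \<tau> \<le> \<delta>2 / 2\<close> \<open>s \<in> {0..1}\<close> that \<open>e ` D \<subseteq> _\<close> \<open>w ` D \<subseteq> _\<close>
      by (simp add: image_subset_iff)
    moreover have "(\<lambda>\<zeta>. den \<tau> s (e \<zeta>) (w \<zeta>)) holomorphic_on D" "(\<lambda>\<zeta>. num \<tau> s (e \<zeta>) (w \<zeta>)) holomorphic_on D"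
      unfolding den_def num_def using that by (auto intro!: holomorphic_intros)
    ultimately show ?thesis unfolding field_def using that E_nz by (auto intro!: holomorphic_intros)
  qed
  have "contraction_ode (field \<tau>) 1 r (\<delta>2 / 2)" if \<tau>: "norm \<tau> \<le> \<delta>2 / 2" for \<tau>
  proof
    show "continuous_on ({0..1} \<times> cball 0 (\<delta>2 / 2) \<times> cball 1 r) (\<lambda>(s, \<epsilon>, v). field \<tau> s \<epsilon> v)"
      unfolding case_prod_unfold
    proof (intro continuous_on_field continuous_intros)
      fix x assume "x \<in> {0..1::real} \<times> cball (0::complex) (\<delta>2 / 2) \<times> cball (1::complex) r"
      thus "den \<tau> (fst x) (fst (snd x)) (snd (snd x)) \<noteq> 0" using sub \<tau> by (intro den_nz) auto
    qed auto
  next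
    fix s :: real and \<epsilon> v :: complex assume "s \<in> {0..1}" "\<epsilon> \<in> cball 0 (\<delta>2 / 2)" "v \<in> cball 1 r"
    thus "norm (field \<tau> s \<epsilon> v) \<le> r / 2" using small[of \<tau> \<epsilon> s v] \<tau> sub by (auto intro: less_imp_le)
  next
    fix s :: real and \<epsilon> v v' :: complex
    assume s: "s \<in> {0..1}" and \<epsilon>: "\<epsilon> \<in> cball 0 (\<delta>2 / 2)" and v: "v \<in> cball 1 r" "v' \<in> cball 1 r"
    have hv: "field \<tau> s \<epsilon> holomorphic_on cball 1 (2 * r)"
      using hol[OF \<tau> s holomorphic_on_const holomorphic_on_ident, of \<epsilon> "cball 1 (2 * r)"] \<epsilon>
      by (auto simp: image_subset_iff)
    have hb: "field \<tau> s \<epsilon> holomorphic_on ball 1 (2 * r)" using hv by (rule holomorphic_on_subset) auto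
    have "norm (field \<tau> s \<epsilon> v - field \<tau> s \<epsilon> v') \<le> 1 / 2 * norm (v - v')"
    proof (rule field_differentiable_bound[of "cball 1 r" _ "deriv (field \<tau> s \<epsilon>)"])
      fix z :: complex assume z: "z \<in> cball 1 r"
      have zb: "z \<in> ball 1 (2 * r)" using z r by auto
      show "(field \<tau> s \<epsilon> has_field_derivative deriv (field \<tau> s \<epsilon>) z) (at z within cball 1 r)"
        by (rule has_field_derivative_at_within[OF holomorphic_derivI[OF hb open_ball zb]])
      have sb: "cball z r \<subseteq> cball 1 (2 * r)"
      proof
        fix y assume "y \<in> cball z r"
        thus "y \<in> cball 1 (2 * r)" using z dist_triangle[of 1 y z] by simp
      qed
      \<comment> \<open>A bound r/2 on a disc of radius r around \<open>z\<close> gives (r/2)/r =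
        1/2 for the derivative.\<close>
      have "norm ((deriv ^^ 1) (field \<tau> s \<epsilon>) z) \<le> fact 1 * (r / 2) / r ^ 1"
      proof (rule Cauchy_inequality)
        show "field \<tau> s \<epsilon> holomorphic_on ball z r"
          using hv sb ball_subset_cball by (blast intro: holomorphic_on_subset)
        show "continuous_on (cball z r) (field \<tau> s \<epsilon>)"
          using holomorphic_on_imp_continuous_on[OF hv] sb by (rule continuous_on_subset)
        fix x assume "norm (z - x) = r"
        hence "x \<in> cball 1 (2 * r)" using sb by (auto simp: dist_norm)
        thus "norm (field \<tau> s \<epsilon> x) \<le> r / 2" using small[OF \<tau> _ s, of \<epsilon> x] \<epsilon> by (auto intro: less_imp_le)
      qed (use r in auto)
      thus "norm (deriv (field \<tau> s \<epsilon>) z) \<le> 1 / 2" using r by simp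
    qed (use v in auto)
    thus "norm (field \<tau> s \<epsilon> v - field \<tau> s \<epsilon> v') \<le> norm (v - v') / 2" by simp
  next
    fix s :: real and D e w
    assume a: "s \<in> {0..1}" "open D" "e holomorphic_on D" "w holomorphic_on D" "e ` D \<subseteq> cball 0 (\<delta>2 / 2)" "w ` D \<subseteq> cball 1 r"
    have "w ` D \<subseteq> cball 1 (2 * r)" using a(6) sub by (rule subset_trans)
    thus "(\<lambda>\<zeta>. field \<tau> s (e \<zeta>) (w \<zeta>)) holomorphic_on D" using hol[OF \<tau> a(1,3,4,5)] by blast
  qed (use r \<delta>2 in auto)
  moreover have "den \<tau> s \<epsilon> v \<noteq> 0"
    if "norm \<tau> \<le> \<delta>2 / 2" "norm \<epsilon> \<le> \<delta>2 / 2" "s \<in> {0..1}" "v \<in> cball 1 r" for \<tau> s \<epsilon> v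
    using den_nz[OF that(1-3)] that(4) sub by blast
  ultimately show ?thesis using that[of "\<delta>2 / 2"] \<delta>2(1) by simp
qed

end

section \<open>Loops near infinity and their holonomy\<close>

text \<open>\<open>R\<close> is now fixed, and the set \<open>B\<close> of values of
  \<open>v\<close> parametrizes the transversal at s = 0. Injectivity of \<open>f\<close> there, on
  the disc of radius \<open>r\<close> that contains all solutions, allows \<open>v\<close> to be
  recovered from the value of \<open>f\<close> and forces the loops to close.\<close>

locale flow_data = loop_data +
  fixes R :: complex and r \<delta> :: real and B :: "complex set"
  assumes R: "R \<noteq> 0" and ode: "contraction_ode (loop_data.field n f P Q u E u' E' (1 / R)) 1 r \<delta>"
    and den_nz: "\<And>s \<epsilon> v. s \<in> {0..1} \<Longrightarrow> norm \<epsilon> \<le> \<delta> \<Longrightarrow> v \<in> cball 1 r \<Longrightarrow>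
      loop_data.den n f P Q u E (1 / R) s \<epsilon> v \<noteq> 0"
    and B: "open B" "connected B" "B \<noteq> {}" "B \<subseteq> cball 1 (r / 2)"
    and inj: "inj_on (\<lambda>v. bieval f (R * (E 0 * v), R * (E 0 * v * u 0))) (cball 1 r)"
begin

sublocale ode: contraction_ode "field (1 / R)" 1 r \<delta>
  by (rule ode)

definition pos :: "real \<Rightarrow> complex \<Rightarrow> complex \<times> complex" where
  "pos s v = (R * (E s * v), R * (E s * v * u s))"

definition vel :: "real \<Rightarrow> complex \<Rightarrow> complex \<Rightarrow> complex \<times> complex" where
  "vel s \<epsilon> v = (R * (E' s * v + E s * field (1 / R) s \<epsilon> v),
    R * ((E' s * v + E s * field (1 / R) s \<epsilon> v) * u s + E s * v * u' s))"

definition level :: "complex \<Rightarrow> complex" where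
  "level v = bieval f (pos 0 v)"

definition "T = level ` B"
definition "coord = the_inv_into B level"
definition "\<sigma> t = pos 0 (coord t)"
definition "\<gamma> \<epsilon> t s = pos s (ode.flow s \<epsilon> (coord t))"
definition "loop t = \<gamma> 0 t"
definition "hol_map \<epsilon> t = level (ode.flow 1 \<epsilon> (coord t))"
text \<open>The last condition makes the endpoint of the lifted path a point of the transversal over
  \<open>T\<close>.\<close>

definition "W = {x. norm (fst x) < \<delta> \<and> snd x \<in> T \<and> ode.flow 1 (fst x) (coord (snd x)) \<in> B}"

lemma r: "r > 0" and \<delta>: "\<delta> > 0"
  using ode.r ode.e0 by auto

lemma half_subset: "cball 1 (r / 2) \<subseteq> cball (1::complex) r"
  using r by auto

lemma level_inj: "inj_on level (cball 1 r)"
  using inj by (simp add: level_def[abs_def] pos_def)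

lemma level_inj_B: "inj_on level B"
  using level_inj B half_subset by (meson inj_on_subset order_trans)

lemma level_holomorphic: "level holomorphic_on A"
  unfolding level_def[abs_def] pos_def by (intro holomorphic_intros)

lemma T_open: "open T" and T_connected: "connected T" and T_nonempty: "T \<noteq> {}"
  using open_mapping_thm3[OF level_holomorphic B(1) level_inj_B] B
    connected_continuous_image[OF holomorphic_on_imp_continuous_on[OF level_holomorphic] B(2)]
  by (auto simp: T_def)

lemma coord: "t \<in> T \<Longrightarrow> coord t \<in> B" "t \<in> T \<Longrightarrow> level (coord t) = t" "v \<in> B \<Longrightarrow> coord (level v) = v"
  unfolding T_def coord_def
  using the_inv_into_into[OF level_inj_B] f_the_inv_into_f[OF level_inj_B] the_inv_into_f_f[OF level_inj_B] by auto

lemma coord_in: "t \<in> T \<Longrightarrow> coord t \<in> cball 1 (r / 2)"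
  using coord(1) B(4) by blast

lemma coord_holomorphic: "coord holomorphic_on T"
proof -
  obtain g where g: "g holomorphic_on level ` B" "\<And>z. z \<in> B \<Longrightarrow> g (level z) = z"
    using holomorphic_has_inverse[OF level_holomorphic B(1) level_inj_B] by metis
  show ?thesis
    by (rule holomorphic_transform[of g]) (use g coord(3) in \<open>auto simp: T_def\<close>)
qed

lemma pos_form_scale:
  assumes "total_degree_le p n"
  shows "bieval p (pos s v) = R ^ n * homogenization (bicoeff p) n (1 / R) (E s * v, E s * v * u s)"
  unfolding pos_def by (rule bieval_scale[OF assms R])

lemma leaf_equation:
  assumes s: "s \<in> {0..1}" and \<epsilon>: "norm \<epsilon> \<le> \<delta>" and v: "v \<in> cball 1 r"
  shows "apply_form (differential f) (pos s v) (vel s \<epsilon> v) + \<epsilon> * apply_form (P, Q) (pos s v) (vel s \<epsilon> v) = 0"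
proof -
  define D N where "D = den (1 / R) s \<epsilon> v" and "N = num (1 / R) s \<epsilon> v"
  define k where "k = E' s * v + E s * field (1 / R) s \<epsilon> v"
  have D: "D \<noteq> 0" unfolding D_def by (rule den_nz[OF s \<epsilon> v])
  have deg: "total_degree_le (map_poly pderiv f) n" "total_degree_le (pderiv f) n"
    using total_degree_le_pderiv[OF degrees(1)] .
  have fxy: "bieval (fst (differential f)) (pos s v) = R ^ n * homogenization fx n (1 / R) (E s * v, E s * v * u s)"
      "bieval (snd (differential f)) (pos s v) = R ^ n * homogenization fy n (1 / R) (E s * v, E s * v * u s)"
    using pos_form_scale[OF deg(1), of s v] pos_form_scale[OF deg(2), of s v]
    by (auto simp: differential_def bicoeff_map_poly_pderiv bicoeff_pderiv)
  have vel: "fst (vel s \<epsilon> v) = R * k" "snd (vel s \<epsilon> v) = R * (k * u s + E s * v * u' s)"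
    by (auto simp: vel_def k_def)
  have "k = - (E s * v * u' s * N / D)"
    using E_nz[OF s] by (simp add: k_def field_def D_def N_def field_simps)
  hence kD: "k * D + E s * v * u' s * N = 0" using D by simp
  have "apply_form (differential f) (pos s v) (vel s \<epsilon> v) + \<epsilon> * apply_form (P, Q) (pos s v) (vel s \<epsilon> v) =
      R ^ n * R * (k * D + E s * v * u' s * N)"
    unfolding apply_form_def fxy vel fst_conv snd_conv pos_form_scale[OF degrees(2)] pos_form_scale[OF degrees(3)]
      D_def N_def den_def num_def by (simp add: algebra_simps)
  thus ?thesis by (simp add: kD)
qed

lemma pos_flow_deriv:
  assumes s: "s \<in> {0..1}" and \<epsilon>: "norm \<epsilon> \<le> \<delta>" and v: "v \<in> cball 1 (r / 2)"
  shows "((\<lambda>s. pos s (ode.flow s \<epsilon> v)) has_vector_derivative vel s \<epsilon> (ode.flow s \<epsilon> v)) (at s within {0..1})"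
proof -
  have fl: "((\<lambda>s. ode.flow s \<epsilon> v) has_vector_derivative field (1 / R) s \<epsilon> (ode.flow s \<epsilon> v)) (at s within {0..1})"
    by (rule ode.flow_deriv) (use assms in auto)
  have Ef: "((\<lambda>s. E s * ode.flow s \<epsilon> v) has_vector_derivative
      E s * field (1 / R) s \<epsilon> (ode.flow s \<epsilon> v) + E' s * ode.flow s \<epsilon> v) (at s within {0..1})"
    by (rule has_vector_derivative_mult[OF E(1)[OF s] fl])
  have Efu: "((\<lambda>s. E s * ode.flow s \<epsilon> v * u s) has_vector_derivative E s * ode.flow s \<epsilon> v * u' s +
      (E s * field (1 / R) s \<epsilon> (ode.flow s \<epsilon> v) + E' s * ode.flow s \<epsilon> v) * u s) (at s within {0..1})"
    by (rule has_vector_derivative_mult[OF Ef u(1)[OF s]])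
  have "((\<lambda>s. (R * (E s * ode.flow s \<epsilon> v), R * (E s * ode.flow s \<epsilon> v * u s))) has_vector_derivative
      (R * (E s * field (1 / R) s \<epsilon> (ode.flow s \<epsilon> v) + E' s * ode.flow s \<epsilon> v),
       R * (E s * ode.flow s \<epsilon> v * u' s + (E s * field (1 / R) s \<epsilon> (ode.flow s \<epsilon> v) + E' s * ode.flow s \<epsilon> v) * u s))) (at s within {0..1})"
    by (intro has_vector_derivative_Pair has_vector_derivative_mult_right Ef Efu)
  thus ?thesis by (simp add: pos_def vel_def algebra_simps)
qed

lemma flow_in: "s \<in> {0..1} \<Longrightarrow> norm \<epsilon> \<le> \<delta> \<Longrightarrow> v \<in> cball 1 (r / 2) \<Longrightarrow> ode.flow s \<epsilon> v \<in> cball 1 r"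
  by (rule ode.flow_in) auto

lemma field_continuous:
  assumes "continuous_on A a" "continuous_on A b" "continuous_on A c"
    and "\<And>x. x \<in> A \<Longrightarrow> a x \<in> {0..1} \<and> norm (b x) \<le> \<delta> \<and> c x \<in> cball 1 r"
  shows "continuous_on A (\<lambda>x. field (1 / R) (a x) (b x) (c x))"
  by (rule ode.continuous_on_G) (use assms in auto)

lemma pos_continuous:
  assumes "continuous_on A a" "continuous_on A c" "a ` A \<subseteq> {0..1}"
  shows "continuous_on A (\<lambda>x. pos (a x) (c x))"
  unfolding pos_def
  by (intro continuous_intros assms continuous_on_compose2[OF cont_u assms(1,3)] continuous_on_compose2[OF cont_E assms(1,3)])

lemma vel_continuous:
  assumes "continuous_on A a" "continuous_on A b" "continuous_on A c"
    and "\<And>x. x \<in> A \<Longrightarrow> a x \<in> {0..1} \<and> norm (b x) \<le> \<delta> \<and> c x \<in> cball 1 r"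
  shows "continuous_on A (\<lambda>x. vel (a x) (b x) (c x))"
proof -
  have a: "a ` A \<subseteq> {0..1}" using assms by auto
  show ?thesis
    unfolding vel_def
    by (intro continuous_intros assms field_continuous continuous_on_compose2[OF cont_u assms(1) a]
        continuous_on_compose2[OF cont_E assms(1) a] continuous_on_compose2[OF u(2) assms(1) a]
        continuous_on_compose2[OF E(2) assms(1) a])
qed

lemma flow_continuous:
  assumes "continuous_on A a" "continuous_on A b" "continuous_on A c"
    and "\<And>x. x \<in> A \<Longrightarrow> a x \<in> {0..1} \<and> norm (b x) \<le> \<delta> \<and> c x \<in> cball 1 (r / 2)"
  shows "continuous_on A (\<lambda>x. ode.flow (a x) (b x) (c x))"
proof -
  have "continuous_on A ((\<lambda>(s, \<epsilon>, v). ode.flow s \<epsilon> v) \<circ> (\<lambda>x. (a x, b x, c x)))"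
    by (intro continuous_on_compose continuous_intros assms continuous_on_subset[OF ode.continuous_on_flow])
       (use assms(4) in auto)
  thus ?thesis by (simp add: o_def)
qed

text \<open>The integral is taken along the path lifted to a leaf for the parameter \<epsilon>; for
  \<epsilon> = 0 it is the integral over the loop in the fiber.\<close>

definition form_integral :: "one_form \<Rightarrow> complex \<Rightarrow> complex \<Rightarrow> complex" where
  "form_integral \<eta> \<epsilon> v = integral {0..1} (\<lambda>s. apply_form \<eta> (pos s (ode.flow s \<epsilon> v)) (vel s \<epsilon> (ode.flow s \<epsilon> v)))"

lemma form_continuous:
  assumes "continuous_on A a" "continuous_on A b" "continuous_on A c"
    and "\<And>x. x \<in> A \<Longrightarrow> a x \<in> {0..1} \<and> norm (b x) \<le> \<delta> \<and> c x \<in> cball 1 (r / 2)"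
  shows "continuous_on A (\<lambda>x. apply_form \<eta> (pos (a x) (ode.flow (a x) (b x) (c x))) (vel (a x) (b x) (ode.flow (a x) (b x) (c x))))"
proof -
  note fl = flow_continuous[OF assms]
  have i: "a x \<in> {0..1} \<and> norm (b x) \<le> \<delta> \<and> ode.flow (a x) (b x) (c x) \<in> cball 1 r" if "x \<in> A" for x
    using assms(4)[OF that] flow_in by blast
  have a: "a ` A \<subseteq> {0..1}" using assms by auto
  show ?thesis
    unfolding apply_form_def
    by (intro continuous_intros vel_continuous[OF assms(1,2) fl i] pos_continuous[OF assms(1) fl a])
qed

text \<open>On a leaf df = -\<epsilon>\<omega>, so integrating along the lifted path gives an
  identity that is exact in \<epsilon>, not just of first order.\<close>

lemma level_displacement:
  assumes \<epsilon>: "norm \<epsilon> \<le> \<delta>" and v: "v \<in> cball 1 (r / 2)"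
  shows "level (ode.flow 1 \<epsilon> v) - level v = - \<epsilon> * form_integral (P, Q) \<epsilon> v"
proof -
  let ?g = "\<lambda>s. pos s (ode.flow s \<epsilon> v)" and ?v = "\<lambda>s. vel s \<epsilon> (ode.flow s \<epsilon> v)"
  have d: "((\<lambda>s. bieval f (?g s)) has_vector_derivative - \<epsilon> * apply_form (P, Q) (?g s) (?v s)) (at s within {0..1})"
    if s: "s \<in> {0..1}" for s
  proof -
    have "((bieval f \<circ> ?g) has_vector_derivative apply_form (differential f) (?g s) (?v s)) (at s within {0..1})"
      by (rule vector_derivative_diff_chain_within[OF pos_flow_deriv[OF s \<epsilon> v] bieval_has_derivative])
    moreover have "apply_form (differential f) (?g s) (?v s) = - \<epsilon> * apply_form (P, Q) (?g s) (?v s)"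
      using leaf_equation[OF s \<epsilon> flow_in[OF s \<epsilon> v]] by (simp add: add_eq_0_iff2)
    ultimately show ?thesis by (simp add: o_def)
  qed
  have "((\<lambda>s. - \<epsilon> * apply_form (P, Q) (?g s) (?v s)) has_integral bieval f (?g 1) - bieval f (?g 0)) {0..1}"
    using d by (intro fundamental_theorem_of_calculus) auto
  hence "bieval f (?g 1) - bieval f (?g 0) = integral {0..1} (\<lambda>s. - \<epsilon> * apply_form (P, Q) (?g s) (?v s))"
    by (rule integral_unique[symmetric])
  also have "\<dots> = - \<epsilon> * form_integral (P, Q) \<epsilon> v" by (simp add: form_integral_def)
  finally have *: "bieval f (?g 1) - bieval f (?g 0) = - \<epsilon> * form_integral (P, Q) \<epsilon> v" .
  have "?g 1 = pos 0 (ode.flow 1 \<epsilon> v)" by (simp add: pos_def closed)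
  moreover have "ode.flow 0 \<epsilon> v = v" using assms by (intro ode.flow_0) auto
  ultimately show ?thesis using * by (simp add: level_def)
qed

lemma level_along_flow:
  assumes s: "s \<in> {0..1}" and v: "v \<in> cball 1 (r / 2)"
  shows "bieval f (pos s (ode.flow s 0 v)) = level v"
proof -
  let ?g = "\<lambda>s. pos s (ode.flow s 0 v)" and ?v = "\<lambda>s. vel s 0 (ode.flow s 0 v)"
  have \<epsilon>: "norm (0::complex) \<le> \<delta>" using \<delta> by simp
  have "((\<lambda>s. bieval f (?g s)) has_derivative (\<lambda>h. 0)) (at s within {0..1})" if s: "s \<in> {0..1}" for s
  proof -
    have "((bieval f \<circ> ?g) has_vector_derivative apply_form (differential f) (?g s) (?v s)) (at s within {0..1})"
      by (rule vector_derivative_diff_chain_within[OF pos_flow_deriv[OF s \<epsilon> v] bieval_has_derivative])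
    moreover have "apply_form (differential f) (?g s) (?v s) = 0"
      using leaf_equation[OF s \<epsilon> flow_in[OF s \<epsilon> v]] by simp
    ultimately show ?thesis by (simp add: o_def has_vector_derivative_def)
  qed
  hence "\<exists>c. \<forall>s\<in>{0..1}. bieval f (?g s) = c"
    by (intro has_derivative_zero_constant) auto
  then obtain c where "\<And>s. s \<in> {0..1} \<Longrightarrow> bieval f (?g s) = c" by blast
  from this[OF s] this[of 0] have "bieval f (?g s) = bieval f (?g 0)" by simp
  moreover have "ode.flow 0 0 v = v" using v \<delta> by (intro ode.flow_0) auto
  ultimately show ?thesis by (simp add: level_def)
qed

text \<open>For \<epsilon> = 0 the value of \<open>f\<close> is preserved, while \<open>u\<close>
  and \<open>E\<close> return to their initial values. Injectivity of \<open>f\<close> on the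
  transversal then forces \<open>v\<close> to return too.\<close>

lemma flow_closes:
  assumes v: "v \<in> cball 1 (r / 2)"
  shows "ode.flow 1 0 v = v"
proof -
  have "level (ode.flow 1 0 v) = level v"
    using level_along_flow[of 1 v] v by (simp add: level_def pos_def closed)
  moreover have "ode.flow 1 0 v \<in> cball 1 r" using v \<delta> by (intro flow_in) auto
  moreover have "v \<in> cball 1 r" using v half_subset by blast
  ultimately show ?thesis using inj_onD[OF level_inj] by blast
qed

lemma section_eq: "t \<in> T \<Longrightarrow> bieval f (\<sigma> t) = t"
  using coord(2) by (simp add: \<sigma>_def level_def)

sublocale transversal_setup f "(P, Q)" T \<sigma>
  by unfold_locales (auto intro: T_open section_eq)

lemma transversal_\<sigma>: "transversal f T \<sigma>"
  unfolding transversal_def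
  by (auto simp: \<sigma>_def[abs_def] pos_def o_def section_eq[unfolded \<sigma>_def[abs_def] pos_def] intro!: holomorphic_intros coord_holomorphic)

lemma \<gamma>_valid_path:
  assumes \<epsilon>: "norm \<epsilon> \<le> \<delta>" and t: "t \<in> T"
  shows "valid_path (\<gamma> \<epsilon> t)"
proof -
  note v = coord_in[OF t]
  have d: "(\<gamma> \<epsilon> t has_vector_derivative vel s \<epsilon> (ode.flow s \<epsilon> (coord t))) (at s within {0..1})" if "s \<in> {0..1}" for s
    unfolding \<gamma>_def[abs_def] by (rule pos_flow_deriv[OF that \<epsilon> v])
  have "continuous_on {0..1} (\<gamma> \<epsilon> t)"
    unfolding continuous_on_eq_continuous_within using d has_vector_derivative_continuous by blast
  \<comment> \<open>The endpoints are treated as corners: only one-sided derivatives are known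
    there.\<close>
  moreover have "\<gamma> \<epsilon> t C1_differentiable_on {0..1} - {0, 1}"
    unfolding C1_differentiable_on_def
  proof (intro exI[of _ "\<lambda>s. vel s \<epsilon> (ode.flow s \<epsilon> (coord t))"] conjI ballI)
    fix s :: real assume s: "s \<in> {0..1} - {0, 1}"
    have "at s within {0..1} = at s" using s by (intro at_within_interior) auto
    thus "(\<gamma> \<epsilon> t has_vector_derivative vel s \<epsilon> (ode.flow s \<epsilon> (coord t))) (at s)" using d[of s] s by auto
  next
    have "continuous_on {0..1} (\<lambda>s. vel s \<epsilon> (ode.flow s \<epsilon> (coord t)))"
      using \<epsilon> v flow_in by (intro vel_continuous flow_continuous continuous_intros) auto
    thus "continuous_on ({0..1} - {0, 1}) (\<lambda>s. vel s \<epsilon> (ode.flow s \<epsilon> (coord t)))"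
      by (rule continuous_on_subset) auto
  qed
  ultimately show ?thesis
    unfolding valid_path_def piecewise_C1_differentiable_on_def by (meson finite.emptyI finite_insert)
qed

lemma \<gamma>_leaf_path:
  assumes \<epsilon>: "norm \<epsilon> \<le> \<delta>" and t: "t \<in> T"
  shows "leaf_path f (P, Q) \<epsilon> (\<gamma> \<epsilon> t)"
  unfolding leaf_path_def
proof (intro conjI ballI allI impI \<gamma>_valid_path[OF \<epsilon> t])
  fix s :: real and v assume s: "s \<in> {0..1}" and v: "(\<gamma> \<epsilon> t has_vector_derivative v) (at s within {0..1})"
  note c = coord_in[OF t]
  have "(\<gamma> \<epsilon> t has_vector_derivative vel s \<epsilon> (ode.flow s \<epsilon> (coord t))) (at s within {0..1})"
    unfolding \<gamma>_def[abs_def] by (rule pos_flow_deriv[OF s \<epsilon> c])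
  hence "v = vel s \<epsilon> (ode.flow s \<epsilon> (coord t))"
    by (rule vector_derivative_unique_within_closed_interval[of 0 1 s, unfolded cbox_interval, OF zero_less_one s v])
  thus "apply_form (differential f) (\<gamma> \<epsilon> t s) v + \<epsilon> * apply_form (P, Q) (\<gamma> \<epsilon> t s) v = 0"
    using leaf_equation[OF s \<epsilon> flow_in[OF s \<epsilon> c]] by (simp add: \<gamma>_def)
qed

lemma coord_continuous: "continuous_on T coord"
  by (rule holomorphic_on_imp_continuous_on[OF coord_holomorphic])

lemma W_open: "open W"
proof -
  let ?U = "ball (0::complex) \<delta> \<times> T"
  have "continuous_on ?U (\<lambda>x. ode.flow 1 (fst x) (coord (snd x)))"
    using coord_in
    by (intro flow_continuous continuous_intros continuous_on_compose2[OF coord_continuous]) auto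
  hence "open (?U \<inter> (\<lambda>x. ode.flow 1 (fst x) (coord (snd x))) -` B)"
    using B(1) T_open by (intro continuous_open_preimage open_Times) auto
  moreover have "?U \<inter> (\<lambda>x. ode.flow 1 (fst x) (coord (snd x))) -` B = W" by (auto simp: W_def)
  ultimately show ?thesis by simp
qed

lemma holonomy_data_loop: "holonomy_data f (P, Q) T \<sigma> W \<gamma> loop hol_map"
  unfolding holonomy_data_def
proof (intro conjI)
  show "{0} \<times> T \<subseteq> W"
    using \<delta> coord(1) flow_closes[OF coord_in] by (auto simp: W_def)
  show "continuous_on (W \<times> {0..1}) (\<lambda>((\<epsilon>, t), s). \<gamma> \<epsilon> t s)"
    unfolding case_prod_unfold \<gamma>_def
    by (intro pos_continuous flow_continuous continuous_intros continuous_on_compose2[OF coord_continuous])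
       (use coord_in in \<open>auto simp: W_def\<close>)
  show "\<forall>t\<in>T. \<forall>s\<in>{0..1}. \<gamma> 0 t s = loop t s" by (simp add: loop_def)
  show "\<forall>t\<in>T. pathfinish (loop t) = \<sigma> t"
    by (simp add: loop_def \<gamma>_def pathfinish_def flow_closes[OF coord_in] \<sigma>_def pos_def closed)
  show "\<forall>(\<epsilon>, t)\<in>W. t \<in> T \<and> hol_map \<epsilon> t \<in> T \<and> leaf_path f (P, Q) \<epsilon> (\<gamma> \<epsilon> t) \<and>
      pathstart (\<gamma> \<epsilon> t) = \<sigma> t \<and> pathfinish (\<gamma> \<epsilon> t) = \<sigma> (hol_map \<epsilon> t)"
  proof (clarify)
    fix \<epsilon> t assume "(\<epsilon>, t) \<in> W"
    hence W: "norm \<epsilon> \<le> \<delta>" "t \<in> T" "ode.flow 1 \<epsilon> (coord t) \<in> B" by (auto simp: W_def)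
    have "ode.flow 0 \<epsilon> (coord t) = coord t" using W coord_in by (intro ode.flow_0) auto
    thus "t \<in> T \<and> hol_map \<epsilon> t \<in> T \<and> leaf_path f (P, Q) \<epsilon> (\<gamma> \<epsilon> t) \<and>
        pathstart (\<gamma> \<epsilon> t) = \<sigma> t \<and> pathfinish (\<gamma> \<epsilon> t) = \<sigma> (hol_map \<epsilon> t)"
      using W \<gamma>_leaf_path[OF W(1,2)] coord(3)[OF W(3)]
      by (auto simp: hol_map_def T_def \<gamma>_def pathstart_def pathfinish_def \<sigma>_def pos_def closed)
  qed
  show "curve_holomorphic W hol_map"
    unfolding curve_holomorphic_def
  proof (intro allI impI)
    fix D e \<tau> assume D: "open D" "e holomorphic_on D" "\<tau> holomorphic_on D" "\<forall>\<zeta>\<in>D. (e \<zeta>, \<tau> \<zeta>) \<in> W"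
    have "\<tau> ` D \<subseteq> T" using D(4) by (auto simp: W_def)
    hence c: "(\<lambda>\<zeta>. coord (\<tau> \<zeta>)) holomorphic_on D"
      using holomorphic_on_compose_gen[OF D(3) coord_holomorphic] by (simp add: o_def)
    have "(\<lambda>\<zeta>. ode.flow 1 (e \<zeta>) (coord (\<tau> \<zeta>))) holomorphic_on D"
      by (rule ode.flow_holomorphic[OF D(1,2) c]) (use D(4) coord_in in \<open>auto simp: W_def\<close>)
    from holomorphic_on_compose[OF this level_holomorphic]
    show "(\<lambda>\<zeta>. hol_map (e \<zeta>) (\<tau> \<zeta>)) holomorphic_on D" by (simp add: o_def hol_map_def)
  qed
qed (rule W_open)

lemma loop_in_fiber: "t \<in> T \<Longrightarrow> loop t \<in> loops_at (fiber f t) (\<sigma> t)"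
proof -
  assume t: "t \<in> T"
  have "path (loop t)" unfolding loop_def using \<delta> t by (intro valid_path_imp_path \<gamma>_valid_path) auto
  moreover have "path_image (loop t) \<subseteq> fiber f t"
    using level_along_flow[OF _ coord_in[OF t]] coord(2)[OF t] by (auto simp: path_image_def fiber_def loop_def \<gamma>_def)
  moreover have "ode.flow 0 0 (coord t) = coord t" using t coord_in \<delta> by (intro ode.flow_0) auto
  ultimately show ?thesis
    using flow_closes[OF coord_in[OF t]]
    by (simp add: loops_at_def loop_def \<gamma>_def pathstart_def pathfinish_def \<sigma>_def pos_def closed)
qed

lemma loop_deriv:
  assumes t: "t \<in> T" and s: "s \<in> {0..1}"
  shows "(loop t has_vector_derivative vel s 0 (ode.flow s 0 (coord t))) (at s within {0..1})"
  unfolding loop_def \<gamma>_def[abs_def] by (rule pos_flow_deriv[OF s _ coord_in[OF t]]) (use \<delta> in simp)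

text \<open>By the exact displacement formula the rescaled displacement is minus the form integral,
  which is jointly continuous in (\<epsilon>, t), also at \<epsilon> = 0.\<close>

lemma displacement_order_loop: "displacement_order T hol_map 1 (\<lambda>t. - form_integral (P, Q) 0 (coord t))"
  unfolding displacement_order_def
proof
  fix t0 assume t0: "t0 \<in> T"
  let ?U = "ball (0::complex) \<delta> \<times> T"
  let ?I = "\<lambda>x. form_integral (P, Q) (fst x) (coord (snd x))"
  have "continuous_on (?U \<times> cbox 0 (1::real)) (\<lambda>(x, s). apply_form (P, Q) (pos s (ode.flow s (fst x) (coord (snd x))))
      (vel s (fst x) (ode.flow s (fst x) (coord (snd x)))))"
    unfolding case_prod_unfold
    by (intro form_continuous continuous_intros continuous_on_compose2[OF coord_continuous]) (use coord_in in auto)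
  from integral_continuous_on_param[OF this] have "continuous_on ?U ?I"
    by (simp add: form_integral_def)
  moreover have "open ?U" using T_open by (intro open_Times) auto
  moreover have "(0, t0) \<in> ?U" using t0 \<delta> by simp
  ultimately have "isCont ?I (0, t0)" by (meson continuous_on_eq_continuous_at)
  hence "(?I \<longlongrightarrow> ?I (0, t0)) (nhds (0, t0))" by (rule tendsto_at_iff_tendsto_nhds[THEN iffD1, OF iffD1[OF isCont_def]])
  hence "(?I \<longlongrightarrow> ?I (0, t0)) (punctured_nhds t0)" by (rule filterlim_mono[OF _ order_refl punctured_nhds_le])
  hence lim: "((\<lambda>x. - ?I x) \<longlongrightarrow> - form_integral (P, Q) 0 (coord t0)) (punctured_nhds t0)"
    by (intro tendsto_minus) simp
  have ne0: "\<forall>\<^sub>F x in punctured_nhds t0. fst x \<noteq> 0"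
    using eventually_compose_filterlim[OF _ filterlim_fst_punctured_nhds, of "\<lambda>\<epsilon>. \<epsilon> \<noteq> 0"]
    by (simp add: eventually_at_filter)
  have "\<forall>\<^sub>F x in nhds (0, t0). x \<in> ?U" using \<open>open ?U\<close> \<open>(0, t0) \<in> ?U\<close> by (rule eventually_nhds_in_open)
  hence "\<forall>\<^sub>F x in punctured_nhds t0. x \<in> ?U" by (rule filter_leD[OF punctured_nhds_le])
  with ne0 have "\<forall>\<^sub>F x in punctured_nhds t0. - ?I x = (hol_map (fst x) (snd x) - snd x) / fst x ^ 1"
  proof eventually_elim
    case (elim x)
    hence x: "norm (fst x) \<le> \<delta>" "snd x \<in> T" by auto
    have "hol_map (fst x) (snd x) - snd x = - fst x * ?I x"
      using level_displacement[OF x(1) coord_in[OF x(2)]] coord(2)[OF x(2)] by (simp add: hol_map_def)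
    thus ?case using elim(1) by simp
  qed
  from Lim_transform_eventually[OF lim this]
  show "((\<lambda>x. (hol_map (fst x) (snd x) - snd x) / fst x ^ 1) \<longlongrightarrow> - form_integral (P, Q) 0 (coord t0)) (punctured_nhds t0)" .
qed

end

section \<open>Sheets and power sums\<close>

context flow_data
begin

lemma reverse_derivs:
  assumes s: "s \<in> {0..1}"
  shows "((\<lambda>s. u (1 - s)) has_vector_derivative - u' (1 - s)) (at s within {0..1})"
    and "((\<lambda>s. E (1 - s)) has_vector_derivative - E' (1 - s)) (at s within {0..1})"
proof -
  have img: "(\<lambda>s. 1 - s) ` {0..1} = {0..1::real}" by (auto simp: image_iff intro!: bexI[of _ "1 - _"])
  have 1: "((\<lambda>s. 1 - s) has_vector_derivative - 1) (at s within {0..1::real})"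
    by (auto intro!: derivative_eq_intros)
  have s': "1 - s \<in> {0..1}" using s by auto
  have "(u has_vector_derivative u' (1 - s)) (at (1 - s) within (\<lambda>s. 1 - s) ` {0..1})"
    unfolding img by (rule u(1)[OF s'])
  from vector_diff_chain_within[OF 1 this] show "((\<lambda>s. u (1 - s)) has_vector_derivative - u' (1 - s)) (at s within {0..1})"
    by (simp add: o_def)
  have "(E has_vector_derivative E' (1 - s)) (at (1 - s) within (\<lambda>s. 1 - s) ` {0..1})"
    unfolding img by (rule E(1)[OF s'])
  from vector_diff_chain_within[OF 1 this] show "((\<lambda>s. E (1 - s)) has_vector_derivative - E' (1 - s)) (at s within {0..1})"
    by (simp add: o_def)
qed

lemma reverse_loop_data: "loop_data n f P Q (\<lambda>s. u (1 - s)) (\<lambda>s. E (1 - s)) (\<lambda>s. - u' (1 - s)) (\<lambda>s. - E' (1 - s))"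
proof
  show "continuous_on {0..1} (\<lambda>s. - u' (1 - s))" "continuous_on {0..1} (\<lambda>s. - E' (1 - s))"
    by (intro continuous_intros continuous_on_compose2[OF u(2)] continuous_on_compose2[OF E(2)]; auto)+
qed (use degrees reverse_derivs E_root closed in auto)

lemma reverse_field:
  "loop_data.field n f P Q (\<lambda>s. u (1 - s)) (\<lambda>s. E (1 - s)) (\<lambda>s. - u' (1 - s)) (\<lambda>s. - E' (1 - s)) \<tau> =
    (\<lambda>s \<epsilon> v. - field \<tau> (1 - s) \<epsilon> v)"
proof -
  interpret rl: loop_data n f P Q "\<lambda>s. u (1 - s)" "\<lambda>s. E (1 - s)" "\<lambda>s. - u' (1 - s)" "\<lambda>s. - E' (1 - s)"
    by (rule reverse_loop_data)
  have "rl.num \<tau> s \<epsilon> v = num \<tau> (1 - s) \<epsilon> v" "rl.den \<tau> s \<epsilon> v = den \<tau> (1 - s) \<epsilon> v" for s \<epsilon> v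
    by (simp_all add: rl.num_def num_def rl.den_def den_def)
  thus ?thesis
    by (intro ext) (simp add: rl.field_def field_def algebra_simps)
qed

lemma reverse_flow_data: "flow_data n f P Q (\<lambda>s. u (1 - s)) (\<lambda>s. E (1 - s)) (\<lambda>s. - u' (1 - s)) (\<lambda>s. - E' (1 - s)) R r \<delta> B"
proof -
  interpret rl: loop_data n f P Q "\<lambda>s. u (1 - s)" "\<lambda>s. E (1 - s)" "\<lambda>s. - u' (1 - s)" "\<lambda>s. - E' (1 - s)"
    by (rule reverse_loop_data)
  show ?thesis
  proof (intro flow_data.intro flow_data_axioms.intro reverse_loop_data)
    show "contraction_ode (rl.field (1 / R)) 1 r \<delta>"
      unfolding reverse_field by (rule contraction_ode_reverse[OF ode])
    show "rl.den (1 / R) s \<epsilon> v \<noteq> 0" if "s \<in> {0..1}" "norm \<epsilon> \<le> \<delta>" "v \<in> cball 1 r" for s \<epsilon> v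
      using den_nz[of "1 - s" \<epsilon> v] that by (simp add: rl.den_def den_def)
    show "inj_on (\<lambda>v. bieval f (R * (E (1 - 0) * v), R * (E (1 - 0) * v * u (1 - 0)))) (cball 1 r)"
      using inj by (simp add: closed)
  qed (use R B in auto)
qed

text \<open>Base points and levels depend on the path only through \<open>u 0\<close> and
  \<open>E 0\<close>. This identifies the transversals of a loop and its reverse, and later those
  over two touching circles.\<close>

lemma same_section:
  assumes "flow_data n f P Q u2 E2 u2' E2' R r \<delta>2 B" and "u2 0 = u 0" "E2 0 = E 0"
  shows "flow_data.level f u2 E2 R = level" "flow_data.T f u2 E2 R B = T"
    "flow_data.coord f u2 E2 R B = coord" "flow_data.\<sigma> f u2 E2 R B = \<sigma>"
proof -
  interpret L2: flow_data n f P Q u2 E2 u2' E2' R r \<delta>2 B by fact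
  show level: "L2.level = level"
    by (intro ext) (simp add: L2.level_def level_def L2.pos_def pos_def assms)
  show "L2.T = T" and coord: "L2.coord = coord"
    by (simp_all add: L2.coord_def coord_def L2.T_def T_def level)
  show "L2.\<sigma> = \<sigma>"
    by (intro ext) (simp add: L2.\<sigma>_def \<sigma>_def coord L2.pos_def pos_def assms)
qed

text \<open>The reversed functions \<open>u\<close>, \<open>E\<close> are loop data for the same
  transversal, and their flow undoes the original one wherever both stay in the domain. Both inverse
  relations are recorded because the germ is inverted again inside commutators.\<close>

lemma reversed_loop_holonomy:
  obtains W' \<gamma>' h' where "holonomy_data f (P, Q) T \<sigma> W' \<gamma>' (\<lambda>t. reversepath (loop t)) h'"
    "inverse_germ T hol_map h'" "inverse_germ T h' hol_map"
proof -
  interpret rev: flow_data n f P Q "\<lambda>s. u (1 - s)" "\<lambda>s. E (1 - s)" "\<lambda>s. - u' (1 - s)" "\<lambda>s. - E' (1 - s)" R r \<delta> B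
    by (rule reverse_flow_data)
  note same = same_section[OF reverse_flow_data]
  have level: "rev.level = level" and coord_eq: "rev.coord = coord" and T_eq: "rev.T = T" and \<sigma>_eq: "rev.\<sigma> = \<sigma>"
    by (rule same; simp add: closed)+
  have flow1: "rev.ode.flow s \<epsilon> (ode.flow 1 \<epsilon> v) = ode.flow (1 - s) \<epsilon> v"
    if "s \<in> {0..1}" "norm \<epsilon> \<le> \<delta>" "v \<in> cball 1 (r / 2)" "ode.flow 1 \<epsilon> v \<in> cball 1 (r / 2)" for s \<epsilon> v
    unfolding reverse_field by (rule flow_reverse[OF ode]) (use that in auto)
  have rr: "(\<lambda>s \<epsilon> v. - rev.field (1 / R) (1 - s) \<epsilon> v) = field (1 / R)"
    by (intro ext) (simp add: reverse_field)
  have flow2: "ode.flow s \<epsilon> (rev.ode.flow 1 \<epsilon> v) = rev.ode.flow (1 - s) \<epsilon> v"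
    if "s \<in> {0..1}" "norm \<epsilon> \<le> \<delta>" "v \<in> cball 1 (r / 2)" "rev.ode.flow 1 \<epsilon> v \<in> cball 1 (r / 2)" for s \<epsilon> v
    using flow_reverse[OF rev.ode that(1) _ that(3,4)] that(2) unfolding rr by simp
  have loop_rev: "rev.loop t s = reversepath (loop t) s" if "t \<in> T" "s \<in> {0..1}" for t s
    using flow1[of s 0 "coord t"] that coord_in[OF that(1)] flow_closes[OF coord_in[OF that(1)]] \<delta>
    by (simp add: rev.loop_def loop_def rev.\<gamma>_def \<gamma>_def coord_eq rev.pos_def pos_def reversepath_def)
  have hd: "holonomy_data f (P, Q) T \<sigma> rev.W rev.\<gamma> rev.loop rev.hol_map"
    using rev.holonomy_data_loop unfolding T_eq \<sigma>_eq .
  have fin: "pathfinish (reversepath (loop t)) = \<sigma> t" if "t \<in> T" for t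
    using loop_in_fiber[OF that] by (simp add: loops_at_def)
  have rl0: "rev.\<gamma> 0 t s = reversepath (loop t) s" if "t \<in> T" "s \<in> {0..1}" for t s
    using loop_rev[OF that] by (simp add: rev.loop_def)
  have hd': "holonomy_data f (P, Q) T \<sigma> rev.W rev.\<gamma> (\<lambda>t. reversepath (loop t)) rev.hol_map"
    using hd fin rl0 unfolding holonomy_data_def by simp
  have inv1: "rev.hol_map \<epsilon> (hol_map \<epsilon> t) = t" if "(\<epsilon>, t) \<in> W" for \<epsilon> t
  proof -
    have w: "norm \<epsilon> \<le> \<delta>" "t \<in> T" "ode.flow 1 \<epsilon> (coord t) \<in> B" using that by (auto simp: W_def)
    have "ode.flow 0 \<epsilon> (coord t) = coord t" using w coord_in by (intro ode.flow_0) auto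
    moreover have "ode.flow 1 \<epsilon> (coord t) \<in> cball 1 (r / 2)" using w(3) B(4) by blast
    ultimately show ?thesis
      using flow1[of 1 \<epsilon> "coord t"] w coord_in[OF w(2)] coord(2)[OF w(2)] coord(3)[OF w(3)]
      by (simp add: rev.hol_map_def hol_map_def coord_eq level)
  qed
  have inv2: "hol_map \<epsilon> (rev.hol_map \<epsilon> t) = t" if "(\<epsilon>, t) \<in> rev.W" for \<epsilon> t
  proof -
    have w: "norm \<epsilon> \<le> \<delta>" "t \<in> T" "rev.ode.flow 1 \<epsilon> (coord t) \<in> B" using that by (auto simp: rev.W_def T_eq coord_eq)
    have "rev.ode.flow 0 \<epsilon> (coord t) = coord t" using w coord_in by (intro rev.ode.flow_0) auto
    moreover have "rev.ode.flow 1 \<epsilon> (coord t) \<in> cball 1 (r / 2)" using w(3) B(4) by blast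
    ultimately show ?thesis
      using flow2[of 1 \<epsilon> "coord t"] w coord_in[OF w(2)] coord(2)[OF w(2)] coord(3)[OF w(3)]
      by (simp add: rev.hol_map_def hol_map_def coord_eq level)
  qed
  have germ: "\<forall>\<^sub>F x in nhds (0, t0). x \<in> X" if "open X" "{0} \<times> T \<subseteq> X" "t0 \<in> T" for X :: "(complex \<times> complex) set" and t0
    by (rule eventually_nhds_in_open) (use that in auto)
  have sub: "{0} \<times> T \<subseteq> W" "{0} \<times> T \<subseteq> rev.W"
    using holonomy_data_loop hd unfolding holonomy_data_def by blast+
  have "inverse_germ T hol_map rev.hol_map"
    unfolding inverse_germ_def
  proof
    fix t0 assume "t0 \<in> T"
    from germ[OF rev.W_open sub(2) this]
    show "\<forall>\<^sub>F x in nhds (0, t0). hol_map (fst x) (rev.hol_map (fst x) (snd x)) = snd x"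
      by eventually_elim (simp add: inv2)
  qed
  moreover have "inverse_germ T rev.hol_map hol_map"
    unfolding inverse_germ_def
  proof
    fix t0 assume "t0 \<in> T"
    from germ[OF W_open sub(1) this]
    show "\<forall>\<^sub>F x in nhds (0, t0). rev.hol_map (fst x) (hol_map (fst x) (snd x)) = snd x"
      by eventually_elim (simp add: inv1)
  qed
  ultimately show ?thesis using that hd' by blast
qed

end

section \<open>One-forms modulo exact forms in the coordinates x, u\<close>

definition reduced_form :: "(nat \<Rightarrow> nat \<Rightarrow> complex) \<Rightarrow> (nat \<Rightarrow> nat \<Rightarrow> complex) \<Rightarrow> nat \<Rightarrow> complex \<Rightarrow> complex" where
  "reduced_form CP CQ j u = slope_poly CQ j u -
    (slope_poly' CP j u + slope_poly CQ j u + u * slope_poly' CQ j u) / of_nat (Suc j)"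

lemma scale_sum_quotient:
  "(c::complex) \<noteq> 0 \<Longrightarrow> (X * (w * a') + x' * (c * p) * a) / c = p * a * x' + X * (a' / c) * w"
  by (simp add: field_simps)

text \<open>\<open>P dx + Q dy\<close> differs from \<open>\<Sum>\<^sub>j x\<^sup>j\<^sup>+\<^sup>1 r\<^sub>j(u) du\<close>, with \<open>r\<^sub>j\<close> the reduced form, by the differential of
  \<open>\<Sum>\<^sub>j x\<^sup>j\<^sup>+\<^sup>1 (P\<^sub>j + u Q\<^sub>j) / (j+1)\<close>.\<close>

lemma (in flow_data) form_integral_reduced:
  assumes \<eta>: "total_degree_le P' n" "total_degree_le Q' n" and v: "v \<in> cball 1 (r / 2)"
  shows "form_integral (P', Q') 0 v = integral {0..1}
    (\<lambda>s. \<Sum>j\<le>n. (R * (E s * ode.flow s 0 v)) ^ Suc j * reduced_form (bicoeff P') (bicoeff Q') j (u s) * u' s)"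
proof -
  let ?x = "\<lambda>s. R * (E s * ode.flow s 0 v)" and ?x' = "\<lambda>s. fst (vel s 0 (ode.flow s 0 v))"
  let ?p = "slope_poly (bicoeff P')" and ?q = "slope_poly (bicoeff Q')"
  let ?p' = "slope_poly' (bicoeff P')" and ?q' = "slope_poly' (bicoeff Q')"
  let ?a = "\<lambda>j u. ?p j u + u * ?q j u" and ?a' = "\<lambda>j u. ?p' j u + (?q j u + u * ?q' j u)"
  let ?red = "reduced_form (bicoeff P') (bicoeff Q')"
  define S where "S = (\<lambda>s. \<Sum>j\<le>n. ?x s ^ Suc j * ?a j (u s) / of_nat (Suc j))"
  have \<epsilon>: "norm (0::complex) \<le> \<delta>" using \<delta> by simp
  have x': "(?x has_vector_derivative ?x' s) (at s within {0..1})" if s: "s \<in> {0..1}" for s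
  proof -
    have "((fst \<circ> (\<lambda>s. pos s (ode.flow s 0 v))) has_vector_derivative ?x' s) (at s within {0..1})"
      by (rule vector_derivative_diff_chain_within[OF pos_flow_deriv[OF s \<epsilon> v]])
         (intro bounded_linear_imp_has_derivative bounded_linear_fst)
    thus ?thesis by (simp add: o_def pos_def)
  qed
  have apply_eq: "apply_form (P', Q') (pos s (ode.flow s 0 v)) (vel s 0 (ode.flow s 0 v)) =
      (\<Sum>j\<le>n. ?x s ^ j * ?a j (u s) * ?x' s + ?x s ^ Suc j * ?q j (u s) * u' s)" for s
  proof -
    have pos: "pos s (ode.flow s 0 v) = (?x s, ?x s * u s)" by (simp add: pos_def mult.assoc)
    have vel: "vel s 0 (ode.flow s 0 v) = (?x' s, ?x' s * u s + ?x s * u' s)"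
      by (simp add: vel_def algebra_simps)
    have "apply_form (P', Q') (pos s (ode.flow s 0 v)) (vel s 0 (ode.flow s 0 v)) =
        (\<Sum>j\<le>n. ?x s ^ j * ?p j (u s)) * ?x' s + (\<Sum>j\<le>n. ?x s ^ j * ?q j (u s)) * (?x' s * u s + ?x s * u' s)"
      unfolding apply_form_def fst_conv snd_conv pos bieval_eq_homogeneous_parts[OF \<eta>(1)]
        bieval_eq_homogeneous_parts[OF \<eta>(2)] homogeneous_part_slope by (subst (1 2) vel) simp
    also have "\<dots> = (\<Sum>j\<le>n. ?x s ^ j * ?a j (u s) * ?x' s + ?x s ^ Suc j * ?q j (u s) * u' s)"
      unfolding sum_distrib_right sum.distrib[symmetric] by (intro sum.cong refl) (simp add: algebra_simps)
    finally show ?thesis .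
  qed
  have S': "(S has_vector_derivative (\<Sum>j\<le>n. ?x s ^ j * ?a j (u s) * ?x' s + ?x s ^ Suc j * (?a' j (u s) / of_nat (Suc j)) * u' s))
      (at s within {0..1})" if s: "s \<in> {0..1}" for s
    unfolding S_def
  proof (rule has_vector_derivative_sum)
    fix j
    have xj: "((\<lambda>s. ?x s ^ Suc j) has_vector_derivative ?x' s * (of_nat (Suc j) * ?x s ^ j)) (at s within {0..1})"
    proof -
      have "((\<lambda>w. w ^ Suc j) has_field_derivative of_nat (Suc j) * ?x s ^ j) (at (?x s) within ?x ` {0..1})"
        by (rule derivative_eq_intros refl | simp)+
      from field_vector_diff_chain_within[OF x'[OF s] this] show ?thesis by (simp add: o_def)
    qed
    have "(?a j has_field_derivative ?a' j (u s)) (at (u s))"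
      by (rule derivative_eq_intros slope_poly_deriv refl | simp)+
    from field_vector_diff_chain_within[OF u(1)[OF s] has_field_derivative_at_within[OF this]]
    have aj: "((\<lambda>s. ?a j (u s)) has_vector_derivative u' s * ?a' j (u s)) (at s within {0..1})" by (simp add: o_def)
    have "((\<lambda>s. ?x s ^ Suc j * ?a j (u s) / of_nat (Suc j)) has_vector_derivative
        (?x s ^ Suc j * (u' s * ?a' j (u s)) + ?x' s * (of_nat (Suc j) * ?x s ^ j) * ?a j (u s)) / of_nat (Suc j)) (at s within {0..1})"
      using has_vector_derivative_mult_left[OF has_vector_derivative_mult[OF xj aj], of "inverse (of_nat (Suc j))"]
      by (simp only: divide_inverse)
    moreover have "(of_nat (Suc j) :: complex) \<noteq> 0" by (simp del: of_nat_Suc)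
    hence "(?x s ^ Suc j * (u' s * ?a' j (u s)) + ?x' s * (of_nat (Suc j) * ?x s ^ j) * ?a j (u s)) / of_nat (Suc j) =
        ?x s ^ j * ?a j (u s) * ?x' s + ?x s ^ Suc j * (?a' j (u s) / of_nat (Suc j)) * u' s"
      by (rule scale_sum_quotient)
    ultimately show "((\<lambda>s. ?x s ^ Suc j * ?a j (u s) / of_nat (Suc j)) has_vector_derivative
        ?x s ^ j * ?a j (u s) * ?x' s + ?x s ^ Suc j * (?a' j (u s) / of_nat (Suc j)) * u' s) (at s within {0..1})"
      by simp
  qed
  have "((\<lambda>s. \<Sum>j\<le>n. ?x s ^ j * ?a j (u s) * ?x' s + ?x s ^ Suc j * (?a' j (u s) / of_nat (Suc j)) * u' s) has_integral S 1 - S 0) {0..1}"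
    using S' by (intro fundamental_theorem_of_calculus) auto
  \<comment> \<open>The loop closes up, so the exact part contributes nothing.\<close>
  moreover have "S 1 = S 0"
  proof -
    have "ode.flow 0 0 v = v" using v \<delta> by (intro ode.flow_0) auto
    thus ?thesis by (simp add: S_def closed flow_closes[OF v])
  qed
  ultimately have exact: "((\<lambda>s. \<Sum>j\<le>n. ?x s ^ j * ?a j (u s) * ?x' s + ?x s ^ Suc j * (?a' j (u s) / of_nat (Suc j)) * u' s) has_integral 0) {0..1}"
    by simp
  have "continuous_on {0..1} (\<lambda>s. apply_form (P', Q') (pos s (ode.flow s 0 v)) (vel s 0 (ode.flow s 0 v)))"
    by (intro form_continuous continuous_intros) (use \<epsilon> v in auto)
  hence "((\<lambda>s. apply_form (P', Q') (pos s (ode.flow s 0 v)) (vel s 0 (ode.flow s 0 v))) has_integral form_integral (P', Q') 0 v) {0..1}"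
    unfolding form_integral_def by (intro integrable_integral integrable_continuous_real)
  from has_integral_diff[OF this exact]
  have "((\<lambda>s. (\<Sum>j\<le>n. ?x s ^ j * ?a j (u s) * ?x' s + ?x s ^ Suc j * ?q j (u s) * u' s) -
      (\<Sum>j\<le>n. ?x s ^ j * ?a j (u s) * ?x' s + ?x s ^ Suc j * (?a' j (u s) / of_nat (Suc j)) * u' s)) has_integral
      form_integral (P', Q') 0 v) {0..1}"
    unfolding apply_eq by simp
  moreover have "(\<Sum>j\<le>n. ?x s ^ j * ?a j (u s) * ?x' s + ?x s ^ Suc j * ?q j (u s) * u' s) -
      (\<Sum>j\<le>n. ?x s ^ j * ?a j (u s) * ?x' s + ?x s ^ Suc j * (?a' j (u s) / of_nat (Suc j)) * u' s) =
      (\<Sum>j\<le>n. ?x s ^ Suc j * ?red j (u s) * u' s)" for s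
    unfolding sum_subtractf[symmetric] reduced_form_def
    by (intro sum.cong refl) (simp add: algebra_simps add_divide_distrib del: of_nat_Suc power_Suc)
  ultimately show ?thesis by (simp add: integral_unique)
qed

text \<open>Newton's identities express the power sums of the roots of \<open>\<Sum>\<^sub>l e(N - l) x\<^sup>l\<close>, where \<open>e 0 = 1\<close>.\<close>

function newton_sum :: "(nat \<Rightarrow> complex) \<Rightarrow> nat \<Rightarrow> complex" where
  "newton_sum e m = - (of_nat m * e m + (\<Sum>i\<in>{..m}. if 1 \<le> i \<and> i < m then e i * newton_sum e (m - i) else 0))"
  by pat_completeness auto
termination by (relation "Wellfounded.measure snd") auto

declare newton_sum.simps [simp del]

lemma newton_sum_cong:
  "(\<And>i. 1 \<le> i \<Longrightarrow> i \<le> m \<Longrightarrow> e i = e' i) \<Longrightarrow> newton_sum e m = newton_sum e' m"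
proof (induction m rule: less_induct)
  case (less m)
  have "of_nat m * e m = of_nat m * e' m" using less.prems by (cases m) auto
  moreover have "e i * newton_sum e (m - i) = e' i * newton_sum e' (m - i)" if "1 \<le> i" "i < m" for i
    using less.IH[of "m - i"] less.prems that by auto
  ultimately show ?case by (subst (1 2) newton_sum.simps) (auto intro!: sum.cong)
qed

text \<open>The coefficient e m enters the recursion only through the term m e(m). Since t occurs
  only in the constant coefficient of the polynomial for x, this makes the top power sum affine in
  t.\<close>

lemma newton_sum_diff:
  assumes "\<And>i. 1 \<le> i \<Longrightarrow> i < m \<Longrightarrow> e i = e' i"
  shows "newton_sum e m = newton_sum e' m - of_nat m * (e m - e' m)"
proof -
  have "e i * newton_sum e (m - i) = e' i * newton_sum e' (m - i)" if "1 \<le> i" "i < m" for i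
    using newton_sum_cong[of "m - i" e e'] assms that by auto
  hence "(\<Sum>i\<in>{..m}. if 1 \<le> i \<and> i < m then e i * newton_sum e (m - i) else 0) =
      (\<Sum>i\<in>{..m}. if 1 \<le> i \<and> i < m then e' i * newton_sum e' (m - i) else 0)"
    by (intro sum.cong) auto
  thus ?thesis by (subst (1 2) newton_sum.simps) (simp add: algebra_simps)
qed

lemma power_diff_sum: "(x::complex) ^ l - y ^ l = (x - y) * (\<Sum>k<l. x ^ k * y ^ (l - Suc k))"
  using power_diff_sumr2[of x l y] by (simp add: mult.commute)

text \<open>For m = N the equations of the roots are summed. For m < N the sum over the roots y of
  the quotients (pol x - pol y)/(x - y) equals the derivative of pol, and coefficients are
  compared.\<close>

lemma Newton_identity:
  fixes X :: "complex set" and e :: "nat \<Rightarrow> complex"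
  assumes X: "finite X" "card X = N" and e0: "e 0 = 1"
    and root: "\<And>x. x \<in> X \<Longrightarrow> (\<Sum>l\<le>N. e (N - l) * x ^ l) = 0" and m: "1 \<le> m" "m \<le> N"
  shows "(\<Sum>i<m. e i * (\<Sum>x\<in>X. x ^ (m - i))) + of_nat m * e m = 0"
proof (cases "m = N")
  case True
  have "0 = (\<Sum>x\<in>X. \<Sum>l\<le>N. e (N - l) * x ^ l)" using root by simp
  also have "\<dots> = (\<Sum>l\<le>N. e (N - l) * (\<Sum>x\<in>X. x ^ l))"
    by (subst sum.swap) (simp add: sum_distrib_left)
  also have "\<dots> = (\<Sum>i\<le>N. e i * (\<Sum>x\<in>X. x ^ (N - i)))"
    by (rule sum.reindex_bij_witness[of _ "\<lambda>i. N - i" "\<lambda>i. N - i"]) auto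
  also have "\<dots> = (\<Sum>i<N. e i * (\<Sum>x\<in>X. x ^ (N - i))) + e N * of_nat N"
    using X by (simp add: lessThan_Suc_atMost[symmetric])
  finally show ?thesis by (simp add: True mult.commute)
next
  case False
  define c where "c = (\<lambda>l. e (N - l))"
  define pol where "pol = (\<lambda>x. \<Sum>l\<le>N. c l * x ^ l)"
  define q where "q = (\<lambda>y x. \<Sum>l\<le>N. c l * (\<Sum>k<l. x ^ k * y ^ (l - Suc k)))"
  have fac: "pol x - pol y = (x - y) * q y x" for x y
    unfolding pol_def q_def sum_subtractf[symmetric] sum_distrib_left
    by (intro sum.cong refl) (simp add: power_diff_sum right_diff_distrib[symmetric] mult_ac sum_distrib_left)
  \<comment> \<open>The polynomial \<Sum>y\<in>X. q y x minus the derivative of pol. At a root x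
    only the summand y = x survives, and it equals the derivative; so \<open>D\<close> has N zeros
    but degree below N.\<close>
  define D :: "complex poly" where "D = (\<Sum>l\<le>N. \<Sum>k<l. monom (c l * (of_nat (Suc 0) * ((\<Sum>x\<in>X. x ^ (l - Suc k))) )) k) -
     (\<Sum>l\<le>N. monom (of_nat l * c l) (l - 1))"
  have qX: "(\<Sum>y\<in>X. q y x) = (\<Sum>l\<le>N. \<Sum>k<l. c l * (\<Sum>y\<in>X. y ^ (l - Suc k)) * x ^ k)" for x
    unfolding q_def sum_distrib_left by (subst sum.swap, intro sum.cong refl, subst sum.swap)
      (simp add: sum_distrib_left sum_distrib_right mult_ac)
  have D_eval: "poly D x = (\<Sum>y\<in>X. q y x) - (\<Sum>l\<le>N. of_nat l * c l * x ^ (l - 1))" for x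
    unfolding D_def qX by (simp add: poly_sum poly_monom)
  have q_diag: "q x x = (\<Sum>l\<le>N. of_nat l * c l * x ^ (l - 1))" for x
    unfolding q_def
  proof (intro sum.cong refl)
    fix l
    have "(\<Sum>k<l. x ^ k * x ^ (l - Suc k)) = (\<Sum>k<l. x ^ (l - 1))"
      by (intro sum.cong refl) (simp flip: power_add)
    thus "c l * (\<Sum>k<l. x ^ k * x ^ (l - Suc k)) = of_nat l * c l * x ^ (l - 1)" by simp
  qed
  have "poly D x = 0" if x: "x \<in> X" for x
  proof -
    have "q y x = 0" if "y \<in> X - {x}" for y
      using fac[of x y] root x that by (auto simp: pol_def c_def)
    hence "(\<Sum>y\<in>X. q y x) = q x x" using X x by (simp add: sum.remove)
    thus ?thesis by (simp add: D_eval q_diag)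
  qed
  moreover have degD: "degree D < N"
  proof -
    have N: "N > 0" using m by simp
    have "degree D \<le> N - 1" unfolding D_def
      by (intro degree_diff_le degree_sum_le order_trans[OF degree_monom_le]) auto
    thus ?thesis using N by simp
  qed
  ultimately have D0: "D = 0"
    using X card_poly_roots_bound[of D] card_mono[of "{x. poly D x = 0}" X] poly_roots_finite[of D]
    by (metis (mono_tags, lifting) leD mem_Collect_eq order_trans subsetI)
  \<comment> \<open>With c(l) = e(N - l), the identity of index m is the coefficient of index N - m
    - 1 in \<open>D = 0\<close>.\<close>
  define k where "k = N - Suc m"
  have k: "Suc k = N - m" "k < N" using m False by (auto simp: k_def)
  have c1: "coeff (\<Sum>l\<le>N. \<Sum>k<l. monom (c l * (of_nat (Suc 0) * ((\<Sum>x\<in>X. x ^ (l - Suc k))))) k) k =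
      (\<Sum>l\<in>{Suc k..N}. c l * (\<Sum>x\<in>X. x ^ (l - Suc k)))"
  proof -
    have "(\<Sum>k'<l. coeff (monom (c l * (of_nat (Suc 0) * ((\<Sum>x\<in>X. x ^ (l - Suc k'))))) k') k) =
        (if k < l then c l * (\<Sum>x\<in>X. x ^ (l - Suc k)) else 0)" for l
      by (simp add: coeff_monom)
    hence "coeff (\<Sum>l\<le>N. \<Sum>k<l. monom (c l * (of_nat (Suc 0) * ((\<Sum>x\<in>X. x ^ (l - Suc k))))) k) k =
        (\<Sum>l\<le>N. if k < l then c l * (\<Sum>x\<in>X. x ^ (l - Suc k)) else 0)"
      by (simp add: coeff_sum)
    also have "\<dots> = (\<Sum>l\<in>{Suc k..N}. c l * (\<Sum>x\<in>X. x ^ (l - Suc k)))"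
      by (rule sum.mono_neutral_cong_right) auto
    finally show ?thesis .
  qed
  have c2: "coeff (\<Sum>l\<le>N. monom (of_nat l * c l) (l - 1)) k = of_nat (Suc k) * c (Suc k)"
  proof -
    have "coeff (\<Sum>l\<le>N. monom (of_nat l * c l) (l - 1)) k = (\<Sum>l\<le>N. if l = Suc k then of_nat l * c l else 0)"
      unfolding coeff_sum coeff_monom
    proof (intro sum.cong refl)
      fix l show "(if l - 1 = k then of_nat l * c l else 0) = (if l = Suc k then of_nat l * c l else 0)" by (cases l) auto
    qed
    also have "\<dots> = of_nat (Suc k) * c (Suc k)" using k by (simp add: sum.delta del: of_nat_Suc)
    finally show ?thesis .
  qed
  have "coeff D k = 0" using D0 by simp
  hence "(\<Sum>l\<in>{Suc k..N}. c l * (\<Sum>x\<in>X. x ^ (l - Suc k))) = of_nat (Suc k) * c (Suc k)"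
    unfolding D_def coeff_diff c1 c2 by simp
  moreover have "(\<Sum>l\<in>{Suc k..N}. c l * (\<Sum>x\<in>X. x ^ (l - Suc k))) = (\<Sum>i\<le>m. e i * (\<Sum>x\<in>X. x ^ (m - i)))"
    by (rule sum.reindex_bij_witness[of _ "\<lambda>i. N - i" "\<lambda>l. N - l"]) (use k m in \<open>auto simp: c_def add.commute\<close>)
  moreover have "(\<Sum>i\<le>m. e i * (\<Sum>x\<in>X. x ^ (m - i))) = (\<Sum>i<m. e i * (\<Sum>x\<in>X. x ^ (m - i))) + e m * of_nat N"
    using X by (simp add: lessThan_Suc_atMost[symmetric])
  moreover have "c (Suc k) = e m" "of_nat (Suc k) = (of_nat N - of_nat m :: complex)"
    using k m by (auto simp: c_def of_nat_diff)
  ultimately have "(\<Sum>i<m. e i * (\<Sum>x\<in>X. x ^ (m - i))) + e m * of_nat N = (of_nat N - of_nat m) * e m" by metis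
  thus ?thesis by (simp add: algebra_simps)
qed

lemma power_sum_eq_newton_sum:
  fixes X :: "complex set" and e :: "nat \<Rightarrow> complex"
  assumes X: "finite X" "card X = N" and e0: "e 0 = 1"
    and root: "\<And>x. x \<in> X \<Longrightarrow> (\<Sum>l\<le>N. e (N - l) * x ^ l) = 0" and m: "1 \<le> m" "m \<le> N"
  shows "(\<Sum>x\<in>X. x ^ m) = newton_sum e m"
  using m
proof (induction m rule: less_induct)
  case (less m)
  have "(\<Sum>i\<in>{..m}. if 1 \<le> i \<and> i < m then e i * newton_sum e (m - i) else 0) =
      (\<Sum>i\<in>{1..<m}. e i * (\<Sum>x\<in>X. x ^ (m - i)))"
  proof (rule sum.mono_neutral_cong_right)
    fix i assume "i \<in> {1..<m}"
    thus "(if 1 \<le> i \<and> i < m then e i * newton_sum e (m - i) else 0) = e i * (\<Sum>x\<in>X. x ^ (m - i))"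
      using less.IH[of "m - i"] less.prems by (simp add: Suc_le_eq)
  qed auto
  moreover have "(\<Sum>i<m. e i * (\<Sum>x\<in>X. x ^ (m - i))) = (\<Sum>x\<in>X. x ^ m) + (\<Sum>i\<in>{1..<m}. e i * (\<Sum>x\<in>X. x ^ (m - i)))"
  proof -
    have "{..<m} = insert 0 {1..<m}" using less.prems by auto
    thus ?thesis using e0 by simp
  qed
  moreover have "(\<Sum>i<m. e i * (\<Sum>x\<in>X. x ^ (m - i))) + of_nat m * e m = 0"
    by (rule Newton_identity[OF X e0 root less.prems])
  ultimately show ?case by (subst newton_sum.simps) (simp add: eq_neg_iff_add_eq_0 algebra_simps)
qed

section \<open>Loops over circles\<close>

definition circ :: "complex \<Rightarrow> complex \<Rightarrow> real \<Rightarrow> complex" where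
  "circ c d \<theta> = c + d * exp (2 * of_real pi * \<i> * of_real \<theta>)"

definition circ' :: "complex \<Rightarrow> real \<Rightarrow> complex" where
  "circ' d \<theta> = d * (2 * of_real pi * \<i> * exp (2 * of_real pi * \<i> * of_real \<theta>))"

definition circle_integral :: "complex \<Rightarrow> complex \<Rightarrow> (complex \<Rightarrow> complex) \<Rightarrow> complex" where
  "circle_integral c d g = integral {0..1} (\<lambda>\<theta>. g (circ c d \<theta>) * circ' d \<theta>)"

text \<open>The two coefficients of the affine function of t given by the integral over the N-fold
  circle: the slope here, the value at t = 0 in \<open>level_const\<close>. The factor n + 1 is the
  factor m of e(m) in the last Newton identity, t entering e(N) as -t/\<phi>.\<close>

definition level_slope :: "(nat \<Rightarrow> nat \<Rightarrow> complex) \<Rightarrow> nat \<Rightarrow> complex \<Rightarrow> complex \<Rightarrow>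
    (nat \<Rightarrow> nat \<Rightarrow> complex) \<Rightarrow> (nat \<Rightarrow> nat \<Rightarrow> complex) \<Rightarrow> complex" where
  "level_slope C n c d CP CQ =
    of_nat (Suc n) * circle_integral c d (\<lambda>u. reduced_form CP CQ n u / slope_poly C (Suc n) u)"

definition level_const :: "(nat \<Rightarrow> nat \<Rightarrow> complex) \<Rightarrow> nat \<Rightarrow> complex \<Rightarrow> complex \<Rightarrow>
    (nat \<Rightarrow> nat \<Rightarrow> complex) \<Rightarrow> (nat \<Rightarrow> nat \<Rightarrow> complex) \<Rightarrow> complex" where
  "level_const C n c d CP CQ = circle_integral c d
    (\<lambda>u. \<Sum>j\<le>n. newton_sum (\<lambda>i. slope_poly C (Suc n - i) u / slope_poly C (Suc n) u) (Suc j) * reduced_form CP CQ j u)"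

lemma circ_deriv: "(circ c d has_vector_derivative circ' d \<theta>) (at \<theta> within S)"
proof -
  have "((\<lambda>x::real. 2 * of_real pi * \<i> * of_real x) has_vector_derivative 2 * of_real pi * \<i> * 1) (at \<theta> within S)"
    by (intro has_vector_derivative_mult_right has_vector_derivative_of_real has_vector_derivative_id)
       (auto intro!: derivative_eq_intros)
  hence "((\<lambda>x::real. 2 * of_real pi * \<i> * of_real x) has_vector_derivative 2 * of_real pi * \<i>) (at \<theta> within S)" by simp
  from field_vector_diff_chain_within[OF this has_field_derivative_at_within[OF DERIV_exp]]
  have "((\<lambda>x::real. exp (2 * of_real pi * \<i> * of_real x)) has_vector_derivative
      2 * of_real pi * \<i> * exp (2 * of_real pi * \<i> * of_real \<theta>)) (at \<theta> within S)" by (simp add: o_def)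
  from has_vector_derivative_add[OF has_vector_derivative_const has_vector_derivative_mult_right[OF this]]
  show ?thesis unfolding circ_def[abs_def] circ'_def by simp
qed

lemma exp_circle_period: "exp (2 * of_real pi * \<i> * of_real (\<theta> + of_int k)) = exp (2 * of_real pi * \<i> * of_real \<theta>)"
proof -
  have "exp (2 * of_int k * of_real pi * \<i>) = 1" using exp_integer_2pi[of "of_int k"] by simp
  moreover have "2 * of_real pi * \<i> * of_real (\<theta> + of_int k) = 2 * of_real pi * \<i> * of_real \<theta> + 2 * of_int k * of_real pi * \<i>"
    by (simp add: distrib_left mult_ac)
  ultimately show ?thesis by (simp only: exp_add mult_1_right)
qed

lemma circ_period: "circ c d (\<theta> + of_int k) = circ c d \<theta>" "circ' d (\<theta> + of_int k) = circ' d \<theta>"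
  unfolding circ_def circ'_def exp_circle_period by simp_all

lemma circ_period_nat: "circ c d (\<theta> + of_nat k) = circ c d \<theta>" "circ' d (\<theta> + of_nat k) = circ' d \<theta>"
  using circ_period(1)[of c d \<theta> "int k"] circ_period(2)[of d \<theta> "int k"] by simp_all

lemma circ_0: "circ c d 0 = c + d"
  by (simp add: circ_def)

lemma continuous_on_circ [continuous_intros]:
  "continuous_on A h \<Longrightarrow> continuous_on A (\<lambda>x. circ c d (h x))"
  "continuous_on A h \<Longrightarrow> continuous_on A (\<lambda>x. circ' d (h x))"
  unfolding circ_def circ'_def by (intro continuous_intros; assumption)+

lemma continuous_on_slope_poly [continuous_intros]:
  assumes "continuous_on A g"
  shows "continuous_on A (\<lambda>x. slope_poly C j (g x))" "continuous_on A (\<lambda>x. slope_poly' C j (g x))"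
  unfolding slope_poly_def slope_poly'_def by (intro continuous_intros assms)+

text \<open>Folds a path that runs N times over a circle into one turn, with the N passages summed
  pointwise.\<close>

lemma integral_equal_pieces:
  fixes g :: "real \<Rightarrow> complex"
  assumes g: "continuous_on {0..1} g" and N: "N > 0"
  shows "integral {0..1} g = integral {0..1} (\<lambda>\<theta>. \<Sum>k<N. g ((\<theta> + of_nat k) / of_nat N) / of_nat N)"
proof -
  obtain F where F: "\<And>x. x \<in> {0..1} \<Longrightarrow> (F has_vector_derivative g x) (at x within {0..1})"
    using antiderivative_continuous[OF g] by blast
  have piece: "((\<lambda>\<theta>. g ((\<theta> + of_nat k) / of_nat N) / of_nat N) has_integral
      F (of_nat (Suc k) / of_nat N) - F (of_nat k / of_nat N)) {0..1}" if k: "k < N" for k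
  proof -
    have i: "(\<lambda>\<theta>. (\<theta> + of_nat k) / of_nat N) ` {0..1} \<subseteq> {0..1::real}"
    proof (rule image_subsetI)
      fix \<theta> :: real assume "\<theta> \<in> {0..1}"
      moreover have "real k + 1 \<le> real N" using k by simp
      ultimately show "(\<theta> + of_nat k) / of_nat N \<in> {0..1::real}" using N by (auto simp: field_simps)
    qed
    have "((\<lambda>\<theta>. F ((\<theta> + of_nat k) / of_nat N)) has_vector_derivative g ((\<theta> + of_nat k) / of_nat N) / of_nat N) (at \<theta> within {0..1})"
      if \<theta>: "\<theta> \<in> {0..1}" for \<theta> :: real
    proof -
      have 1: "((\<lambda>\<theta>. (\<theta> + of_nat k) / of_nat N) has_vector_derivative 1 / of_nat N) (at \<theta> within {0..1::real})"
        using N by (auto intro!: derivative_eq_intros simp: has_real_derivative_iff_has_vector_derivative[symmetric])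
      have "(F has_vector_derivative g ((\<theta> + of_nat k) / of_nat N)) (at ((\<theta> + of_nat k) / of_nat N) within (\<lambda>\<theta>. (\<theta> + of_nat k) / of_nat N) ` {0..1})"
        by (rule has_vector_derivative_within_subset[OF F i]) (use i \<theta> in blast)
      from vector_diff_chain_within[OF 1 this] show ?thesis
        by (simp add: o_def scaleR_conv_of_real)
    qed
    hence "((\<lambda>\<theta>. g ((\<theta> + of_nat k) / of_nat N) / of_nat N) has_integral
        F ((1 + of_nat k) / of_nat N) - F ((0 + of_nat k) / of_nat N)) {0..1}"
      by (intro fundamental_theorem_of_calculus) auto
    thus ?thesis by (simp add: add.commute)
  qed
  have "((\<lambda>\<theta>. \<Sum>k<N. g ((\<theta> + of_nat k) / of_nat N) / of_nat N) has_integral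
      (\<Sum>k<N. F (of_nat (Suc k) / of_nat N) - F (of_nat k / of_nat N))) {0..1}"
    by (intro has_integral_sum piece) auto
  moreover have "(\<Sum>k<N. F (of_nat (Suc k) / of_nat N) - F (of_nat k / of_nat N)) = F 1 - F 0"
    using sum_lessThan_telescope[of "\<lambda>k. F (of_nat k / of_nat N)" N] N by simp
  moreover have "(g has_integral F 1 - F 0) {0..1}"
    using F by (intro fundamental_theorem_of_calculus) auto
  ultimately show ?thesis by (simp add: integral_unique)
qed

text \<open>The winding number of \<phi> along the circle is an integer, so being within 1/2 of 1
  already fixes it, and in this form the condition is visibly open. \<open>l0\<close> is a logarithm
  at the starting point; two circles with the same start can share it and thereby the value
  \<open>E 0\<close>.\<close>

locale circle_loop =
  fixes n :: nat and f :: bipoly and c d l0 :: complex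
  assumes nz: "\<And>\<theta>. \<theta> \<in> {0..1} \<Longrightarrow> slope_poly (bicoeff f) (Suc n) (circ c d \<theta>) \<noteq> 0"
    and winding: "norm (circle_integral c d (\<lambda>u. slope_poly' (bicoeff f) (Suc n) u / slope_poly (bicoeff f) (Suc n) u) /
      (2 * of_real pi * \<i>) - 1) < 1 / 2"
    and l0: "exp l0 = slope_poly (bicoeff f) (Suc n) (c + d)"
begin

abbreviation "\<phi> \<equiv> slope_poly (bicoeff f) (Suc n)"
abbreviation "\<phi>' \<equiv> slope_poly' (bicoeff f) (Suc n)"
abbreviation "N \<equiv> Suc n"

definition "log_deriv \<theta> = \<phi>' (circ c d \<theta>) / \<phi> (circ c d \<theta>) * circ' d \<theta>"
text \<open>A continuous logarithm of \<phi> along the circle, obtained by integrating the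
  logarithmic derivative. \<open>E\<close> below is the resulting N-th root of 1/\<phi>.\<close>

definition "lift \<theta> = l0 + integral {0..\<theta>} log_deriv"
definition "u s = circ c d (of_nat N * s)"
definition "u' s = of_nat N * circ' d (of_nat N * s)"
definition "E s = exp (- lift (of_nat N * s) / of_nat N)"
definition "E' s = - log_deriv (of_nat N * s) * E s"

lemma nonzero: "\<phi> (circ c d \<theta>) \<noteq> 0"
proof -
  have "circ c d \<theta> = circ c d (frac \<theta>)"
    using circ_period(1)[of c d "frac \<theta>" "\<lfloor>\<theta>\<rfloor>"] by (simp add: frac_def)
  moreover have "frac \<theta> \<in> {0..1}" using frac_ge_0[of \<theta>] frac_lt_1[of \<theta>] by (simp only: atLeastAtMost_iff less_imp_le)
  ultimately show ?thesis using nz by simp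
qed

lemma continuous_on_log_deriv: "continuous_on A h \<Longrightarrow> continuous_on A (\<lambda>x. log_deriv (h x))"
  unfolding log_deriv_def using nonzero by (intro continuous_intros) auto

lemma lift_deriv: "\<theta> \<in> {0..b} \<Longrightarrow> (lift has_vector_derivative log_deriv \<theta>) (at \<theta> within {0..b})"
  unfolding lift_def[abs_def]
  using has_vector_derivative_add[OF has_vector_derivative_const
      integral_has_vector_derivative[OF continuous_on_log_deriv[OF continuous_on_id]]] by fastforce

lemma zero_deriv_constant:
  fixes g :: "real \<Rightarrow> complex"
  assumes "\<And>s. s \<in> {0..b} \<Longrightarrow> (g has_vector_derivative 0) (at s within {0..b})" and s: "s \<in> {0..b}"
  shows "g s = g 0"
proof -
  have "\<exists>c. \<forall>s\<in>{0..b}. g s = c"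
    using assms(1) by (intro has_derivative_zero_constant) (auto simp: has_vector_derivative_def)
  thus ?thesis using s by auto
qed

lemma exp_lift: "\<theta> \<ge> 0 \<Longrightarrow> exp (lift \<theta>) = \<phi> (circ c d \<theta>)"
proof -
  assume \<theta>: "\<theta> \<ge> 0"
  define g where "g = (\<lambda>s. exp (- lift s) * \<phi> (circ c d s))"
  have "g \<theta> = g 0"
  proof (rule zero_deriv_constant[of \<theta>])
    fix s assume s: "s \<in> {0..\<theta>}"
    have 1: "((\<lambda>s. exp (- lift s)) has_vector_derivative - log_deriv s * exp (- lift s)) (at s within {0..\<theta>})"
      using field_vector_diff_chain_within[OF has_vector_derivative_minus[OF lift_deriv[OF s]] has_field_derivative_at_within[OF DERIV_exp]]
      by (simp add: o_def)
    have 2: "((\<lambda>s. \<phi> (circ c d s)) has_vector_derivative circ' d s * \<phi>' (circ c d s)) (at s within {0..\<theta>})"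
      using field_vector_diff_chain_within[OF circ_deriv has_field_derivative_at_within[OF slope_poly_deriv]] by (simp add: o_def)
    show "(g has_vector_derivative 0) (at s within {0..\<theta>})"
      unfolding g_def using has_vector_derivative_mult[OF 1 2] nonzero[of s] by (simp add: log_deriv_def)
  qed (use \<theta> in auto)
  hence "exp (- lift \<theta>) * \<phi> (circ c d \<theta>) = 1"
    by (simp add: g_def lift_def circ_0 l0[symmetric] exp_minus)
  thus ?thesis by (simp add: exp_minus field_simps)
qed

text \<open>After one turn \<phi> returns to its value, so the logarithm has changed by an integer
  multiple of 2 pi i; \<open>winding\<close> forces the integer to be 1.\<close>

lemma lift_1: "lift 1 = lift 0 + 2 * of_real pi * \<i>"
proof -
  let ?I = "circle_integral c d (\<lambda>u. \<phi>' u / \<phi> u)"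
  have I: "lift 1 = lift 0 + ?I" by (simp add: lift_def circle_integral_def log_deriv_def[abs_def])
  have "exp (lift 0) * exp ?I = exp (lift 0)"
    using exp_lift[of 1] exp_lift[of 0] circ_period_nat(1)[of c d 0 1] by (simp add: I exp_add)
  hence "exp ?I = 1" by simp
  then obtain m :: int where "Re ?I = 0" "Im ?I = of_int (2 * m) * pi" unfolding exp_eq_1 by blast
  hence m: "?I = 2 * of_real pi * \<i> * of_int m" by (simp add: complex_eq_iff)
  have "norm (of_int (m - 1) :: complex) < 1 / 2" using winding unfolding m by simp
  hence "\<bar>real_of_int (m - 1)\<bar> < 1 / 2" unfolding norm_of_int by simp
  hence "m = 1" by linarith
  thus ?thesis using I m by simp
qed

lemma lift_add_1: "\<theta> \<ge> 0 \<Longrightarrow> lift (\<theta> + 1) = lift \<theta> + 2 * of_real pi * \<i>"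
proof -
  assume \<theta>: "\<theta> \<ge> 0"
  define g where "g = (\<lambda>s. lift (s + 1) - lift s)"
  have "g \<theta> = g 0"
  proof (rule zero_deriv_constant[of \<theta>])
    fix s assume s: "s \<in> {0..\<theta>}"
    have 1: "((\<lambda>s. s + 1) has_vector_derivative 1) (at s within {0..\<theta>})"
      by (auto intro!: derivative_eq_intros)
    have "(lift has_vector_derivative log_deriv (s + 1)) (at (s + 1) within (\<lambda>s. s + 1) ` {0..\<theta>})"
      by (rule has_vector_derivative_within_subset[OF lift_deriv[of _ "\<theta> + 1"]]) (use s in auto)
    from vector_diff_chain_within[OF 1 this]
    have "((\<lambda>s. lift (s + 1)) has_vector_derivative log_deriv s) (at s within {0..\<theta>})"
      using circ_period_nat(1)[of c d s 1] circ_period_nat(2)[of d s 1] by (simp add: o_def log_deriv_def)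
    from has_vector_derivative_diff[OF this lift_deriv[OF s]]
    show "(g has_vector_derivative 0) (at s within {0..\<theta>})" by (simp add: g_def)
  qed (use \<theta> in auto)
  thus ?thesis using lift_1 by (simp add: g_def algebra_simps)
qed

lemma lift_add_nat: "\<theta> \<ge> 0 \<Longrightarrow> lift (\<theta> + of_nat k) = lift \<theta> + 2 * of_real pi * \<i> * of_nat k"
proof (induction k)
  case (Suc k)
  have "lift (\<theta> + of_nat k + 1) = lift (\<theta> + of_nat k) + 2 * of_real pi * \<i>"
    using Suc.prems by (intro lift_add_1) auto
  thus ?case using Suc by (simp add: algebra_simps)
qed simp

lemma N_nz: "(of_nat N :: complex) \<noteq> 0"
  by (simp del: of_nat_Suc)

lemma u_0: "u 0 = c + d" and E_0: "E 0 = exp (- l0 / of_nat N)"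
  by (simp_all add: u_def E_def circ_0 lift_def)

lemma circle_loop_data:
  assumes "total_degree_le f N" "total_degree_le P n" "total_degree_le Q n"
  shows "loop_data n f P Q u E u' E'"
proof
  have scale: "((\<lambda>s. of_nat N * s) has_vector_derivative of_nat N) (at s within {0..1::real})" for s
    by (auto intro!: derivative_eq_intros simp: has_real_derivative_iff_has_vector_derivative[symmetric])
  have img: "(\<lambda>s. of_nat N * s) ` {0..1} \<subseteq> {0..real N}"
    by (auto intro!: mult_left_le simp del: of_nat_Suc)
  fix s :: real assume s: "s \<in> {0..1}"
  show "(u has_vector_derivative u' s) (at s within {0..1})"
    using vector_diff_chain_within[OF scale[of s] circ_deriv[of c d]] by (simp add: u_def[abs_def] u'_def o_def scaleR_conv_of_real)
  have "((lift \<circ> (\<lambda>s. of_nat N * s)) has_vector_derivative of_nat N *\<^sub>R log_deriv (of_nat N * s)) (at s within {0..1})"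
    by (intro vector_diff_chain_within scale has_vector_derivative_within_subset[OF lift_deriv img]) (use img s in blast)
  hence "((\<lambda>s. lift (of_nat N * s)) has_vector_derivative of_nat N * log_deriv (of_nat N * s)) (at s within {0..1})"
    by (simp add: o_def scaleR_conv_of_real)
  from has_vector_derivative_mult_left[OF has_vector_derivative_minus[OF this], of "inverse (of_nat N)"]
  have "((\<lambda>s. - lift (of_nat N * s) / of_nat N) has_vector_derivative - log_deriv (of_nat N * s)) (at s within {0..1})"
    using N_nz by (simp add: field_simps del: of_nat_Suc)
  from field_vector_diff_chain_within[OF this has_field_derivative_at_within[OF DERIV_exp]]
  show "(E has_vector_derivative E' s) (at s within {0..1})"
    by (simp add: E_def[abs_def] E'_def o_def del: of_nat_Suc)
  have "E s ^ N = exp (of_nat N * (- lift (of_nat N * s) / of_nat N))" unfolding E_def exp_of_nat_mult ..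
  also have "of_nat N * (- lift (of_nat N * s) / of_nat N) = - lift (of_nat N * s)" using N_nz by (simp del: of_nat_Suc)
  finally show "E s ^ N * \<phi> (u s) = 1"
    using exp_lift[of "of_nat N * s"] s nonzero[of "of_nat N * s"]
    by (simp add: u_def exp_minus del: of_nat_Suc power_Suc)
next
  have cE: "continuous_on {0..1} E"
  proof -
    have "continuous_on {0..real N} lift"
      unfolding continuous_on_eq_continuous_within using lift_deriv has_vector_derivative_continuous by blast
    hence "continuous_on {0..1} (\<lambda>s. lift (of_nat N * s))"
      by (rule continuous_on_compose2) (auto intro!: continuous_intros mult_left_le simp del: of_nat_Suc)
    thus ?thesis unfolding E_def[abs_def] using N_nz by (intro continuous_intros) auto
  qed
  show "continuous_on {0..1} u'" unfolding u'_def[abs_def] by (intro continuous_intros)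
  show "continuous_on {0..1} E'" unfolding E'_def[abs_def] by (intro continuous_intros continuous_on_log_deriv cE)
  show "u 1 = u 0" using circ_period_nat(1)[of c d 0 N] by (simp add: u_def del: of_nat_Suc)
  have "lift (of_nat N) = lift 0 + 2 * of_real pi * \<i> * of_nat N" using lift_add_nat[of 0 N] by simp
  hence "- lift (of_nat N) / of_nat N = - lift 0 / of_nat N - 2 * of_real pi * \<i>"
    using N_nz by (simp add: field_simps del: of_nat_Suc)
  thus "E 1 = E 0" by (simp add: E_def exp_diff del: of_nat_Suc)
qed (use assms in auto)

text \<open>Each turn adds 2 pi i to the logarithm and hence multiplies \<open>E\<close> by a
  primitive N-th root of unity: the passages lie on different sheets, and \<open>E\<close> closes
  after N turns.\<close>

lemma E_sheet: "\<theta> \<ge> 0 \<Longrightarrow> E ((\<theta> + of_nat k) / of_nat N) = E (\<theta> / of_nat N) * exp (- (2 * of_real pi * \<i> * of_nat k / of_nat N))"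
proof -
  assume \<theta>: "\<theta> \<ge> 0"
  have N: "of_nat N * (x / of_nat N) = x" for x :: real by (simp del: of_nat_Suc)
  have "- (lift \<theta> + 2 * of_real pi * \<i> * of_nat k) / of_nat N = - lift \<theta> / of_nat N + - (2 * of_real pi * \<i> * of_nat k / of_nat N)"
    by (simp add: add_divide_distrib diff_divide_distrib)
  thus ?thesis unfolding E_def N lift_add_nat[OF \<theta>] by (simp only: exp_add)
qed

text \<open>The circle is run through \<open>N = n + 1\<close> times, so that over each point of it the loop passes through the
  \<open>N\<close> points of the fiber with the given slope \<open>u = y / x\<close>.\<close>

lemma form_integral_circle:
  assumes fd: "flow_data n f P Q u E u' E' R r \<delta> B" and n: "n \<ge> 1"
    and sep: "\<And>k. 0 < k \<Longrightarrow> k < N \<Longrightarrow> 2 * r < norm (exp (2 * of_real pi * \<i> * of_nat k / of_nat N) - 1)"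
    and \<eta>: "total_degree_le P' n" "total_degree_le Q' n" and v: "v \<in> cball 1 (r / 2)"
  shows "flow_data.form_integral n f P Q u E u' E' R (P', Q') 0 v =
    level_const (bicoeff f) n c d (bicoeff P') (bicoeff Q') +
    level_slope (bicoeff f) n c d (bicoeff P') (bicoeff Q') * flow_data.level f u E R v"
proof -
  interpret flow_data n f P Q u E u' E' R r \<delta> B by (rule fd)
  let ?\<rho> = "reduced_form (bicoeff P') (bicoeff Q')"
  let ?F = "\<lambda>s. ode.flow s 0 v"
  define x where "x = (\<lambda>s. R * (E s * ?F s))"
  define t where "t = level v"
  define g where "g = (\<lambda>s. \<Sum>j\<le>n. x s ^ Suc j * ?\<rho> j (u s) * u' s)"
  define X where "X = (\<lambda>\<theta>. (\<lambda>k. x ((\<theta> + of_nat k) / of_nat N)) ` {..<N})"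
  define e where "e = (\<lambda>u i. slope_poly (bicoeff f) (N - i) u / \<phi> u)"
  have in01: "(\<theta> + of_nat k) / of_nat N \<in> {0..1}" if "\<theta> \<in> {0..1}" "k < N" for \<theta> :: real and k
  proof -
    have "real k + 1 \<le> real N" using that by linarith
    thus ?thesis using that by (auto simp: field_simps)
  qed
  have u_s: "u ((\<theta> + of_nat k) / of_nat N) = circ c d \<theta>" "u' ((\<theta> + of_nat k) / of_nat N) = of_nat N * circ' d \<theta>" for \<theta> :: real and k
    by (simp_all add: u_def u'_def circ_period_nat del: of_nat_Suc)
  \<comment> \<open>On different sheets x carries different roots of unity. The factors
    \<open>v\<close> stay within r of 1, too close to compensate for a ratio whose distance from 1
    exceeds 2r.\<close>
  have inj_sheet: "inj_on (\<lambda>k. x ((\<theta> + of_nat k) / of_nat N)) {..<N}" if \<theta>: "\<theta> \<in> {0..1}" for \<theta>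
  proof -
    let ?z = "\<lambda>k. exp (- (2 * of_real pi * \<i> * of_nat k / of_nat N)) :: complex"
    have ne: "x ((\<theta> + of_nat k) / of_nat N) \<noteq> x ((\<theta> + of_nat l) / of_nat N)" if kl: "k < l" "l < N" for k l
    proof
      let ?a = "?F ((\<theta> + of_nat k) / of_nat N)" and ?b = "?F ((\<theta> + of_nat l) / of_nat N)"
      assume "x ((\<theta> + of_nat k) / of_nat N) = x ((\<theta> + of_nat l) / of_nat N)"
      hence "?z k * ?a = ?z l * ?b"
        using R \<theta> E_nz[OF in01[OF \<theta>, of 0]] by (simp add: x_def E_sheet del: of_nat_Suc)
      moreover have zl: "?z l = ?z k * exp (- (2 * of_real pi * \<i> * of_nat (l - k) / of_nat N))"
        using kl by (simp add: exp_add[symmetric] of_nat_diff diff_divide_distrib algebra_simps del: of_nat_Suc)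
      ultimately have "?a = exp (- (2 * of_real pi * \<i> * of_nat (l - k) / of_nat N)) * ?b" by simp
      hence ab: "exp (2 * of_real pi * \<i> * of_nat (l - k) / of_nat N) * ?a = ?b"
        by (simp add: exp_minus field_simps)
      let ?w = "exp (2 * of_real pi * \<i> * of_nat (l - k) / of_nat N) :: complex"
      have "norm ?w = 1" by simp
      have "?w - 1 = (?b - 1) - ?w * (?a - 1)" using ab by (simp add: algebra_simps)
      hence "norm (?w - 1) \<le> norm (?b - 1) + norm (?w * (?a - 1))" by (metis norm_triangle_ineq4)
      also have "\<dots> = norm (?b - 1) + norm (?a - 1)" unfolding norm_mult \<open>norm ?w = 1\<close> by simp
      also have "\<dots> \<le> 2 * r"
      proof -
        have "?a \<in> cball 1 r" "?b \<in> cball 1 r"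
          by (rule flow_in[OF in01[OF \<theta>] _ v]; use kl \<delta> in simp)+
        thus ?thesis by (simp add: dist_norm norm_minus_commute)
      qed
      finally have "norm (?w - 1) \<le> 2 * r" .
      moreover have "0 < l - k" "l - k < N" using kl by linarith+
      ultimately show False using sep by (meson not_le)
    qed
    show ?thesis
      by (rule linorder_inj_onI) (use ne in auto)
  qed
  \<comment> \<open>The N sheets are all the roots x of f(x, u x) = t divided by \<phi>(u). Only the
    coefficient of index N contains t, and it affects only the power sum of exponent N, that is j =
    n.\<close>
  have power_sums: "(\<Sum>k<N. x ((\<theta> + of_nat k) / of_nat N) ^ Suc j) =
      newton_sum (e (circ c d \<theta>)) (Suc j) + (if j = n then of_nat N * t / \<phi> (circ c d \<theta>) else 0)"
    if \<theta>: "\<theta> \<in> {0..1}" and j: "j \<le> n" for \<theta> j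
  proof -
    define u0 where "u0 = circ c d \<theta>"
    define e' where "e' = (\<lambda>i. (slope_poly (bicoeff f) (N - i) u0 - (if i = N then t else 0)) / \<phi> u0)"
    have nz': "\<phi> u0 \<noteq> 0" unfolding u0_def by (rule nonzero)
    have root: "(\<Sum>l\<le>N. e' (N - l) * y ^ l) = 0" if y: "y \<in> X \<theta>" for y
    proof -
      obtain k where k: "k < N" "y = x ((\<theta> + of_nat k) / of_nat N)" using y by (auto simp: X_def)
      have "bieval f (pos ((\<theta> + of_nat k) / of_nat N) (?F ((\<theta> + of_nat k) / of_nat N))) = t"
        unfolding t_def by (rule level_along_flow[OF in01[OF \<theta> k(1)] v])
      moreover have "pos ((\<theta> + of_nat k) / of_nat N) (?F ((\<theta> + of_nat k) / of_nat N)) = (y, y * u0)"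
        unfolding pos_def u_s k(2) x_def u0_def by (simp add: mult.assoc)
      ultimately have "(\<Sum>l\<le>N. y ^ l * slope_poly (bicoeff f) l u0) = t"
        using bieval_eq_homogeneous_parts[OF degrees(1), of "(y, y * u0)"] by (simp only: homogeneous_part_slope)
      moreover have "(\<Sum>l\<le>N. e' (N - l) * y ^ l) = ((\<Sum>l\<le>N. y ^ l * slope_poly (bicoeff f) l u0) - t) / \<phi> u0"
      proof -
        have "(\<Sum>l\<le>N. e' (N - l) * y ^ l) = (\<Sum>l\<le>N. (y ^ l * slope_poly (bicoeff f) l u0 - (if l = 0 then t else 0)) / \<phi> u0)"
          by (intro sum.cong refl) (auto simp: e'_def algebra_simps)
        also have "\<dots> = ((\<Sum>l\<le>N. y ^ l * slope_poly (bicoeff f) l u0) - (\<Sum>l\<le>N. if l = 0 then t else 0)) / \<phi> u0"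
          by (simp only: sum_divide_distrib[symmetric] sum_subtractf)
        finally show ?thesis by (simp add: sum.delta)
      qed
      ultimately show ?thesis by simp
    qed
    have card: "card (X \<theta>) = N" unfolding X_def using inj_sheet[OF \<theta>] by (simp add: card_image)
    have "(\<Sum>k<N. x ((\<theta> + of_nat k) / of_nat N) ^ Suc j) = (\<Sum>y\<in>X \<theta>. y ^ Suc j)"
      unfolding X_def using sum.reindex[OF inj_sheet[OF \<theta>], of "\<lambda>y. y ^ Suc j"] by (simp add: o_def)
    also have "\<dots> = newton_sum e' (Suc j)"
      by (rule power_sum_eq_newton_sum[OF _ card _ root]) (use j n nz' in \<open>auto simp: X_def e'_def\<close>)
    also have "\<dots> = newton_sum (e u0) (Suc j) - of_nat (Suc j) * (e' (Suc j) - e u0 (Suc j))"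
      by (rule newton_sum_diff) (use j in \<open>auto simp: e'_def e_def\<close>)
    also have "of_nat (Suc j) * (e' (Suc j) - e u0 (Suc j)) = (if j = n then - (of_nat N * t / \<phi> u0) else 0)"
      by (auto simp: e'_def e_def diff_divide_distrib)
    finally show ?thesis by (simp add: u0_def del: of_nat_Suc)
  qed
  have cont_g: "continuous_on {0..1} g"
  proof -
    have "continuous_on {0..1} (\<lambda>s. ?F s)"
      by (intro flow_continuous continuous_intros) (use v \<delta> in auto)
    thus ?thesis
      unfolding g_def x_def reduced_form_def by (intro continuous_intros cont_u cont_E u) (simp_all del: of_nat_Suc)
  qed
  have sheets: "(\<Sum>k<N. g ((\<theta> + of_nat k) / of_nat N) / of_nat N) =
      (\<Sum>j\<le>n. newton_sum (e (circ c d \<theta>)) (Suc j) * ?\<rho> j (circ c d \<theta>)) * circ' d \<theta> +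
      of_nat N * t * (?\<rho> n (circ c d \<theta>) / \<phi> (circ c d \<theta>) * circ' d \<theta>)" if \<theta>: "\<theta> \<in> {0..1}" for \<theta>
  proof -
    have "(\<Sum>k<N. g ((\<theta> + of_nat k) / of_nat N) / of_nat N) =
        (\<Sum>k<N. \<Sum>j\<le>n. x ((\<theta> + of_nat k) / of_nat N) ^ Suc j * (?\<rho> j (circ c d \<theta>) * circ' d \<theta>))"
      unfolding g_def u_s sum_divide_distrib using N_nz by (intro sum.cong refl) (simp del: of_nat_Suc)
    also have "\<dots> = (\<Sum>j\<le>n. (\<Sum>k<N. x ((\<theta> + of_nat k) / of_nat N) ^ Suc j) * (?\<rho> j (circ c d \<theta>) * circ' d \<theta>))"
      by (subst sum.swap) (simp only: sum_distrib_right)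
    also have "\<dots> = (\<Sum>j\<le>n. newton_sum (e (circ c d \<theta>)) (Suc j) * ?\<rho> j (circ c d \<theta>) * circ' d \<theta> +
        (if j = n then of_nat N * t / \<phi> (circ c d \<theta>) * (?\<rho> j (circ c d \<theta>) * circ' d \<theta>) else 0))"
      by (intro sum.cong refl) (simp add: power_sums[OF \<theta>] distrib_right mult.assoc del: of_nat_Suc power_Suc sum.lessThan_Suc)
    also have "\<dots> = (\<Sum>j\<le>n. newton_sum (e (circ c d \<theta>)) (Suc j) * ?\<rho> j (circ c d \<theta>)) * circ' d \<theta> +
        of_nat N * t / \<phi> (circ c d \<theta>) * (?\<rho> n (circ c d \<theta>) * circ' d \<theta>)"
      unfolding sum.distrib sum_distrib_right by (simp add: sum.delta del: of_nat_Suc)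
    finally show ?thesis by (simp del: of_nat_Suc sum.lessThan_Suc sum.atMost_Suc)
  qed
  have newton_cont: "continuous_on A (\<lambda>\<theta>. newton_sum (e (circ c d \<theta>)) m)" for A m
  proof (induction m rule: less_induct)
    case (less m)
    have e: "continuous_on A (\<lambda>\<theta>. e (circ c d \<theta>) i)" for i
      unfolding e_def using nonzero by (intro continuous_intros) auto
    have "continuous_on A (\<lambda>\<theta>. if 1 \<le> i \<and> i < m then e (circ c d \<theta>) i * newton_sum (e (circ c d \<theta>)) (m - i) else 0)" for i
      using less.IH[of "m - i"] e by (cases "1 \<le> i \<and> i < m") (auto intro!: continuous_intros)
    thus ?case by (subst newton_sum.simps) (intro continuous_intros e)
  qed
  have "flow_data.form_integral n f P Q u E u' E' R (P', Q') 0 v = integral {0..1} g"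
    unfolding form_integral_reduced[OF \<eta> v] g_def x_def ..
  also have "\<dots> = integral {0..1} (\<lambda>\<theta>. \<Sum>k<N. g ((\<theta> + of_nat k) / of_nat N) / of_nat N)"
    by (rule integral_equal_pieces[OF cont_g]) simp
  also have "\<dots> = integral {0..1} (\<lambda>\<theta>. (\<Sum>j\<le>n. newton_sum (e (circ c d \<theta>)) (Suc j) * ?\<rho> j (circ c d \<theta>)) * circ' d \<theta> +
      of_nat N * t * (?\<rho> n (circ c d \<theta>) / \<phi> (circ c d \<theta>) * circ' d \<theta>))"
    by (rule integral_cong) (rule sheets)
  also have "\<dots> = integral {0..1} (\<lambda>\<theta>. (\<Sum>j\<le>n. newton_sum (e (circ c d \<theta>)) (Suc j) * ?\<rho> j (circ c d \<theta>)) * circ' d \<theta>) +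
      integral {0..1} (\<lambda>\<theta>. of_nat N * t * (?\<rho> n (circ c d \<theta>) / \<phi> (circ c d \<theta>) * circ' d \<theta>))"
  proof (intro integral_add integrable_continuous_real)
    show "continuous_on {0..1} (\<lambda>\<theta>. (\<Sum>j\<le>n. newton_sum (e (circ c d \<theta>)) (Suc j) * ?\<rho> j (circ c d \<theta>)) * circ' d \<theta>)"
      unfolding reduced_form_def by (intro continuous_intros newton_cont) (simp_all del: of_nat_Suc)
    show "continuous_on {0..1} (\<lambda>\<theta>. of_nat N * t * (?\<rho> n (circ c d \<theta>) / \<phi> (circ c d \<theta>) * circ' d \<theta>))"
      unfolding reduced_form_def using nonzero by (intro continuous_intros) (simp_all del: of_nat_Suc)
  qed
  finally show ?thesis
    unfolding integral_mult_right level_const_def level_slope_def circle_integral_def e_def t_def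
    by (simp only: mult_ac)
qed

end

section \<open>Iterated commutators of loops\<close>

lemma inverse_germ_compose:
  assumes "inverse_germ T h1 h1'" "inverse_germ T h2 h2'" "germ_at_identity T h2'"
  shows "inverse_germ T (\<lambda>\<epsilon> t. h2 \<epsilon> (h1 \<epsilon> t)) (\<lambda>\<epsilon> t. h1' \<epsilon> (h2' \<epsilon> t))"
  unfolding inverse_germ_def
proof
  fix t0 assume t0: "t0 \<in> T"
  have "((\<lambda>x. h2' (fst x) (snd x)) \<longlongrightarrow> t0) (nhds (0, t0))"
    using assms(3) t0 unfolding germ_at_identity_def by blast
  note inverse_germ_comp[OF assms(1) t0 this]
  moreover have "\<forall>\<^sub>F x in nhds (0, t0). h2 (fst x) (h2' (fst x) (snd x)) = snd x"
    using assms(2) t0 unfolding inverse_germ_def by blast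
  ultimately show "\<forall>\<^sub>F x in nhds (0, t0). h2 (fst x) (h1 (fst x) (h1' (fst x) (h2' (fst x) (snd x)))) = snd x"
    by eventually_elim simp
qed

lemma displacement_order_cong:
  assumes "displacement_order T h k m" "\<And>t. t \<in> T \<Longrightarrow> m t = m' t"
  shows "displacement_order T h k m'"
  using assms unfolding displacement_order_def by simp

lemma class_join:
  assumes "p \<in> loops_at S a" "q \<in> loops_at S a"
  shows "p +++ q \<in> loops_at S a"
    and "homotopy_class S (p +++ q) = homotopy_class S p \<otimes>\<^bsub>fundamental_group S a\<^esub> homotopy_class S q"
  using assms fundamental_group_mult[OF assms] by (auto simp: loops_at_def path_image_join)

lemma class_reversepath:
  assumes p: "p \<in> loops_at S a"
  shows "reversepath p \<in> loops_at S a"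
    and "homotopy_class S (reversepath p) = inv\<^bsub>fundamental_group S a\<^esub> (homotopy_class S p)"
proof -
  have "a \<in> S" using p by (auto simp: loops_at_def path_image_def pathstart_def)
  then interpret group "fundamental_group S a" by (rule group_fundamental_group)
  show rev: "reversepath p \<in> loops_at S a" using p by (auto simp: loops_at_def)
  have "homotopic_paths S (reversepath p +++ p) (linepath a a)"
    using p homotopic_paths_linv[of p S] by (auto simp: loops_at_def)
  hence "homotopy_class S (reversepath p) \<otimes>\<^bsub>fundamental_group S a\<^esub> homotopy_class S p = \<one>\<^bsub>fundamental_group S a\<^esub>"
    using fundamental_group_mult[OF rev p] homotopy_class_eq by (simp add: fundamental_group_def)
  moreover have "homotopy_class S p \<in> carrier (fundamental_group S a)" "homotopy_class S (reversepath p) \<in> carrier (fundamental_group S a)"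
    using p rev by (auto simp: fundamental_group_def)
  ultimately show "homotopy_class S (reversepath p) = inv\<^bsub>fundamental_group S a\<^esub> (homotopy_class S p)"
    by (intro inv_equality[symmetric])
qed

context transversal_setup
begin

abbreviation "\<pi> t \<equiv> fundamental_group (fiber f t) (\<sigma> t)"
abbreviation "cls t p \<equiv> homotopy_class (fiber f t) p"

text \<open>\<open>\<delta>'\<close> represents the inverse of \<open>\<delta>\<close>; it is carried along so that commutators can be formed.\<close>

definition loop_displacement where
  "loop_displacement \<delta> \<delta>' k m \<longleftrightarrow>
    (\<exists>W \<gamma> h W' \<gamma>' h'. holonomy_data f \<omega> T \<sigma> W \<gamma> \<delta> h \<and> holonomy_data f \<omega> T \<sigma> W' \<gamma>' \<delta>' h' \<and>
      inverse_germ T h h' \<and> inverse_germ T h' h \<and> displacement_order T h k m) \<and>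
    (\<forall>t\<in>T. \<delta> t \<in> loops_at (fiber f t) (\<sigma> t) \<and> valid_path (\<delta> t) \<and> \<delta>' t \<in> loops_at (fiber f t) (\<sigma> t) \<and>
      valid_path (\<delta>' t) \<and> cls t (\<delta>' t) = inv\<^bsub>\<pi> t\<^esub> (cls t (\<delta> t)))"

text \<open>\<open>\<delta>'\<close> is the commutator with \<open>a\<close> and \<open>c\<close>
  exchanged, hence the inverse class of \<open>\<delta>\<close>; its holonomy inverts that of
  \<open>\<delta>\<close> by cancelling factor after factor.\<close>

lemma loop_displacement_commutator:
  assumes a: "loop_displacement a a' 1 ma" and c: "loop_displacement c c' k mc"
    and hol: "ma holomorphic_on T" "mc holomorphic_on T" and k: "k \<ge> 1"
  defines "\<delta> \<equiv> \<lambda>t. ((a t +++ c t) +++ a' t) +++ c' t" and "\<delta>' \<equiv> \<lambda>t. ((c t +++ a t) +++ c' t) +++ a' t"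
  shows "loop_displacement \<delta> \<delta>' (Suc k) (\<lambda>t. ma t * deriv mc t - deriv ma t * mc t)"
    and "\<And>t. t \<in> T \<Longrightarrow> cls t (\<delta> t) = cls t (a t) \<otimes>\<^bsub>\<pi> t\<^esub> cls t (c t) \<otimes>\<^bsub>\<pi> t\<^esub> inv\<^bsub>\<pi> t\<^esub> (cls t (a t)) \<otimes>\<^bsub>\<pi> t\<^esub> inv\<^bsub>\<pi> t\<^esub> (cls t (c t))"
proof -
  obtain Wa \<gamma>a ha Wa' \<gamma>a' ha' where ha: "holonomy_data f \<omega> T \<sigma> Wa \<gamma>a a ha" "holonomy_data f \<omega> T \<sigma> Wa' \<gamma>a' a' ha'"
      "inverse_germ T ha ha'" "inverse_germ T ha' ha" "displacement_order T ha 1 ma"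
    using a unfolding loop_displacement_def by (elim conjE exE)
  obtain Wc \<gamma>c hc Wc' \<gamma>c' hc' where hc: "holonomy_data f \<omega> T \<sigma> Wc \<gamma>c c hc" "holonomy_data f \<omega> T \<sigma> Wc' \<gamma>c' c' hc'"
      "inverse_germ T hc hc'" "inverse_germ T hc' hc" "displacement_order T hc k mc"
    using c unfolding loop_displacement_def by (elim conjE exE)
  note g = holonomy_germ_at_identity[OF ha(1)] holonomy_germ_at_identity[OF ha(2)]
    holonomy_germ_at_identity[OF hc(1)] holonomy_germ_at_identity[OF hc(2)]
  note j1 = holonomy_data_join[OF holonomy_data_join[OF holonomy_data_join[OF ha(1) hc(1)] ha(2)] hc(2), folded \<delta>_def]
  note j2 = holonomy_data_join[OF holonomy_data_join[OF holonomy_data_join[OF hc(1) ha(1)] hc(2)] ha(2), folded \<delta>'_def]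
  note i1 = inverse_germ_compose[OF inverse_germ_compose[OF inverse_germ_compose[OF ha(3) hc(3) g(4)] ha(4) g(1)] hc(4) g(3)]
  note i2 = inverse_germ_compose[OF inverse_germ_compose[OF inverse_germ_compose[OF hc(3) ha(3) g(2)] hc(4) g(3)] ha(4) g(1)]
  note ord = displacement_order_commutator[OF T_open g ha(3) hc(3) ha(5) hc(5) hol k]
  have data: "\<exists>W \<gamma> h W' \<gamma>' h'. holonomy_data f \<omega> T \<sigma> W \<gamma> \<delta> h \<and> holonomy_data f \<omega> T \<sigma> W' \<gamma>' \<delta>' h' \<and>
      inverse_germ T h h' \<and> inverse_germ T h' h \<and> displacement_order T h (Suc k) (\<lambda>t. ma t * deriv mc t - deriv ma t * mc t)"
    by (intro exI conjI, rule j1, rule j2, rule i1, rule i2, rule ord)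
  have paths: "\<delta> t \<in> loops_at (fiber f t) (\<sigma> t) \<and> valid_path (\<delta> t) \<and> \<delta>' t \<in> loops_at (fiber f t) (\<sigma> t) \<and>
      valid_path (\<delta>' t) \<and> cls t (\<delta>' t) = inv\<^bsub>\<pi> t\<^esub> (cls t (\<delta> t)) \<and>
      cls t (\<delta> t) = cls t (a t) \<otimes>\<^bsub>\<pi> t\<^esub> cls t (c t) \<otimes>\<^bsub>\<pi> t\<^esub> inv\<^bsub>\<pi> t\<^esub> (cls t (a t)) \<otimes>\<^bsub>\<pi> t\<^esub> inv\<^bsub>\<pi> t\<^esub> (cls t (c t))"
    if t: "t \<in> T" for t
  proof -
    have ll: "a t \<in> loops_at (fiber f t) (\<sigma> t)" "a' t \<in> loops_at (fiber f t) (\<sigma> t)"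
        "c t \<in> loops_at (fiber f t) (\<sigma> t)" "c' t \<in> loops_at (fiber f t) (\<sigma> t)"
      and vp: "valid_path (a t)" "valid_path (a' t)" "valid_path (c t)" "valid_path (c' t)"
      and iv: "cls t (a' t) = inv\<^bsub>\<pi> t\<^esub> (cls t (a t))" "cls t (c' t) = inv\<^bsub>\<pi> t\<^esub> (cls t (c t))"
      using a c t unfolding loop_displacement_def by blast+
    have ends: "pathstart (p +++ q) = \<sigma> t" "pathfinish (p +++ q) = \<sigma> t"
      if "pathstart p = \<sigma> t" "pathfinish q = \<sigma> t" for p q using that by simp_all
    have e: "pathstart (a t) = \<sigma> t" "pathfinish (a t) = \<sigma> t" "pathstart (a' t) = \<sigma> t" "pathfinish (a' t) = \<sigma> t"
        "pathstart (c t) = \<sigma> t" "pathfinish (c t) = \<sigma> t" "pathstart (c' t) = \<sigma> t" "pathfinish (c' t) = \<sigma> t"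
      using ll by (auto simp: loops_at_def)
    have l1: "a t +++ c t \<in> loops_at (fiber f t) (\<sigma> t)" "(a t +++ c t) +++ a' t \<in> loops_at (fiber f t) (\<sigma> t)"
        "\<delta> t \<in> loops_at (fiber f t) (\<sigma> t)" and l2: "c t +++ a t \<in> loops_at (fiber f t) (\<sigma> t)"
        "(c t +++ a t) +++ c' t \<in> loops_at (fiber f t) (\<sigma> t)" "\<delta>' t \<in> loops_at (fiber f t) (\<sigma> t)"
      unfolding \<delta>_def \<delta>'_def by (intro class_join ll)+
    have vps: "valid_path (\<delta> t)" "valid_path (\<delta>' t)"
      unfolding \<delta>_def \<delta>'_def by (simp_all add: valid_path_join vp e)
    have "\<sigma> t \<in> fiber f t" using section_eq[OF t] by (simp add: fiber_def)
    then interpret G: group "\<pi> t" by (rule group_fundamental_group)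
    have carr: "cls t (a t) \<in> carrier (\<pi> t)" "cls t (c t) \<in> carrier (\<pi> t)"
      using ll by (auto simp: fundamental_group_def)
    have c1: "cls t (\<delta> t) = cls t (a t) \<otimes>\<^bsub>\<pi> t\<^esub> cls t (c t) \<otimes>\<^bsub>\<pi> t\<^esub> inv\<^bsub>\<pi> t\<^esub> (cls t (a t)) \<otimes>\<^bsub>\<pi> t\<^esub> inv\<^bsub>\<pi> t\<^esub> (cls t (c t))"
      unfolding \<delta>_def class_join(2)[OF l1(2) ll(4)] class_join(2)[OF l1(1) ll(2)] class_join(2)[OF ll(1,3)] iv ..
    have c2: "cls t (\<delta>' t) = cls t (c t) \<otimes>\<^bsub>\<pi> t\<^esub> cls t (a t) \<otimes>\<^bsub>\<pi> t\<^esub> inv\<^bsub>\<pi> t\<^esub> (cls t (c t)) \<otimes>\<^bsub>\<pi> t\<^esub> inv\<^bsub>\<pi> t\<^esub> (cls t (a t))"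
      unfolding \<delta>'_def class_join(2)[OF l2(2) ll(2)] class_join(2)[OF l2(1) ll(4)] class_join(2)[OF ll(3,1)] iv ..
    have "cls t (\<delta>' t) = inv\<^bsub>\<pi> t\<^esub> (cls t (\<delta> t))"
      unfolding c1 c2 using carr by (simp add: G.inv_mult_group G.m_assoc)
    with l1 l2 vps c1 show ?thesis by blast
  qed
  show "loop_displacement \<delta> \<delta>' (Suc k) (\<lambda>t. ma t * deriv mc t - deriv ma t * mc t)"
    unfolding loop_displacement_def using data paths by blast
  show "\<And>t. t \<in> T \<Longrightarrow> cls t (\<delta> t) = cls t (a t) \<otimes>\<^bsub>\<pi> t\<^esub> cls t (c t) \<otimes>\<^bsub>\<pi> t\<^esub> inv\<^bsub>\<pi> t\<^esub> (cls t (a t)) \<otimes>\<^bsub>\<pi> t\<^esub> inv\<^bsub>\<pi> t\<^esub> (cls t (c t))"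
    using paths by blast
qed

lemma loop_displacement_cong:
  assumes "loop_displacement \<delta> \<delta>' k m" "\<And>t. t \<in> T \<Longrightarrow> m t = m' t"
  shows "loop_displacement \<delta> \<delta>' k m'"
proof -
  have "displacement_order T h k m \<Longrightarrow> displacement_order T h k m'" for h
    using displacement_order_cong[of T h k m m'] assms(2) by blast
  thus ?thesis using assms(1) unfolding loop_displacement_def by blast
qed

lemma ad_loops:
  assumes a: "loop_displacement a a' 1 (\<lambda>t. - (A1 + B1 * t))" and b: "loop_displacement b b' 1 (\<lambda>t. - (A2 + B2 * t))"
  shows "\<exists>\<delta> \<delta>'. loop_displacement \<delta> \<delta>' (Suc (Suc m)) (\<lambda>t. B1 ^ m * (A1 * B2 - A2 * B1)) \<and>
    (\<forall>t\<in>T. cls t (\<delta> t) = group.ad_word (\<pi> t) (cls t (a t)) (cls t (b t)) (Suc m))"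
proof (induction m)
  case 0
  have lin: "deriv (\<lambda>t. - (A + B * t)) t = - B" for A B t :: complex
    by (rule DERIV_imp_deriv) (auto intro!: derivative_eq_intros)
  have hol: "(\<lambda>t. - (A + B * t)) holomorphic_on T" for A B by (intro holomorphic_intros)
  note comm = loop_displacement_commutator[OF a b hol hol order_refl, unfolded lin]
  have g: "group (\<pi> t)" if "t \<in> T" for t
    using section_eq[OF that] by (intro group_fundamental_group) (simp add: fiber_def)
  have "loop_displacement (\<lambda>t. ((a t +++ b t) +++ a' t) +++ b' t) (\<lambda>t. ((b t +++ a t) +++ b' t) +++ a' t)
      (Suc (Suc 0)) (\<lambda>t. B1 ^ 0 * (A1 * B2 - A2 * B1))"
    by (rule loop_displacement_cong[OF comm(1)[unfolded One_nat_def]]) (simp add: algebra_simps)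
  moreover have "cls t (((a t +++ b t) +++ a' t) +++ b' t) = group.ad_word (\<pi> t) (cls t (a t)) (cls t (b t)) (Suc 0)"
    if "t \<in> T" for t
    using comm(2)[OF that] group.ad_word.simps[OF g[OF that]] by simp
  ultimately show ?case by blast
next
  case (Suc m)
  then obtain c c' where c: "loop_displacement c c' (Suc (Suc m)) (\<lambda>t. B1 ^ m * (A1 * B2 - A2 * B1))"
      and cls: "\<And>t. t \<in> T \<Longrightarrow> cls t (c t) = group.ad_word (\<pi> t) (cls t (a t)) (cls t (b t)) (Suc m)" by blast
  have lin: "deriv (\<lambda>t. - (A + B * t)) t = - B" for A B t :: complex
    by (rule DERIV_imp_deriv) (auto intro!: derivative_eq_intros)
  have hol: "(\<lambda>t. - (A + B * t)) holomorphic_on T" for A B by (intro holomorphic_intros)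
  have k: "1 \<le> Suc (Suc m)" by simp
  note comm = loop_displacement_commutator[OF a c hol holomorphic_on_const k, unfolded lin deriv_const]
  have g: "group (\<pi> t)" if "t \<in> T" for t
    using section_eq[OF that] by (intro group_fundamental_group) (simp add: fiber_def)
  have "loop_displacement (\<lambda>t. ((a t +++ c t) +++ a' t) +++ c' t) (\<lambda>t. ((c t +++ a t) +++ c' t) +++ a' t)
      (Suc (Suc (Suc m))) (\<lambda>t. B1 ^ Suc m * (A1 * B2 - A2 * B1))"
    by (rule loop_displacement_cong[OF comm(1)]) simp
  moreover have "cls t (((a t +++ c t) +++ a' t) +++ c' t) = group.ad_word (\<pi> t) (cls t (a t)) (cls t (b t)) (Suc (Suc m))"
    if "t \<in> T" for t
    unfolding comm(2)[OF that] cls[OF that] group.ad_word.simps(2)[OF g[OF that], of _ _ "Suc m"] ..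
  ultimately show ?case by blast
qed

lemma loop_displacement_family:
  assumes "loop_displacement \<delta> \<delta>' k m" and T: "T \<noteq> {}" "connected T" "\<And>t. t \<in> T \<Longrightarrow> regular_value f t"
    and \<sigma>: "transversal f T \<sigma>"
  shows "loop_family f T \<sigma> \<delta>"
proof -
  obtain W \<gamma> h where hd: "holonomy_data f \<omega> T \<sigma> W \<gamma> \<delta> h" using assms(1) unfolding loop_displacement_def by blast
  have W: "{0} \<times> T \<subseteq> W" and c: "continuous_on (W \<times> {0..1}) (\<lambda>((\<epsilon>, t), s). \<gamma> \<epsilon> t s)"
      and \<gamma>: "\<forall>t\<in>T. \<forall>s\<in>{0..1}. \<gamma> 0 t s = \<delta> t s"
    using hd unfolding holonomy_data_def by blast+
  have "continuous_on (T \<times> {0..1}) ((\<lambda>((\<epsilon>, t), s). \<gamma> \<epsilon> t s) \<circ> (\<lambda>x. ((0, fst x), snd x)))"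
    by (intro continuous_on_compose continuous_on_subset[OF c] continuous_intros) (use W in auto)
  hence "continuous_on (T \<times> {0..1}) (\<lambda>(t, s). \<delta> t s)"
    by (rule continuous_on_eq) (use \<gamma> in auto)
  thus ?thesis
    using assms unfolding loop_family_def loop_displacement_def by (intro conjI T_open \<sigma>) blast+
qed

lemma loop_displacement_Poincare_Pontryagin:
  assumes "loop_displacement \<delta> \<delta>' k m" "k \<ge> 1" and t: "t \<in> T" "m t \<noteq> 0"
  shows "\<exists>mk. Poincare_Pontryagin f \<omega> T \<sigma> \<delta> k mk \<and> (\<exists>t\<in>T. mk t \<noteq> 0)"
proof -
  obtain W \<gamma> h where hd: "holonomy_data f \<omega> T \<sigma> W \<gamma> \<delta> h" "displacement_order T h k m"
    using assms(1) unfolding loop_displacement_def by blast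
  obtain mk where "Poincare_Pontryagin f \<omega> T \<sigma> \<delta> k mk" "\<And>t. t \<in> T \<Longrightarrow> mk t = m t"
    using Poincare_Pontryagin_of_displacement_order[OF hd assms(2)] by metis
  thus ?thesis using t by (intro exI[of _ mk]) auto
qed

end

lemma (in flow_data) loop_displacement_loop:
  assumes "\<And>t. t \<in> T \<Longrightarrow> form_integral (P, Q) 0 (coord t) = A + B' * t"
  shows "loop_displacement loop (\<lambda>t. reversepath (loop t)) 1 (\<lambda>t. - (A + B' * t))"
proof -
  obtain W' \<gamma>' h' where r: "holonomy_data f (P, Q) T \<sigma> W' \<gamma>' (\<lambda>t. reversepath (loop t)) h'"
      "inverse_germ T hol_map h'" "inverse_germ T h' hol_map"
    by (rule reversed_loop_holonomy)
  have "displacement_order T hol_map 1 (\<lambda>t. - (A + B' * t))"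
    by (rule displacement_order_cong[OF displacement_order_loop]) (simp add: assms)
  moreover have "loop t \<in> loops_at (fiber f t) (\<sigma> t) \<and> valid_path (loop t) \<and> reversepath (loop t) \<in> loops_at (fiber f t) (\<sigma> t) \<and>
      valid_path (reversepath (loop t)) \<and> cls t (reversepath (loop t)) = inv\<^bsub>\<pi> t\<^esub> (cls t (loop t))" if t: "t \<in> T" for t
  proof -
    have "valid_path (loop t)" unfolding loop_def using \<delta> t by (intro \<gamma>_valid_path) auto
    thus ?thesis using class_reversepath[OF loop_in_fiber[OF t]] loop_in_fiber[OF t] valid_path_imp_reverse by blast
  qed
  ultimately show ?thesis
    unfolding loop_displacement_def using holonomy_data_loop r by blast
qed

lemma (in flow_data) class_integrals_loop:
  assumes t: "t \<in> T" and ff: "integrable_forms (fiber f t) (apply_form \<theta>) (apply_form \<eta>)"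
  shows "integrable_forms.class_integral (fiber f t) (apply_form \<theta>) (cls t (loop t)) = form_integral \<theta> 0 (coord t)"
    and "integrable_forms.class_iterated_integral (fiber f t) (apply_form \<theta>) (apply_form \<eta>) 1 (cls t (loop t)) = form_integral \<eta> 0 (coord t)"
proof -
  interpret integrable_forms "fiber f t" "apply_form \<theta>" "apply_form \<eta>" by (rule ff)
  have p: "path (loop t)" "path_image (loop t) \<subseteq> fiber f t" using loop_in_fiber[OF t] by (auto simp: loops_at_def)
  have d: "(loop t has_vector_derivative vel s 0 (ode.flow s 0 (coord t))) (at s within {0..1})" if "s \<in> {0..1}" for s
    by (rule loop_deriv[OF t that])
  show "class_integral (cls t (loop t)) = form_integral \<theta> 0 (coord t)"
    using integrals_of_C1_path(1)[OF p(2) d] class_integral_eq(1)[OF p]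
    by (simp add: form_integral_def loop_def[unfolded \<gamma>_def] \<gamma>_def)
  show "class_iterated_integral 1 (cls t (loop t)) = form_integral \<eta> 0 (coord t)"
    using integrals_of_C1_path(2)[OF p(2) d] class_integral_eq(2)[OF p, of 1]
    by (simp add: form_integral_def loop_def[unfolded \<gamma>_def] \<gamma>_def)
qed

section \<open>Loops over two circles\<close>

text \<open>The top parts of the two partial derivatives have no common zero on the sphere, so all
  critical points lie in a bounded set, on which \<open>f\<close> is bounded.\<close>

lemma regular_value_large:
  assumes f: "total_degree_le f (Suc n)"
    and top: "\<And>z. z \<in> sphere 0 1 \<Longrightarrow> homogeneous_part (coeffs_dx (bicoeff f)) n z \<noteq> 0 \<or>
      homogeneous_part (coeffs_dy (bicoeff f)) n z \<noteq> 0"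
  obtains M where "\<And>t. norm t > M \<Longrightarrow> regular_value f t"
proof -
  let ?X = "homogenization (coeffs_dx (bicoeff f)) n" and ?Y = "homogenization (coeffs_dy (bicoeff f)) n"
  let ?K = "sphere (0 :: complex \<times> complex) 1"
  define g where "g = (\<lambda>k p. complex_of_real (norm (?X p k) + norm (?Y p k)))"
  have K: "compact ?K" by simp
  have cg: "continuous_on (?K \<times> cball 0 1) (\<lambda>(k, p). g k p)"
    unfolding g_def case_prod_unfold by (intro continuous_intros)
  have pos0: "norm (?X 0 k) + norm (?Y 0 k) > 0" if "k \<in> ?K" for k
    using top[OF that] by (auto simp: homogenization_0 add_pos_nonneg add_nonneg_pos)
  have "continuous_on ?K (\<lambda>k. norm (?X 0 k) + norm (?Y 0 k))" by (intro continuous_intros)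
  moreover have "(1, 0) \<in> ?K" by simp
  ultimately obtain k0 where k0: "k0 \<in> ?K" "\<And>k. k \<in> ?K \<Longrightarrow> norm (?X 0 k0) + norm (?Y 0 k0) \<le> norm (?X 0 k) + norm (?Y 0 k)"
    using continuous_attains_inf[OF K, of "\<lambda>k. norm (?X 0 k) + norm (?Y 0 k)"] by blast
  define m where "m = norm (?X 0 k0) + norm (?Y 0 k0)"
  have m: "m > 0" unfolding m_def by (rule pos0[OF k0(1)])
  obtain \<delta> where \<delta>: "\<delta> > 0" "\<And>k p. k \<in> ?K \<Longrightarrow> norm p \<le> \<delta> \<Longrightarrow> norm (g k p - g k 0) < m"
    using small_parameter[OF K zero_less_one cg m] by metis
  have nz: "?X p k \<noteq> 0 \<or> ?Y p k \<noteq> 0" if "k \<in> ?K" "norm p \<le> \<delta>" for p k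
  proof (rule ccontr)
    assume "\<not> ?thesis"
    hence "g k p = 0" by (simp add: g_def)
    hence "norm (g k 0) < m" using \<delta>(2)[OF that] by simp
    moreover have "m \<le> norm (g k 0)" using k0(2)[OF that(1)] by (simp add: g_def m_def del: of_real_add)
    ultimately show False by simp
  qed
  have deg: "total_degree_le (map_poly pderiv f) n" "total_degree_le (pderiv f) n"
    using total_degree_le_pderiv[OF f] .
  have crit: "\<exists>v. apply_form (differential f) z v \<noteq> 0" if z: "norm z \<ge> 1 / \<delta>" for z
  proof -
    have z0: "norm z > 0" using z \<delta>(1) by (meson less_le_trans zero_less_divide_1_iff)
    define R where "R = complex_of_real (norm z)"
    define k where "k = (fst z / R, snd z / R)"
    have R: "R \<noteq> 0" using z0 by (simp add: R_def)
    have zk: "z = (R * fst k, R * snd k)" using R by (simp add: k_def)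
    have "k = z /\<^sub>R norm z"
      using z0 by (cases z) (simp add: k_def R_def scaleR_conv_of_real divide_inverse mult.commute)
    hence "k \<in> ?K" using z0 by simp
    moreover have "norm (1 / R) \<le> \<delta>" using z z0 \<delta>(1) by (simp add: R_def norm_divide field_simps)
    ultimately have "?X (1 / R) k \<noteq> 0 \<or> ?Y (1 / R) k \<noteq> 0" by (rule nz)
    hence "bieval (map_poly pderiv f) z \<noteq> 0 \<or> bieval (pderiv f) z \<noteq> 0"
      using bieval_scale[OF deg(1) R, of "fst k" "snd k"] bieval_scale[OF deg(2) R, of "fst k" "snd k"] R zk
      by (auto simp: bicoeff_map_poly_pderiv bicoeff_pderiv)
    thus ?thesis
    proof
      assume "bieval (map_poly pderiv f) z \<noteq> 0"
      thus ?thesis by (intro exI[of _ "(1, 0)"]) (simp add: apply_form_def differential_def)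
    next
      assume "bieval (pderiv f) z \<noteq> 0"
      thus ?thesis by (intro exI[of _ "(0, 1)"]) (simp add: apply_form_def differential_def)
    qed
  qed
  have "compact (bieval f ` cball 0 (1 / \<delta>))"
    by (intro compact_continuous_image continuous_on_bieval) auto
  then obtain M where M: "\<And>z. norm z \<le> 1 / \<delta> \<Longrightarrow> norm (bieval f z) \<le> M"
    using compact_imp_bounded bounded_iff by (metis (no_types, lifting) imageI mem_cball_0)
  have "regular_value f t" if "norm t > M" for t
    unfolding regular_value_def
  proof
    fix z assume "z \<in> fiber f t"
    hence "\<not> norm z \<le> 1 / \<delta>" using M[of z] that by (auto simp: fiber_def)
    thus "\<exists>v. apply_form (differential f) z v \<noteq> 0" using crit by simp
  qed
  thus ?thesis by (rule that)
qed

text \<open>The difference of \<open>g\<close> and the identity is a contraction.\<close>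

lemma injective_of_deriv_near_1:
  fixes g :: "complex \<Rightarrow> complex"
  assumes "convex S" and c: "c < 1"
    and g: "\<And>z. z \<in> S \<Longrightarrow> (g has_field_derivative g' z) (at z within S)" "\<And>z. z \<in> S \<Longrightarrow> norm (g' z - 1) \<le> c"
  shows "inj_on g S"
proof (rule inj_onI)
  fix x y assume xy: "x \<in> S" "y \<in> S" "g x = g y"
  have "norm ((g x - x) - (g y - y)) \<le> c * norm (x - y)"
  proof (rule field_differentiable_bound[OF assms(1) _ g(2) xy(1,2)])
    fix z assume "z \<in> S"
    thus "((\<lambda>z. g z - z) has_field_derivative g' z - 1) (at z within S)"
      by (intro DERIV_diff g DERIV_ident)
  qed
  hence "norm (x - y) \<le> c * norm (x - y)" using xy(3) by (simp add: norm_minus_commute)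
  hence "(1 - c) * norm (x - y) \<le> 0" by (simp add: left_diff_distrib)
  hence "norm (x - y) \<le> 0" using c by (simp add: mult_le_0_iff)
  thus "x = y" by simp
qed

text \<open>For large R the level is R^(n+1) times a small perturbation of v^(n+1). After division
  by n + 1 its derivative is within 1/4 + 1/2 of 1, hence injectivity. The lower bound uses norm v
  \<ge> 3/4 and gives up one half to the perturbation; it will make the values of \<open>f\<close>
  large enough to be regular.\<close>

lemma level_asymptotics:
  assumes f: "total_degree_le f (Suc n)" and e: "e ^ Suc n * slope_poly (bicoeff f) (Suc n) u = 1"
  obtains r0 \<delta> :: real where "r0 > 0" "r0 \<le> 1 / 4" "\<delta> > 0"
    "\<And>R. R \<noteq> 0 \<Longrightarrow> norm (1 / R) \<le> \<delta> \<Longrightarrow> inj_on (\<lambda>v. bieval f (R * (e * v), R * (e * v * u))) (cball 1 r0)"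
    "\<And>R v. R \<noteq> 0 \<Longrightarrow> norm (1 / R) \<le> \<delta> \<Longrightarrow> v \<in> cball 1 r0 \<Longrightarrow>
      norm (bieval f (R * (e * v), R * (e * v * u))) \<ge> (3 / 4) ^ Suc n / 2 * norm R ^ Suc n"
proof -
  let ?C = "bicoeff f" and ?N = "Suc n"
  define g where "g = (\<lambda>v \<tau>. homogenization ?C ?N \<tau> (e * v, e * v * u))"
  define g' where "g' = (\<lambda>v \<tau>. \<Sum>j\<le>?N. \<tau> ^ (?N - j) * (of_nat j * e ^ j * v ^ (j - 1) * slope_poly ?C j u))"
  have g_eq: "g v \<tau> = (\<Sum>j\<le>?N. \<tau> ^ (?N - j) * ((e * v) ^ j * slope_poly ?C j u))" for v \<tau>
    by (simp only: g_def homogenization_def homogeneous_part_slope)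
  have N_nz: "(of_nat ?N :: complex) \<noteq> 0" by (simp del: of_nat_Suc)
  have only_top: "(\<Sum>j\<le>?N. 0 ^ (?N - j) * a j) = a ?N" for a :: "nat \<Rightarrow> complex"
  proof -
    have "(\<Sum>j\<le>?N. 0 ^ (?N - j) * a j) = (\<Sum>j\<in>{?N}. 0 ^ (?N - j) * a j)"
      by (rule sum.mono_neutral_right) (auto simp: zero_power simp del: power_Suc)
    thus ?thesis by simp
  qed
  have g0: "g v 0 = v ^ ?N" for v
    unfolding g_eq only_top power_mult_distrib using e by (simp add: mult_ac del: power_Suc)
  have g'0: "g' v 0 = of_nat ?N * v ^ n" for v
    unfolding g'_def only_top using e by (simp add: mult_ac del: power_Suc of_nat_Suc)
  have deriv: "((\<lambda>v. g v \<tau>) has_field_derivative g' v \<tau>) (at v within S)" for v \<tau> S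
    unfolding g_eq g'_def
    by (intro DERIV_sum DERIV_cmult) (auto intro!: derivative_eq_intros simp: power_mult_distrib)
  obtain r1 where r1: "r1 > 0" "\<And>v::complex. norm (v - 1) \<le> r1 \<Longrightarrow> norm (v ^ n - 1) < 1 / 2"
  proof -
    have "isCont (\<lambda>v::complex. v ^ n) 1" by (intro continuous_intros)
    then obtain d where d: "d > 0" "\<And>v. dist v 1 < d \<Longrightarrow> dist (v ^ n) ((1::complex) ^ n) < 1 / 2"
      unfolding continuous_at_eps_delta by (meson half_gt_zero zero_less_one)
    thus ?thesis by (intro that[of "d / 2"]) (auto simp: dist_norm)
  qed
  define r0 where "r0 = min r1 (1 / 4)"
  have r0: "r0 > 0" "r0 \<le> 1 / 4" "r0 \<le> r1" using r1 by (auto simp: r0_def)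
  let ?K = "cball (1::complex) r0"
  have cont: "continuous_on (?K \<times> cball 0 1) (\<lambda>(v, \<tau>). g v \<tau>)" "continuous_on (?K \<times> cball 0 1) (\<lambda>(v, \<tau>). g' v \<tau>)"
    unfolding case_prod_unfold g_eq g'_def by (intro continuous_intros)+
  have "(3 / 4 :: real) ^ ?N / 2 > 0" by simp
  then obtain \<delta>1 where \<delta>1: "\<delta>1 > 0" "\<And>v \<tau>. v \<in> ?K \<Longrightarrow> norm \<tau> \<le> \<delta>1 \<Longrightarrow> norm (g v \<tau> - g v 0) < (3 / 4) ^ ?N / 2"
    using small_parameter[OF compact_cball zero_less_one cont(1)] by metis
  have "real ?N / 4 > 0" by simp
  then obtain \<delta>2 where \<delta>2: "\<delta>2 > 0" "\<And>v \<tau>. v \<in> ?K \<Longrightarrow> norm \<tau> \<le> \<delta>2 \<Longrightarrow> norm (g' v \<tau> - g' v 0) < real ?N / 4"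
    using small_parameter[OF compact_cball zero_less_one cont(2)] by metis
  have q: "bieval f (R * (e * v), R * (e * v * u)) = R ^ ?N * g v (1 / R)" if "R \<noteq> 0" for R v
    unfolding g_def by (rule bieval_scale[OF f that])
  show ?thesis
  proof (rule that[OF r0(1,2), of "min \<delta>1 \<delta>2"])
    show "min \<delta>1 \<delta>2 > 0" using \<delta>1 \<delta>2 by simp
  next
    fix R :: complex assume R: "R \<noteq> 0" "norm (1 / R) \<le> min \<delta>1 \<delta>2"
    have "inj_on (\<lambda>v. g v (1 / R) / of_nat ?N) ?K"
    proof (rule injective_of_deriv_near_1[where c = "3 / 4"])
      fix v assume v: "v \<in> ?K"
      show "((\<lambda>v. g v (1 / R) / of_nat ?N) has_field_derivative g' v (1 / R) / of_nat ?N) (at v within ?K)"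
        by (intro DERIV_cdivide deriv)
      have "norm (g' v (1 / R) - of_nat ?N * v ^ n) / real ?N \<le> 1 / 4"
        using \<delta>2(2)[OF v, of "1 / R"] R by (simp add: g'0 field_simps del: of_nat_Suc)
      hence "norm (g' v (1 / R) / of_nat ?N - v ^ n) \<le> 1 / 4"
      proof -
        have "g' v (1 / R) / of_nat ?N - v ^ n = (g' v (1 / R) - of_nat ?N * v ^ n) / of_nat ?N"
          using N_nz by (simp add: diff_divide_distrib del: of_nat_Suc)
        thus ?thesis using \<open>norm (g' v (1 / R) - of_nat ?N * v ^ n) / real ?N \<le> 1 / 4\<close>
          by (simp only: norm_divide norm_of_nat)
      qed
      moreover have "norm (v ^ n - 1) < 1 / 2" using v r0 by (intro r1(2)) (simp add: dist_norm norm_minus_commute)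
      ultimately show "norm (g' v (1 / R) / of_nat ?N - 1) \<le> 3 / 4"
        using norm_triangle_ineq[of "g' v (1 / R) / of_nat ?N - v ^ n" "v ^ n - 1"] by simp
    qed auto
    moreover have "bieval f (R * (e * v), R * (e * v * u)) = R ^ ?N * of_nat ?N * (g v (1 / R) / of_nat ?N)" for v
      using N_nz by (simp add: q[OF R(1)] del: of_nat_Suc power_Suc)
    ultimately show "inj_on (\<lambda>v. bieval f (R * (e * v), R * (e * v * u))) ?K"
      using R(1) N_nz by (simp add: inj_on_def del: of_nat_Suc power_Suc)
  next
    fix R v :: complex assume R: "R \<noteq> 0" "norm (1 / R) \<le> min \<delta>1 \<delta>2" and v: "v \<in> ?K"
    have "norm (v ^ ?N) \<ge> (3 / 4) ^ ?N"
    proof -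
      have "norm v \<ge> 1 - norm (1 - v)" using norm_triangle_ineq2[of 1 "1 - v"] by simp
      hence "norm v \<ge> 3 / 4" using v r0 by (simp add: dist_norm)
      thus ?thesis unfolding norm_power by (intro power_mono) auto
    qed
    moreover have "norm (g v (1 / R) - v ^ ?N) < (3 / 4) ^ ?N / 2"
      using \<delta>1(2)[OF v, of "1 / R"] R by (simp add: g0 del: power_Suc)
    ultimately have "norm (g v (1 / R)) \<ge> (3 / 4) ^ ?N / 2"
      using norm_triangle_ineq2[of "v ^ ?N" "v ^ ?N - g v (1 / R)"] by (simp add: norm_minus_commute del: power_Suc)
    thus "norm (bieval f (R * (e * v), R * (e * v * u))) \<ge> (3 / 4) ^ ?N / 2 * norm R ^ ?N"
      unfolding q[OF R(1)] norm_mult norm_power by (subst mult.commute) (rule mult_left_mono, simp_all del: power_Suc)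
  qed
qed

lemma roots_of_unity_separated:
  obtains s :: real where "s > 0"
    "\<And>k. 0 < k \<Longrightarrow> k < Suc n \<Longrightarrow> s < norm (exp (2 * of_real pi * \<i> * of_nat k / of_nat (Suc n)) - 1)"
proof -
  let ?z = "\<lambda>k. norm (exp (2 * of_real pi * \<i> * of_nat k / of_nat (Suc n)) - 1)"
  have pos: "?z k > 0" if "0 < k" "k < Suc n" for k
  proof -
    have "\<not> Suc n dvd k" using that by (auto dest: dvd_imp_le)
    hence "exp (2 * of_real pi * \<i> * of_nat k / of_nat (Suc n)) \<noteq> (1::complex)"
      using complex_root_unity_eq_1[of "Suc n" k] by (simp del: of_nat_Suc)
    thus ?thesis by simp
  qed
  \<comment> \<open>The inserted 1 keeps the set non-empty when n = 0.\<close>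
  define m where "m = Min (insert 1 (?z ` {k. 0 < k \<and> k < Suc n}))"
  have "m > 0" unfolding m_def using pos by (subst Min_gr_iff) auto
  moreover have "m \<le> ?z k" if "0 < k" "k < Suc n" for k
    unfolding m_def using that by (intro Min_le) auto
  ultimately have "m / 2 > 0 \<and> (\<forall>k. 0 < k \<and> k < Suc n \<longrightarrow> m / 2 < ?z k)"
    by (intro conjI allI impI) (simp, rule less_le_trans[of _ m], simp, blast)
  thus ?thesis using that[of "m / 2"] by blast
qed

text \<open>The circle about \<open>c\<close> with radius vector \<open>d\<close> and the one about
  \<open>c + 2 * d\<close> with radius vector \<open>- d\<close> touch at \<open>c + d\<close>,
  where both start. The two loops therefore have the same transversal and the same base
  points.\<close>

lemma two_circles:
  fixes f P Q P' Q' :: bipoly and c d l0 :: complex and n k :: nat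
  defines "A i X Y \<equiv> level_const (bicoeff f) n (if i then c else c + 2 * d) (if i then d else - d) (bicoeff X) (bicoeff Y)"
    and "S i X Y \<equiv> level_slope (bicoeff f) n (if i then c else c + 2 * d) (if i then d else - d) (bicoeff X) (bicoeff Y)"
  assumes n: "n \<ge> 1" and deg: "total_degree_le f (Suc n)" "total_degree_le P n" "total_degree_le Q n"
      "total_degree_le P' n" "total_degree_le Q' n"
    and top: "\<And>z. z \<in> sphere 0 1 \<Longrightarrow> homogeneous_part (coeffs_dx (bicoeff f)) n z \<noteq> 0 \<or>
      homogeneous_part (coeffs_dy (bicoeff f)) n z \<noteq> 0"
    and loops: "circle_loop n f c d l0" "circle_loop n f (c + 2 * d) (- d) l0"
    and B1: "S True P Q \<noteq> 0" and k: "k \<ge> 1"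
    and k2: "k \<ge> 2 \<Longrightarrow> A True P Q * S False P Q - A False P Q * S True P Q \<noteq> 0"
      "k \<ge> 2 \<Longrightarrow> S True P Q * S False P' Q' - S False P Q * S True P' Q' \<noteq> 0"
  shows "\<exists>T \<sigma> \<delta> mk. loop_family f T \<sigma> \<delta> \<and>
    (\<forall>t\<in>T. represents_nonzero_gr (fundamental_group (fiber f t) (\<sigma> t)) k (homotopy_class (fiber f t) (\<delta> t))) \<and>
    Poincare_Pontryagin f (P, Q) T \<sigma> \<delta> k mk \<and> (\<exists>t\<in>T. mk t \<noteq> 0)"
proof -
  interpret L1: circle_loop n f c d l0 by (rule loops)
  interpret L2: circle_loop n f "c + 2 * d" "- d" l0 by (rule loops)
  have ld1: "loop_data n f P Q L1.u L1.E L1.u' L1.E'" by (rule L1.circle_loop_data[OF deg(1-3)])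
  have ld2: "loop_data n f P Q L2.u L2.E L2.u' L2.E'" by (rule L2.circle_loop_data[OF deg(1-3)])
  have uE: "L2.u 0 = L1.u 0" "L2.E 0 = L1.E 0" by (simp_all add: L1.u_0 L2.u_0 L1.E_0 L2.E_0)
  have root: "L1.E 0 ^ Suc n * slope_poly (bicoeff f) (Suc n) (L1.u 0) = 1"
    using loop_data.E_root[OF ld1, of 0] by simp
  obtain s :: real where s: "s > 0"
      "\<And>k. 0 < k \<Longrightarrow> k < Suc n \<Longrightarrow> s < norm (exp (2 * of_real pi * \<i> * of_nat k / of_nat (Suc n)) - 1)"
    using roots_of_unity_separated[of n] by blast
  define q where "q = (\<lambda>R v. bieval f (R * (L1.E 0 * v), R * (L1.E 0 * v * L1.u 0)))"
  obtain r0 \<delta>0 where r0: "r0 > 0" "r0 \<le> 1 / 4" "\<delta>0 > 0"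
      "\<And>R. R \<noteq> 0 \<Longrightarrow> norm (1 / R) \<le> \<delta>0 \<Longrightarrow> inj_on (q R) (cball 1 r0)"
      "\<And>R v. R \<noteq> 0 \<Longrightarrow> norm (1 / R) \<le> \<delta>0 \<Longrightarrow> v \<in> cball 1 r0 \<Longrightarrow> norm (q R v) \<ge> (3 / 4) ^ Suc n / 2 * norm R ^ Suc n"
    unfolding q_def by (rule level_asymptotics[OF deg(1) root]) blast
  \<comment> \<open>The second entry gives 2r \<le> s, which separates the sheets.\<close>
  define r where "r = min r0 (s / 2)"
  have r: "r > 0" "r \<le> 1 / 4" "r \<le> r0" "2 * r \<le> s" using r0 s(1) by (auto simp: r_def)
  obtain \<delta>1 where \<delta>1: "\<delta>1 > 0" "\<And>\<tau>. norm \<tau> \<le> \<delta>1 \<Longrightarrow> contraction_ode (loop_data.field n f P Q L1.u L1.E L1.u' L1.E' \<tau>) 1 r \<delta>1"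
      "\<And>\<tau> s \<epsilon> v. norm \<tau> \<le> \<delta>1 \<Longrightarrow> norm \<epsilon> \<le> \<delta>1 \<Longrightarrow> s \<in> {0..1} \<Longrightarrow> v \<in> cball 1 r \<Longrightarrow> loop_data.den n f P Q L1.u L1.E \<tau> s \<epsilon> v \<noteq> 0"
    by (rule loop_data.contraction_ode_exists[OF ld1 r(1,2)]) blast
  obtain \<delta>2 where \<delta>2: "\<delta>2 > 0" "\<And>\<tau>. norm \<tau> \<le> \<delta>2 \<Longrightarrow> contraction_ode (loop_data.field n f P Q L2.u L2.E L2.u' L2.E' \<tau>) 1 r \<delta>2"
      "\<And>\<tau> s \<epsilon> v. norm \<tau> \<le> \<delta>2 \<Longrightarrow> norm \<epsilon> \<le> \<delta>2 \<Longrightarrow> s \<in> {0..1} \<Longrightarrow> v \<in> cball 1 r \<Longrightarrow> loop_data.den n f P Q L2.u L2.E \<tau> s \<epsilon> v \<noteq> 0"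
    by (rule loop_data.contraction_ode_exists[OF ld2 r(1,2)]) blast
  obtain M where M: "\<And>t. norm t > M \<Longrightarrow> regular_value f t" using regular_value_large[OF deg(1) top] by blast
  \<comment> \<open>Large enough for 1/R to meet the three smallness conditions and for all values
    of \<open>f\<close> on the transversal to exceed \<open>M\<close>; the entry 1 gives \<rho>
    \<le> \<rho>^(n+1).\<close>
  define \<rho> where "\<rho> = Max {1, 1 / \<delta>0, 1 / \<delta>1, 1 / \<delta>2, (\<bar>M\<bar> + 1) / ((3 / 4) ^ Suc n / 2)}"
  define R where "R = complex_of_real \<rho>"
  have \<rho>: "\<rho> \<ge> 1" "\<rho> \<ge> 1 / \<delta>0" "\<rho> \<ge> 1 / \<delta>1" "\<rho> \<ge> 1 / \<delta>2" "\<rho> \<ge> (\<bar>M\<bar> + 1) / ((3 / 4) ^ Suc n / 2)"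
    unfolding \<rho>_def by (rule Max_ge; simp)+
  have R: "R \<noteq> 0" "norm R = \<rho>" using \<rho>(1) by (auto simp: R_def)
  have small: "norm (1 / R) \<le> \<delta>" if "\<rho> \<ge> 1 / \<delta>" "\<delta> > 0" for \<delta>
    using that \<rho>(1) by (simp add: norm_divide R field_simps)
  have inj: "inj_on (q R) (cball 1 r)"
    by (rule inj_on_subset[OF r0(4)[OF R(1) small[OF \<rho>(2) r0(3)]]]) (use r(3) in auto)
  have large: "norm (q R v) > M" if "v \<in> cball 1 r" for v
  proof -
    have "M < \<bar>M\<bar> + 1" by simp
    also have "\<dots> \<le> (3 / 4) ^ Suc n / 2 * \<rho>"
      using \<rho>(5) by (subst (asm) pos_divide_le_eq) (simp_all add: mult.commute del: power_Suc)
    also have "\<dots> \<le> (3 / 4) ^ Suc n / 2 * \<rho> ^ Suc n"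
      using \<rho>(1) by (intro mult_left_mono self_le_power) auto
    also have "\<dots> \<le> norm (q R v)"
      using r0(5)[OF R(1) small[OF \<rho>(2) r0(3)], of v] that r(3) by (simp add: R(2))
    finally show ?thesis .
  qed
  \<comment> \<open>As polynomials in t, \<open>D1\<close> is the integral of \<omega> over the
    first loop and \<open>D2\<close> the determinant that detects the commutator; the coefficient of
    t^2 in \<open>D2\<close> is non-zero by assumption. For k = 1 there is no determinant and
    \<open>D2\<close> is set to 1.\<close>
  define D1 where "D1 = [:A True P Q, S True P Q:]"
  define D2 where "D2 = (if k \<ge> 2 then D1 * [:A False P' Q', S False P' Q':] -
    [:A False P Q, S False P Q:] * [:A True P' Q', S True P' Q':] else 1)"
  have top_coeff: "coeff D2 2 = S True P Q * S False P' Q' - S False P Q * S True P' Q'" if "k \<ge> 2"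
    using that by (simp add: D2_def D1_def numeral_2_eq_2)
  have "D2 \<noteq> 0"
  proof (cases "k \<ge> 2")
    case True
    with top_coeff k2(2) have "coeff D2 2 \<noteq> 0" by simp
    thus ?thesis by (metis coeff_0)
  qed (simp add: D2_def)
  moreover have "D1 \<noteq> 0" using B1 by (simp add: D1_def)
  ultimately have finZ: "finite {t. poly (D1 * D2) t = 0}" by (intro poly_roots_finite) simp
  \<comment> \<open>The finitely many \<open>v\<close> whose level is a zero of
    \<open>D1 * D2\<close> are removed, so that the class is non-trivial for every t in the
    resulting domain.\<close>
  define X where "X = ball 1 (r / 2) - (q R -` {t. poly (D1 * D2) t = 0} \<inter> cball 1 r)"
  have fin: "finite (q R -` {t. poly (D1 * D2) t = 0} \<inter> cball 1 r)"
    by (rule finite_vimage_IntI[OF finZ inj])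
  have "open X" unfolding X_def by (intro open_Diff open_ball finite_imp_closed fin)
  moreover have "X \<noteq> {}"
  proof
    assume "X = {}"
    hence "ball 1 (r / 2) \<subseteq> q R -` {t. poly (D1 * D2) t = 0} \<inter> cball 1 r" by (auto simp: X_def)
    hence "finite (ball (1::complex) (r / 2))" using fin by (rule finite_subset)
    thus False using uncountable_ball[of "r / 2" "1::complex"] r(1) countable_finite by auto
  qed
  ultimately obtain v0 e where e: "e > 0" "ball v0 e \<subseteq> X" by (meson all_not_in_conv openE)
  define B where "B = ball v0 e"
  have B: "open B" "connected B" "B \<noteq> {}" "B \<subseteq> cball 1 (r / 2)"
    using e by (auto simp: B_def X_def subset_eq)
  have fd1: "flow_data n f P Q L1.u L1.E L1.u' L1.E' R r \<delta>1 B"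
    using inj \<delta>1 small[OF \<rho>(3) \<delta>1(1)] R(1) B
    by (intro flow_data.intro flow_data_axioms.intro ld1) (auto simp: q_def)
  have fd2: "flow_data n f P Q L2.u L2.E L2.u' L2.E' R r \<delta>2 B"
    using inj \<delta>2 small[OF \<rho>(4) \<delta>2(1)] R(1) B
    by (intro flow_data.intro flow_data_axioms.intro ld2) (auto simp: q_def uE)
  interpret F1: flow_data n f P Q L1.u L1.E L1.u' L1.E' R r \<delta>1 B by (rule fd1)
  interpret F2: flow_data n f P Q L2.u L2.E L2.u' L2.E' R r \<delta>2 B by (rule fd2)
  note same = F1.same_section[OF fd2 uE]
  have level: "F1.level = q R" by (intro ext) (simp add: F1.level_def F1.pos_def q_def)
  have sep: "2 * r < norm (exp (2 * of_real pi * \<i> * of_nat k / of_nat (Suc n)) - 1)" if "0 < k" "k < Suc n" for k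
    using s(2)[OF that] r(4) by simp
  have fi: "F1.form_integral (X, Y) 0 (F1.coord t) = A True X Y + S True X Y * t"
      "F2.form_integral (X, Y) 0 (F1.coord t) = A False X Y + S False X Y * t"
    if "t \<in> F1.T" "total_degree_le X n" "total_degree_le Y n" for X Y t
    using L1.form_integral_circle[OF fd1 n sep that(2,3) F1.coord_in[OF that(1)]]
      L2.form_integral_circle[OF fd2 n sep that(2,3) F1.coord_in[OF that(1)]] F1.coord(2)[OF that(1)]
    unfolding same A_def S_def by simp_all
  note fiP = fi[OF _ deg(2,3)] and fi' = fi[OF _ deg(4,5)]
  have avoid: "poly D1 t \<noteq> 0" "poly D2 t \<noteq> 0" and reg: "regular_value f t" if t: "t \<in> F1.T" for t
  proof -
    have "F1.coord t \<in> X" using F1.coord(1)[OF t] e(2) by (auto simp: B_def)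
    moreover have "F1.coord t \<in> cball 1 r" using F1.coord_in[OF t] F1.half_subset by blast
    ultimately have "poly (D1 * D2) (q R (F1.coord t)) \<noteq> 0" "regular_value f (q R (F1.coord t))"
      using M large by (auto simp: X_def)
    thus "poly D1 t \<noteq> 0" "poly D2 t \<noteq> 0" "regular_value f t"
      using F1.coord(2)[OF t] by (auto simp: level)
  qed
  have a: "F1.loop_displacement F1.loop (\<lambda>t. reversepath (F1.loop t)) 1 (\<lambda>t. - (A True P Q + S True P Q * t))"
    by (rule F1.loop_displacement_loop[OF fiP(1)])
  have b: "F1.loop_displacement F2.loop (\<lambda>t. reversepath (F2.loop t)) 1 (\<lambda>t. - (A False P Q + S False P Q * t))"
    using F2.loop_displacement_loop[of "A False P Q" "S False P Q"] fiP(2) unfolding same by blast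
  have pairing: "integrable_forms (fiber f t) (apply_form (P, Q)) (apply_form (P', Q'))" if "t \<in> F1.T" for t
    by (rule fiber_integrable_forms[OF reg[OF that]])
  have base: "F1.\<sigma> t \<in> fiber f t" if "t \<in> F1.T" for t using F1.section_eq[OF that] by (simp add: fiber_def)
  have carr: "F1.cls t (F1.loop t) \<in> carrier (F1.\<pi> t)" "F1.cls t (F2.loop t) \<in> carrier (F1.\<pi> t)" if "t \<in> F1.T" for t
    using F1.loop_in_fiber[OF that] F2.loop_in_fiber[unfolded same, OF that] by (auto simp: fundamental_group_def)
  have vals: "integrable_forms.class_integral (fiber f t) (apply_form (P, Q)) (F1.cls t (F1.loop t)) = A True P Q + S True P Q * t"
      "integrable_forms.class_integral (fiber f t) (apply_form (P, Q)) (F1.cls t (F2.loop t)) = A False P Q + S False P Q * t"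
      "integrable_forms.class_iterated_integral (fiber f t) (apply_form (P, Q)) (apply_form (P', Q')) 1 (F1.cls t (F1.loop t)) = A True P' Q' + S True P' Q' * t"
      "integrable_forms.class_iterated_integral (fiber f t) (apply_form (P, Q)) (apply_form (P', Q')) 1 (F1.cls t (F2.loop t)) = A False P' Q' + S False P' Q' * t"
    if t: "t \<in> F1.T" for t
    using F1.class_integrals_loop[OF t pairing[OF t]] F2.class_integrals_loop[unfolded same, OF t pairing[OF t]]
      fiP[OF t] fi'[OF t] by simp_all
  obtain t0 where t0: "t0 \<in> F1.T" using F1.T_nonempty by blast
  have conclude: ?thesis if ld: "F1.loop_displacement \<delta> \<delta>' k m" and mt: "m t0 \<noteq> 0"
      and gr: "\<And>t. t \<in> F1.T \<Longrightarrow> represents_nonzero_gr (F1.\<pi> t) k (F1.cls t (\<delta> t))" for \<delta> \<delta>' m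
    using F1.loop_displacement_family[OF ld F1.T_nonempty F1.T_connected reg F1.transversal_\<sigma>]
      F1.loop_displacement_Poincare_Pontryagin[OF ld k t0 mt] gr by blast
  show ?thesis
  proof (cases "k = 1")
    case True
    have "represents_nonzero_gr (F1.\<pi> t) k (F1.cls t (F1.loop t))" if t: "t \<in> F1.T" for t
      unfolding True
      by (rule iterated_integral_pairing.represents_nonzero_gr_1[OF integrable_forms.iterated_integral_pairing[OF pairing[OF t] base[OF t]] carr(1)[OF t]])
         (use avoid(1)[OF t] in \<open>simp add: vals[OF t] D1_def mult.commute\<close>)
    moreover have "- (A True P Q + S True P Q * t0) \<noteq> 0" using avoid(1)[OF t0] unfolding neg_equal_0_iff_equal by (simp add: D1_def mult.commute)
    ultimately show ?thesis using conclude[of F1.loop "\<lambda>t. reversepath (F1.loop t)"] a True by blast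
  next
    case False
    define m where "m = k - 2"
    have m: "k = Suc (Suc m)" using k False by (simp add: m_def)
    obtain \<delta> \<delta>' where \<delta>: "F1.loop_displacement \<delta> \<delta>' k (\<lambda>t. S True P Q ^ m * (A True P Q * S False P Q - A False P Q * S True P Q))"
        "\<And>t. t \<in> F1.T \<Longrightarrow> F1.cls t (\<delta> t) = group.ad_word (F1.\<pi> t) (F1.cls t (F1.loop t)) (F1.cls t (F2.loop t)) (Suc m)"
      using F1.ad_loops[OF a b, of m] unfolding m by blast
    have "represents_nonzero_gr (F1.\<pi> t) k (F1.cls t (\<delta> t))" if t: "t \<in> F1.T" for t
      unfolding \<delta>(2)[OF t] m
    proof (rule iterated_integral_pairing.represents_nonzero_gr_ad_word[OF
          integrable_forms.iterated_integral_pairing[OF pairing[OF t] base[OF t]] carr[OF t]])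
      show "integrable_forms.class_integral (fiber f t) (apply_form (P, Q)) (F1.cls t (F1.loop t)) \<noteq> 0"
        using avoid(1)[OF t] by (simp add: vals[OF t] D1_def mult.commute)
      have "poly D2 t = (A True P Q + S True P Q * t) * (A False P' Q' + S False P' Q' * t) -
          (A False P Q + S False P Q * t) * (A True P' Q' + S True P' Q' * t)"
        by (simp add: D2_def D1_def m algebra_simps)
      thus "integrable_forms.class_integral (fiber f t) (apply_form (P, Q)) (F1.cls t (F1.loop t)) *
          integrable_forms.class_iterated_integral (fiber f t) (apply_form (P, Q)) (apply_form (P', Q')) 1 (F1.cls t (F2.loop t)) -
          integrable_forms.class_integral (fiber f t) (apply_form (P, Q)) (F1.cls t (F2.loop t)) *
          integrable_forms.class_iterated_integral (fiber f t) (apply_form (P, Q)) (apply_form (P', Q')) 1 (F1.cls t (F1.loop t)) \<noteq> 0"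
        using avoid(2)[OF t] by (simp only: vals[OF t] not_False_eq_True)
    qed
    thus ?thesis using conclude[OF \<delta>(1)] B1 k2(1) m by simp
  qed
qed

section \<open>Openness of the generic conditions\<close>

text \<open>The tube lemma; it makes non-vanishing along a compact circle or sphere an open
  condition on the coefficients.\<close>

lemma open_tube:
  fixes S :: "('a::topological_space \<times> 'b::topological_space) set"
  assumes K: "compact K" and S: "open S"
  shows "open {x. \<forall>k\<in>K. (x, k) \<in> S}"
proof (rule iffD2[OF open_subopen], intro ballI)
  fix x assume x: "x \<in> {x. \<forall>k\<in>K. (x, k) \<in> S}"
  have "\<forall>k\<in>K. \<exists>AB. open (fst AB) \<and> open (snd AB) \<and> x \<in> fst AB \<and> k \<in> snd AB \<and> fst AB \<times> snd AB \<subseteq> S"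
  proof
    fix k assume "k \<in> K"
    hence "(x, k) \<in> S" using x by blast
    then obtain A B where "open A" "open B" "(x, k) \<in> A \<times> B" "A \<times> B \<subseteq> S" by (rule open_prod_elim[OF S])
    thus "\<exists>AB. open (fst AB) \<and> open (snd AB) \<and> x \<in> fst AB \<and> k \<in> snd AB \<and> fst AB \<times> snd AB \<subseteq> S"
      by (intro exI[of _ "(A, B)"]) auto
  qed
  from bchoice[OF this] obtain F where F: "\<And>k. k \<in> K \<Longrightarrow> open (fst (F k)) \<and> open (snd (F k)) \<and> x \<in> fst (F k) \<and> k \<in> snd (F k) \<and>
      fst (F k) \<times> snd (F k) \<subseteq> S" by blast
  have "K \<subseteq> (\<Union>k\<in>K. snd (F k))" using F by blast
  then obtain D where D: "D \<subseteq> K" "finite D" "K \<subseteq> (\<Union>k\<in>D. snd (F k))"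
    using compactE_image[OF K, of K "\<lambda>k. snd (F k)"] F by blast
  have "open (\<Inter>k\<in>D. fst (F k))" using D F by (intro open_INT) auto
  moreover have "x \<in> (\<Inter>k\<in>D. fst (F k))" using D F by auto
  moreover have "(\<Inter>k\<in>D. fst (F k)) \<subseteq> {x. \<forall>k\<in>K. (x, k) \<in> S}"
  proof (intro subsetI CollectI ballI)
    fix y k assume y: "y \<in> (\<Inter>k\<in>D. fst (F k))" and k: "k \<in> K"
    then obtain k' where k': "k' \<in> D" "k \<in> snd (F k')" using D(3) by blast
    hence "(y, k) \<in> fst (F k') \<times> snd (F k')" using y by auto
    thus "(y, k) \<in> S" using F k' D(1) by blast
  qed
  ultimately show "\<exists>T. open T \<and> x \<in> T \<and> T \<subseteq> {x. \<forall>k\<in>K. (x, k) \<in> S}" by blast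
qed

text \<open>Continuity coefficient by coefficient suffices, since each functional below involves
  only finitely many coefficients.\<close>

definition continuous_coeffs :: "'a::topological_space set \<Rightarrow> ('a \<Rightarrow> nat \<Rightarrow> nat \<Rightarrow> complex) \<Rightarrow> bool" where
  "continuous_coeffs A C \<longleftrightarrow> (\<forall>i j. continuous_on A (\<lambda>x. C x i j))"

lemma continuous_coeffs_comp:
  assumes "continuous_on A (g :: _ \<Rightarrow> nat \<Rightarrow> nat \<Rightarrow> complex)"
  shows "continuous_coeffs A g"
  unfolding continuous_coeffs_def
proof (intro allI)
  fix i j
  have "continuous_on A (\<lambda>x. g x i)"
    by (rule continuous_on_compose2[OF continuous_on_product_coordinates assms]) auto
  thus "continuous_on A (\<lambda>x. g x i j)"
    by (rule continuous_on_compose2[OF continuous_on_product_coordinates]) auto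
qed

lemma continuous_on_slope_poly_coeffs:
  assumes "continuous_coeffs A C" "continuous_on A u"
  shows "continuous_on A (\<lambda>x. slope_poly (C x) j (u x))" "continuous_on A (\<lambda>x. slope_poly' (C x) j (u x))"
  using assms unfolding slope_poly_def slope_poly'_def continuous_coeffs_def by (auto intro!: continuous_intros)

lemma continuous_on_reduced_form:
  assumes "continuous_coeffs A CP" "continuous_coeffs A CQ" "continuous_on A u"
  shows "continuous_on A (\<lambda>x. reduced_form (CP x) (CQ x) j (u x))"
  unfolding reduced_form_def
  by (intro continuous_intros continuous_on_slope_poly_coeffs assms) (simp del: of_nat_Suc)

lemma continuous_on_newton_sum:
  assumes "\<And>i. continuous_on A (\<lambda>x. e x i)"
  shows "continuous_on A (\<lambda>x. newton_sum (e x) m)"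
proof (induction m rule: less_induct)
  case (less m)
  have "continuous_on A (\<lambda>x. if 1 \<le> i \<and> i < m then e x i * newton_sum (e x) (m - i) else 0)" for i
    using less.IH[of "m - i"] assms by (cases "1 \<le> i \<and> i < m") (auto intro!: continuous_intros)
  thus ?case by (subst newton_sum.simps) (intro continuous_intros assms)
qed

lemma continuous_on_circle_integral:
  assumes "continuous_on (A \<times> {0..1}) (\<lambda>y. g (fst y) (circ c d (snd y)))"
  shows "continuous_on A (\<lambda>x. circle_integral c d (g x))"
proof -
  have "continuous_on (A \<times> cbox 0 (1::real)) (\<lambda>(x, \<theta>). g x (circ c d \<theta>) * circ' d \<theta>)"
    unfolding case_prod_unfold cbox_interval by (intro continuous_intros assms)
  from integral_continuous_on_param[OF this] show ?thesis
    by (simp add: circle_integral_def cbox_interval)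
qed

lemma continuous_on_level_functionals:
  assumes C: "continuous_coeffs A C" and CP: "continuous_coeffs A CP" and CQ: "continuous_coeffs A CQ"
    and nz: "\<And>x \<theta>. x \<in> A \<Longrightarrow> \<theta> \<in> {0..1} \<Longrightarrow> slope_poly (C x) (Suc n) (circ c d \<theta>) \<noteq> 0"
  shows "continuous_on A (\<lambda>x. level_slope (C x) n c d (CP x) (CQ x))"
    and "continuous_on A (\<lambda>x. level_const (C x) n c d (CP x) (CQ x))"
    and "continuous_on A (\<lambda>x. circle_integral c d (\<lambda>u. slope_poly' (C x) (Suc n) u / slope_poly (C x) (Suc n) u))"
proof -
  let ?B = "A \<times> {0..1::real}"
  have lift: "continuous_coeffs ?B (\<lambda>y. D (fst y))" if "continuous_coeffs A D" for D :: "'a \<Rightarrow> nat \<Rightarrow> nat \<Rightarrow> complex"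
    using that unfolding continuous_coeffs_def
    by (auto intro!: continuous_on_compose2[OF _ continuous_on_fst[OF continuous_on_id]])
  have u: "continuous_on ?B (\<lambda>y. circ c d (snd y))" by (intro continuous_intros)
  have nz': "slope_poly (C (fst y)) (Suc n) (circ c d (snd y)) \<noteq> 0" if "y \<in> ?B" for y using nz that by auto
  note s = continuous_on_slope_poly_coeffs[OF lift[OF C] u] continuous_on_reduced_form[OF lift[OF CP] lift[OF CQ] u]
  show "continuous_on A (\<lambda>x. level_slope (C x) n c d (CP x) (CQ x))"
    unfolding level_slope_def
    by (intro continuous_on_mult_left continuous_on_circle_integral continuous_on_divide s ballI nz')
  show "continuous_on A (\<lambda>x. level_const (C x) n c d (CP x) (CQ x))"
    unfolding level_const_def
    by (intro continuous_on_circle_integral continuous_on_sum continuous_on_mult continuous_on_newton_sum continuous_on_divide s ballI nz')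
  show "continuous_on A (\<lambda>x. circle_integral c d (\<lambda>u. slope_poly' (C x) (Suc n) u / slope_poly (C x) (Suc n) u))"
    by (intro continuous_on_circle_integral continuous_on_divide s ballI nz')
qed

definition admissible_circle :: "nat \<Rightarrow> complex \<Rightarrow> complex \<Rightarrow> (nat \<Rightarrow> nat \<Rightarrow> complex) \<Rightarrow> bool" where
  "admissible_circle n c d C \<longleftrightarrow> (\<forall>\<theta>\<in>{0..1}. slope_poly C (Suc n) (circ c d \<theta>) \<noteq> 0) \<and>
    norm (circle_integral c d (\<lambda>u. slope_poly' C (Suc n) u / slope_poly C (Suc n) u) / (2 * of_real pi * \<i>) - 1) < 1 / 2"

definition smooth_at_infinity :: "nat \<Rightarrow> (nat \<Rightarrow> nat \<Rightarrow> complex) \<Rightarrow> bool" where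
  "smooth_at_infinity n C \<longleftrightarrow> (\<forall>z\<in>sphere 0 1. homogeneous_part (coeffs_dx C) n z \<noteq> 0 \<or> homogeneous_part (coeffs_dy C) n z \<noteq> 0)"

text \<open>The first determinant is the one in M_k and the second is the leading coefficient of the
  one that detects the class. Both concern k \<ge> 2, which the theorem demands only for n \<ge>
  2.\<close>

definition generic_coeffs :: "nat \<Rightarrow> complex \<Rightarrow> complex \<Rightarrow> (nat \<Rightarrow> nat \<Rightarrow> complex) \<Rightarrow> (nat \<Rightarrow> nat \<Rightarrow> complex) \<Rightarrow>
    (nat \<Rightarrow> nat \<Rightarrow> complex) \<times> (nat \<Rightarrow> nat \<Rightarrow> complex) \<times> (nat \<Rightarrow> nat \<Rightarrow> complex) \<Rightarrow> bool" where
  "generic_coeffs n c d CP' CQ' x \<longleftrightarrow> (case x of (C, CP, CQ) \<Rightarrow>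
    admissible_circle n c d C \<and> admissible_circle n (c + 2 * d) (- d) C \<and> smooth_at_infinity n C \<and>
    level_slope C n c d CP CQ \<noteq> 0 \<and>
    (n \<ge> 2 \<longrightarrow>
      level_const C n c d CP CQ * level_slope C n (c + 2 * d) (- d) CP CQ -
        level_const C n (c + 2 * d) (- d) CP CQ * level_slope C n c d CP CQ \<noteq> 0 \<and>
      level_slope C n c d CP CQ * level_slope C n (c + 2 * d) (- d) CP' CQ' -
        level_slope C n (c + 2 * d) (- d) CP CQ * level_slope C n c d CP' CQ' \<noteq> 0))"

lemma open_nonvanishing_on_circle:
  assumes "continuous_coeffs UNIV C"
  shows "open {x. \<forall>\<theta>\<in>{0..1}. slope_poly (C x) (Suc n) (circ c d \<theta>) \<noteq> 0}"
proof -
  have "continuous_coeffs UNIV (\<lambda>y. C (fst y))"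
    using assms unfolding continuous_coeffs_def
    by (auto intro!: continuous_on_compose2[OF _ continuous_on_fst[OF continuous_on_id]])
  hence "continuous_on UNIV (\<lambda>y. slope_poly (C (fst y)) (Suc n) (circ c d (snd y)))"
    by (intro continuous_on_slope_poly_coeffs continuous_intros)
  hence "open ((\<lambda>y. slope_poly (C (fst y)) (Suc n) (circ c d (snd y))) -` (- {0}))"
    by (intro open_vimage) auto
  from open_tube[OF _ this, of "{0..1}"] show ?thesis by simp
qed

lemma open_smooth_at_infinity:
  assumes "continuous_coeffs UNIV C"
  shows "open {x. smooth_at_infinity n (C x)}"
proof -
  have c: "continuous_on UNIV (\<lambda>y. C (fst y) i j)" for i j
    using assms unfolding continuous_coeffs_def
    by (auto intro!: continuous_on_compose2[OF _ continuous_on_fst[OF continuous_on_id]])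
  have "continuous_on UNIV (\<lambda>y. homogeneous_part (coeffs_dx (C (fst y))) n (snd y))"
      "continuous_on UNIV (\<lambda>y. homogeneous_part (coeffs_dy (C (fst y))) n (snd y))"
    unfolding homogeneous_part_def coeffs_dx_def coeffs_dy_def by (intro continuous_intros c)+
  hence "open ((\<lambda>y. homogeneous_part (coeffs_dx (C (fst y))) n (snd y)) -` (- {0}) \<union>
      (\<lambda>y. homogeneous_part (coeffs_dy (C (fst y))) n (snd y)) -` (- {0}))"
    by (intro open_Un open_vimage) auto
  from open_tube[OF _ this, of "sphere 0 1"] show ?thesis by (simp add: smooth_at_infinity_def)
qed

lemma open_generic_coeffs: "open {x. generic_coeffs n c d CP' CQ' x}"
proof -
  let ?C = "fst" and ?P = "\<lambda>x. fst (snd x)" and ?Q = "\<lambda>x. snd (snd x)"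
  let ?c = "c + 2 * d" and ?d = "- d"
  \<comment> \<open>On this open set the denominators do not vanish, so the functionals are
    continuous there; the remaining conditions are then relatively open.\<close>
  define A where "A = {x :: (nat \<Rightarrow> nat \<Rightarrow> complex) \<times> (nat \<Rightarrow> nat \<Rightarrow> complex) \<times> (nat \<Rightarrow> nat \<Rightarrow> complex).
      \<forall>\<theta>\<in>{0..1}. slope_poly (?C x) (Suc n) (circ c d \<theta>) \<noteq> 0} \<inter>
    {x. \<forall>\<theta>\<in>{0..1}. slope_poly (?C x) (Suc n) (circ ?c ?d \<theta>) \<noteq> 0} \<inter> {x. smooth_at_infinity n (?C x)}"
  have cc: "continuous_coeffs S ?C" "continuous_coeffs S ?P" "continuous_coeffs S ?Q"
    for S :: "((nat \<Rightarrow> nat \<Rightarrow> complex) \<times> (nat \<Rightarrow> nat \<Rightarrow> complex) \<times> (nat \<Rightarrow> nat \<Rightarrow> complex)) set"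
    by (intro continuous_coeffs_comp continuous_intros)+
  have k: "continuous_coeffs A (\<lambda>x. K)" for K :: "nat \<Rightarrow> nat \<Rightarrow> complex" by (simp add: continuous_coeffs_def)
  have A: "open A" unfolding A_def by (intro open_Int open_nonvanishing_on_circle open_smooth_at_infinity cc)
  have n1: "x \<in> A \<Longrightarrow> \<theta> \<in> {0..1} \<Longrightarrow> slope_poly (?C x) (Suc n) (circ c d \<theta>) \<noteq> 0"
    and n2: "x \<in> A \<Longrightarrow> \<theta> \<in> {0..1} \<Longrightarrow> slope_poly (?C x) (Suc n) (circ ?c ?d \<theta>) \<noteq> 0" for x \<theta>
    by (auto simp: A_def)
  note F1 = continuous_on_level_functionals[OF cc n1] and F2 = continuous_on_level_functionals[OF cc n2]
    and G1 = continuous_on_level_functionals(1)[OF cc(1) k[of CP'] k[of CQ'] n1]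
    and G2 = continuous_on_level_functionals(1)[OF cc(1) k[of CP'] k[of CQ'] n2]
  have ne: "open {x \<in> A. g x \<noteq> 0}" if "continuous_on A g" for g :: "_ \<Rightarrow> complex"
  proof -
    have "open (A \<inter> g -` (- {0}))" by (intro continuous_open_preimage that A) auto
    moreover have "A \<inter> g -` (- {0}) = {x \<in> A. g x \<noteq> 0}" by auto
    ultimately show ?thesis by simp
  qed
  have lt: "open {x \<in> A. norm (g x / (2 * of_real pi * \<i>) - 1) < 1 / 2}" if "continuous_on A g" for g :: "_ \<Rightarrow> complex"
  proof -
    have "continuous_on A (\<lambda>x. norm (g x / (2 * of_real pi * \<i>) - 1))" by (intro continuous_intros that) auto
    hence "open (A \<inter> (\<lambda>x. norm (g x / (2 * of_real pi * \<i>) - 1)) -` {..<1 / 2})"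
      by (intro continuous_open_preimage A) auto
    moreover have "A \<inter> (\<lambda>x. norm (g x / (2 * of_real pi * \<i>) - 1)) -` {..<1 / 2} = {x \<in> A. norm (g x / (2 * of_real pi * \<i>) - 1) < 1 / 2}" by auto
    ultimately show ?thesis by simp
  qed
  define d1 where "d1 = (\<lambda>x. level_const (?C x) n c d (?P x) (?Q x) * level_slope (?C x) n ?c ?d (?P x) (?Q x) -
        level_const (?C x) n ?c ?d (?P x) (?Q x) * level_slope (?C x) n c d (?P x) (?Q x))"
  define d2 where "d2 = (\<lambda>x. level_slope (?C x) n c d (?P x) (?Q x) * level_slope (?C x) n ?c ?d CP' CQ' -
        level_slope (?C x) n ?c ?d (?P x) (?Q x) * level_slope (?C x) n c d CP' CQ')"
  have d: "continuous_on A d1" "continuous_on A d2"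
    unfolding d1_def d2_def
    by (rule continuous_on_diff[OF continuous_on_mult[OF F1(2) F2(1)] continuous_on_mult[OF F2(2) F1(1)]], simp_all)
       (rule continuous_on_diff[OF continuous_on_mult[OF F1(1) G2] continuous_on_mult[OF F2(1) G1]], simp_all)
  define W where "W = {x \<in> A. norm (circle_integral c d (\<lambda>u. slope_poly' (?C x) (Suc n) u / slope_poly (?C x) (Suc n) u) / (2 * of_real pi * \<i>) - 1) < 1 / 2} \<inter>
     {x \<in> A. norm (circle_integral ?c ?d (\<lambda>u. slope_poly' (?C x) (Suc n) u / slope_poly (?C x) (Suc n) u) / (2 * of_real pi * \<i>) - 1) < 1 / 2} \<inter>
     {x \<in> A. level_slope (?C x) n c d (?P x) (?Q x) \<noteq> 0}"
  have W: "open W" unfolding W_def by (intro open_Int lt ne F1 F2)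
  have "{x. generic_coeffs n c d CP' CQ' x} = (if n \<ge> 2 then W \<inter> {x \<in> A. d1 x \<noteq> 0} \<inter> {x \<in> A. d2 x \<noteq> 0} else W)"
    by (auto simp: generic_coeffs_def admissible_circle_def W_def A_def d1_def d2_def case_prod_unfold)
  moreover have "open (if n \<ge> 2 then W \<inter> {x \<in> A. d1 x \<noteq> 0} \<inter> {x \<in> A. d2 x \<noteq> 0} else W)"
    using W ne[OF d(1)] ne[OF d(2)] by (simp add: open_Int)
  ultimately show ?thesis by simp
qed

section \<open>The open set of generic pairs\<close>

definition pair_coeffs :: "bipoly \<times> one_form \<Rightarrow> (nat \<Rightarrow> nat \<Rightarrow> complex) \<times> (nat \<Rightarrow> nat \<Rightarrow> complex) \<times> (nat \<Rightarrow> nat \<Rightarrow> complex)" where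
  "pair_coeffs = (\<lambda>(f, P, Q). (bicoeff f, bicoeff P, bicoeff Q))"

text \<open>Circles and auxiliary form may vary with the pair: a union of open sets is open, while
  no single choice has to work for a dense set.\<close>

definition generic_pairs :: "nat \<Rightarrow> (bipoly \<times> one_form) set" where
  "generic_pairs n = {v \<in> V n. \<exists>c d P' Q'. total_degree_le P' n \<and> total_degree_le Q' n \<and>
    generic_coeffs n c d (bicoeff P') (bicoeff Q') (pair_coeffs v)}"

lemma V_topology_eq: "V_topology n = pullback_topology (V n) pair_coeffs euclidean"
  unfolding V_topology_def pair_coeffs_def by (rule refl)

lemma openin_V_topology: "openin (V_topology n) X \<longleftrightarrow> (\<exists>S. open S \<and> X = pair_coeffs -` S \<inter> V n)"
proof -
  have "(\<exists>S. openin euclidean S \<and> X = pair_coeffs -` S \<inter> V n) \<longleftrightarrow> (\<exists>S. open S \<and> X = pair_coeffs -` S \<inter> V n)"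
    by (rule arg_cong[where f = Ex], rule ext, subst open_openin[symmetric], rule refl)
  thus ?thesis unfolding V_topology_eq openin_pullback_topology .
qed

lemma topspace_V_topology: "topspace (V_topology n) = V n"
  by (simp add: V_topology_def topspace_pullback_topology)

lemma openin_generic_pairs: "openin (V_topology n) (generic_pairs n)"
  unfolding openin_V_topology
proof (intro exI conjI)
  let ?S = "{x. \<exists>c d P' Q'. total_degree_le P' n \<and> total_degree_le Q' n \<and> generic_coeffs n c d (bicoeff P') (bicoeff Q') x}"
  have "?S = (\<Union>c. \<Union>d. \<Union>P'\<in>{P'. total_degree_le P' n}. \<Union>Q'\<in>{Q'. total_degree_le Q' n}.
      {x. generic_coeffs n c d (bicoeff P') (bicoeff Q') x})" by blast
  also have "open \<dots>" by (intro open_UN ballI open_generic_coeffs)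
  finally show "open ?S" .
  show "generic_pairs n = pair_coeffs -` ?S \<inter> V n" 
  proof (rule Set.set_eqI)
    fix v show "v \<in> generic_pairs n \<longleftrightarrow> v \<in> pair_coeffs -` ?S \<inter> V n"
      unfolding generic_pairs_def Int_iff vimage_def mem_Collect_eq by (rule conj_commute)
  qed
qed

lemma generic_pairs_conclusion:
  assumes v: "(f, \<omega>) \<in> generic_pairs n" and n: "n \<ge> 1" and k: "k \<ge> 1" "n = 1 \<longrightarrow> k = 1"
  shows "\<exists>T \<sigma> \<delta> mk. loop_family f T \<sigma> \<delta> \<and>
    (\<forall>t\<in>T. represents_nonzero_gr (fundamental_group (fiber f t) (\<sigma> t)) k (homotopy_class (fiber f t) (\<delta> t))) \<and>
    Poincare_Pontryagin f \<omega> T \<sigma> \<delta> k mk \<and> (\<exists>t\<in>T. mk t \<noteq> 0)"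
proof -
  obtain P Q where \<omega>: "\<omega> = (P, Q)" by (cases \<omega>)
  obtain c d P' Q' where \<eta>: "total_degree_le P' n" "total_degree_le Q' n"
      and g: "generic_coeffs n c d (bicoeff P') (bicoeff Q') (bicoeff f, bicoeff P, bicoeff Q)"
    using v by (auto simp: generic_pairs_def pair_coeffs_def \<omega>)
  have deg: "total_degree_le f (Suc n)" "total_degree_le P n" "total_degree_le Q n"
    using v by (auto simp: generic_pairs_def V_def \<omega>)
  note g = g[unfolded generic_coeffs_def split]
  have adm: "admissible_circle n c d (bicoeff f)" "admissible_circle n (c + 2 * d) (- d) (bicoeff f)" using g by blast+
  have "slope_poly (bicoeff f) (Suc n) (c + d) \<noteq> 0"
    using adm(1) circ_0[of c d] unfolding admissible_circle_def by (metis atLeastAtMost_iff order_refl zero_le_one)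
  hence l0: "exp (Ln (slope_poly (bicoeff f) (Suc n) (c + d))) = slope_poly (bicoeff f) (Suc n) (c + d)" by (rule exp_Ln)
  have loops: "circle_loop n f c d (Ln (slope_poly (bicoeff f) (Suc n) (c + d)))"
      "circle_loop n f (c + 2 * d) (- d) (Ln (slope_poly (bicoeff f) (Suc n) (c + d)))"
  proof -
    have e: "c + 2 * d + - d = c + d" by simp
    show "circle_loop n f c d (Ln (slope_poly (bicoeff f) (Suc n) (c + d)))"
        "circle_loop n f (c + 2 * d) (- d) (Ln (slope_poly (bicoeff f) (Suc n) (c + d)))"
      using adm l0 unfolding admissible_circle_def circle_loop_def e by blast+
  qed
  show ?thesis
    unfolding \<omega>
  proof (rule two_circles[OF n deg \<eta> _ loops _ k(1)])
    fix z :: "complex \<times> complex" assume "z \<in> sphere 0 1"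
    thus "homogeneous_part (coeffs_dx (bicoeff f)) n z \<noteq> 0 \<or> homogeneous_part (coeffs_dy (bicoeff f)) n z \<noteq> 0"
      using g unfolding smooth_at_infinity_def by blast
  next
    show "level_slope (bicoeff f) n (if True then c else c + 2 * d) (if True then d else - d) (bicoeff P) (bicoeff Q) \<noteq> 0"
      using g by simp
  next
    assume "k \<ge> 2"
    hence n2: "n \<ge> 2" using n k by (cases "n = 1") auto
    show "level_const (bicoeff f) n (if True then c else c + 2 * d) (if True then d else - d) (bicoeff P) (bicoeff Q) *
        level_slope (bicoeff f) n (if False then c else c + 2 * d) (if False then d else - d) (bicoeff P) (bicoeff Q) -
        level_const (bicoeff f) n (if False then c else c + 2 * d) (if False then d else - d) (bicoeff P) (bicoeff Q) *
        level_slope (bicoeff f) n (if True then c else c + 2 * d) (if True then d else - d) (bicoeff P) (bicoeff Q) \<noteq> 0"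
      "level_slope (bicoeff f) n (if True then c else c + 2 * d) (if True then d else - d) (bicoeff P) (bicoeff Q) *
        level_slope (bicoeff f) n (if False then c else c + 2 * d) (if False then d else - d) (bicoeff P') (bicoeff Q') -
        level_slope (bicoeff f) n (if False then c else c + 2 * d) (if False then d else - d) (bicoeff P) (bicoeff Q) *
        level_slope (bicoeff f) n (if True then c else c + 2 * d) (if True then d else - d) (bicoeff P') (bicoeff Q') \<noteq> 0"
      using g n2 by simp_all
  qed
qed

section \<open>Density of the generic conditions\<close>

lemma eventually_notin_finite:
  fixes a :: "'a::t1_space"
  assumes "finite F"
  shows "\<forall>\<^sub>F s in at a. s \<notin> F"
  unfolding eventually_at_topological
  by (intro exI[of _ "- (F - {a})"] conjI open_Compl finite_imp_closed finite_Diff assms) auto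

lemma eventually_affine_nonzero:
  fixes a b :: complex
  assumes "b \<noteq> 0"
  shows "\<forall>\<^sub>F s in at 0. a + s * b \<noteq> 0"
  using eventually_notin_finite[of "{- a / b}" 0] assms
  by (rule_tac eventually_mono[of "\<lambda>s. s \<notin> {- a / b}"]) (auto simp: field_simps add_eq_0_iff2)

lemma bicoeff_perturb: "bicoeff (f + smult [:s:] g) i j = bicoeff f i j + s * bicoeff g i j"
  by (simp add: bicoeff_def)

text \<open>A move by s in a fixed direction stays in \<open>X\<close> for small s. Hence any
  condition violated by only finitely many s can be achieved inside \<open>X\<close>.\<close>

lemma perturb_in_open:
  assumes X: "openin (V_topology n) X" "(f, P, Q) \<in> X" and w: "(g, P', Q') \<in> V n"
  shows "\<forall>\<^sub>F s in at 0. (f + smult [:s:] g, P + smult [:s:] P', Q + smult [:s:] Q') \<in> X"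
proof -
  obtain S where S: "open S" "X = pair_coeffs -` S \<inter> V n" using X(1) unfolding openin_V_topology by blast
  let ?v = "\<lambda>s. (f + smult [:s:] g, P + smult [:s:] P', Q + smult [:s:] Q')"
  have deg: "total_degree_le (p + smult [:s:] q) d" if "total_degree_le p d" "total_degree_le q d" for p q s d
    using that unfolding total_degree_le_def bicoeff_perturb by (metis add_0 mult_zero_right)
  have V: "?v s \<in> V n" for s using X(2) S(2) w by (auto simp: V_def intro: deg)
  have c: "continuous_on UNIV (\<lambda>s. bicoeff (p + smult [:s:] q))" for p q
    by (intro continuous_on_coordinatewise_then_product) (simp add: bicoeff_perturb, intro continuous_intros)
  have "continuous_on UNIV (\<lambda>s. pair_coeffs (?v s))"
    unfolding pair_coeffs_def split by (intro continuous_on_Pair c)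
  hence "open ((\<lambda>s. pair_coeffs (?v s)) -` S)" by (intro open_vimage S)
  moreover have "0 \<in> (\<lambda>s. pair_coeffs (?v s)) -` S" using X(2) S(2) by simp
  ultimately have "\<forall>\<^sub>F s in at 0. s \<in> (\<lambda>s. pair_coeffs (?v s)) -` S"
    by (rule eventually_at_in_open')
  thus ?thesis by (rule eventually_mono) (use S(2) V in auto)
qed

section \<open>Effect of perturbations on the functionals\<close>

definition monomial :: "nat \<Rightarrow> nat \<Rightarrow> bipoly" where
  "monomial a b = monom (monom 1 a) b"

lemma bicoeff_monomial: "bicoeff (monomial a b) i j = (if i = a \<and> j = b then 1 else 0)"
  by (simp add: bicoeff_def monomial_def coeff_monom)

lemma bicoeff_0: "bicoeff 0 = (\<lambda>i j. 0)"
  by (intro ext) (simp add: bicoeff_def)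

lemma total_degree_le_monomial: "a + b \<le> d \<Longrightarrow> total_degree_le (monomial a b) d" and total_degree_le_0: "total_degree_le 0 d"
  by (auto simp: total_degree_le_def bicoeff_monomial bicoeff_0)

lemma slope_poly_monomial:
  "slope_poly (bicoeff (monomial a b)) j u = (if j = a + b then u ^ b else 0)"
  "slope_poly' (bicoeff (monomial a b)) j u = (if j = a + b then of_nat b * u ^ (b - 1) else 0)"
proof -
  have e: "j - i = a \<and> i = b \<longleftrightarrow> i = b \<and> j = a + b" if "i \<le> j" for i using that by auto
  have "slope_poly (bicoeff (monomial a b)) j u = (\<Sum>i\<le>j. if i = b then (if j = a + b then u ^ b else 0) else 0)"
    unfolding slope_poly_def bicoeff_monomial by (intro sum.cong refl) (auto simp: e)
  thus "slope_poly (bicoeff (monomial a b)) j u = (if j = a + b then u ^ b else 0)" by (auto simp: sum.delta)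
  have "slope_poly' (bicoeff (monomial a b)) j u = (\<Sum>i\<le>j. if i = b then (if j = a + b then of_nat b * u ^ (b - 1) else 0) else 0)"
    unfolding slope_poly'_def bicoeff_monomial by (intro sum.cong refl) (auto simp: e)
  thus "slope_poly' (bicoeff (monomial a b)) j u = (if j = a + b then of_nat b * u ^ (b - 1) else 0)" by (auto simp: sum.delta)
qed

lemma slope_poly_perturb:
  "slope_poly (bicoeff (f + smult [:s:] g)) j u = slope_poly (bicoeff f) j u + s * slope_poly (bicoeff g) j u"
  "slope_poly' (bicoeff (f + smult [:s:] g)) j u = slope_poly' (bicoeff f) j u + s * slope_poly' (bicoeff g) j u"
  unfolding slope_poly_def slope_poly'_def bicoeff_perturb
  by (simp_all add: sum_distrib_left sum.distrib[symmetric] algebra_simps)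

lemma slope_poly_0: "slope_poly (bicoeff 0) j u = 0" "slope_poly' (bicoeff 0) j u = 0"
  by (simp_all add: slope_poly_def slope_poly'_def bicoeff_0)

lemma reduced_form_perturb:
  "reduced_form (bicoeff (P + smult [:s:] P')) (bicoeff (Q + smult [:s:] Q')) j u =
    reduced_form (bicoeff P) (bicoeff Q) j u + s * reduced_form (bicoeff P') (bicoeff Q') j u"
  unfolding reduced_form_def slope_poly_perturb
  by (simp add: add_divide_distrib algebra_simps del: of_nat_Suc)

lemma circle_integral_affine:
  assumes "continuous_on {0..1} (\<lambda>\<theta>. g (circ c d \<theta>))" "continuous_on {0..1} (\<lambda>\<theta>. h (circ c d \<theta>))"
  shows "circle_integral c d (\<lambda>u. g u + s * h u) = circle_integral c d g + s * circle_integral c d h"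
proof -
  have "integral {0..1} (\<lambda>\<theta>. g (circ c d \<theta>) * circ' d \<theta> + s * (h (circ c d \<theta>) * circ' d \<theta>)) =
      integral {0..1} (\<lambda>\<theta>. g (circ c d \<theta>) * circ' d \<theta>) + integral {0..1} (\<lambda>\<theta>. s * (h (circ c d \<theta>) * circ' d \<theta>))"
    by (intro integral_add integrable_continuous_real continuous_intros assms)
  thus ?thesis by (simp add: circle_integral_def distrib_right mult.assoc)
qed

section \<open>Simple roots at infinity and residues\<close>

definition slope_polynomial :: "(nat \<Rightarrow> nat \<Rightarrow> complex) \<Rightarrow> nat \<Rightarrow> complex poly" where
  "slope_polynomial C j = (\<Sum>i\<le>j. monom (C (j - i) i) i)"

lemma poly_slope_polynomial: "poly (slope_polynomial C j) u = slope_poly C j u"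
  by (simp add: slope_polynomial_def slope_poly_def poly_sum poly_monom)

lemma poly_pderiv_slope_polynomial: "poly (pderiv (slope_polynomial C j)) u = slope_poly' C j u"
  using poly_DERIV[of "slope_polynomial C j" u] slope_poly_deriv[of C j u]
  by (auto simp: poly_slope_polynomial[abs_def] intro: DERIV_unique)

lemma degree_slope_polynomial:
  assumes "C 0 j \<noteq> 0"
  shows "degree (slope_polynomial C j) = j"
proof (rule antisym)
  show "degree (slope_polynomial C j) \<le> j"
    unfolding slope_polynomial_def by (intro degree_sum_le order_trans[OF degree_monom_le]) auto
  have "coeff (slope_polynomial C j) j = (\<Sum>i\<le>j. if i = j then C (j - i) i else 0)"
    unfolding slope_polynomial_def coeff_sum coeff_monom by (intro sum.cong) auto
  hence "coeff (slope_polynomial C j) j \<noteq> 0" using assms by (simp add: sum.delta)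
  thus "j \<le> degree (slope_polynomial C j)" by (rule le_degree)
qed

text \<open>The first condition says that the direction x = 0, which no slope u represents, is not a
  root of the top part; equivalently \<phi> has full degree n + 1.\<close>

definition simple_at_infinity :: "nat \<Rightarrow> (nat \<Rightarrow> nat \<Rightarrow> complex) \<Rightarrow> bool" where
  "simple_at_infinity n C \<longleftrightarrow> C 0 (Suc n) \<noteq> 0 \<and> (\<forall>u. slope_poly C (Suc n) u = 0 \<longrightarrow> slope_poly' C (Suc n) u \<noteq> 0)"

lemma simple_at_infinity_dense:
  assumes X: "openin (V_topology n) X" "(f, P, Q) \<in> X"
  obtains f' where "(f', P, Q) \<in> X" "simple_at_infinity n (bicoeff f')"
proof -
  have mono: "(monomial a b, 0, 0) \<in> V n" if "a + b \<le> Suc n" for a b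
    using that by (auto simp: V_def total_degree_le_monomial total_degree_le_0)
  have "\<forall>\<^sub>F s in at 0. (f + smult [:s:] (monomial 0 (Suc n)), P, Q) \<in> X"
    using perturb_in_open[OF X mono[of 0 "Suc n"]] by simp
  moreover have "\<forall>\<^sub>F s in at 0. bicoeff f 0 (Suc n) + s * 1 \<noteq> 0" by (rule eventually_affine_nonzero) simp
  ultimately have "\<forall>\<^sub>F s in at 0. (f + smult [:s:] (monomial 0 (Suc n)), P, Q) \<in> X \<and> bicoeff f 0 (Suc n) + s * 1 \<noteq> 0"
    by (rule eventually_conj)
  then obtain s where s: "(f + smult [:s:] (monomial 0 (Suc n)), P, Q) \<in> X" "bicoeff f 0 (Suc n) + s * 1 \<noteq> 0"
    using eventually_happens'[OF at_neq_bot] by blast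
  define f1 where "f1 = f + smult [:s:] (monomial 0 (Suc n))"
  have f1: "(f1, P, Q) \<in> X" "bicoeff f1 0 (Suc n) \<noteq> 0"
    using s by (auto simp: f1_def bicoeff_perturb bicoeff_monomial)
  let ?p = "slope_polynomial (bicoeff f1) (Suc n)"
  have "pderiv ?p \<noteq> 0" using degree_slope_polynomial[of "bicoeff f1" "Suc n", OF f1(2)] by (auto simp: pderiv_eq_0_iff)
  \<comment> \<open>Adding r x^(n+1) to f shifts \<phi> by the constant r and leaves its derivative
    alone. Roots become simple once r avoids the negatives of the finitely many critical
    values.\<close>
  hence fin: "finite ((\<lambda>u. - slope_poly (bicoeff f1) (Suc n) u) ` {u. poly (pderiv ?p) u = 0})"
    by (intro finite_imageI poly_roots_finite)
  have "\<forall>\<^sub>F s in at 0. (f1 + smult [:s:] (monomial (Suc n) 0), P, Q) \<in> X"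
    using perturb_in_open[OF X(1) f1(1) mono[of "Suc n" 0]] by simp
  from eventually_conj[OF this eventually_notin_finite[OF fin]]
  obtain r where r: "(f1 + smult [:r:] (monomial (Suc n) 0), P, Q) \<in> X"
      "r \<notin> (\<lambda>u. - slope_poly (bicoeff f1) (Suc n) u) ` {u. poly (pderiv ?p) u = 0}"
    using eventually_happens'[OF at_neq_bot] by blast
  define f2 where "f2 = f1 + smult [:r:] (monomial (Suc n) 0)"
  have sp: "slope_poly (bicoeff f2) (Suc n) u = slope_poly (bicoeff f1) (Suc n) u + r"
      "slope_poly' (bicoeff f2) (Suc n) u = slope_poly' (bicoeff f1) (Suc n) u" for u
    by (simp_all add: f2_def slope_poly_perturb slope_poly_monomial)
  have "slope_poly' (bicoeff f2) (Suc n) u \<noteq> 0" if "slope_poly (bicoeff f2) (Suc n) u = 0" for u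
  proof
    assume "slope_poly' (bicoeff f2) (Suc n) u = 0"
    hence "u \<in> {u. poly (pderiv ?p) u = 0}" by (simp add: sp poly_pderiv_slope_polynomial)
    moreover have "r = - slope_poly (bicoeff f1) (Suc n) u" using that by (simp add: sp eq_neg_iff_add_eq_0 add.commute)
    ultimately show False using r(2) by blast
  qed
  moreover have "bicoeff f2 0 (Suc n) \<noteq> 0" using f1(2) by (simp add: f2_def bicoeff_perturb bicoeff_monomial)
  ultimately show ?thesis using that[of f2] r(1) by (simp add: simple_at_infinity_def f2_def)
qed

text \<open>By Euler's identity a common zero of the top partial derivatives would be a multiple
  root of \<phi>. In the direction x = 0 the leading coefficient of \<phi> decides.\<close>

lemma simple_imp_smooth_at_infinity:
  assumes "simple_at_infinity n C"
  shows "smooth_at_infinity n C"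
  unfolding smooth_at_infinity_def
proof
  fix z :: "complex \<times> complex" assume z: "z \<in> sphere 0 1"
  obtain x y where xy: "z = (x, y)" by (cases z)
  show "homogeneous_part (coeffs_dx C) n z \<noteq> 0 \<or> homogeneous_part (coeffs_dy C) n z \<noteq> 0"
  proof (cases "x = 0")
    case False
    define u where "u = y / x"
    have z': "z = (x, x * u)" using False by (simp add: xy u_def)
    show ?thesis
    proof (rule ccontr)
      assume "\<not> ?thesis"
      hence *: "slope_poly (coeffs_dx C) n u = 0" "slope_poly (coeffs_dy C) n u = 0"
        using False unfolding z' homogeneous_part_slope by auto
      hence "of_nat (Suc n) * slope_poly C (Suc n) u = 0" using slope_poly_Euler[of C n u] by simp
      hence "slope_poly C (Suc n) u = 0" by (simp del: of_nat_Suc)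
      thus False using assms *(2) by (simp add: simple_at_infinity_def slope_poly_dy)
    qed
  next
    case True
    have y: "y \<noteq> 0" using z by (auto simp: xy True)
    have "homogeneous_part (coeffs_dy C) n z = (\<Sum>i\<le>n. if i = n then coeffs_dy C 0 n * y ^ n else 0)"
      unfolding homogeneous_part_def xy True fst_conv snd_conv by (intro sum.cong refl) auto
    also have "\<dots> = coeffs_dy C 0 n * y ^ n" by (simp add: sum.delta)
    finally show ?thesis using assms y by (simp add: simple_at_infinity_def coeffs_dy_def del: of_nat_Suc)
  qed
qed

text \<open>Degree at least 2 and simplicity yield two distinct roots, and among the finitely many
  pairs one has minimal distance. Minimality makes the discs of half that distance free of other
  roots.\<close>

lemma closest_roots:
  fixes p :: "complex poly"
  assumes deg: "degree p \<ge> 2" and simple: "\<And>u. poly p u = 0 \<Longrightarrow> poly (pderiv p) u \<noteq> 0"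
  obtains a b where "poly p a = 0" "poly p b = 0" "a \<noteq> b"
    "\<And>u v. poly p u = 0 \<Longrightarrow> poly p v = 0 \<Longrightarrow> u \<noteq> v \<Longrightarrow> norm (a - b) \<le> norm (u - v)"
proof -
  let ?S = "{(u, v). poly p u = 0 \<and> poly p v = 0 \<and> u \<noteq> v}"
  have p0: "p \<noteq> 0" using deg by auto
  have "\<not> constant (poly p)" using deg by (simp add: constant_degree)
  then obtain a where a: "poly p a = 0" using fundamental_theorem_of_algebra by blast
  then obtain q where q: "p = [:- a, 1:] * q" by (auto simp: poly_eq_0_iff_dvd dvd_def)
  have q0: "q \<noteq> 0" using p0 q by auto
  have "degree p = Suc (degree q)" unfolding q using q0 by (subst degree_mult_eq) auto
  hence "\<not> constant (poly q)" using deg by (simp add: constant_degree)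
  then obtain b where b: "poly q b = 0" using fundamental_theorem_of_algebra by blast
  have "poly (pderiv p) a = poly q a" unfolding q pderiv_mult by (simp add: pderiv_pCons)
  hence "a \<noteq> b" using simple[OF a] b by auto
  moreover have "poly p b = 0" by (simp add: q b)
  ultimately have ne: "?S \<noteq> {}" using a by blast
  have "?S \<subseteq> {u. poly p u = 0} \<times> {u. poly p u = 0}" by auto
  hence fin: "finite ?S" using poly_roots_finite[OF p0] by (meson finite_SigmaI finite_subset)
  define x where "x = arg_min_on (\<lambda>y. norm (fst y - snd y)) ?S"
  have x: "x \<in> ?S" "\<And>y. y \<in> ?S \<Longrightarrow> norm (fst x - snd x) \<le> norm (fst y - snd y)"
    unfolding x_def using arg_min_if_finite[OF fin ne, of "\<lambda>y. norm (fst y - snd y)"] by (simp, meson not_le)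
  show ?thesis by (rule that[of "fst x" "snd x"]) (use x in \<open>auto simp: case_prod_unfold\<close>)
qed

text \<open>Cauchy's integral formula after the substitution u = a + d w, which carries the unit
  circle to a circle that starts in an arbitrary complex direction \<open>d\<close>.\<close>

lemma circle_integral_residue:
  fixes p :: "complex poly"
  assumes a: "poly p a = 0" and d: "d \<noteq> 0" and other: "\<And>u. u \<in> cball a (norm d) \<Longrightarrow> u \<noteq> a \<Longrightarrow> poly p u \<noteq> 0"
    and simple: "poly (pderiv p) a \<noteq> 0" and h: "h holomorphic_on UNIV"
  shows "circle_integral a d (\<lambda>u. h u / poly p u) = 2 * of_real pi * \<i> * h a / poly (pderiv p) a"
proof -
  obtain q where q: "p = [:- a, 1:] * q" using a by (auto simp: poly_eq_0_iff_dvd dvd_def)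
  have qa: "poly (pderiv p) a = poly q a" unfolding q pderiv_mult by (simp add: pderiv_pCons)
  have q_nz: "poly q u \<noteq> 0" if "u \<in> cball a (norm d)" for u
    using other[OF that] simple qa by (cases "u = a") (auto simp: q)
  define F where "F = (\<lambda>w. h (a + d * w) / poly q (a + d * w))"
  have in_ball: "a + d * w \<in> cball a (norm d)" if "w \<in> cball 0 1" for w
    using that by (simp add: dist_norm norm_mult mult_left_le)
  have "(\<lambda>w. h (a + d * w)) holomorphic_on cball 0 1"
    using holomorphic_on_compose_gen[OF _ h, of "\<lambda>w. a + d * w" "cball 0 1"] by (simp add: o_def holomorphic_intros)
  hence F: "F holomorphic_on cball 0 1"
    unfolding F_def using q_nz in_ball by (intro holomorphic_intros) auto
  have "((\<lambda>u. F u / (u - 0)) has_contour_integral 2 * of_real pi * \<i> * F 0) (circlepath 0 1)"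
    by (rule Cauchy_integral_circlepath_simple[OF F]) simp
  hence "((\<lambda>x. F (circlepath 0 1 x) / (circlepath 0 1 x - 0) * vector_derivative (circlepath 0 1) (at x within {0..1}))
      has_integral 2 * of_real pi * \<i> * F 0) {0..1}"
    by (simp only: has_contour_integral_def)
  moreover have "F (circlepath 0 1 x) / (circlepath 0 1 x - 0) * vector_derivative (circlepath 0 1) (at x within {0..1}) =
      h (circ a d x) / poly p (circ a d x) * circ' d x" if x: "x \<in> {0..1}" for x
  proof -
    let ?e = "exp (2 * of_real pi * \<i> * of_real x) :: complex"
    have "vector_derivative (circlepath 0 1) (at x within {0..1}) = 2 * of_real pi * \<i> * 1 * ?e"
      using x vector_derivative_circlepath01[of x 0 1] by simp
    moreover have "circlepath 0 1 x = ?e" by (simp add: circlepath)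
    ultimately have "F (circlepath 0 1 x) / (circlepath 0 1 x - 0) * vector_derivative (circlepath 0 1) (at x within {0..1}) =
        F ?e * (2 * of_real pi * \<i>)" by simp
    moreover have "poly p (circ a d x) = d * ?e * poly q (a + d * ?e)" by (simp add: q circ_def algebra_simps)
    ultimately show ?thesis using d by (simp add: F_def circ_def circ'_def)
  qed
  ultimately have "((\<lambda>x. h (circ a d x) / poly p (circ a d x) * circ' d x) has_integral 2 * of_real pi * \<i> * F 0) {0..1}"
    by (metis (no_types, lifting) has_integral_cong)
  thus ?thesis by (simp add: circle_integral_def integral_unique F_def qa)
qed

definition isolating_circle :: "nat \<Rightarrow> (nat \<Rightarrow> nat \<Rightarrow> complex) \<Rightarrow> complex \<Rightarrow> complex \<Rightarrow> bool" where
  "isolating_circle n C a d \<longleftrightarrow> d \<noteq> 0 \<and> slope_poly C (Suc n) a = 0 \<and> slope_poly' C (Suc n) a \<noteq> 0 \<and>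
    (\<forall>u\<in>cball a (norm d). u \<noteq> a \<longrightarrow> slope_poly C (Suc n) u \<noteq> 0)"

lemma isolating_circle_residue:
  assumes "isolating_circle n C a d" "h holomorphic_on UNIV"
  shows "circle_integral a d (\<lambda>u. h u / slope_poly C (Suc n) u) = 2 * of_real pi * \<i> * h a / slope_poly' C (Suc n) a"
  using assms circle_integral_residue[of "slope_polynomial C (Suc n)" a d h]
  by (simp add: isolating_circle_def poly_slope_polynomial poly_pderiv_slope_polynomial)

lemma isolating_circle_nonzero:
  assumes "isolating_circle n C a d"
  shows "slope_poly C (Suc n) (circ a d \<theta>) \<noteq> 0"
proof -
  have "circ a d \<theta> \<noteq> a" "circ a d \<theta> \<in> cball a (norm d)"
    using assms by (auto simp: circ_def isolating_circle_def dist_norm norm_mult)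
  thus ?thesis using assms unfolding isolating_circle_def by blast
qed

lemma holomorphic_slope_poly: "slope_poly C j holomorphic_on A" "slope_poly' C j holomorphic_on A"
  unfolding slope_poly_def[abs_def] slope_poly'_def[abs_def] by (intro holomorphic_intros)+

lemma isolating_circle_admissible:
  assumes "isolating_circle n C a d"
  shows "admissible_circle n a d C"
  using isolating_circle_nonzero[OF assms] isolating_circle_residue[OF assms holomorphic_slope_poly(2)[of C "Suc n"]] assms
  by (simp add: admissible_circle_def isolating_circle_def)

lemma level_slope_residue:
  assumes "isolating_circle n C a d"
  shows "level_slope C n a d CP CQ = of_nat (Suc n) * (2 * of_real pi * \<i> * reduced_form CP CQ n a / slope_poly' C (Suc n) a)"
proof -
  have "(\<lambda>u. reduced_form CP CQ n u) holomorphic_on UNIV"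
    unfolding reduced_form_def by (intro holomorphic_intros holomorphic_slope_poly) (simp del: of_nat_Suc)
  from isolating_circle_residue[OF assms this] show ?thesis by (simp only: level_slope_def)
qed

lemma level_functionals_perturb:
  assumes nz: "\<And>\<theta>. slope_poly C (Suc n) (circ c d \<theta>) \<noteq> 0"
  shows "level_slope C n c d (bicoeff (P + smult [:s:] P')) (bicoeff (Q + smult [:s:] Q')) =
      level_slope C n c d (bicoeff P) (bicoeff Q) + s * level_slope C n c d (bicoeff P') (bicoeff Q')"
    and "level_const C n c d (bicoeff (P + smult [:s:] P')) (bicoeff (Q + smult [:s:] Q')) =
      level_const C n c d (bicoeff P) (bicoeff Q) + s * level_const C n c d (bicoeff P') (bicoeff Q')"
proof -
  have k: "continuous_coeffs {0..1::real} (\<lambda>x. K)" for K :: "nat \<Rightarrow> nat \<Rightarrow> complex" by (simp add: continuous_coeffs_def)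
  have u: "continuous_on {0..1} (\<lambda>\<theta>. circ c d \<theta>)" by (intro continuous_intros)
  note cont = continuous_on_slope_poly_coeffs[OF k u] continuous_on_reduced_form[OF k k u]
  have 1: "continuous_on {0..1} (\<lambda>\<theta>. reduced_form CP CQ n (circ c d \<theta>) / slope_poly C (Suc n) (circ c d \<theta>))" for CP CQ
    by (intro continuous_on_divide cont ballI nz)
  have 2: "continuous_on {0..1} (\<lambda>\<theta>. \<Sum>j\<le>n. newton_sum (\<lambda>i. slope_poly C (Suc n - i) (circ c d \<theta>) / slope_poly C (Suc n) (circ c d \<theta>)) (Suc j) *
      reduced_form CP CQ j (circ c d \<theta>))" for CP CQ
    by (intro continuous_on_sum continuous_on_mult continuous_on_newton_sum continuous_on_divide cont ballI nz)
  show "level_slope C n c d (bicoeff (P + smult [:s:] P')) (bicoeff (Q + smult [:s:] Q')) =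
      level_slope C n c d (bicoeff P) (bicoeff Q) + s * level_slope C n c d (bicoeff P') (bicoeff Q')"
    using circle_integral_affine[OF 1[of "bicoeff P" "bicoeff Q"] 1[of "bicoeff P'" "bicoeff Q'"], of s]
    unfolding level_slope_def reduced_form_perturb by (simp add: add_divide_distrib distrib_left mult_ac del: of_nat_Suc)
  have lin: "(\<Sum>j\<le>n. e j * (r j + s * r' j)) = (\<Sum>j\<le>n. e j * r j) + s * (\<Sum>j\<le>n. e j * r' j)"
    for e r r' :: "nat \<Rightarrow> complex"
    by (simp add: sum_distrib_left sum.distrib distrib_left mult_ac)
  show "level_const C n c d (bicoeff (P + smult [:s:] P')) (bicoeff (Q + smult [:s:] Q')) =
      level_const C n c d (bicoeff P) (bicoeff Q) + s * level_const C n c d (bicoeff P') (bicoeff Q')"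
    unfolding level_const_def reduced_form_perturb lin by (rule circle_integral_affine[OF 2 2])
qed

text \<open>The factor of_nat a vanishes for a = 0, where dy and y dy are exact; the density
  argument for k \<ge> 2 therefore works with n \<ge> 2.\<close>

lemma reduced_form_monomial:
  "reduced_form (bicoeff 0) (bicoeff (monomial a 0)) j u = (if j = a then of_nat a / of_nat (Suc a) else 0)"
  "reduced_form (bicoeff 0) (bicoeff (monomial a 1)) j u = (if j = Suc a then of_nat a / of_nat (Suc (Suc a)) * u else 0)"
proof -
  have nz: "(of_nat (Suc m) :: complex) \<noteq> 0" for m by (simp del: of_nat_Suc)
  show "reduced_form (bicoeff 0) (bicoeff (monomial a 0)) j u = (if j = a then of_nat a / of_nat (Suc a) else 0)"
    using nz[of a] by (auto simp: reduced_form_def slope_poly_0 slope_poly_monomial field_simps)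
  define m where "m = (of_nat (Suc (Suc a)) :: complex)"
  have m: "of_nat a = m - 2" "m \<noteq> 0" using nz[of "Suc a"] by (simp_all add: m_def)
  have "u - (u + u) / m = of_nat a / m * u" unfolding m(1) using m(2) by (simp add: field_simps)
  thus "reduced_form (bicoeff 0) (bicoeff (monomial a 1)) j u = (if j = Suc a then of_nat a / of_nat (Suc (Suc a)) * u else 0)"
    by (cases "j = Suc a") (simp_all add: reduced_form_def slope_poly_0 slope_poly_monomial m_def of_nat_1[unfolded One_nat_def] del: of_nat_Suc)
qed

text \<open>The coefficient of \<open>x\<close> in \<open>f\<close> enters the Newton sum of degree \<open>n\<close> linearly.\<close>

lemma level_const_perturb:
  assumes iso: "isolating_circle n (bicoeff f) a d" and n: "n \<ge> 2"
  shows "level_const (bicoeff (f + smult [:s:] (monomial 1 0))) n a d (bicoeff 0) (bicoeff (monomial (n - 1) 0)) =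
    level_const (bicoeff f) n a d (bicoeff 0) (bicoeff (monomial (n - 1) 0)) +
    s * (- of_nat (n - 1) * (2 * of_real pi * \<i> / slope_poly' (bicoeff f) (Suc n) a))"
proof -
  let ?f = "f + smult [:s:] (monomial 1 0)" and ?\<phi> = "slope_poly (bicoeff f) (Suc n)"
  let ?\<kappa> = "of_nat (n - 1) / of_nat n :: complex"
  have top: "slope_poly (bicoeff ?f) (Suc n) u = ?\<phi> u" for u
    using n by (simp add: slope_poly_perturb slope_poly_monomial)
  define e where "e = (\<lambda>g u i. slope_poly (bicoeff g) (Suc n - i) u / ?\<phi> u)"
  \<comment> \<open>The monomial x changes only the part of degree 1 of f, that is the coefficient
    of index n, and it enters the n-th Newton sum linearly.\<close>
  have ns: "newton_sum (e ?f u) n = newton_sum (e f u) n + s * (- of_nat n / ?\<phi> u)" for u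
  proof -
    have "newton_sum (e ?f u) n = newton_sum (e f u) n - of_nat n * (e ?f u n - e f u n)"
    proof (rule newton_sum_diff)
      fix i assume "1 \<le> i" "i < n"
      thus "e ?f u i = e f u i" by (simp add: e_def slope_poly_perturb slope_poly_monomial)
    qed
    moreover have "e ?f u n - e f u n = s / ?\<phi> u"
      by (simp add: e_def slope_poly_perturb slope_poly_monomial Suc_diff_le add_divide_distrib)
    ultimately show ?thesis by (simp add: algebra_simps)
  qed
  have lc: "level_const (bicoeff g) n a d (bicoeff 0) (bicoeff (monomial (n - 1) 0)) = circle_integral a d (\<lambda>u. ?\<kappa> * newton_sum (e g u) n)"
    if "\<And>u. slope_poly (bicoeff g) (Suc n) u = ?\<phi> u" for g
  proof -
    have "(\<Sum>j\<le>n. newton_sum (e g u) (Suc j) * reduced_form (bicoeff 0) (bicoeff (monomial (n - 1) 0)) j u) = ?\<kappa> * newton_sum (e g u) n" for u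
    proof -
      have "(\<Sum>j\<le>n. newton_sum (e g u) (Suc j) * reduced_form (bicoeff 0) (bicoeff (monomial (n - 1) 0)) j u) =
          (\<Sum>j\<le>n. if j = n - 1 then newton_sum (e g u) (Suc j) * (of_nat (n - 1) / of_nat (Suc (n - 1))) else 0)"
        by (intro sum.cong refl) (simp add: reduced_form_monomial)
      also have "\<dots> = newton_sum (e g u) (Suc (n - 1)) * (of_nat (n - 1) / of_nat (Suc (n - 1)))" by (simp add: sum.delta)
      finally show ?thesis using n by (simp add: Suc_diff_1)
    qed
    thus ?thesis unfolding level_const_def that e_def by simp
  qed
  have nz: "?\<phi> (circ a d \<theta>) \<noteq> 0" for \<theta> by (rule isolating_circle_nonzero[OF iso])
  have k: "continuous_coeffs {0..1::real} (\<lambda>x. bicoeff f)" by (simp add: continuous_coeffs_def)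
  have u: "continuous_on {0..1} (\<lambda>\<theta>. circ a d \<theta>)" by (intro continuous_intros)
  note cont = continuous_on_slope_poly_coeffs[OF k u]
  have "circle_integral a d (\<lambda>u. ?\<kappa> * newton_sum (e ?f u) n) =
      circle_integral a d (\<lambda>u. ?\<kappa> * newton_sum (e f u) n + s * (- of_nat (n - 1) / ?\<phi> u))"
  proof (intro arg_cong[where f = "circle_integral a d"] ext)
    have gen: "k * (x + s * (- m / y)) = k * x + s * (- m' / y)" if "k * m = m'" for k x m m' y :: complex
      unfolding that[symmetric] by (simp add: distrib_left right_diff_distrib mult_ac)
    fix u show "?\<kappa> * newton_sum (e ?f u) n = ?\<kappa> * newton_sum (e f u) n + s * (- of_nat (n - 1) / ?\<phi> u)"
      unfolding ns by (rule gen) (use n in simp)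
  qed
  also have "\<dots> = circle_integral a d (\<lambda>u. ?\<kappa> * newton_sum (e f u) n) + s * circle_integral a d (\<lambda>u. - of_nat (n - 1) / ?\<phi> u)"
    unfolding e_def
    by (intro circle_integral_affine continuous_on_mult_left continuous_on_newton_sum continuous_on_divide continuous_on_const cont ballI nz)
  also have "circle_integral a d (\<lambda>u. - of_nat (n - 1) / ?\<phi> u) = - of_nat (n - 1) * (2 * of_real pi * \<i> / slope_poly' (bicoeff f) (Suc n) a)"
    using isolating_circle_residue[OF iso holomorphic_on_const[of "- of_nat (n - 1)"]] by simp
  finally show ?thesis unfolding lc[OF refl] lc[OF top] .
qed

text \<open>The circles are centered at two closest roots \<open>a\<close>, \<open>b\<close> of the top part of \<open>f\<close> in the variable \<open>u = y / x\<close>, so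
  that neither disc contains another root. The form \<open>R dy\<close> has \<open>u - a\<close> as top reduced form, up to a factor:
  its slope vanishes at the first circle but not at the second.\<close>

lemma generic_pairs_dense:
  assumes n: "n \<ge> 1" and X: "openin (V_topology n) X" "(f, P, Q) \<in> X"
  shows "\<exists>y\<in>generic_pairs n. y \<in> X"
proof -
  note happens = eventually_happens'[OF at_neq_bot]
  have XV: "X \<subseteq> V n" using openin_subset[OF X(1)] by (simp add: topspace_V_topology)
  have mono0: "(0, 0, monomial a b) \<in> V n" if "a + b \<le> n" for a b
    using that by (auto simp: V_def total_degree_le_monomial total_degree_le_0)
  obtain f1 where f1: "(f1, P, Q) \<in> X" "simple_at_infinity n (bicoeff f1)"
    by (rule simple_at_infinity_dense[OF X])
  let ?p = "slope_polynomial (bicoeff f1) (Suc n)"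
  have deg: "degree ?p \<ge> 2"
    using degree_slope_polynomial[of "bicoeff f1" "Suc n"] f1(2) n by (simp add: simple_at_infinity_def)
  have simple: "poly (pderiv ?p) u \<noteq> 0" if "poly ?p u = 0" for u
    using f1(2) that by (simp add: simple_at_infinity_def poly_slope_polynomial poly_pderiv_slope_polynomial)
  obtain a b where ab: "poly ?p a = 0" "poly ?p b = 0" "a \<noteq> b"
      "\<And>u v. poly ?p u = 0 \<Longrightarrow> poly ?p v = 0 \<Longrightarrow> u \<noteq> v \<Longrightarrow> norm (a - b) \<le> norm (u - v)"
  proof (rule closest_roots[OF deg simple])
    fix a b assume "poly ?p a = 0" "poly ?p b = 0" "a \<noteq> b"
      "\<And>u v. poly ?p u = 0 \<Longrightarrow> poly ?p v = 0 \<Longrightarrow> u \<noteq> v \<Longrightarrow> norm (a - b) \<le> norm (u - v)"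
    thus thesis by (rule that)
  qed
  \<comment> \<open>The circles meet at the midpoint of \<open>a\<close> and \<open>b\<close>; their
    radius is half the minimal distance of roots.\<close>
  define d where "d = (b - a) / 2"
  have d0: "d \<noteq> 0" "norm d < norm (a - b)"
    using ab(3) by (auto simp: d_def norm_divide norm_minus_commute)
  have b_eq: "a + 2 * d = b" by (simp add: d_def field_simps)
  have iso: "isolating_circle n (bicoeff f1) z e" if z: "poly ?p z = 0" and e: "e = d \<or> e = - d" for z e
  proof -
    have ne: "norm e = norm d" "e \<noteq> 0" using e d0(1) by auto
    have "slope_poly (bicoeff f1) (Suc n) u \<noteq> 0" if u: "u \<in> cball z (norm e)" "u \<noteq> z" for u
    proof
      assume "slope_poly (bicoeff f1) (Suc n) u = 0"
      hence "norm (a - b) \<le> norm (z - u)" using ab(4)[OF z, of u] u(2) by (auto simp: poly_slope_polynomial)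
      thus False using u(1) d0(2) by (simp add: ne dist_norm)
    qed
    thus ?thesis
      using z simple[OF z] ne(2) by (simp add: isolating_circle_def poly_slope_polynomial poly_pderiv_slope_polynomial)
  qed
  \<comment> \<open>For n \<ge> 2 the constant of x^(n-1) dy over the first circle is made non-zero
    by adding a multiple of x to f. This leaves the top part of f, and with it both circles,
    unchanged.\<close>
  let ?A = "\<lambda>f. level_const (bicoeff f) n a d (bicoeff 0) (bicoeff (monomial (n - 1) 0))"
  obtain f2 where f2: "(f2, P, Q) \<in> X" "simple_at_infinity n (bicoeff f2)" "isolating_circle n (bicoeff f2) a d"
      "isolating_circle n (bicoeff f2) b (- d)" "n \<ge> 2 \<Longrightarrow> ?A f2 \<noteq> 0"
  proof (cases "n \<ge> 2")
    case False
    thus ?thesis using f1 iso[OF ab(1), of d] iso[OF ab(2), of "- d"] by (intro that[of f1]) auto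
  next
    case True
    have i1: "isolating_circle n (bicoeff f1) a d" using iso[OF ab(1), of d] by simp
    have "(monomial 1 0, 0, 0) \<in> V n"
      using n by (auto simp: V_def total_degree_le_monomial total_degree_le_0)
    from perturb_in_open[OF X(1) f1(1) this]
    have "\<forall>\<^sub>F s in at 0. (f1 + smult [:s:] (monomial 1 0), P, Q) \<in> X" by simp
    moreover have "\<forall>\<^sub>F s in at 0. ?A f1 + s * (- of_nat (n - 1) * (2 * of_real pi * \<i> / slope_poly' (bicoeff f1) (Suc n) a)) \<noteq> 0"
      using True i1 by (intro eventually_affine_nonzero) (auto simp: isolating_circle_def)
    ultimately obtain s where s: "(f1 + smult [:s:] (monomial 1 0), P, Q) \<in> X"
        "?A f1 + s * (- of_nat (n - 1) * (2 * of_real pi * \<i> / slope_poly' (bicoeff f1) (Suc n) a)) \<noteq> 0"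
      using happens[OF eventually_conj] by blast
    let ?f = "f1 + smult [:s:] (monomial 1 0)"
    have same: "slope_poly (bicoeff ?f) (Suc n) u = slope_poly (bicoeff f1) (Suc n) u"
        "slope_poly' (bicoeff ?f) (Suc n) u = slope_poly' (bicoeff f1) (Suc n) u" for u
      using True by (simp_all add: slope_poly_perturb slope_poly_monomial)
    have "?A ?f \<noteq> 0" using s(2) unfolding level_const_perturb[OF i1 True] .
    moreover have "simple_at_infinity n (bicoeff ?f)"
      using f1(2) unfolding simple_at_infinity_def same by (simp add: bicoeff_perturb bicoeff_monomial)
    moreover have "isolating_circle n (bicoeff ?f) a d" "isolating_circle n (bicoeff ?f) b (- d)"
      using i1 iso[OF ab(2), of "- d"] unfolding isolating_circle_def same by simp_all
    ultimately show ?thesis using that s(1) by blast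
  qed
  define C where "C = bicoeff f2"
  define S where "S i P Q = level_slope C n (if i then a else b) (if i then d else - d) (bicoeff P) (bicoeff Q)" for i P Q
  define A where "A i P Q = level_const C n (if i then a else b) (if i then d else - d) (bicoeff P) (bicoeff Q)" for i P Q
  have isoC: "isolating_circle n C (if i then a else b) (if i then d else - d)" for i using f2 by (simp add: C_def)
  have lin: "S i P (Q + smult [:s:] Q') = S i P Q + s * S i 0 Q'" "A i P (Q + smult [:s:] Q') = A i P Q + s * A i 0 Q'" for i P Q Q' s
    using level_functionals_perturb[OF isolating_circle_nonzero[OF isoC[of i]], of P s 0 Q Q'] by (simp_all add: S_def A_def)
  have S_eq: "S i P Q = of_nat (Suc n) * (2 * of_real pi * \<i> * reduced_form (bicoeff P) (bicoeff Q) n (if i then a else b) /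
      slope_poly' C (Suc n) (if i then a else b))" for i P Q
    unfolding S_def by (rule level_slope_residue[OF isoC])
  have S0: "S i P Q = 0 \<longleftrightarrow> reduced_form (bicoeff P) (bicoeff Q) n (if i then a else b) = 0" for i P Q
    using isoC[of i] unfolding S_eq by (simp add: isolating_circle_def del: of_nat_Suc)
  have smooth: "smooth_at_infinity n C" unfolding C_def by (rule simple_imp_smooth_at_infinity[OF f2(2)])
  have adm: "admissible_circle n a d C" "admissible_circle n b (- d) C"
    using isolating_circle_admissible[OF isoC[of True]] isolating_circle_admissible[OF isoC[of False]] by simp_all
  have generic: "(f2, P', Q') \<in> generic_pairs n"
    if "(f2, P', Q') \<in> X" "S True P' Q' \<noteq> 0" "total_degree_le R n"
      "n \<ge> 2 \<Longrightarrow> A True P' Q' * S False P' Q' - A False P' Q' * S True P' Q' \<noteq> 0"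
      "n \<ge> 2 \<Longrightarrow> S True P' Q' * S False 0 R - S False P' Q' * S True 0 R \<noteq> 0" for P' Q' R
  proof -
    have "generic_coeffs n a d (bicoeff 0) (bicoeff R) (pair_coeffs (f2, P', Q'))"
      unfolding generic_coeffs_def pair_coeffs_def split b_eq
      using that(2,4,5) adm smooth by (simp add: C_def S_def A_def)
    thus ?thesis using that(1,3) XV total_degree_le_0 unfolding generic_pairs_def by blast
  qed
  have step: "\<exists>s. (f2, P, Q' + smult [:s:] R) \<in> X \<and> x + s * y \<noteq> 0"
    if "(f2, P, Q') \<in> X" "total_degree_le R n" "y \<noteq> 0" for Q' R x y
  proof -
    have "(0, 0, R) \<in> V n" using that(2) by (simp add: V_def total_degree_le_0)
    from perturb_in_open[OF X(1) that(1) this]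
    have "\<forall>\<^sub>F s in at 0. (f2, P, Q' + smult [:s:] R) \<in> X" by simp
    from happens[OF eventually_conj[OF this eventually_affine_nonzero[OF that(3)]]] show ?thesis by blast
  qed
  \<comment> \<open>x^n dy has the constant reduced form n/(n+1) in degree n, so it moves the slope
    over either circle.\<close>
  have xi: "S i 0 (monomial n 0) \<noteq> 0" for i
    using n unfolding S0 by (simp add: reduced_form_monomial del: of_nat_Suc)
  obtain s1 where s1: "(f2, P, Q + smult [:s1:] (monomial n 0)) \<in> X" "S True P Q + s1 * S True 0 (monomial n 0) \<noteq> 0"
    using step[OF f2(1) _ xi[of True]] total_degree_le_monomial[of n 0 n] by auto
  define Q1 where "Q1 = Q + smult [:s1:] (monomial n 0)"
  have Q1: "(f2, P, Q1) \<in> X" "S True P Q1 \<noteq> 0" using s1 by (simp_all add: Q1_def lin)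
  show ?thesis
  proof (cases "n \<ge> 2")
    case False
    thus ?thesis using generic[OF Q1 total_degree_le_0] Q1(1) by blast
  next
    case True
    \<comment> \<open>In degree n the reduced forms of x^(n-1) y dy and x^n dy are (n-1)u/(n+1) and
      n/(n+1); the coefficients n and -(n-1)a combine them to a multiple of u - a.\<close>
    define R where "R = (0 + smult [:of_nat n:] (monomial (n - 1) 1)) + smult [:- of_nat (n - 1) * a:] (monomial n 0)"
    have degR: "total_degree_le R n"
      using True unfolding total_degree_le_def R_def bicoeff_perturb bicoeff_monomial bicoeff_0 by auto
    have R: "reduced_form (bicoeff 0) (bicoeff R) n u = of_nat n * of_nat (n - 1) / of_nat (Suc n) * (u - a)" for u
    proof -
      have r: "reduced_form (bicoeff 0) (bicoeff (Q + smult [:s:] Q')) n u =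
          reduced_form (bicoeff 0) (bicoeff Q) n u + s * reduced_form (bicoeff 0) (bicoeff Q') n u" for s Q Q'
        using reduced_form_perturb[of 0 s 0 Q Q' n u] by simp
      have "reduced_form (bicoeff 0) (bicoeff 0) n u = 0" by (simp add: reduced_form_def slope_poly_0)
      moreover have "reduced_form (bicoeff 0) (bicoeff (monomial (n - 1) 1)) n u = of_nat (n - 1) / of_nat (Suc n) * u"
        using True by (simp add: reduced_form_monomial Suc_diff_1 del: of_nat_Suc One_nat_def)
      ultimately show ?thesis
        unfolding R_def r reduced_form_monomial(1) by (simp add: right_diff_distrib left_diff_distrib diff_divide_distrib mult_ac del: of_nat_Suc)
    qed
    have SR: "S True 0 R = 0" "S False 0 R \<noteq> 0"
      using True ab(3) by (simp_all add: S0 R del: of_nat_Suc)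
    \<comment> \<open>x^(n-1) dy has no reduced form in degree n, so adding it to \<omega> alters
      the constants \<open>A\<close> but not the slopes \<open>S\<close>.\<close>
    define \<eta> where "\<eta> = monomial (n - 1) 0"
    have deg\<eta>: "total_degree_le \<eta> n" unfolding \<eta>_def by (rule total_degree_le_monomial) simp
    have S\<eta>: "S i 0 \<eta> = 0" for i using True by (simp add: S0 \<eta>_def reduced_form_monomial del: of_nat_Suc)
    have A\<eta>: "A True 0 \<eta> \<noteq> 0" using f2(5)[OF True] by (simp add: A_def \<eta>_def C_def)
    \<comment> \<open>The main determinant depends on the multiple s3 of \<eta> affinely, with the
      determinant of the constants of \<eta> against the slopes of \<omega> as coefficient. That
      coefficient is first made non-zero by s2, through the slope over the second circle, which
      \<open>R\<close> moves while fixing the first.\<close>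
    have "A True 0 \<eta> * S False 0 R \<noteq> 0" using A\<eta> SR by simp
    then obtain s2 where s2: "(f2, P, Q1 + smult [:s2:] R) \<in> X"
        "(A True 0 \<eta> * S False P Q1 - A False 0 \<eta> * S True P Q1) + s2 * (A True 0 \<eta> * S False 0 R) \<noteq> 0"
      using step[OF Q1(1) degR] by blast
    define Q2 where "Q2 = Q1 + smult [:s2:] R"
    have Q2: "(f2, P, Q2) \<in> X" "S True P Q2 \<noteq> 0" using s2 Q1 by (simp_all add: Q2_def lin SR)
    have E: "A True 0 \<eta> * S False P Q2 - A False 0 \<eta> * S True P Q2 \<noteq> 0"
      using s2(2) by (simp add: Q2_def lin SR algebra_simps)
    obtain s3 where s3: "(f2, P, Q2 + smult [:s3:] \<eta>) \<in> X"
        "(A True P Q2 * S False P Q2 - A False P Q2 * S True P Q2) +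
          s3 * (A True 0 \<eta> * S False P Q2 - A False 0 \<eta> * S True P Q2) \<noteq> 0"
      using step[OF Q2(1) deg\<eta> E] by blast
    define Q3 where "Q3 = Q2 + smult [:s3:] \<eta>"
    have Q3: "(f2, P, Q3) \<in> X" "S i P Q3 = S i P Q2" for i using s3(1) by (simp_all add: Q3_def lin S\<eta>)
    have "A True P Q3 * S False P Q3 - A False P Q3 * S True P Q3 \<noteq> 0"
      using s3(2) unfolding Q3(2) by (simp add: Q3_def lin algebra_simps)
    moreover have "S True P Q3 * S False 0 R - S False P Q3 * S True 0 R \<noteq> 0"
      using Q2(2) SR by (simp add: Q3(2))
    ultimately show ?thesis using generic[OF Q3(1) _ degR] Q2(2) Q3 by metis
  qed
qed

theorem theorem6:
  fixes n :: nat
  assumes "n \<ge> 1"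
  shows "\<exists>U. openin (V_topology n) U \<and> V_topology n closure_of U = V n \<and>
    (\<forall>(f, \<omega>)\<in>U. \<forall>k\<ge>1. (n = 1 \<longrightarrow> k = 1) \<longrightarrow>
      (\<exists>T \<sigma> \<delta> M\<^sub>k. loop_family f T \<sigma> \<delta> \<and>
        (\<forall>t\<in>T. represents_nonzero_gr (fundamental_group (fiber f t) (\<sigma> t)) k
                 (homotopy_class (fiber f t) (\<delta> t))) \<and>
        Poincare_Pontryagin f \<omega> T \<sigma> \<delta> k M\<^sub>k \<and>
        (\<exists>t\<in>T. M\<^sub>k t \<noteq> 0)))"
proof (intro exI[of _ "generic_pairs n"] conjI openin_generic_pairs)
  show "V_topology n closure_of generic_pairs n = V n"
  proof
    show "V_topology n closure_of generic_pairs n \<subseteq> V n"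
      using closure_of_subset_topspace[of "V_topology n"] by (simp add: topspace_V_topology)
    show "V n \<subseteq> V_topology n closure_of generic_pairs n"
    proof
      fix v assume v: "v \<in> V n"
      have dense: "\<exists>y\<in>generic_pairs n. y \<in> X" if "v \<in> X" "openin (V_topology n) X" for X
        using generic_pairs_dense[OF assms that(2)] that(1) by (cases v) blast
      thus "v \<in> V_topology n closure_of generic_pairs n"
        unfolding in_closure_of topspace_V_topology using v dense by blast
    qed
  qed
  show "\<forall>(f, \<omega>)\<in>generic_pairs n. \<forall>k\<ge>1. (n = 1 \<longrightarrow> k = 1) \<longrightarrow>
      (\<exists>T \<sigma> \<delta> M\<^sub>k. loop_family f T \<sigma> \<delta> \<and>
        (\<forall>t\<in>T. represents_nonzero_gr (fundamental_group (fiber f t) (\<sigma> t)) k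
                 (homotopy_class (fiber f t) (\<delta> t))) \<and>
        Poincare_Pontryagin f \<omega> T \<sigma> \<delta> k M\<^sub>k \<and>
        (\<exists>t\<in>T. M\<^sub>k t \<noteq> 0))"
    using generic_pairs_conclusion[OF _ assms] by (intro ballI, clarify) blast
qed

end
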